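(* Let $d\ge1$ and $q\ge2$ be integers. Let $\gamma_n$ (resp. $\gamma$) denote the spectral gap of the Swendsen-Wang dynamics for the ferromagnetic $q$-state Potts model at inverse temperature $\beta$ on $(\mathbb{Z}/n\mathbb{Z})^d$ (resp. on $\mathbb{Z}^d$). Then there exists $\beta_0=\beta_0(d,q)>0$ such that for any $0<\beta<\beta_0$, $$\lim_{n\to\infty}\gamma_n=\gamma\qquad\text{and}\qquad 0<\gamma<1.$$
   Context: Potts model: for a finite graph $G=(V,E)$, integer $q\ge2$ and $\beta\ge0$, the $q$-state ferromagnetic Potts measure is $\pi(\sigma)\propto \exp(\beta|E_m(\sigma)|)$ on $\{1,\dots,q\}^V$, where $E_m(\sigma)=\{(uv)\in E:\sigma(u)=\sigma(v)\}$. The torus $(\mathbb{Z}/n\mathbb{Z})^d$ and $\mathbb{Z}^d$ carry nearest-neighbor edges. Swendsen-Wang dynamics: put $p=1-e^{-\beta}$. Given $X_t\in\{1,\dots,q\}^V$: (1) independently for each edge $e\in E_m(X_t)$ set $\omega_t(e)=1$ with probability $p$ and $\omega_t(e)=0$ otherwise; set $\omega_t(e)=0$ for $e\notin E_m(X_t)$; (2) assign to each connected component of $(V,\{e:\omega_t(e)=1\})$ (isolated vertices included), independently, a uniformly random color in $\{1,\dots,q\}$; the result is $X_{t+1}$. This chain is reversible with respect to $\pi$. The same rule on $\mathbb{Z}^d$ defines the infinite-volume dynamics; for small $\beta$ it is reversible with respect to $\pi^\infty$, the unique infinite-volume Potts (Gibbs) measure on $\{1,\dots,q\}^{\mathbb{Z}^d}$.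 Spectral gap: for a finite reversible chain with eigenvalues $1=\lambda_1\ge\dots\ge\lambda_N\ge-1$, the spectral gap is $1-\max\{\lambda_2,|\lambda_N|\}$. For the infinite-volume dynamics with transition kernel $P$ (non-negative definite on $L^2(\pi^\infty)$), $$\gamma=\inf_{f}\frac{\mathcal{E}_\infty(f,f)}{\mathrm{Var}_{\pi^\infty}(f)},\qquad \mathcal{E}_\infty(f,f)=\frac12\int\!\!\int (f(x)-f(y))^2P(x,dy)\,\pi^\infty(dx),$$ the infimum being over $f\in L^2(\pi^\infty)$ with $\mathrm{Var}_{\pi^\infty}(f)\ne0$. *)

theory Defs
  imports "HOL-Probability.Probability" "Jordan_Normal_Form.Char_Poly"
begin

text \<open>
  A graph is given by a vertex set \<open>V\<close>, finite or countable, and a set \<open>E\<close> of edges \<open>{u, v}\<close>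
  with \<open>u, v \<in> V\<close>.  A configuration is an element of \<open>V \<rightarrow>\<^sub>E {1..q}\<close>.
\<close>

definition spin_space :: "'v set \<Rightarrow> nat \<Rightarrow> ('v \<Rightarrow> nat) measure" where
  "spin_space V q = PiM V (\<lambda>_. count_space {1..q})"

definition mono_edges :: "'v set set \<Rightarrow> ('v \<Rightarrow> nat) \<Rightarrow> 'v set set" where
  "mono_edges E \<sigma> = {e \<in> E. \<forall>u\<in>e. \<forall>v\<in>e. \<sigma> u = \<sigma> v}"

subsection \<open>Swendsen-Wang dynamics\<close>

definition cluster :: "'v set \<Rightarrow> 'v set set \<Rightarrow> 'v \<Rightarrow> 'v set" where
  "cluster V F v = {w \<in> V. (v, w) \<in> {(x, y). {x, y} \<in> F}\<^sup>*}"

definition random_coloring :: "'v set \<Rightarrow> 'v set set \<Rightarrow> nat \<Rightarrow> ('v \<Rightarrow> nat) measure" where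
  "random_coloring V F q =
     distr (PiM (cluster V F ` V) (\<lambda>_. uniform_count_measure {1..q})) (spin_space V q)
       (\<lambda>\<kappa>. \<lambda>v\<in>V. \<kappa> (cluster V F v))"

definition edge_percolation ::
  "'v set set \<Rightarrow> real \<Rightarrow> ('v \<Rightarrow> nat) \<Rightarrow> ('v set \<Rightarrow> bool) measure" where
  "edge_percolation E \<beta> \<sigma> =
     PiM E (\<lambda>e. measure_pmf (bernoulli_pmf (if e \<in> mono_edges E \<sigma> then 1 - exp (- \<beta>) else 0)))"

definition sw_kernel ::
  "'v set \<Rightarrow> 'v set set \<Rightarrow> nat \<Rightarrow> real \<Rightarrow> ('v \<Rightarrow> nat) \<Rightarrow> ('v \<Rightarrow> nat) measure" where
  "sw_kernel V E q \<beta> \<sigma> =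
     edge_percolation E \<beta> \<sigma> \<bind> (\<lambda>\<omega>. random_coloring V {e \<in> E. \<omega> e} q)"

subsection \<open>Infinite-volume Potts measure\<close>

text \<open>
  Gibbs measures are defined by the DLR equations.  Only edges meeting \<open>\<Lambda>\<close> enter the weight:
  the other ones have both ends fixed by the boundary condition \<open>\<eta>\<close>, and cancel.
\<close>

definition bc_configs :: "'v set \<Rightarrow> nat \<Rightarrow> 'v set \<Rightarrow> ('v \<Rightarrow> nat) \<Rightarrow> ('v \<Rightarrow> nat) set" where
  "bc_configs V q \<Lambda> \<eta> = {\<sigma> \<in> V \<rightarrow>\<^sub>E {1..q}. \<forall>v \<in> V - \<Lambda>. \<sigma> v = \<eta> v}"

definition potts_weight :: "'v set set \<Rightarrow> real \<Rightarrow> 'v set \<Rightarrow> ('v \<Rightarrow> nat) \<Rightarrow> real" where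
  "potts_weight E \<beta> \<Lambda> \<sigma> = exp (\<beta> * real (card {e \<in> mono_edges E \<sigma>. e \<inter> \<Lambda> \<noteq> {}}))"

definition potts_bc_prob ::
  "'v set \<Rightarrow> 'v set set \<Rightarrow> nat \<Rightarrow> real \<Rightarrow> 'v set \<Rightarrow> ('v \<Rightarrow> nat) \<Rightarrow> ('v \<Rightarrow> nat) set \<Rightarrow> real" where
  "potts_bc_prob V E q \<beta> \<Lambda> \<eta> A =
     (\<Sum>\<sigma> \<in> bc_configs V q \<Lambda> \<eta> \<inter> A. potts_weight E \<beta> \<Lambda> \<sigma>) /
     (\<Sum>\<sigma> \<in> bc_configs V q \<Lambda> \<eta>. potts_weight E \<beta> \<Lambda> \<sigma>)"

definition potts_gibbs ::
  "'v set \<Rightarrow> 'v set set \<Rightarrow> nat \<Rightarrow> real \<Rightarrow> ('v \<Rightarrow> nat) measure \<Rightarrow> bool" where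
  "potts_gibbs V E q \<beta> \<mu> \<longleftrightarrow>
     prob_space \<mu> \<and> sets \<mu> = sets (spin_space V q) \<and>
     (\<forall>\<Lambda> A. finite \<Lambda> \<longrightarrow> \<Lambda> \<subseteq> V \<longrightarrow> A \<in> sets (spin_space V q) \<longrightarrow>
        measure \<mu> A = (\<integral>\<eta>. potts_bc_prob V E q \<beta> \<Lambda> \<eta> A \<partial>\<mu>))"

text \<open>Meaningful only when the Gibbs measure is unique, as it is on the lattice for small \<open>\<beta>\<close>.\<close>

definition the_potts_gibbs :: "'v set \<Rightarrow> 'v set set \<Rightarrow> nat \<Rightarrow> real \<Rightarrow> ('v \<Rightarrow> nat) measure" where
  "the_potts_gibbs V E q \<beta> = (THE \<mu>. potts_gibbs V E q \<beta> \<mu>)"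

subsection \<open>Spectral gaps\<close>

text \<open>
  The eigenvalues are listed in descending order with their multiplicity as roots of the
  characteristic polynomial, so that \<open>\<lambda>\<^sub>1, \<lambda>\<^sub>2, \<dots>\<close> are the entries \<open>0, 1, \<dots>\<close>.  All of them are
  real for a reversible chain.  The enumeration of \<open>S\<close> does not affect them.
\<close>

definition transition_matrix :: "'s set \<Rightarrow> ('s \<Rightarrow> 's \<Rightarrow> real) \<Rightarrow> real mat" where
  "transition_matrix S P =
     Matrix.mat (card S) (card S) (\<lambda>(i, j). P (from_nat_into S i) (from_nat_into S j))"

definition eigenvalue_list :: "'s set \<Rightarrow> ('s \<Rightarrow> 's \<Rightarrow> real) \<Rightarrow> real list" where
  "eigenvalue_list S P =
     rev (sorted_list_of_multiset (proots (char_poly (transition_matrix S P))))"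

definition finite_spectral_gap :: "'s set \<Rightarrow> ('s \<Rightarrow> 's \<Rightarrow> real) \<Rightarrow> real" where
  "finite_spectral_gap S P =
     1 - max (eigenvalue_list S P ! 1) \<bar>eigenvalue_list S P ! (card S - 1)\<bar>"

definition square_integrable :: "'s measure \<Rightarrow> ('s \<Rightarrow> real) \<Rightarrow> bool" where
  "square_integrable \<mu> f \<longleftrightarrow> f \<in> borel_measurable \<mu> \<and> integrable \<mu> (\<lambda>x. (f x)\<^sup>2)"

definition variance_of :: "'s measure \<Rightarrow> ('s \<Rightarrow> real) \<Rightarrow> real" where
  "variance_of \<mu> f = (\<integral>x. (f x - (\<integral>y. f y \<partial>\<mu>))\<^sup>2 \<partial>\<mu>)"

definition dirichlet_form :: "'s measure \<Rightarrow> ('s \<Rightarrow> 's measure) \<Rightarrow> ('s \<Rightarrow> real) \<Rightarrow> real" where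
  "dirichlet_form \<mu> P f = (1/2) * (\<integral>x. (\<integral>y. (f x - f y)\<^sup>2 \<partial>(P x)) \<partial>\<mu>)"

definition variational_gap :: "'s measure \<Rightarrow> ('s \<Rightarrow> 's measure) \<Rightarrow> real" where
  "variational_gap \<mu> P =
     Inf {dirichlet_form \<mu> P f / variance_of \<mu> f | f.
            square_integrable \<mu> f \<and> variance_of \<mu> f \<noteq> 0}"

subsection \<open>Torus and lattice\<close>

text \<open>
  \<open>\<int>/n\<int>\<close> is represented by \<open>{0..<n}\<close>.  The graph is read as a simple graph: for \<open>n = 2\<close> the
  double edges are merged, and for \<open>n = 1\<close> the edge is a loop, which has no effect.
\<close>

definition torus_verts :: "nat \<Rightarrow> nat \<Rightarrow> (nat \<Rightarrow> int) set" where
  "torus_verts d n = {..<d} \<rightarrow>\<^sub>E {0..<int n}"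

definition torus_edges :: "nat \<Rightarrow> nat \<Rightarrow> (nat \<Rightarrow> int) set set" where
  "torus_edges d n = {{x, x(i := (x i + 1) mod int n)} | x i. x \<in> torus_verts d n \<and> i < d}"

definition lattice_verts :: "nat \<Rightarrow> (nat \<Rightarrow> int) set" where
  "lattice_verts d = {..<d} \<rightarrow>\<^sub>E UNIV"

definition lattice_edges :: "nat \<Rightarrow> (nat \<Rightarrow> int) set set" where
  "lattice_edges d = {{x, x(i := x i + 1)} | x i. x \<in> lattice_verts d \<and> i < d}"

definition sw_gap_torus :: "nat \<Rightarrow> nat \<Rightarrow> real \<Rightarrow> nat \<Rightarrow> real" where
  "sw_gap_torus d q \<beta> n =
     finite_spectral_gap (torus_verts d n \<rightarrow>\<^sub>E {1..q})
       (\<lambda>\<sigma> \<tau>. measure (sw_kernel (torus_verts d n) (torus_edges d n) q \<beta> \<sigma>) {\<tau>})"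

definition sw_gap_lattice :: "nat \<Rightarrow> nat \<Rightarrow> real \<Rightarrow> real" where
  "sw_gap_lattice d q \<beta> =
     variational_gap (the_potts_gibbs (lattice_verts d) (lattice_edges d) q \<beta>)
       (sw_kernel (lattice_verts d) (lattice_edges d) q \<beta>)"

end

theory Submission
  imports Defs
begin

text \<open>
  Write \<open>p = 1 - e\<^sup>-\<^sup>\<beta>\<close> and let \<open>\<phi>\<^sub>F\<close> be the indicator that all edges of \<open>F\<close> are monochromatic.
  Moebius inversion of the colour average over the open edges turns the Swendsen-Wang operator \<open>P\<close>
  applied to a local function into a sum of terms \<open>c\<^sub>F p\<^sup>|\<^sup>F\<^sup>| \<phi>\<^sub>F\<close>, where \<open>c\<^sub>F = 0\<close> unless \<open>F\<close> is attached to
  the support of the function.  For small \<open>p\<close> these sums converge uniformly in the graph, and the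
  matrix of \<open>P\<close> in the functions \<open>\<phi>\<^sub>F\<close> contracts a weighted \<open>l\<^sup>1\<close> norm.

  Dobrushin's method gives uniqueness of the Gibbs measure, convergence of the torus expectations of
  local functions, and exponential decay of covariances.  Uniform limits of local functions are stable
  under \<open>P\<close> and products, so invariance, reversibility and positivity pass to infinite volume, and by
  density of the local functions in \<open>L\<^sup>2\<close> a gap along a subsequence of tori is also a gap on the lattice.

  For the converse let \<open>\<lambda> = 1 - \<gamma>\<close>, which is at least \<open>p/4\<close>.  The \<open>l\<^sup>1\<close> norm of the row of \<open>P\<^sup>t\<close> belonging to a single
  edge is controlled by covariances of \<open>P\<^sup>t \<phi>\<^sub>e\<close> with single edges, up to a term of order \<open>p\<^sup>2\<close> per step,
  which is negligible against \<open>\<lambda>\<close>.  Covariances with nearby edges are at most \<open>2 \<lambda>\<^sup>t\<close> on large tori because they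
  converge to those of the lattice, and distant edges contribute exponentially little.  Hence the rows
  of \<open>P\<^sup>t\<close> grow at most like \<open>r\<^sup>t\<close> for every \<open>r > \<lambda>\<close>, and so does \<open>(1 - \<gamma>\<^sub>n)\<^sup>t\<close> for large \<open>n\<close>.
\<close>

subsection \<open>Moebius inversion and attached edge sets\<close>

text \<open>One inequality between torus and lattice is soft; the difficulty is to exclude
  eigenvalues on large tori above the lattice value \<open>\<lambda>\<close>. A torus eigenfunction
  lives on the whole torus, so convergence of local expectations says nothing about it directly. The
  remedy is to measure the operator in a weighted l1 norm of coefficients: a bound on the rows at
  one fixed time \<open>t\<close> controls every eigenvalue, and a row belongs to one edge, hence is
  a local object. For fixed \<open>t\<close> only finitely many covariances have to be compared, so
  \<open>t\<close> is chosen before the torus size. Nearby means within a radius linear in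
  \<open>t\<close>, with slope so large that the decay beyond it beats \<open>\<lambda>\<close> to
  the power \<open>t\<close>. The number of nearby edges grows polynomially in \<open>t\<close>;
  this is absorbed by passing to a rate \<open>r > \<lambda>\<close>, with a prefactor that does not
  depend on \<open>t\<close> and so disappears in the \<open>t\<close>-th root. The lower bound on
  \<open>\<lambda>\<close> enters because the recursion for the rows feeds a multiple of the row
  back into itself, and that multiple has to stay below \<open>r / 2\<close>.\<close>

definition submoeb :: "('a set => real) => 'a set => real" where
  "submoeb g F = (\<Sum>G\<in>Pow F. (-1) ^ card (F - G) * g G)"

lemma sum_Pow_insert:
  fixes g :: "'a set => 'b::comm_monoid_add"
  assumes "finite A" "a \<notin> A"
  shows "(\<Sum>F\<in>Pow (insert a A). g F) = (\<Sum>F\<in>Pow A. g F) + (\<Sum>F\<in>Pow A. g (insert a F))"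
proof -
  have "inj_on (insert a) (Pow A)" using assms(2) by (auto simp: inj_on_def)
  moreover have "Pow A \<inter> insert a ` Pow A = {}" using assms(2) by auto
  ultimately show ?thesis using assms(1)
    by (simp add: Pow_insert sum.union_disjoint sum.reindex)
qed

lemma submoeb_insert:
  assumes "finite A" "a \<notin> A"
  shows "submoeb g (insert a A) = submoeb (\<lambda>G. g (insert a G)) A - submoeb g A"
proof -
  have "(\<Sum>F\<in>Pow A. (-1) ^ card (insert a A - F) * g F) = (\<Sum>F\<in>Pow A. - ((-1) ^ card (A - F) * g F))"
  proof (rule sum.cong)
    fix F assume "F \<in> Pow A"
    then have "insert a A - F = insert a (A - F)" "a \<notin> A - F" "finite (A - F)" using assms by auto
    then show "(-1) ^ card (insert a A - F) * g F = - ((-1) ^ card (A - F) * g F)" by simp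
  qed simp
  moreover have "(\<Sum>F\<in>Pow A. (-1) ^ card (insert a A - insert a F) * g (insert a F)) =
      (\<Sum>F\<in>Pow A. (-1) ^ card (A - F) * g (insert a F))"
    using assms(2) by (intro sum.cong) auto
  ultimately show ?thesis
    unfolding submoeb_def using assms by (simp add: sum_Pow_insert sum_negf)
qed

lemma submoeb_inversion:
  assumes "finite A"
  shows "(\<Sum>F\<in>Pow A. submoeb g F) = g A"
  using assms
proof (induction A arbitrary: g)
  case empty
  then show ?case by (simp add: submoeb_def)
next
  case (insert a A)
  have "(\<Sum>F\<in>Pow (insert a A). submoeb g F) =
      (\<Sum>F\<in>Pow A. submoeb g F) + (\<Sum>F\<in>Pow A. submoeb g (insert a F))"
    by (rule sum_Pow_insert) (use insert in auto)
  also have "(\<Sum>F\<in>Pow A. submoeb g (insert a F)) =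
      (\<Sum>F\<in>Pow A. submoeb (\<lambda>G. g (insert a G)) F - submoeb g F)"
    by (intro sum.cong refl submoeb_insert) (use insert finite_subset in auto)
  finally show ?case using insert.IH by (simp add: sum_subtractf)
qed

lemma submoeb_cong: "(\<And>G. G \<subseteq> F ==> g G = g' G) ==> submoeb g F = submoeb g' F"
  unfolding submoeb_def by (intro sum.cong) auto

lemma abs_submoeb_le:
  assumes "finite F" "\<And>G. G \<subseteq> F ==> \<bar>g G\<bar> <= M"
  shows "\<bar>submoeb g F\<bar> <= 2 ^ card F * M"
proof -
  have "\<bar>submoeb g F\<bar> <= (\<Sum>G\<in>Pow F. \<bar>(-1) ^ card (F - G) * g G\<bar>)"
    unfolding submoeb_def by (rule sum_abs)
  also have "... <= (\<Sum>G\<in>Pow F. M)" using assms(2) by (intro sum_mono) (auto simp: abs_mult)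
  finally show ?thesis using assms(1) by (simp add: card_Pow)
qed

text \<open>Subsets with and without \<open>b\<close> carry opposite signs, so they cancel in pairs
  when adding \<open>b\<close> leaves \<open>g\<close> unchanged. This cancellation confines the
  expansion of the dynamics to edge sets tied to the support of the function.\<close>

lemma submoeb_eq_0:
  assumes "finite F" "b \<in> F" "\<And>G. G \<subseteq> F - {b} ==> g (insert b G) = g G"
  shows "submoeb g F = 0"
proof -
  have "submoeb g (insert b (F - {b})) = submoeb (\<lambda>G. g (insert b G)) (F - {b}) - submoeb g (F - {b})"
    by (rule submoeb_insert) (use assms in auto)
  also have "submoeb (\<lambda>G. g (insert b G)) (F - {b}) = submoeb g (F - {b})"
    by (rule submoeb_cong) (use assms in auto)
  finally show ?thesis using assms(2) by (simp add: insert_absorb)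
qed

lemma submoeb_image:
  assumes "inj_on f F" "\<And>G. G \<subseteq> F ==> g' (f ` G) = g G"
  shows "submoeb g' (f ` F) = submoeb g F"
proof -
  have "submoeb g' (f ` F) = (\<Sum>G\<in>image f ` Pow F. (-1) ^ card (f ` F - G) * g' G)"
    unfolding submoeb_def by (simp add: image_Pow_surj)
  also have "... = (\<Sum>G\<in>Pow F. (-1) ^ card (f ` F - f ` G) * g' (f ` G))"
    by (rule sum.reindex_cong[OF inj_on_image_Pow[OF assms(1)]]) auto
  also have "... = submoeb g F"
    unfolding submoeb_def
  proof (intro sum.cong refl)
    fix G assume "G \<in> Pow F"
    then have "f ` F - f ` G = f ` (F - G)" using assms(1) by (auto simp: inj_on_def)
    moreover have "card (f ` (F - G)) = card (F - G)"
      by (intro card_image inj_on_subset[OF assms(1)]) auto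
    ultimately show "(-1) ^ card (f ` F - f ` G) * g' (f ` G) = (-1) ^ card (F - G) * g G"
      using assms(2) \<open>G \<in> Pow F\<close> by simp
  qed
  finally show ?thesis .
qed

text \<open>Equivalently, every connected component of \<open>F\<close> meets \<open>S\<close>. The
  formulation by subsets avoids paths and components, and a violating \<open>B\<close> is exactly
  what makes a Moebius coefficient vanish.\<close>

definition attached :: "'v set => 'v set set => bool" where
  "attached S F \<longleftrightarrow> (\<forall>B\<subseteq>F. B ~= {} --> \<Union>B \<inter> (S \<union> \<Union>(F - B)) ~= {})"

lemma sum_Pow_power_card:
  fixes x :: real
  assumes "finite A"
  shows "(\<Sum>F\<in>Pow A. x ^ card F) = (1 + x) ^ card A"
  using assms
proof (induction A)
  case (insert a A)
  have "(\<Sum>F\<in>Pow A. x ^ card (insert a F)) = x * (\<Sum>F\<in>Pow A. x ^ card F)"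
    unfolding sum_distrib_left
  proof (intro sum.cong refl)
    fix F assume "F \<in> Pow A"
    then have "finite F" "a \<notin> F" using insert finite_subset by auto
    then show "x ^ card (insert a F) = x * x ^ card F" by simp
  qed
  then show ?case using insert by (simp add: sum_Pow_insert algebra_simps)
qed simp

text \<open>A set \<open>B\<close> of remaining edges misses \<open>s\<close>, so its point of
  contact is another vertex of \<open>S\<close>, lies on a remaining edge, or lies on a removed edge
  and then belongs to the enlarged vertex set.\<close>

lemma attached_peel:
  assumes "attached S F" "s \<in> S"
  shows "attached ((S - {s}) \<union> (\<Union>{e\<in>F. s \<in> e} - {s})) (F - {e\<in>F. s \<in> e})"
  unfolding attached_def
proof (intro allI impI)
  fix B assume B: "B \<subseteq> F - {e \<in> F. s \<in> e}" "B ~= {}"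
  then have "\<Union>B \<inter> (S \<union> \<Union>(F - B)) ~= {}" using assms(1) unfolding attached_def by blast
  then obtain x where x: "x \<in> \<Union>B" "x \<in> S \<or> x \<in> \<Union>(F - B)" by blast
  have "x ~= s" using B x by auto
  then show "\<Union>B \<inter> (S - {s} \<union> (\<Union>{e \<in> F. s \<in> e} - {s}) \<union> \<Union>(F - {e \<in> F. s \<in> e} - B)) ~= {}"
    using x by blast
qed

lemma attached_remove_edge:
  assumes "attached S F" "e \<in> F"
  shows "attached (S \<union> e) (F - {e})"
  unfolding attached_def
proof (intro allI impI)
  fix B assume B: "B \<subseteq> F - {e}" "B ~= {}"
  then have "\<Union>B \<inter> (S \<union> \<Union>(F - B)) ~= {}" using assms(1) unfolding attached_def by blast
  then show "\<Union>B \<inter> (S \<union> e \<union> \<Union>(F - {e} - B)) ~= {}" by blast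
qed

lemma attached_meets:
  assumes "attached S F" "F ~= {}"
  shows "\<exists>e\<in>F. e \<inter> S ~= {}"
proof -
  have "\<Union>F \<inter> (S \<union> \<Union>(F - F)) ~= {}" using assms unfolding attached_def by blast
  then show ?thesis by auto
qed

text \<open>Induction on the edge set: peel off one vertex of \<open>S\<close> together with its edges in \<open>F\<close>.\<close>

lemma sum_attached_le:
  fixes x :: real
  assumes "finite E" "\<And>e. e \<in> E ==> card e = 2" "\<And>v. card {e\<in>E. v \<in> e} <= \<Delta>"
    and x: "0 <= x" "(1 + 2 * x) ^ \<Delta> <= 2" and "finite S"
  shows "(\<Sum>F\<in>{F\<in>Pow E. attached S F}. x ^ card F) <= 2 ^ card S"
  using assms(1-3,6)
proof (induction E arbitrary: S rule: finite_psubset_induct)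
  case (psubset E)
  let ?A = "{F\<in>Pow E. attached S F}"
  show ?case
  proof (cases "\<exists>s\<in>S. {e\<in>E. s \<in> e} ~= {}")
    case False
    have "?A \<subseteq> {{}}"
    proof
      fix F assume F: "F \<in> ?A"
      show "F \<in> {{}}"
      proof (rule ccontr)
        assume "F \<notin> {{}}"
        then obtain e where "e \<in> F" "e \<inter> S ~= {}" using attached_meets[of S F] F by auto
        then show False using False F by auto
      qed
    qed
    then have "(\<Sum>F\<in>?A. x ^ card F) <= (\<Sum>F\<in>{{}::'a set set}. x ^ card F)"
      by (intro sum_mono2) (use x in auto)
    also have "... <= 2 ^ card S" by simp
    finally show ?thesis .
  next
    case True
    then obtain s where s: "s \<in> S" "{e\<in>E. s \<in> e} ~= {}" by blast
    define I where "I = {e\<in>E. s \<in> e}"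
    define E' where "E' = E - I"
    define T where "T J = (S - {s}) \<union> (\<Union>J - {s})" for J
    define A where "A J = {F\<in>Pow E'. attached (T J) F}" for J
    have finI: "finite I" "finite E'" using psubset.hyps by (auto simp: I_def E'_def)
    have E': "E' \<subset> E" using s by (auto simp: E'_def I_def)
    have bd: "(\<Sum>F\<in>A J. x ^ card F) <= 2 ^ (card S - 1 + card J)" if J: "J \<in> Pow I" for J
    proof -
      have finJ: "finite J" using J finI finite_subset by auto
      have e2: "finite e \<and> card (e - {s}) = 1" if "e \<in> J" for e
      proof -
        have "card e = 2" "s \<in> e" using that J psubset.prems(1) by (auto simp: I_def)
        then show ?thesis by (simp add: card_ge_0_finite)
      qed
      have "\<Union>J - {s} = (\<Union>e\<in>J. e - {s})" by auto
      then have "card (\<Union>J - {s}) = card (\<Union>e\<in>J. e - {s})" by simp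
      also have "... <= (\<Sum>e\<in>J. card (e - {s}))" by (rule card_UN_le[OF finJ])
      also have "... = card J" using e2 by simp
      finally have c: "card (\<Union>J - {s}) <= card J" .
      have "finite (T J)" unfolding T_def using psubset.prems(3) finJ e2 by auto
      have "card (T J) <= card (S - {s}) + card J"
        unfolding T_def using card_Un_le[of "S - {s}" "\<Union>J - {s}"] c by linarith
      then have cT: "card (T J) <= card S - 1 + card J"
        using s psubset.prems(3) by simp
      have "(\<Sum>F\<in>A J. x ^ card F) <= 2 ^ card (T J)"
        unfolding A_def
      proof (rule psubset.IH[OF E'])
        show "card e = 2" if "e \<in> E'" for e using that psubset.prems E' by auto
        show "card {e \<in> E'. v \<in> e} <= \<Delta>" for v
        proof -
          have "card {e \<in> E'. v \<in> e} <= card {e \<in> E. v \<in> e}"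
            by (intro card_mono) (use psubset.hyps E' in auto)
          then show ?thesis using psubset.prems(2)[of v] by linarith
        qed
      qed fact
      also have "... <= 2 ^ (card S - 1 + card J)" by (rule power_increasing[OF cT]) simp
      finally show ?thesis .
    qed
    \<comment> \<open>An attached set is determined by its edges at \<open>s\<close> and the rest.
      It suffices that this map is injective into the pairs counted below, since all terms are
      nonnegative.\<close>
    define h where "h F = (F \<inter> I, F - I)" for F :: "'a set set"
    have inj: "inj_on h ?A"
    proof (rule inj_onI)
      fix F G assume "h F = h G"
      then have "F \<inter> I = G \<inter> I" "F - I = G - I" by (auto simp: h_def)
      then show "F = G" by blast
    qed
    have im: "h ` ?A \<subseteq> (SIGMA J:Pow I. A J)"
    proof
      fix z assume "z \<in> h ` ?A"
      then obtain F where F: "F \<subseteq> E" "attached S F" "z = h F" by auto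
      have FI: "{e\<in>F. s \<in> e} = F \<inter> I" using F by (auto simp: I_def)
      have FI': "F - F \<inter> I = F - I" by auto
      have "attached (T (F \<inter> I)) (F - I)"
        using attached_peel[OF F(2) s(1)] unfolding FI FI' T_def by simp
      then show "z \<in> (SIGMA J:Pow I. A J)"
        using F by (auto simp: h_def A_def E'_def)
    qed
    have fS: "finite (SIGMA J:Pow I. A J)" using finI by (auto simp: A_def)
    have "(\<Sum>F\<in>?A. x ^ card F) =
        (\<Sum>F\<in>?A. (case h F of (J, F') => x ^ card J * x ^ card F'))"
    proof (intro sum.cong refl)
      fix F assume "F \<in> ?A"
      then have "finite F" using psubset.hyps finite_subset by auto
      then have "card F = card (F \<inter> I) + card (F - I)"
        by (metis card_Int_Diff add.commute)
      then show "x ^ card F = (case h F of (J, F') => x ^ card J * x ^ card F')"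
        by (simp add: h_def power_add)
    qed
    also have "... = (\<Sum>z\<in>h ` ?A. (case z of (J, F') => x ^ card J * x ^ card F'))"
      by (subst sum.reindex[OF inj]) (simp add: comp_def)
    also have "... <= (\<Sum>z\<in>(SIGMA J:Pow I. A J). (case z of (J, F') => x ^ card J * x ^ card F'))"
      by (intro sum_mono2 fS im) (use x in auto)
    also have "... = (\<Sum>J\<in>Pow I. x ^ card J * (\<Sum>F'\<in>A J. x ^ card F'))"
      using finI by (subst sum.Sigma[symmetric]) (auto simp: A_def sum_distrib_left)
    also have "... <= (\<Sum>J\<in>Pow I. x ^ card J * 2 ^ (card S - 1 + card J))"
      by (intro sum_mono mult_left_mono bd) (use x in auto)
    also have "... = 2 ^ (card S - 1) * (\<Sum>J\<in>Pow I. (2 * x) ^ card J)"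
      by (simp add: sum_distrib_left power_add power_mult_distrib algebra_simps)
    also have "... = 2 ^ (card S - 1) * (1 + 2 * x) ^ card I"
      using sum_Pow_power_card[OF finI(1), of "2 * x"] by simp
    also have "... <= 2 ^ (card S - 1) * (1 + 2 * x) ^ \<Delta>"
      using psubset.prems(2)[of s] x by (intro mult_left_mono power_increasing) (auto simp: I_def)
    \<comment> \<open>The sum over the edges chosen at \<open>s\<close> costs a factor 2, which is
      paid by the vertex \<open>s\<close> that left \<open>S\<close>. The condition on
      \<open>x\<close> is made for this balance.\<close>
    also have "... <= 2 ^ (card S - 1) * 2" using x by simp
    also have "... = 2 ^ card S"
    proof -
      have "card S > 0" using s psubset.prems(3) by (auto simp: card_gt_0_iff)
      then show ?thesis by (metis Suc_diff_1 power_Suc2)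
    qed
    finally show ?thesis .
  qed
qed

text \<open>An edge meeting \<open>S\<close> is removed and its vertices join \<open>S\<close>, at
  the price of raising \<open>r\<close> by one. Read backwards, an attached set that reaches far
  must have many edges, which is the source of locality.\<close>

lemma attached_level:
  fixes D :: "'v => nat"
  assumes "finite F" "attached S F" "\<And>v. v \<in> S ==> D v <= r"
    and "\<And>e u v. e \<in> F ==> u \<in> e ==> v \<in> e ==> D v <= D u + 1"
    and "v \<in> \<Union>F"
  shows "D v <= r + card F"
  using assms
proof (induction "card F" arbitrary: F S r)
  case 0
  then show ?case by auto
next
  case (Suc k)
  have "F ~= {}" using Suc by auto
  then obtain e where e: "e \<in> F" "e \<inter> S ~= {}" using attached_meets[OF Suc.prems(2)] by auto
  then obtain s where s: "s \<in> e" "s \<in> S" by auto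
  have De: "D w <= r + 1" if "w \<in> e" for w
    using Suc.prems(4)[OF e(1) s(1) that] Suc.prems(3)[OF s(2)] by linarith
  have card: "k = card (F - {e})" using Suc e by simp
  show ?case
  proof (cases "v \<in> e")
    case True
    have "card F >= 1" using Suc by simp
    then show ?thesis using De[OF True] by linarith
  next
    case False
    have "D v <= (r + 1) + card (F - {e})"
    proof (rule Suc.hyps(1)[OF card])
      show "attached (S \<union> e) (F - {e})" by (rule attached_remove_edge) fact+
      show "D w <= r + 1" if "w \<in> S \<union> e" for w
        using that De Suc.prems(3)[of w] by auto
      show "v \<in> \<Union>(F - {e})" using False Suc.prems(5) by auto
    qed (use Suc.prems in auto)
    then show ?thesis using card Suc.hyps(2) by simp
  qed
qed

subsection \<open>Colourings constant on clusters\<close>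

type_synonym 'v obs = "('v => nat) => real"

definition mono_ind :: "'v set set => 'v obs" where
  "mono_ind F s = of_bool (\<forall>e\<in>F. \<forall>u\<in>e. \<forall>v\<in>e. s u = s v)"

abbreviation "ph e \<equiv> mono_ind {e}"

definition depends_on :: "'v set => 'v obs => bool" where
  "depends_on S f \<longleftrightarrow> (\<forall>s t. (\<forall>v\<in>S. s v = t v) --> f s = f t)"

definition conn :: "'v set set => ('v \<times> 'v) set" where
  "conn F = {(x, y). {x, y} \<in> F}\<^sup>*"

abbreviation spins :: "nat => 'v set => ('v => nat) set" where
  "spins q S \<equiv> S \<rightarrow>\<^sub>E {1..q}"

definition colorings :: "nat => 'v set => 'v set set => ('v => nat) set" where
  "colorings q S F = {t \<in> spins q S. \<forall>u\<in>S. \<forall>v\<in>S. (u, v) \<in> conn F --> t u = t v}"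

text \<open>The conditional expectation of \<open>f\<close> given that \<open>F\<close> is the set
  of open edges. Only connections between vertices of \<open>S\<close> enter, so \<open>F\<close>
  may be infinite while the sum stays finite.\<close>

definition color_avg :: "nat => 'v set => 'v obs => 'v set set => real" where
  "color_avg q S f F = (\<Sum>t\<in>colorings q S F. f t) / real (card (colorings q S F))"

lemma depends_onD: "depends_on S f ==> (\<And>v. v \<in> S ==> s v = t v) ==> f s = f t"
  unfolding depends_on_def by simp

lemma depends_on_restrict: "depends_on S f ==> f (restrict s S) = f s"
  by (rule depends_onD) auto

lemma depends_on_mono_ind: "depends_on (\<Union>F) (mono_ind F)"
  unfolding depends_on_def mono_ind_def
proof (intro allI impI)
  fix s t :: "'a => nat" assume a: "\<forall>v\<in>\<Union>F. s v = t v"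
  have "s u = t u" if "e \<in> F" "u \<in> e" for e u using a that by auto
  then show "(of_bool (\<forall>e\<in>F. \<forall>u\<in>e. \<forall>v\<in>e. s u = s v) :: real) =
      of_bool (\<forall>e\<in>F. \<forall>u\<in>e. \<forall>v\<in>e. t u = t v)" by simp
qed

lemma mono_ind_range: "0 <= mono_ind F s" "mono_ind F s <= 1" "\<bar>mono_ind F s\<bar> <= 1"
  unfolding mono_ind_def by auto

lemma mono_ind_empty [simp]: "mono_ind {} s = 1"
  by (simp add: mono_ind_def)

lemma mono_ind_mult: "mono_ind F s * mono_ind G s = mono_ind (F \<union> G) s"
  unfolding mono_ind_def by (simp only: ball_Un of_bool_conj)

lemma conn_refl [simp]: "(u, u) \<in> conn F" by (simp add: conn_def)

lemma conn_mono: "F \<subseteq> G ==> conn F \<subseteq> conn G"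
  unfolding conn_def by (intro rtrancl_mono) auto

lemma conn_sym: "(u, v) \<in> conn F ==> (v, u) \<in> conn F"
proof -
  have "sym {(x, y). {x, y} \<in> F}" by (auto simp: sym_def insert_commute)
  then show "(u, v) \<in> conn F ==> (v, u) \<in> conn F"
    unfolding conn_def by (metis symE sym_rtrancl)
qed

lemma conn_trans: "(u, v) \<in> conn F ==> (v, w) \<in> conn F ==> (u, w) \<in> conn F"
  unfolding conn_def by (rule rtrancl_trans)

lemma conn_edge: "{u, v} \<in> F ==> (u, v) \<in> conn F"
  unfolding conn_def by auto

text \<open>A path that starts in \<open>U\<close> never leaves it: the edges of \<open>A\<close>
  stay inside and the edges of \<open>B\<close> do not touch it.\<close>

lemma conn_avoid:
  assumes "u \<in> U" "\<Union>A \<subseteq> U" "\<And>e. e \<in> B ==> e \<inter> U = {}"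
  shows "(u, v) \<in> conn (A \<union> B) \<longleftrightarrow> (u, v) \<in> conn A"
proof
  assume "(u, v) \<in> conn (A \<union> B)"
  then have "(u, v) \<in> conn A \<and> v \<in> U" unfolding conn_def
  proof (induction rule: rtrancl_induct)
    case (step y z)
    have "{y, z} \<notin> B" using step assms(3) by blast
    then have "{y, z} \<in> A" using step by auto
    moreover have "z \<in> U" using calculation assms(2) by auto
    ultimately show ?case using step by (auto intro: rtrancl_into_rtrancl)
  qed (use assms in auto)
  then show "(u, v) \<in> conn A" ..
qed (use conn_mono[of A "A \<union> B"] in auto)

lemma finite_colorings: "finite S ==> finite (colorings q S F)"
  unfolding colorings_def by (intro finite_subset[OF _ finite_PiE[of S "\<lambda>_. {1..q}"]]) auto

lemma colorings_nonempty: "q >= 1 ==> colorings q S F ~= {}"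
  unfolding colorings_def by (auto intro!: exI[of _ "\<lambda>v\<in>S. 1"])

lemma card_colorings_pos: "q >= 1 ==> finite S ==> card (colorings q S F) > 0"
  by (simp add: card_gt_0_iff finite_colorings colorings_nonempty)

lemma colorings_cong:
  assumes "\<And>u v. u \<in> S ==> v \<in> S ==> (u, v) \<in> conn F \<longleftrightarrow> (u, v) \<in> conn G"
  shows "colorings q S F = colorings q S G"
  unfolding colorings_def using assms by auto

lemma color_avg_cong:
  assumes "\<And>u v. u \<in> S ==> v \<in> S ==> (u, v) \<in> conn F \<longleftrightarrow> (u, v) \<in> conn G"
  shows "color_avg q S f F = color_avg q S f G"
  unfolding color_avg_def using colorings_cong[of S F G] assms by simp

lemma abs_color_avg_le:
  assumes "finite S" "q >= 1" "\<And>t. t \<in> spins q S ==> \<bar>f t\<bar> <= M"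
  shows "\<bar>color_avg q S f F\<bar> <= M"
proof -
  have "\<bar>\<Sum>t\<in>colorings q S F. f t\<bar> <= (\<Sum>t\<in>colorings q S F. \<bar>f t\<bar>)" by (rule sum_abs)
  also have "... <= (\<Sum>t\<in>colorings q S F. M)"
    by (intro sum_mono assms(3)) (auto simp: colorings_def)
  finally have "\<bar>\<Sum>t\<in>colorings q S F. f t\<bar> <= M * real (card (colorings q S F))"
    by (simp add: mult.commute)
  then show ?thesis unfolding color_avg_def
    using card_colorings_pos[OF assms(2,1), of F] by (simp add: abs_divide divide_le_eq)
qed

text \<open>The coefficients of the colour average as a multilinear polynomial in the indicators of
  open edges. Percolation turns the monomial of \<open>F\<close> into
  \<open>p ^ card F * mono_ind F\<close>, so these are the coefficients of the dynamics up to a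
  power of \<open>p\<close>.\<close>

definition sw_coeff :: "nat => 'v set => 'v obs => 'v set set => real" where
  "sw_coeff q S f = submoeb (color_avg q S f)"

text \<open>The edges of a violating \<open>B\<close> touch neither \<open>S\<close> nor the other
  edges of \<open>F\<close>, so they never help to connect two vertices of \<open>S\<close>.
  Switching one of them leaves the colour average unchanged, and the Moebius coefficient
  vanishes.\<close>

lemma sw_coeff_not_attached:
  assumes "finite F" "\<not> attached S F"
  shows "sw_coeff q S f F = 0"
proof -
  obtain B where B: "B \<subseteq> F" "B ~= {}" "\<Union>B \<inter> (S \<union> \<Union>(F - B)) = {}"
    using assms(2) unfolding attached_def by blast
  then obtain b where b: "b \<in> B" by blast
  show ?thesis unfolding sw_coeff_def
  proof (rule submoeb_eq_0[OF assms(1)])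
    show "b \<in> F" using b B by auto
    fix G assume G: "G \<subseteq> F - {b}"
    \<comment> \<open>Everything that a path from \<open>S\<close> can reach inside \<open>F\<close>
      without using \<open>B\<close>; the edges of \<open>B\<close> are disjoint from it.\<close>
    define U where "U = S \<union> \<Union>(F - B)"
    have U: "u \<in> U ==> (u, v) \<in> conn ((G - B) \<union> C) \<longleftrightarrow> (u, v) \<in> conn (G - B)"
      if "C \<subseteq> B" for C u v
    proof (rule conn_avoid)
      show "\<Union>(G - B) \<subseteq> U" using G by (auto simp: U_def)
      show "e \<inter> U = {}" if "e \<in> C" for e
      proof -
        have "e \<subseteq> \<Union>B" using that \<open>C \<subseteq> B\<close> by auto
        then show ?thesis using B(3) unfolding U_def by blast
      qed
    qed
    have e: "insert b G = (G - B) \<union> (insert b G \<inter> B)" "G = (G - B) \<union> (G \<inter> B)" using b by auto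
    have 1: "color_avg q S f (insert b G) = color_avg q S f (G - B)"
      by (subst e(1), rule color_avg_cong, rule U) (auto simp: U_def)
    have 2: "color_avg q S f G = color_avg q S f (G - B)"
      by (subst e(2), rule color_avg_cong, rule U) (auto simp: U_def)
    show "color_avg q S f (insert b G) = color_avg q S f G" using 1 2 by simp
  qed
qed

lemma abs_sw_coeff_le:
  assumes "finite F" "finite S" "q >= 1" "\<And>t. t \<in> spins q S ==> \<bar>f t\<bar> <= M"
  shows "\<bar>sw_coeff q S f F\<bar> <= 2 ^ card F * M"
  unfolding sw_coeff_def by (intro abs_submoeb_le abs_color_avg_le assms)

declare One_nat_def [simp del]

subsection \<open>The Swendsen-Wang kernel on local functions\<close>

lemmas bochner_cong = Bochner_Integration.integral_cong
lemmas bochner_nonneg = Bochner_Integration.integral_nonneg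

lemma (in product_prob_space) integral_restrict_finite:
  fixes G :: "('i => 'a) => real"
  assumes "J \<subseteq> I" "finite J" "finite B"
    and "\<And>i. i \<in> I ==> space (M i) = B" "\<And>i. i \<in> I ==> sets (M i) = Pow B"
  shows "(\<integral>\<kappa>. G (restrict \<kappa> J) \<partial>PiM I M) = (\<Sum>k\<in>J \<rightarrow>\<^sub>E B. G k * (\<Prod>j\<in>J. measure (M j) {k j}))"
proof -
  define C where "C k = prod_emb I M J (\<Pi>\<^sub>E j\<in>J. {k j})" for k
  have fin: "finite (J \<rightarrow>\<^sub>E B)" using assms by (intro finite_PiE) auto
  have sing: "{k i} \<in> sets (M i)" if "k \<in> J \<rightarrow>\<^sub>E B" "i \<in> J" for k i
    using PiE_mem[OF that] assms(1) assms(5)[of i] that(2) by auto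
  have sets: "C k \<in> sets (PiM I M)" if "k \<in> J \<rightarrow>\<^sub>E B" for k
    unfolding C_def by (rule sets_PiM_I[OF assms(2,1)]) (use sing that in blast)
  have "(\<integral>\<kappa>. G (restrict \<kappa> J) \<partial>PiM I M) = (\<integral>\<kappa>. (\<Sum>k\<in>J \<rightarrow>\<^sub>E B. G k * indicator (C k) \<kappa>) \<partial>PiM I M)"
  proof (intro bochner_cong refl)
    fix \<kappa> assume \<kappa>: "\<kappa> \<in> space (PiM I M)"
    have r: "restrict \<kappa> J \<in> J \<rightarrow>\<^sub>E B" using \<kappa> assms by (auto simp: space_PiM PiE_def Pi_def)
    have ind: "indicator (C k) \<kappa> = (of_bool (k = restrict \<kappa> J) :: real)" if "k \<in> J \<rightarrow>\<^sub>E B" for k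
    proof -
      have "\<kappa> \<in> C k \<longleftrightarrow> k = restrict \<kappa> J"
        using \<kappa> that by (auto simp: C_def prod_emb_def space_PiM restrict_def PiE_def extensional_def Pi_def fun_eq_iff)
      then show ?thesis by (auto simp: indicator_def)
    qed
    have "(\<Sum>k\<in>J \<rightarrow>\<^sub>E B. G k * indicator (C k) \<kappa>) = (\<Sum>k\<in>J \<rightarrow>\<^sub>E B. if k = restrict \<kappa> J then G k else 0)"
      by (intro sum.cong refl) (simp add: ind)
    also have "... = G (restrict \<kappa> J)" using r fin by simp
    finally show "G (restrict \<kappa> J) = (\<Sum>k\<in>J \<rightarrow>\<^sub>E B. G k * indicator (C k) \<kappa>)" by simp
  qed
  also have "... = (\<Sum>k\<in>J \<rightarrow>\<^sub>E B. G k * measure (PiM I M) (C k))"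
    using sets by (subst Bochner_Integration.integral_sum)
      (auto intro!: Bochner_Integration.integrable_mult_right integrable_real_indicator simp: P.emeasure_eq_measure
        sets.Int_space_eq2)
  also have "... = (\<Sum>k\<in>J \<rightarrow>\<^sub>E B. G k * (\<Prod>j\<in>J. measure (M j) {k j}))"
  proof (intro sum.cong refl)
    fix k assume k: "k \<in> J \<rightarrow>\<^sub>E B"
    have "measure (PiM I M) (C k) = (\<Prod>j\<in>J. measure (M j) {k j})"
      unfolding C_def by (intro measure_PiM_emb assms sing k)
    then show "G k * measure (PiM I M) (C k) = G k * (\<Prod>j\<in>J. measure (M j) {k j})" by simp
  qed
  finally show ?thesis .
qed

lemma conn_UN:
  assumes "incseq F" "(u, v) \<in> conn (\<Union>n::nat. F n)"
  shows "\<exists>n. (u, v) \<in> conn (F n)"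
  using assms(2) unfolding conn_def
proof (induction rule: rtrancl_induct)
  case (step y z)
  obtain n m where n: "(u, y) \<in> {(x, y). {x, y} \<in> F n}\<^sup>*" and m: "{y, z} \<in> F m" using step by auto
  have "(u, y) \<in> conn (F (max n m))"
    using n conn_mono[OF incseqD[OF assms(1), of n "max n m"]] unfolding conn_def by auto
  moreover have "(y, z) \<in> conn (F (max n m))"
    by (rule subsetD[OF conn_mono[OF incseqD[OF assms(1)]] conn_edge[OF m]]) simp
  ultimately have "(u, z) \<in> conn (F (max n m))" by (rule conn_trans)
  then show ?case unfolding conn_def by blast
qed blast

text \<open>A connection uses finitely many edges, and only finitely many pairs of vertices of
  \<open>S\<close> matter, so the averages become constant along an exhaustion. This replaces any
  continuity argument on the infinite graph.\<close>

lemma color_avg_eventually: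
  assumes "finite S" "incseq F"
  shows "\<forall>\<^sub>F n in sequentially. color_avg q S f (F n) = color_avg q S f (\<Union>n::nat. F n)"
proof -
  have ev: "\<forall>\<^sub>F n in sequentially. (u, v) \<in> conn (F n) \<longleftrightarrow> (u, v) \<in> conn (\<Union>n. F n)" for u v
  proof (cases "(u, v) \<in> conn (\<Union>n. F n)")
    case True
    then obtain m where "(u, v) \<in> conn (F m)" using conn_UN[OF assms(2)] by auto
    then have "(u, v) \<in> conn (F n)" if "n >= m" for n
      using conn_mono[OF incseqD[OF assms(2) that]] by auto
    then show ?thesis using True by (auto simp: eventually_sequentially)
  next
    case False
    then have "(u, v) \<notin> conn (F n)" for n using conn_mono[of "F n" "\<Union>n. F n"] by auto
    then show ?thesis using False by auto
  qed
  have "\<forall>\<^sub>F n in sequentially. \<forall>u\<in>S. \<forall>v\<in>S. (u, v) \<in> conn (F n) \<longleftrightarrow> (u, v) \<in> conn (\<Union>n. F n)"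
    by (intro eventually_ball_finite assms(1) ballI ev)
  then show ?thesis by eventually_elim (rule color_avg_cong, blast)
qed

lemma color_avg_polynomial:
  assumes "finite A"
  shows "color_avg q S f {e\<in>A. w e} = (\<Sum>F\<in>Pow A. sw_coeff q S f F * of_bool (\<forall>e\<in>F. w e))"
proof -
  have "color_avg q S f {e\<in>A. w e} = (\<Sum>F\<in>Pow {e\<in>A. w e}. sw_coeff q S f F)"
    unfolding sw_coeff_def by (rule submoeb_inversion[symmetric]) (simp add: assms)
  also have "... = (\<Sum>F\<in>Pow A. sw_coeff q S f F * of_bool (\<forall>e\<in>F. w e))"
  proof (rule sum.mono_neutral_cong_left)
    show "\<forall>F\<in>Pow A - Pow {e \<in> A. w e}. sw_coeff q S f F * of_bool (\<forall>e\<in>F. w e) = 0"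
    proof
      fix F assume "F \<in> Pow A - Pow {e \<in> A. w e}"
      then have "\<not> (\<forall>e\<in>F. w e)" by blast
      then show "sw_coeff q S f F * of_bool (\<forall>e\<in>F. w e) = 0" by simp
    qed
    show "sw_coeff q S f F = sw_coeff q S f F * of_bool (\<forall>e\<in>F. w e)" if "F \<in> Pow {e \<in> A. w e}" for F
    proof -
      have "\<forall>e\<in>F. w e" using that by auto
      then show ?thesis by simp
    qed
    show "finite (Pow A)" using assms by simp
    show "Pow {e \<in> A. w e} \<subseteq> Pow A" by blast
  qed
  finally show ?thesis .
qed

lemma space_spin_space [simp]: "space (spin_space V q) = spins q V"
  by (simp add: spin_space_def space_PiM)

lemma depends_on_measurable:
  assumes "finite S" "S \<subseteq> V" "depends_on S f"
  shows "f \<in> borel_measurable (spin_space V q)"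
proof -
  have "(\<lambda>s. restrict s S) \<in> spin_space V q \<rightarrow>\<^sub>M PiM S (\<lambda>_. count_space {1..q})"
    unfolding spin_space_def by (rule measurable_restrict_subset) fact
  also have "PiM S (\<lambda>_. count_space {1..q}) = count_space (spins q S)"
    by (rule count_space_PiM_finite) (use assms in auto)
  finally have "(\<lambda>s. f (restrict s S)) \<in> borel_measurable (spin_space V q)"
    by (rule measurable_compose) simp
  then show ?thesis using depends_on_restrict[OF assms(3)] by simp
qed

lemma cluster_eq_iff:
  assumes "u \<in> V" "v \<in> V"
  shows "cluster V F u = cluster V F v \<longleftrightarrow> (u, v) \<in> conn F"
proof
  assume "cluster V F u = cluster V F v"
  moreover have "v \<in> cluster V F v" using assms by (auto simp: cluster_def)
  ultimately have "v \<in> cluster V F u" by simp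
  then show "(u, v) \<in> conn F" by (auto simp: cluster_def conn_def)
next
  assume uv: "(u, v) \<in> conn F"
  have "(u, w) \<in> conn F \<longleftrightarrow> (v, w) \<in> conn F" for w
    using conn_trans conn_sym uv by metis
  then show "cluster V F u = cluster V F v" unfolding cluster_def conn_def by auto
qed

text \<open>Only the colours of the clusters meeting \<open>S\<close> are seen by \<open>f\<close>,
  and choices of these colours correspond bijectively to colourings of \<open>S\<close> that are
  constant on connected vertices. Both are uniform.\<close>

lemma random_coloring_integral:
  assumes S: "finite S" "S \<subseteq> V" and f: "depends_on S f" and q: "q >= 1"
  shows "(\<integral>s. f s \<partial>random_coloring V F q) = color_avg q S f F"
    and "prob_space (random_coloring V F q)"
    and "sets (random_coloring V F q) = sets (spin_space V q)"
proof -
  let ?c = "cluster V F"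
  let ?U = "\<lambda>_::'a set. uniform_count_measure {1..q}"
  let ?M = "PiM (?c ` V) ?U"
  let ?g = "\<lambda>\<kappa>. \<lambda>v\<in>V. \<kappa> (?c v)"
  interpret U: product_prob_space ?U "?c ` V"
    by (intro product_prob_spaceI prob_space_uniform_count_measure) (use q in auto)
  have U1: "measure (uniform_count_measure {1..q}) {a} = 1 / real q" if "a \<in> {1..q}" for a
    using that q by (simp add: measure_uniform_count_measure)
  have g: "?g \<in> ?M \<rightarrow>\<^sub>M spin_space V q"
    unfolding spin_space_def
  proof (rule measurable_restrict)
    fix v assume "v \<in> V"
    then have "(\<lambda>\<kappa>. \<kappa> (?c v)) \<in> ?M \<rightarrow>\<^sub>M uniform_count_measure {1..q}"
      by (intro measurable_component_singleton) auto
    then show "(\<lambda>\<kappa>. \<kappa> (?c v)) \<in> ?M \<rightarrow>\<^sub>M count_space {1..q}"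
      unfolding measurable_cong_sets[OF refl sets_uniform_count_measure_count_space] .
  qed
  show "prob_space (random_coloring V F q)"
    unfolding random_coloring_def by (rule U.prob_space_distr[OF g])
  show "sets (random_coloring V F q) = sets (spin_space V q)"
    unfolding random_coloring_def by simp
  define J where "J = ?c ` S"
  define G where "G k = f (\<lambda>v\<in>S. k (?c v))" for k
  have J: "finite J" "J \<subseteq> ?c ` V" using S by (auto simp: J_def)
  have "(\<integral>s. f s \<partial>random_coloring V F q) = (\<integral>\<kappa>. f (?g \<kappa>) \<partial>?M)"
    unfolding random_coloring_def
    by (rule integral_distr[OF g]) (rule depends_on_measurable[OF S f])
  also have "... = (\<integral>\<kappa>. G (restrict \<kappa> J) \<partial>?M)"
    unfolding G_def
    by (intro bochner_cong refl depends_onD[OF f]) (use S in \<open>auto simp: J_def\<close>)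
  also have "... = (\<Sum>k\<in>spins q J. G k * (\<Prod>j\<in>J. measure (uniform_count_measure {1..q}) {k j}))"
    by (rule U.integral_restrict_finite)
      (use J in \<open>auto simp: space_uniform_count_measure sets_uniform_count_measure\<close>)
  also have "... = (\<Sum>k\<in>spins q J. G k * (1 / real q) ^ card J)"
  proof (intro sum.cong refl)
    fix k assume "k \<in> spins q J"
    then have "(\<Prod>j\<in>J. measure (uniform_count_measure {1..q}) {k j}) = (\<Prod>j\<in>J. 1 / real q)"
      by (intro prod.cong refl U1) auto
    then show "G k * (\<Prod>j\<in>J. measure (uniform_count_measure {1..q}) {k j}) = G k * (1 / real q) ^ card J"
      by simp
  qed
  also have "... = (\<Sum>k\<in>spins q J. G k) / real q ^ card J"
    by (simp add: sum_divide_distrib power_divide)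
  finally have 1: "(\<integral>s. f s \<partial>random_coloring V F q) = (\<Sum>k\<in>spins q J. G k) / real q ^ card J" .
  have ceq: "?c u = ?c v \<longleftrightarrow> (u, v) \<in> conn F" if "u \<in> S" "v \<in> S" for u v
    using cluster_eq_iff[of u V v F] that S by auto
  define r where "r k = (\<lambda>v\<in>S. k (?c v))" for k :: "'a set => nat"
  have bij: "bij_betw r (spins q J) (colorings q S F)"
    unfolding bij_betw_def
  proof
    show "inj_on r (spins q J)"
    proof (rule inj_onI)
      fix k l assume kl: "k \<in> spins q J" "l \<in> spins q J" "r k = r l"
      show "k = l"
      proof (rule PiE_ext[OF kl(1,2)])
        fix j assume "j \<in> J"
        then obtain v where v: "v \<in> S" "j = ?c v" by (auto simp: J_def)
        then show "k j = l j" using fun_cong[OF kl(3), of v] by (simp add: r_def)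
      qed
    qed
    show "r ` (spins q J) = colorings q S F"
    proof
      show "r ` (spins q J) \<subseteq> colorings q S F"
      proof
        fix t assume "t \<in> r ` (spins q J)"
        then obtain k where k: "k \<in> spins q J" "t = r k" by auto
        have kJ: "k (?c v) \<in> {1..q}" if "v \<in> S" for v
          using PiE_mem[OF k(1), of "?c v"] that unfolding J_def by blast
        have "t \<in> spins q S" unfolding k(2) r_def by (rule restrict_PiE_iff[THEN iffD2]) (use kJ in blast)
        moreover have "t u = t v" if "u \<in> S" "v \<in> S" "(u, v) \<in> conn F" for u v
        proof -
          have "?c u = ?c v" using ceq[OF that(1,2)] that(3) by simp
          then show ?thesis unfolding k(2) r_def using that by simp
        qed
        ultimately show "t \<in> colorings q S F" unfolding colorings_def by blast
      qed
      show "colorings q S F \<subseteq> r ` (spins q J)"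
      proof
        fix t assume t: "t \<in> colorings q S F"
        define k where "k = (\<lambda>j\<in>J. t (inv_into S ?c j))"
        have k: "k (?c v) = t v" if v: "v \<in> S" for v
        proof -
          have j: "?c v \<in> J" using v by (simp add: J_def)
          then have w: "inv_into S ?c (?c v) \<in> S" "(inv_into S ?c (?c v), v) \<in> conn F"
            using ceq[OF _ v] inv_into_into[of "?c v" ?c S] f_inv_into_f[of "?c v" ?c S] unfolding J_def by auto
          then have "t (inv_into S ?c (?c v)) = t v" using t v unfolding colorings_def by blast
          then show ?thesis using j by (simp add: k_def)
        qed
        have tS: "t \<in> spins q S" using t unfolding colorings_def by blast
        have "r k = t"
        proof
          fix v show "r k v = t v"
            using k[of v] PiE_arb[OF tS, of v] by (cases "v \<in> S") (auto simp: r_def)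
        qed
        moreover have "k \<in> spins q J"
        proof (rule PiE_I)
          fix j assume "j \<in> J"
          then obtain v where v: "v \<in> S" "j = ?c v" by (auto simp: J_def)
          show "k j \<in> {1..q}" unfolding v(2) k[OF v(1)] by (rule PiE_mem[OF tS v(1)])
        qed (simp add: k_def)
        ultimately show "t \<in> r ` (spins q J)" by blast
      qed
    qed
  qed
  have "(\<Sum>k\<in>spins q J. G k) = (\<Sum>t\<in>colorings q S F. f t)"
    using sum.reindex_bij_betw[OF bij, of f] by (simp add: G_def r_def)
  moreover have "card (colorings q S F) = q ^ card J"
    using bij_betw_same_card[OF bij] J by (simp add: card_PiE)
  ultimately show "(\<integral>s. f s \<partial>random_coloring V F q) = color_avg q S f F"
    using 1 by (simp add: color_avg_def)
qed

section \<open>Graphs of bounded degree: edge percolation and the dynamics as probability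
  kernels\<close>

locale sw_graph =
  fixes V :: "'v set" and E :: "'v set set" and q :: nat and \<beta> :: real and \<Delta> :: nat
  assumes countable_V: "countable V"
    and edgeE: "e \<in> E ==> \<exists>u\<in>V. \<exists>v\<in>V. u ~= v \<and> e = {u, v}"
    and deg: "v \<in> V ==> finite {e\<in>E. v \<in> e} \<and> card {e\<in>E. v \<in> e} <= \<Delta>"
    and q2: "q >= 2" and beta_pos: "\<beta> > 0"
begin

definition p :: real where "p = 1 - exp (- \<beta>)"

abbreviation "perc \<equiv> edge_percolation E \<beta>"
abbreviation "sw \<equiv> sw_kernel V E q \<beta>"
abbreviation "cfg \<equiv> spins q V"
abbreviation "sps \<equiv> spin_space V q"

lemma q1: "q >= 1" using q2 by simp

lemma p_bounds: "0 < p" "p < 1" "p <= \<beta>"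
  using beta_pos exp_ge_add_one_self[of "-\<beta>"] by (auto simp: p_def)

lemma card_edge: "e \<in> E ==> card e = 2"
  using edgeE by force

lemma edge_subset: "e \<in> E ==> e \<subseteq> V"
  using edgeE by force

lemma finite_edge: "e \<in> E ==> finite e"
  using edgeE by force

lemma countable_E: "countable E"
proof (rule countable_subset)
  show "E \<subseteq> (\<lambda>(u, v). {u, v}) ` (V \<times> V)" using edgeE by force
qed (use countable_V in auto)

lemma mono_ind_eq:
  assumes "F \<subseteq> E" "finite F"
  shows "mono_ind F s = of_bool (F \<subseteq> mono_edges E s)"
proof -
  have "(\<forall>e\<in>F. \<forall>u\<in>e. \<forall>v\<in>e. s u = s v) \<longleftrightarrow> F \<subseteq> mono_edges E s"
    using assms unfolding mono_edges_def by blast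
  then show ?thesis by (simp add: mono_ind_def)
qed

sublocale perc_prod: product_prob_space
  "\<lambda>e. measure_pmf (bernoulli_pmf (if e \<in> mono_edges E s then 1 - exp (- \<beta>) else 0))" E for s
  by (intro product_prob_spaceI prob_space_measure_pmf)

lemma prob_space_perc: "prob_space (perc s)"
  unfolding edge_percolation_def by (intro prob_space_PiM prob_space_measure_pmf)

lemma sets_perc: "sets (perc s) = sets (PiM E (\<lambda>_. count_space (UNIV :: bool set)))"
  unfolding edge_percolation_def by (intro sets_PiM_cong) auto

lemma perc_open_sets:
  assumes "F \<subseteq> E" "finite F"
  shows "(\<lambda>w. of_bool (\<forall>e\<in>F. w e) :: real) \<in> borel_measurable (PiM E (\<lambda>_. count_space UNIV))"
proof -
  have "(\<lambda>w. \<Prod>e\<in>F. (\<lambda>b. of_bool b) (w e) :: real) \<in> borel_measurable (PiM E (\<lambda>_. count_space UNIV))"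
  proof (rule borel_measurable_prod)
    fix e assume "e \<in> F"
    then have "(\<lambda>w. w e) \<in> PiM E (\<lambda>_. count_space UNIV) \<rightarrow>\<^sub>M count_space (UNIV::bool set)"
      using assms by (intro measurable_component_singleton) auto
    then show "(\<lambda>w. (\<lambda>b. of_bool b :: real) (w e)) \<in> borel_measurable (PiM E (\<lambda>_. count_space UNIV))"
      by (rule measurable_compose) simp
  qed
  moreover have "(\<Prod>e\<in>F. of_bool (w e) :: real) = of_bool (\<forall>e\<in>F. w e)" for w
    using assms(2) by (induction F) auto
  ultimately show ?thesis by simp
qed

text \<open>The edges are independent, and an edge that is not monochromatic is closed almost
  surely, so one such edge in \<open>F\<close> makes the product vanish.\<close>

lemma integral_perc:
  assumes F: "F \<subseteq> E" "finite F"
  shows "integrable (perc s) (\<lambda>w. of_bool (\<forall>e\<in>F. w e) :: real)"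
    and "(\<integral>w. of_bool (\<forall>e\<in>F. w e) \<partial>perc s) = p ^ card F * mono_ind F s"
proof -
  interpret P: prob_space "perc s" by (rule prob_space_perc)
  show int: "integrable (perc s) (\<lambda>w. of_bool (\<forall>e\<in>F. w e) :: real)"
    by (rule P.integrable_const_bound[of _ 1])
      (use perc_open_sets[OF F] in \<open>auto simp: measurable_cong_sets[OF sets_perc refl]\<close>)
  let ?M = "\<lambda>e. measure_pmf (bernoulli_pmf (if e \<in> mono_edges E s then 1 - exp (- \<beta>) else 0))"
  let ?A = "prod_emb E ?M F (\<Pi>\<^sub>E e\<in>F. {True})"
  have "(\<integral>w. of_bool (\<forall>e\<in>F. w e) \<partial>perc s) = (\<integral>w. indicator ?A w \<partial>perc s :: real)"
  proof (intro bochner_cong refl)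
    fix w assume w: "w \<in> space (perc s)"
    have "w \<in> ?A \<longleftrightarrow> (\<forall>e\<in>F. w e)"
      using w F by (auto simp: prod_emb_def edge_percolation_def space_PiM fun_eq_iff restrict_def)
    then show "of_bool (\<forall>e\<in>F. w e) = (indicator ?A w :: real)" by (simp add: indicator_def)
  qed
  also have "... = measure (perc s) ?A"
  proof -
    have "?A \<in> sets (perc s)" unfolding edge_percolation_def by (intro sets_PiM_I) (use F in auto)
    then show ?thesis by simp
  qed
  also have "... = (\<Prod>e\<in>F. measure (?M e) {True})"
    unfolding edge_percolation_def by (rule perc_prod.measure_PiM_emb) (use F in auto)
  also have "... = (\<Prod>e\<in>F. p * of_bool (e \<in> mono_edges E s))"
    by (intro prod.cong refl) (use p_bounds in \<open>simp add: measure_pmf_single p_def\<close>)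
  also have "... = p ^ card F * of_bool (F \<subseteq> mono_edges E s)"
    using F(2) by (induction F) (auto simp: )
  finally show "(\<integral>w. of_bool (\<forall>e\<in>F. w e) \<partial>perc s) = p ^ card F * mono_ind F s"
    using mono_ind_eq[OF F] by simp
qed

lemma exhaust_edges:
  obtains A :: "nat => 'v set set" where "incseq A" "\<And>n. finite (A n)" "\<And>n. A n \<subseteq> E" "(\<Union>n. A n) = E"
proof
  let ?A = "\<lambda>n. {e\<in>E. to_nat_on E e <= n}"
  show "incseq ?A" by (auto simp: incseq_def)
  show "finite (?A n)" for n
  proof (rule inj_on_finite)
    show "inj_on (to_nat_on E) (?A n)"
      by (rule inj_on_subset[OF inj_on_to_nat_on[OF countable_E]]) auto
    show "to_nat_on E ` ?A n \<subseteq> {..n}" by auto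
  qed simp
  show "(\<Union>n. ?A n) = E" by auto
qed auto

lemma color_avg_exhaust:
  assumes "finite S" "incseq A" "(\<Union>n. A n) = E"
  shows "(\<lambda>n. color_avg q S f {e\<in>A n. w e}) \<longlonglongrightarrow> color_avg q S f {e\<in>E. w e}"
proof -
  have "incseq (\<lambda>n. {e\<in>A n. w e})" using assms(2) unfolding incseq_def by blast
  moreover have "(\<Union>n. {e\<in>A n. w e}) = {e\<in>E. w e}" using assms(3) by auto
  ultimately show ?thesis
    using tendsto_eventually[OF color_avg_eventually[OF assms(1), of "\<lambda>n. {e\<in>A n. w e}" q f]] by simp
qed

lemma color_avg_open_measurable:
  assumes "finite S"
  shows "(\<lambda>w. color_avg q S f {e\<in>E. w e}) \<in> borel_measurable (PiM E (\<lambda>_. count_space UNIV))"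
proof -
  obtain A where A: "incseq A" "\<And>n. finite (A n)" "\<And>n. A n \<subseteq> E" "(\<Union>n. A n) = E"
    by (rule exhaust_edges) (rule that)
  show ?thesis
  proof (rule borel_measurable_LIMSEQ_real)
    show "(\<lambda>n. color_avg q S f {e\<in>A n. w e}) \<longlonglongrightarrow> color_avg q S f {e\<in>E. w e}" for w
      by (rule color_avg_exhaust) fact+
    show "(\<lambda>w. color_avg q S f {e\<in>A n. w e}) \<in> borel_measurable (PiM E (\<lambda>_. count_space UNIV))" for n
      unfolding color_avg_polynomial[OF A(2)]
    proof (intro borel_measurable_sum borel_measurable_times borel_measurable_const)
      fix F assume "F \<in> Pow (A n)"
      then show "(\<lambda>w. of_bool (\<forall>e\<in>F. w e) :: real) \<in> borel_measurable (PiM E (\<lambda>_. count_space UNIV))"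
        using A finite_subset[of F "A n"] by (intro perc_open_sets) auto
    qed
  qed
qed

lemma prod_emb_indicator:
  assumes "J \<subseteq> V" "s \<in> cfg"
  shows "indicator (prod_emb V (\<lambda>_. count_space {1..q}) J (Pi\<^sub>E J X)) s = of_bool (\<forall>v\<in>J. s v \<in> X v)"
  using assms by (auto simp: indicator_def prod_emb_def PiE_iff)

lemma emeasure_cylinder:
  assumes L: "prob_space L" "sets L = sets sps"
    and J: "finite J" "J \<subseteq> V" "\<And>i. i \<in> J ==> X i \<in> sets (count_space {1..q})"
  shows "emeasure L (prod_emb V (\<lambda>_. count_space {1..q}) J (Pi\<^sub>E J X)) = ennreal (\<integral>s. of_bool (\<forall>v\<in>J. s v \<in> X v) \<partial>L)"
proof -
  interpret prob_space L by fact
  let ?A = "prod_emb V (\<lambda>_. count_space {1..q}) J (Pi\<^sub>E J X)"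
  have "?A \<in> sets sps" unfolding spin_space_def using J by (intro sets_PiM_I) auto
  then have "emeasure L ?A = ennreal (\<integral>s. indicator ?A s \<partial>L)" using L by (simp add: emeasure_eq_measure)
  also have "(\<integral>s. indicator ?A s \<partial>L) = (\<integral>s. of_bool (\<forall>v\<in>J. s v \<in> X v) \<partial>L :: real)"
  proof (rule bochner_cong)
    fix s assume "s \<in> space L"
    then show "indicator ?A s = (of_bool (\<forall>v\<in>J. s v \<in> X v) :: real)"
      using sets_eq_imp_space_eq[OF L(2)] by (intro prod_emb_indicator[OF J(2)]) simp
  qed simp
  finally show ?thesis .
qed

text \<open>Cylinder events generate the product sigma-algebra and are stable under intersection,
  and their probabilities are integrals of local functions. Thus it is enough to test a kernel on
  local functions.\<close>

lemma kernel_measurableI: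
  assumes ps: "\<And>a. a \<in> space M ==> prob_space (K a)"
    and sets: "\<And>a. a \<in> space M ==> sets (K a) = sets sps"
    and meas: "\<And>S f. finite S ==> S \<subseteq> V ==> depends_on S f ==> (\<lambda>a. \<integral>s. f s \<partial>K a) \<in> borel_measurable M"
  shows "K \<in> M \<rightarrow>\<^sub>M prob_algebra sps"
proof (rule measurable_prob_algebra_generated)
  show "sets sps = sigma_sets cfg (prod_algebra V (\<lambda>_. count_space {1..q}))"
    unfolding spin_space_def sets_PiM by simp
  show "Int_stable (prod_algebra V (\<lambda>_. count_space {1..q}))" by (rule Int_stable_prod_algebra)
  show "prod_algebra V (\<lambda>_. count_space {1..q}) \<subseteq> Pow cfg"
    using prod_algebra_sets_into_space[of V "\<lambda>_. count_space {1..q}"] by simp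
  fix A assume "A \<in> prod_algebra V (\<lambda>_. count_space {1..q})"
  then obtain J X where A: "A = prod_emb V (\<lambda>_. count_space {1..q}) J (\<Pi>\<^sub>E j\<in>J. X j)" "finite J" "J \<subseteq> V"
    "\<And>i. i \<in> J ==> X i \<in> sets (count_space {1..q})"
    by (rule prod_algebraE) blast
  have "emeasure (K a) A = ennreal (\<integral>s. of_bool (\<forall>v\<in>J. s v \<in> X v) \<partial>K a)" if "a \<in> space M" for a
    unfolding A(1) by (rule emeasure_cylinder[OF ps[OF that] sets[OF that] A(2-4)])
  moreover have "(\<lambda>a. \<integral>s. of_bool (\<forall>v\<in>J. s v \<in> X v) \<partial>K a :: real) \<in> borel_measurable M"
    by (rule meas[OF A(2,3)]) (auto simp: depends_on_def)
  ultimately show "(\<lambda>a. emeasure (K a) A) \<in> borel_measurable M"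
    by (subst measurable_cong[where g = "\<lambda>a. ennreal (\<integral>s. of_bool (\<forall>v\<in>J. s v \<in> X v) \<partial>K a)"]) auto
qed fact+

lemma random_coloring_kernel:
  "(\<lambda>w. random_coloring V {e\<in>E. w e} q) \<in> perc s \<rightarrow>\<^sub>M prob_algebra sps"
proof (rule kernel_measurableI)
  show "prob_space (random_coloring V {e \<in> E. w e} q)" for w
    by (rule random_coloring_integral(2)[of "{}" V "\<lambda>_. 0"]) (use q1 in \<open>auto simp: depends_on_def\<close>)
  show "sets (random_coloring V {e \<in> E. w e} q) = sets sps" for w
    by (rule random_coloring_integral(3)[of "{}" V "\<lambda>_. 0"]) (use q1 in \<open>auto simp: depends_on_def\<close>)
  fix S and f :: "'v obs" assume S: "finite S" "S \<subseteq> V" "depends_on S f"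
  show "(\<lambda>w. \<integral>t. f t \<partial>random_coloring V {e \<in> E. w e} q) \<in> borel_measurable (perc s)"
    unfolding random_coloring_integral(1)[OF S q1] measurable_cong_sets[OF sets_perc refl]
    by (rule color_avg_open_measurable[OF S(1)])
qed

lemma prob_space_sw: "prob_space (sw s)" and sets_sw: "sets (sw s) = sets sps"
proof -
  have "perc s \<in> space (prob_algebra (perc s))"
    using prob_space_perc by (simp add: space_prob_algebra)
  note * = this random_coloring_kernel[of s]
  show "prob_space (sw s)" unfolding sw_kernel_def by (rule prob_space_bind'[OF *])
  show "sets (sw s) = sets sps" unfolding sw_kernel_def by (rule sets_bind'[OF *])
qed

lemma space_sw: "space (sw s) = cfg"
  using sets_eq_imp_space_eq[OF sets_sw] by simp

lemma local_bounded:
  assumes "finite S" "depends_on S f" "S \<subseteq> V"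
  obtains M where "M >= 0" "\<And>s. s \<in> spins q S ==> \<bar>f s\<bar> <= M" "\<And>s. s \<in> cfg ==> \<bar>f s\<bar> <= M"
proof
  let ?M = "\<Sum>s\<in>spins q S. \<bar>f s\<bar>"
  show "?M >= 0" by (rule sum_nonneg) simp
  show *: "\<bar>f s\<bar> <= ?M" if "s \<in> spins q S" for s
    by (rule member_le_sum) (use that assms(1) in \<open>auto intro: finite_PiE\<close>)
  show "\<bar>f s\<bar> <= ?M" if "s \<in> cfg" for s
  proof -
    have "restrict s S \<in> spins q S" using that assms(3) by (auto simp: PiE_def Pi_def)
    from *[OF this] show ?thesis unfolding depends_on_restrict[OF assms(2)] .
  qed
qed

text \<open>For finitely many edges the colour average is a polynomial whose percolation mean is
  explicit. Along an exhaustion the averages converge pointwise and stay bounded by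
  \<open>M\<close>, so dominated convergence applies. The limit form is what gives a meaning to the
  expansion on an infinite graph.\<close>

lemma sw_integral_limit:
  assumes S: "finite S" "S \<subseteq> V" "depends_on S f"
    and A: "incseq A" "\<And>n. finite (A n)" "(\<Union>n. A n) = E"
  shows "(\<lambda>n. \<Sum>F\<in>Pow (A n). sw_coeff q S f F * p ^ card F * mono_ind F s) \<longlonglongrightarrow> (\<integral>t. f t \<partial>sw s)"
proof -
  interpret P: prob_space "perc s" by (rule prob_space_perc)
  obtain M where M: "M >= 0" "\<And>s. s \<in> spins q S ==> \<bar>f s\<bar> <= M" "\<And>s. s \<in> cfg ==> \<bar>f s\<bar> <= M"
    using local_bounded[OF S(1,3,2)] by blast
  have AE: "A n \<subseteq> E" for n using A(3) by auto
  have "(\<integral>t. f t \<partial>sw s) = (\<integral>u. \<integral>t. f t \<partial>random_coloring V {e\<in>E. u e} q \<partial>perc s)"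
    unfolding sw_kernel_def
  proof (rule integral_bind[where K = sps and B = M and B' = 1])
    show "(\<lambda>u. random_coloring V {e \<in> E. u e} q) \<in> perc s \<rightarrow>\<^sub>M subprob_algebra sps"
      by (rule measurable_prob_algebraD[OF random_coloring_kernel])
    show "f \<in> borel_measurable sps" by (rule depends_on_measurable[OF S])
    show "AE x in perc s. emeasure (random_coloring V {e \<in> E. x e} q) (space (random_coloring V {e \<in> E. x e} q)) <= ennreal 1"
      using measurable_space[OF random_coloring_kernel[of s]]
      by (intro AE_I2) (auto simp: space_prob_algebra prob_space.emeasure_space_1)
  qed (use M P.finite_measure_axioms in auto)
  also have "... = (\<integral>u. color_avg q S f {e\<in>E. u e} \<partial>perc s)"
    unfolding random_coloring_integral(1)[OF S q1] ..
  finally have 1: "(\<integral>t. f t \<partial>sw s) = (\<integral>u. color_avg q S f {e\<in>E. u e} \<partial>perc s)" .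
  have 2: "(\<integral>u. color_avg q S f {e\<in>A n. u e} \<partial>perc s) =
      (\<Sum>F\<in>Pow (A n). sw_coeff q S f F * p ^ card F * mono_ind F s)" for n
  proof -
    have F: "F \<subseteq> E" "finite F" if "F \<in> Pow (A n)" for F
      using that AE[of n] finite_subset[OF _ A(2)] by auto
    have "(\<integral>u. color_avg q S f {e\<in>A n. u e} \<partial>perc s) =
      (\<Sum>F\<in>Pow (A n). (\<integral>u. sw_coeff q S f F * of_bool (\<forall>e\<in>F. u e) \<partial>perc s))"
      unfolding color_avg_polynomial[OF A(2)]
      by (intro Bochner_Integration.integral_sum integrable_mult_right integral_perc F)
    also have "... = (\<Sum>F\<in>Pow (A n). sw_coeff q S f F * (p ^ card F * mono_ind F s))"
      by (intro sum.cong refl) (simp add: integral_perc F)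
    finally show ?thesis by (simp add: mult.assoc)
  qed
  have "(\<lambda>n. \<integral>u. color_avg q S f {e\<in>A n. u e} \<partial>perc s) \<longlonglongrightarrow> (\<integral>u. color_avg q S f {e\<in>E. u e} \<partial>perc s)"
  proof (rule integral_dominated_convergence[where w = "\<lambda>_. M"])
    show "(\<lambda>u. color_avg q S f {e \<in> E. u e}) \<in> borel_measurable (perc s)"
      unfolding measurable_cong_sets[OF sets_perc refl] by (rule color_avg_open_measurable[OF S(1)])
    show "(\<lambda>u. color_avg q S f {e \<in> A n. u e}) \<in> borel_measurable (perc s)" for n
      unfolding measurable_cong_sets[OF sets_perc refl] color_avg_polynomial[OF A(2)]
    proof (intro borel_measurable_sum borel_measurable_times borel_measurable_const)
      fix F assume "F \<in> Pow (A n)"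
      then show "(\<lambda>u. of_bool (\<forall>e\<in>F. u e) :: real) \<in> borel_measurable (PiM E (\<lambda>_. count_space UNIV))"
        using AE[of n] finite_subset[of F "A n"] A(2) by (intro perc_open_sets) auto
    qed
    show "AE u in perc s. (\<lambda>n. color_avg q S f {e \<in> A n. u e}) \<longlonglongrightarrow> color_avg q S f {e \<in> E. u e}"
      by (intro AE_I2 color_avg_exhaust S A)
    show "AE u in perc s. norm (color_avg q S f {e \<in> A n. u e}) <= M" for n
      by (intro AE_I2) (simp add: abs_color_avg_le[OF S(1) q1 M(2)])
  qed simp
  then show ?thesis unfolding 1 2 .
qed

lemma sw_kernel_measurable: "sw \<in> sps \<rightarrow>\<^sub>M prob_algebra sps"
proof (rule kernel_measurableI)
  fix S and f :: "'v obs" assume S: "finite S" "S \<subseteq> V" "depends_on S f"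
  obtain A where A: "incseq A" "\<And>n. finite (A n)" "\<And>n. A n \<subseteq> E" "(\<Union>n. A n) = E"
    by (rule exhaust_edges) (rule that)
  show "(\<lambda>s. \<integral>t. f t \<partial>sw s) \<in> borel_measurable sps"
  proof (rule borel_measurable_LIMSEQ_real)
    show "(\<lambda>n. \<Sum>F\<in>Pow (A n). sw_coeff q S f F * p ^ card F * mono_ind F s) \<longlonglongrightarrow> (\<integral>t. f t \<partial>sw s)" for s
      by (rule sw_integral_limit) fact+
    show "(\<lambda>s. \<Sum>F\<in>Pow (A n). sw_coeff q S f F * p ^ card F * mono_ind F s) \<in> borel_measurable sps" for n
    proof (intro borel_measurable_sum borel_measurable_times borel_measurable_const)
      fix F assume F: "F \<in> Pow (A n)"
      have "finite F" "F \<subseteq> E" using F A finite_subset[of F "A n"] by auto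
      then show "mono_ind F \<in> borel_measurable sps"
        using edge_subset finite_edge by (intro depends_on_measurable[OF _ _ depends_on_mono_ind]) (auto intro!: finite_Union)
    qed
  qed
qed (rule prob_space_sw, rule sets_sw)

end

subsection \<open>Heat-bath kernels and Dobrushin's method\<close>

context sw_graph
begin

abbreviation "pw \<equiv> potts_weight E \<beta>"

text \<open>The conditional expectation of \<open>f\<close> under the Gibbs specification, given the
  configuration outside \<open>A\<close>.\<close>

definition heat_bath :: "'v set => 'v obs => ('v => nat) => real" where
  "heat_bath A f h = (\<Sum>s\<in>bc_configs V q A h. pw A s * f s) /
     (\<Sum>s\<in>bc_configs V q A h. pw A s)"

definition site_weight :: "'v => ('v => nat) => nat => real" where
  "site_weight v s a = pw {v} (s(v := a))"

definition site_prob :: "'v => ('v => nat) => nat => real" where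
  "site_prob v s a = site_weight v s a / (\<Sum>b\<in>{1..q}. site_weight v s b)"

definition site_avg :: "'v => 'v obs => ('v => nat) => real" where
  "site_avg v f s = (\<Sum>a\<in>{1..q}. site_prob v s a * f (s(v := a)))"

definition nbrs :: "'v => 'v set" where
  "nbrs v = \<Union>{e\<in>E. v \<in> e} - {v}"

text \<open>The functions and oscillation vectors of Dobrushin's method: \<open>b v\<close>
  dominates the effect on \<open>f\<close> of resampling the spin at \<open>v\<close>.\<close>

definition osc_bound :: "'v set => ('v => real) => 'v obs => bool" where
  "osc_bound S b f \<longleftrightarrow> finite S \<and> S \<subseteq> V \<and> depends_on S f \<and> (\<forall>v. 0 <= b v) \<and>
     (\<forall>s\<in>cfg. \<forall>v\<in>S. \<forall>a\<in>{1..q}. \<bar>f (s(v := a)) - f s\<bar> <= b v)"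

text \<open>A bound for the influence of one neighbour on the law of a spin: the weight and the
  normalisation each change by a factor at most \<open>exp \<beta>\<close> in either
  direction.\<close>

definition infl :: real where "infl = exp (2 * \<beta>) - 1"

lemma infl_nonneg: "infl >= 0" using beta_pos by (simp add: infl_def)

lemma bc_configs_single:
  assumes "v \<in> V" "h \<in> cfg"
  shows "bc_configs V q {v} h = (\<lambda>a. h(v := a)) ` {1..q}"
proof
  show "bc_configs V q {v} h \<subseteq> (\<lambda>a. h(v := a)) ` {1..q}"
  proof
    fix s assume s: "s \<in> bc_configs V q {v} h"
    have "s w = (h(v := s v)) w" for w
      using s assms by (cases "w \<in> V") (auto simp: bc_configs_def PiE_def extensional_def)
    then have "s = h(v := s v)" by (rule ext)
    moreover have "s v \<in> {1..q}" using s assms(1) by (auto simp: bc_configs_def)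
    ultimately show "s \<in> (\<lambda>a. h(v := a)) ` {1..q}" by blast
  qed
  show "(\<lambda>a. h(v := a)) ` {1..q} \<subseteq> bc_configs V q {v} h"
    using assms by (auto simp: bc_configs_def PiE_def extensional_def split: if_splits)
qed

lemma heat_bath_single:
  assumes "v \<in> V" "h \<in> cfg"
  shows "heat_bath {v} f h = site_avg v f h"
proof -
  have inj: "inj_on (\<lambda>a. h(v := a)) {1..q}" by (auto simp: inj_on_def fun_upd_def fun_eq_iff)
  show ?thesis
    unfolding heat_bath_def bc_configs_single[OF assms] sum.reindex[OF inj]
    by (simp add: site_avg_def site_prob_def site_weight_def sum_divide_distrib)
qed

lemma cfg_upd: "s \<in> cfg ==> v \<in> V ==> a \<in> {1..q} ==> s(v := a) \<in> cfg"
  by (auto simp: PiE_def extensional_def)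

lemma potts_weight_pos: "pw A s > 0"
  by (simp add: potts_weight_def)

lemma site_weight_pos: "site_weight v s a > 0"
  unfolding site_weight_def by (rule potts_weight_pos)

lemma site_total_pos: "(\<Sum>b\<in>{1..q}. site_weight v s b) > 0"
  by (rule sum_pos) (use site_weight_pos q1 in auto)

lemma site_prob_nonneg: "site_prob v s a >= 0"
  unfolding site_prob_def using site_weight_pos[of v s a] site_total_pos[of v s] by simp

lemma site_prob_sum: "(\<Sum>a\<in>{1..q}. site_prob v s a) = 1"
  unfolding site_prob_def using site_total_pos[of v s] by (simp add: sum_divide_distrib[symmetric])

lemma finite_nbrs: "v \<in> V ==> finite (nbrs v)"
  using deg finite_edge by (auto simp: nbrs_def)

lemma nbrs_subset: "nbrs v \<subseteq> V"
  using edge_subset by (auto simp: nbrs_def)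

lemma nbrs_edge: "u \<in> nbrs v \<longleftrightarrow> {u, v} \<in> E \<and> u ~= v"
proof
  assume "u \<in> nbrs v"
  then obtain e where e: "e \<in> E" "u \<in> e" "v \<in> e" "u ~= v" by (auto simp: nbrs_def)
  then have "e = {u, v}" using edgeE[of e] by force
  then show "{u, v} \<in> E \<and> u ~= v" using e by simp
qed (auto simp: nbrs_def)

lemma card_nbrs: "v \<in> V ==> card (nbrs v) <= \<Delta>"
proof -
  assume v: "v \<in> V"
  have "inj_on (\<lambda>u. {u, v}) (nbrs v)" by (auto simp: inj_on_def doubleton_eq_iff)
  then have "card (nbrs v) <= card {e\<in>E. v \<in> e}"
    by (rule card_inj_on_le) (use deg[OF v] nbrs_edge in auto)
  then show ?thesis using deg[OF v] by linarith
qed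

lemma mono_edges_cong:
  assumes "\<And>w. w \<in> e ==> s w = t w"
  shows "e \<in> mono_edges E s \<longleftrightarrow> e \<in> mono_edges E t"
  by (simp add: mono_edges_def assms)

lemma mono_at_site:
  assumes "\<And>w. w \<in> insert v (nbrs v) ==> s w = t w"
  shows "{e \<in> mono_edges E s. e \<inter> {v} ~= {}} = {e \<in> mono_edges E t. e \<inter> {v} ~= {}}"
proof -
  have "w \<in> insert v (nbrs v)" if "e \<in> E" "v \<in> e" "w \<in> e" for e w
    using that by (auto simp: nbrs_def)
  then have "s w = t w" if "e \<in> E" "v \<in> e" "w \<in> e" for e w using assms that by blast
  then have *: "e \<in> mono_edges E s \<longleftrightarrow> e \<in> mono_edges E t" if "e \<in> E" "v \<in> e" for e
    using that by (intro mono_edges_cong) blast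
  have "mono_edges E s \<subseteq> E" "mono_edges E t \<subseteq> E" by (auto simp: mono_edges_def)
  then show ?thesis using * by blast
qed

lemma site_prob_cong:
  assumes "\<And>w. w \<in> nbrs v ==> s w = t w"
  shows "site_prob v s a = site_prob v t a"
proof -
  have "site_weight v s b = site_weight v t b" for b
    unfolding site_weight_def potts_weight_def
    by (subst mono_at_site[of v "s(v := b)" "t(v := b)"]) (use assms in auto)
  then show ?thesis by (simp add: site_prob_def)
qed

lemma site_avg_depends:
  assumes "depends_on S f"
  shows "depends_on (S \<union> nbrs v) (site_avg v f)"
  unfolding depends_on_def
proof (intro allI impI)
  fix s t :: "'v => nat" assume a: "\<forall>w\<in>S \<union> nbrs v. s w = t w"
  have "f (s(v := b)) = f (t(v := b))" for b
    by (rule depends_onD[OF assms]) (use a in auto)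
  moreover have "site_prob v s b = site_prob v t b" for b by (rule site_prob_cong) (use a in auto)
  ultimately show "site_avg v f s = site_avg v f t" by (simp add: site_avg_def)
qed

lemma site_avg_upd: "site_avg v f (s(v := a)) = site_avg v f s"
proof -
  have "site_prob v (s(v := a)) b = site_prob v s b" for b by (rule site_prob_cong) (auto simp: nbrs_def)
  then show ?thesis by (simp add: site_avg_def)
qed

text \<open>Among the edges at \<open>v\<close>, only \<open>{u, v}\<close> can become monochromatic
  when the spin at \<open>u\<close> changes, so the exponent grows by at most one
  \<open>\<beta>\<close>.\<close>

lemma site_weight_change:
  assumes v: "v \<in> V" and uv: "u ~= v"
  shows "site_weight v (s(u := b)) a <= exp \<beta> * site_weight v s a"
proof -
  let ?M = "\<lambda>s. {e \<in> mono_edges E (s(v := a)). e \<inter> {v} ~= {}}"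
  have fin: "finite (?M s)"
    by (rule finite_subset[OF _ conjunct1[OF deg[OF v]]]) (auto simp: mono_edges_def)
  have "?M (s(u := b)) \<subseteq> insert {u, v} (?M s)"
  proof
    fix e assume e: "e \<in> ?M (s(u := b))"
    then have eE: "e \<in> E" "v \<in> e" by (auto simp: mono_edges_def)
    show "e \<in> insert {u, v} (?M s)"
    proof (cases "u \<in> e")
      case True
      then have "e = {u, v}" using edgeE[OF eE(1)] eE uv by force
      then show ?thesis by simp
    next
      case False
      then have "e \<in> mono_edges E ((s(u := b))(v := a)) \<longleftrightarrow> e \<in> mono_edges E (s(v := a))"
        by (intro mono_edges_cong) auto
      then have "e \<in> mono_edges E (s(v := a))" using e by simp
      then show ?thesis using eE by auto
    qed
  qed
  then have "card (?M (s(u := b))) <= card (insert {u, v} (?M s))"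
    by (rule card_mono[OF finite.insertI[OF fin]])
  also have "... <= card (?M s) + 1" by (subst card_insert_if[OF fin]) simp
  finally have "card (?M (s(u := b))) <= card (?M s) + 1" .
  then have "real (card (?M (s(u := b)))) <= real (card (?M s)) + 1" by linarith
  then have "\<beta> * real (card (?M (s(u := b)))) <= \<beta> * (real (card (?M s)) + 1)"
    using beta_pos by (intro mult_left_mono) auto
  then have "\<beta> * real (card (?M (s(u := b)))) <= \<beta> + \<beta> * real (card (?M s))" by (simp add: distrib_left)
  then show ?thesis
    unfolding site_weight_def potts_weight_def exp_add[symmetric] by simp
qed

lemma site_prob_change:
  assumes v: "v \<in> V" and uv: "u ~= v"
  shows "site_prob v (x(u := b)) a <= exp (2 * \<beta>) * site_prob v x a"
proof -
  let ?s = "x(u := b)"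
  have s: "x = ?s(u := x u)" by simp
  have 1: "site_weight v ?s a <= exp \<beta> * site_weight v x a" by (rule site_weight_change[OF assms])
  have "(\<Sum>c\<in>{1..q}. site_weight v x c) <= (\<Sum>c\<in>{1..q}. exp \<beta> * site_weight v ?s c)"
  proof (rule sum_mono)
    fix c show "site_weight v x c <= exp \<beta> * site_weight v ?s c"
      using site_weight_change[OF assms, of ?s "x u" c] by simp
  qed
  then have 2: "(\<Sum>c\<in>{1..q}. site_weight v x c) <= exp \<beta> * (\<Sum>c\<in>{1..q}. site_weight v ?s c)"
    by (simp add: sum_distrib_left)
  let ?Z = "\<Sum>c\<in>{1..q}. site_weight v x c" and ?Z' = "\<Sum>c\<in>{1..q}. site_weight v ?s c"
  have "site_weight v ?s a * ?Z <= (exp \<beta> * site_weight v x a) * (exp \<beta> * ?Z')"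
    by (intro mult_mono 1 2) (use less_imp_le[OF site_weight_pos] less_imp_le[OF site_total_pos] in auto)
  also have "... = exp (2 * \<beta>) * site_weight v x a * ?Z'"
    by (simp add: mult_exp_exp)
  finally show ?thesis
    unfolding site_prob_def using site_total_pos[of v x] site_total_pos[of v ?s]
    by (simp add: field_simps)
qed

lemma site_prob_tv:
  assumes v: "v \<in> V" and uv: "u ~= v"
  shows "(\<Sum>a\<in>{1..q}. \<bar>site_prob v (s(u := b)) a - site_prob v s a\<bar>) <= infl"
proof -
  have "\<bar>site_prob v (s(u := b)) a - site_prob v s a\<bar> <= infl * site_prob v s a" for a
  proof -
    let ?r = "site_prob v s a" and ?r' = "site_prob v (s(u := b)) a"
    have 1: "?r' <= exp (2 * \<beta>) * ?r" by (rule site_prob_change[OF assms])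
    have 2: "?r <= exp (2 * \<beta>) * ?r'" using site_prob_change[OF assms, of "s(u := b)" "s u" a] by simp
    have e: "exp (2 * \<beta>) >= 1" using beta_pos by simp
    have "(exp (2 * \<beta>) - 1) * (?r - ?r') >= 0" if "?r >= ?r'" using that e by simp
    moreover have r: "?r' >= 0" "?r >= 0" by (rule site_prob_nonneg)+
    ultimately show ?thesis using 1 2 unfolding infl_def by (cases "?r >= ?r'") (auto simp: algebra_simps)
  qed
  then have "(\<Sum>a\<in>{1..q}. \<bar>site_prob v (s(u := b)) a - site_prob v s a\<bar>) <= (\<Sum>a\<in>{1..q}. infl * site_prob v s a)"
    by (intro sum_mono)
  also have "... = infl" using site_prob_sum[of v s] by (simp add: sum_distrib_left[symmetric])
  finally show ?thesis .
qed

lemma osc_boundD: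
  assumes "osc_bound S b f"
  shows "finite S" "S \<subseteq> V" "depends_on S f" "0 <= b v"
    "s \<in> cfg ==> v \<in> S ==> a \<in> {1..q} ==> \<bar>f (s(v := a)) - f s\<bar> <= b v"
  using assms unfolding osc_bound_def by auto

text \<open>Averaging at \<open>v\<close> removes the dependence on \<open>v\<close> and hands its
  oscillation on to the neighbours, each receiving the fraction \<open>infl\<close>. This is the one
  estimate on which Dobrushin's method rests.\<close>

lemma osc_bound_site_avg:
  assumes o: "osc_bound S c f" and v: "v \<in> S"
  shows "osc_bound (S \<union> nbrs v)
    (\<lambda>u. if u = v then 0 else (if u \<in> S then c u else 0) + (if u \<in> nbrs v then infl * c v else 0)) (site_avg v f)"
  (is "osc_bound _ ?d _")
  unfolding osc_bound_def
proof (intro conjI ballI allI)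
  note oD = osc_boundD[OF o]
  have vV: "v \<in> V" using v oD by auto
  show "finite (S \<union> nbrs v)" using oD finite_nbrs[OF vV] by auto
  show "S \<union> nbrs v \<subseteq> V" using oD nbrs_subset by auto
  show "depends_on (S \<union> nbrs v) (site_avg v f)" by (rule site_avg_depends) fact
  show "0 <= ?d u" for u using oD(4) infl_nonneg by auto
  fix x u b assume x: "x \<in> cfg" and u: "u \<in> S \<union> nbrs v" and b: "b \<in> {1..q}"
  show "\<bar>site_avg v f (x(u := b)) - site_avg v f x\<bar> <= ?d u"
  proof (cases "u = v")
    case True
    then show ?thesis by (simp add: site_avg_upd)
  next
    case uv: False
    let ?s = "x(u := b)"
    let ?d1 = "\<lambda>a. site_prob v ?s a - site_prob v x a" and ?d2 = "\<lambda>a. f (?s(v := a)) - f (x(v := a))"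
    have fc: "\<bar>?d2 a\<bar> <= (if u \<in> S then c u else 0)" if a: "a \<in> {1..q}" for a
    proof (cases "u \<in> S")
      case True
      have "?s(v := a) = (x(v := a))(u := b)" using uv by (simp add: fun_upd_twist)
      then show ?thesis using oD(5)[OF cfg_upd[OF x vV a] True b] True by simp
    next
      case False
      have "f (?s(v := a)) = f (x(v := a))" by (rule depends_onD[OF oD(3)]) (use False in auto)
      then show ?thesis using False by simp
    qed
    have tv: "(\<Sum>a\<in>{1..q}. \<bar>?d1 a\<bar>) * c v <= (if u \<in> nbrs v then infl * c v else 0)"
    proof (cases "u \<in> nbrs v")
      case True
      then show ?thesis using site_prob_tv[OF vV uv, of x b] oD(4)[of v] by (simp add: mult_right_mono)
    next
      case False
      have "site_prob v ?s a = site_prob v x a" for a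
        by (rule site_prob_cong) (use False in auto)
      then show ?thesis using False by simp
    qed
    \<comment> \<open>The changes of the probabilities add up to zero, so the constant
      \<open>f x\<close> may be subtracted under the sum; what remains is an oscillation at
      \<open>v\<close> instead of the size of \<open>f\<close>.\<close>
    have s0: "(\<Sum>a\<in>{1..q}. (?d1 a) * f x) = 0"
    proof -
      have "(\<Sum>a\<in>{1..q}. (?d1 a) * f x) =
          ((\<Sum>a\<in>{1..q}. site_prob v ?s a) - (\<Sum>a\<in>{1..q}. site_prob v x a)) * f x"
        by (simp only: sum_distrib_right sum_subtractf left_diff_distrib)
      then show ?thesis by (simp add: site_prob_sum)
    qed
    have eq: "site_avg v f ?s - site_avg v f x =
        (\<Sum>a\<in>{1..q}. site_prob v ?s a * (?d2 a)) +
        (\<Sum>a\<in>{1..q}. (?d1 a) * (f (x(v := a)) - f x)) +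
        (\<Sum>a\<in>{1..q}. (?d1 a) * f x)"
      by (simp add: site_avg_def sum_subtractf sum.distrib left_diff_distrib right_diff_distrib)
    have "\<bar>site_avg v f ?s - site_avg v f x\<bar> <=
        \<bar>\<Sum>a\<in>{1..q}. site_prob v ?s a * (?d2 a)\<bar> +
        \<bar>\<Sum>a\<in>{1..q}. (?d1 a) * (f (x(v := a)) - f x)\<bar>"
      using eq s0 by linarith
    also have "... <= (\<Sum>a\<in>{1..q}. \<bar>site_prob v ?s a * (?d2 a)\<bar>) +
        (\<Sum>a\<in>{1..q}. \<bar>(?d1 a) * (f (x(v := a)) - f x)\<bar>)"
      by (intro add_mono sum_abs)
    also have "... <= (\<Sum>a\<in>{1..q}. site_prob v ?s a * (if u \<in> S then c u else 0)) +
        (\<Sum>a\<in>{1..q}. \<bar>?d1 a\<bar> * c v)"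
    proof (intro add_mono sum_mono)
      fix a assume a: "a \<in> {1..q}"
      show "\<bar>site_prob v ?s a * (?d2 a)\<bar> <= site_prob v ?s a * (if u \<in> S then c u else 0)"
        using mult_left_mono[OF fc[OF a] site_prob_nonneg[of v ?s a]] site_prob_nonneg[of v ?s a]
        by (simp add: abs_mult)
      show "\<bar>(?d1 a) * (f (x(v := a)) - f x)\<bar> <= \<bar>?d1 a\<bar> * c v"
        unfolding abs_mult by (intro mult_left_mono oD(5)[OF x v a]) simp
    qed
    also have "... = (if u \<in> S then c u else 0) + (\<Sum>a\<in>{1..q}. \<bar>?d1 a\<bar>) * c v"
      by (simp add: sum_distrib_right[symmetric] site_prob_sum)
    also have "... <= (if u \<in> S then c u else 0) + (if u \<in> nbrs v then infl * c v else 0)"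
      using tv by linarith
    finally show ?thesis using uv by simp
  qed
qed

text \<open>One sweep: if \<open>c\<close> times the weight is an estimate vector in Dobrushin's sense, it can be
  replaced by \<open>c / 2 + B\<close> times the weight at one site after the other.\<close>

lemma dobrushin_sweep:
  fixes D :: "'v obs => real"
  assumes \<theta>: "\<And>v. v \<in> V ==> 0 <= \<theta> v"
    and infl: "\<And>v. v \<in> V ==> infl * (\<Sum>u\<in>nbrs v. \<theta> u) <= \<theta> v / 2"
    and b: "\<And>v. v \<in> V ==> b v <= B * \<theta> v"
    and c: "2 * B <= c" "0 <= B"
    and D0: "\<And>S h f. osc_bound S h f ==> D f <= c * (\<Sum>v\<in>S. \<theta> v * h v)"
    and D1: "\<And>S h f v. osc_bound S h f ==> v \<in> S ==> D f <= D (site_avg v f) + h v * b v"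
    and "finite T" "osc_bound S h f"
  shows "D f <= (\<Sum>v\<in>S. (if v \<in> T then c / 2 + B else c) * \<theta> v * h v)"
  using assms(8,9)
proof (induction T arbitrary: S h f rule: finite_induct)
  case empty
  then show ?case using D0[OF empty] by (simp add: sum_distrib_left mult.assoc)
next
  case (insert v T)
  note oD = osc_boundD[OF insert.prems]
  define a where "a u = (if u \<in> T then c / 2 + B else c) * \<theta> u" for u
  have c0: "c >= 0" using c by simp
  have a_le: "a u <= c * \<theta> u" "0 <= a u" if "u \<in> V" for u
    using that \<theta>[OF that] c c0 by (auto simp: a_def intro!: mult_right_mono)
  have V: "u \<in> V" if "u \<in> S" for u using that oD by auto
  show ?case
  proof (cases "v \<in> S")
    case False
    have "D f <= (\<Sum>u\<in>S. a u * h u)" using insert.IH[OF insert.prems] by (simp add: a_def)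
    also have "... = (\<Sum>u\<in>S. (if u \<in> insert v T then c / 2 + B else c) * \<theta> u * h u)"
      using False by (intro sum.cong) (auto simp: a_def)
    finally show ?thesis .
  next
    case True
    let ?d = "\<lambda>u. if u = v then 0 else (if u \<in> S then h u else 0) + (if u \<in> nbrs v then infl * h v else 0)"
    have vV: "v \<in> V" using V True .
    have vn: "v \<notin> nbrs v" by (simp add: nbrs_def)
    have fin: "finite (S \<union> nbrs v)" using oD(1) finite_nbrs[OF vV] by simp
    have 1: "D f <= D (site_avg v f) + h v * b v" by (rule D1[OF insert.prems True])
    \<comment> \<open>The induction hypothesis holds for all functions, so it applies to the
      averaged one, whose support has grown by the neighbours of \<open>v\<close>.\<close>
    have "D (site_avg v f) <= (\<Sum>u\<in>S \<union> nbrs v. a u * ?d u)"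
      using insert.IH[OF osc_bound_site_avg[OF insert.prems True]] by (simp add: a_def)
    also have "... =
        (\<Sum>u\<in>S \<union> nbrs v. (if u \<in> S - {v} then a u * h u else 0) + (if u \<in> nbrs v then a u * (infl * h v) else 0))"
      by (intro sum.cong refl) (use vn in \<open>auto simp: distrib_left\<close>)
    also have "... = (\<Sum>u\<in>S - {v}. a u * h u) + (\<Sum>u\<in>nbrs v. a u * (infl * h v))"
    proof -
      have "(\<Sum>u\<in>S \<union> nbrs v. if u \<in> S - {v} then a u * h u else 0) = (\<Sum>u\<in>S - {v}. a u * h u)"
        by (rule sum.mono_neutral_cong_right) (use fin in auto)
      moreover have "(\<Sum>u\<in>S \<union> nbrs v. if u \<in> nbrs v then a u * (infl * h v) else 0) =
          (\<Sum>u\<in>nbrs v. a u * (infl * h v))"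
        by (rule sum.mono_neutral_cong_right) (use fin in auto)
      ultimately show ?thesis by (simp only: sum.distrib)
    qed
    finally have 2: "D (site_avg v f) <= (\<Sum>u\<in>S - {v}. a u * h u) + (\<Sum>u\<in>nbrs v. a u * (infl * h v))" .
    have "(\<Sum>u\<in>nbrs v. a u * (infl * h v)) <= (\<Sum>u\<in>nbrs v. (c * \<theta> u) * (infl * h v))"
      using nbrs_subset[of v] a_le infl_nonneg oD(4)[of v] by (intro sum_mono mult_right_mono) auto
    also have "... = (infl * (\<Sum>u\<in>nbrs v. \<theta> u)) * (c * h v)"
      by (simp add: sum_distrib_left sum_distrib_right algebra_simps)
    also have "... <= (\<theta> v / 2) * (c * h v)"
      using infl[OF vV] c0 oD(4)[of v] by (intro mult_right_mono) auto
    finally have 3: "(\<Sum>u\<in>nbrs v. a u * (infl * h v)) <= (\<theta> v / 2) * (c * h v)" .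
    have 4: "h v * b v <= h v * (B * \<theta> v)" using b[OF vV] oD(4)[of v] by (intro mult_left_mono)
    have 5: "(c / 2 + B) * \<theta> v * h v = (\<theta> v / 2) * (c * h v) + h v * (B * \<theta> v)"
      by (simp add: algebra_simps)
    have "D f <= (\<Sum>u\<in>S - {v}. a u * h u) + (c / 2 + B) * \<theta> v * h v"
      using 1 2 3 4 5 by linarith
    also have "... = (\<Sum>u\<in>S. (if u \<in> insert v T then c / 2 + B else c) * \<theta> u * h u)"
      using True oD(1) by (subst (2) sum.remove[of _ v]) (auto simp: a_def intro!: sum.cong)
    finally show ?thesis .
  qed
qed

text \<open>Each full sweep replaces the constant \<open>c\<close> by \<open>c / 2 + B\<close>,
  whose fixed point is \<open>2 * B\<close>, so the a priori constant disappears in the limit.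
  \<open>D\<close> is an arbitrary functional: a difference of two expectations, an asymptotic
  oscillation of torus means, and a weighted sum of covariances will all be inserted. The first two
  have \<open>B = 0\<close>.\<close>

theorem dobrushin:
  fixes D :: "'v obs => real"
  assumes \<theta>: "\<And>v. v \<in> V ==> 0 <= \<theta> v"
    and infl: "\<And>v. v \<in> V ==> infl * (\<Sum>u\<in>nbrs v. \<theta> u) <= \<theta> v / 2"
    and b: "\<And>v. v \<in> V ==> b v <= B * \<theta> v" "0 <= B"
    and D0: "\<And>S h f. osc_bound S h f ==> D f <= c * (\<Sum>v\<in>S. \<theta> v * h v)"
    and D1: "\<And>S h f v. osc_bound S h f ==> v \<in> S ==> D f <= D (site_avg v f) + h v * b v"
    and o: "osc_bound S h f"
  shows "D f <= 2 * B * (\<Sum>v\<in>S. \<theta> v * h v)"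
proof -
  let ?s = "\<lambda>S h. \<Sum>v\<in>S. \<theta> v * h v"
  \<comment> \<open>Starting at or above the fixed point keeps every iterate at least
    \<open>2 * B\<close>, as the sweep demands.\<close>
  define C where "C = max c (2 * B)"
  have pos: "0 <= ?s S h" if "osc_bound S h f" for S h f
    using osc_boundD[OF that] \<theta> by (intro sum_nonneg mult_nonneg_nonneg) auto
  have step: "\<forall>S h f. osc_bound S h f --> D f <= (2 * B + (C - 2 * B) / 2 ^ n) * ?s S h" for n
  proof (induction n)
    case 0
    have "D f <= C * ?s S h" if "osc_bound S h f" for S h f
    proof -
      have "c * ?s S h <= C * ?s S h"
        by (rule mult_right_mono[OF _ pos[OF that]]) (simp add: C_def)
      then show ?thesis using D0[OF that] by linarith
    qed
    then show ?case by simp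
  next
    case (Suc n)
    let ?c = "2 * B + (C - 2 * B) / 2 ^ n"
    show ?case
    proof (intro allI impI)
      fix S h f assume o: "osc_bound S h f"
      have "D f <= (\<Sum>v\<in>S. (if v \<in> S then ?c / 2 + B else ?c) * \<theta> v * h v)"
      proof (rule dobrushin_sweep[where \<theta> = \<theta> and b = b and B = B and c = ?c and D = D])
        show "2 * B <= ?c" by (simp add: C_def)
        show "\<And>S h f. osc_bound S h f ==> D f <= ?c * ?s S h" using Suc by blast
        show "finite S" by (rule osc_boundD(1)[OF o])
      qed (fact \<theta> infl b D1 o)+
      also have "... = (?c / 2 + B) * ?s S h"
        by (simp add: sum_distrib_left mult.assoc)
      also have "... = (2 * B + (C - 2 * B) / 2 ^ Suc n) * ?s S h"
        by (simp add: field_simps)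
      finally show "D f <= (2 * B + (C - 2 * B) / 2 ^ Suc n) * ?s S h" .
    qed
  qed
  have "(\<lambda>n. (C - 2 * B) / 2 ^ n) \<longlonglongrightarrow> 0"
    using LIMSEQ_divide_realpow_zero[of 2 "C - 2 * B"] by simp
  then have "(\<lambda>n. (2 * B + (C - 2 * B) / 2 ^ n) * ?s S h) \<longlonglongrightarrow> (2 * B + 0) * ?s S h"
    by (intro tendsto_intros)
  then have "D f <= (2 * B + 0) * ?s S h"
    by (rule LIMSEQ_le_const) (use step o in blast)
  then show ?thesis by simp
qed

lemma osc_bound_total:
  assumes o: "osc_bound S b f" and "x \<in> cfg" "t \<in> cfg"
  shows "\<bar>f x - f t\<bar> <= (\<Sum>v\<in>S. b v)"
proof -
  note oD = osc_boundD[OF o]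
  have "\<bar>f (\<lambda>v. if v \<in> T then x v else t v) - f t\<bar> <= (\<Sum>v\<in>T. b v) \<and> (\<lambda>v. if v \<in> T then x v else t v) \<in> cfg"
    if "T \<subseteq> S" for T
    using finite_subset[OF that oD(1)] that
  proof (induction T rule: finite_induct)
    case empty
    then show ?case using assms by simp
  next
    case (insert w T)
    let ?s = "\<lambda>v. if v \<in> T then x v else t v"
    have w: "w \<in> S" "w \<in> V" using insert oD by auto
    have xw: "x w \<in> {1..q}" using assms(2) w by (auto simp: PiE_def Pi_def)
    have e: "(\<lambda>v. if v \<in> insert w T then x v else t v) = ?s(w := x w)" by auto
    have c: "?s \<in> cfg" using insert by auto
    have "\<bar>f (?s(w := x w)) - f ?s\<bar> <= b w" by (rule oD(5)[OF c w(1) xw])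
    moreover have "\<bar>f ?s - f t\<bar> <= (\<Sum>v\<in>T. b v)" using insert by auto
    ultimately show ?case
      unfolding e using insert.hyps cfg_upd[OF c w(2) xw] by (auto simp: )
  qed
  from this[of S] have "\<bar>f (\<lambda>v. if v \<in> S then x v else t v) - f t\<bar> <= (\<Sum>v\<in>S. b v)" by simp
  moreover have "f (\<lambda>v. if v \<in> S then x v else t v) = f x" by (rule depends_onD[OF oD(3)]) simp
  ultimately show ?thesis by simp
qed

lemma osc_bound_exists:
  assumes "finite S" "S \<subseteq> V" "depends_on S f"
  obtains b where "osc_bound S b f"
proof -
  obtain M where M: "M >= 0" "\<And>s. s \<in> cfg ==> \<bar>f s\<bar> <= M"
    by (rule local_bounded[OF assms(1,3,2)]) (rule that)
  have "osc_bound S (\<lambda>_. 2 * M) f"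
    unfolding osc_bound_def
  proof (intro conjI ballI allI assms)
    fix s v a assume "s \<in> cfg" "v \<in> S" "a \<in> {1..q}"
    then show "\<bar>f (s(v := a)) - f s\<bar> <= 2 * M"
      using M(2)[of s] M(2)[OF cfg_upd[of s v a]] assms(2) by force
  qed (use M in auto)
  then show thesis by (rule that)
qed

lemma osc_bound_mono_ind:
  assumes "finite F" "F \<subseteq> E"
  shows "osc_bound (\<Union>F) (\<lambda>_. 1) (mono_ind F)"
  unfolding osc_bound_def
proof (intro conjI ballI allI depends_on_mono_ind)
  show "finite (\<Union>F)" "\<Union>F \<subseteq> V" using assms finite_edge edge_subset by (auto intro!: finite_Union)
  show "\<bar>mono_ind F (s(v := a)) - mono_ind F s\<bar> <= 1" for s v a
    using mono_ind_range(1,2)[of F s] mono_ind_range(1,2)[of F "s(v := a)"] by linarith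
qed simp

lemma site_avg_not_dep:
  assumes "depends_on S f" "v \<notin> S"
  shows "site_avg v f s = f s"
proof -
  have "f (s(v := a)) = f s" for a by (rule depends_onD[OF assms(1)]) (use assms(2) in auto)
  then show ?thesis by (simp add: site_avg_def sum_distrib_right[symmetric] site_prob_sum)
qed

lemma site_avg_diff:
  assumes o: "osc_bound S b f" and "v \<in> S" "s \<in> cfg"
  shows "\<bar>f s - site_avg v f s\<bar> <= b v"
proof -
  have eq: "f s - site_avg v f s = (\<Sum>a\<in>{1..q}. site_prob v s a * (f s - f (s(v := a))))"
    by (simp add: site_avg_def right_diff_distrib sum_subtractf sum_distrib_right[symmetric] site_prob_sum)
  have "\<bar>f s - site_avg v f s\<bar> <= (\<Sum>a\<in>{1..q}. \<bar>site_prob v s a * (f s - f (s(v := a)))\<bar>)"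
    unfolding eq by (rule sum_abs)
  also have "... <= (\<Sum>a\<in>{1..q}. site_prob v s a * b v)"
  proof (rule sum_mono)
    fix a assume "a \<in> {1..q}"
    then have "\<bar>f s - f (s(v := a))\<bar> <= b v" using osc_boundD(5)[OF o assms(3,2)] by (simp add: abs_minus_commute)
    from mult_left_mono[OF this site_prob_nonneg[of v s a]]
    show "\<bar>site_prob v s a * (f s - f (s(v := a)))\<bar> <= site_prob v s a * b v"
      using site_prob_nonneg[of v s a] by (simp add: abs_mult)
  qed
  also have "... = b v" by (simp add: sum_distrib_right[symmetric] site_prob_sum)
  finally show ?thesis .
qed

text \<open>Each of the at most \<open>\<Delta>\<close> edges at \<open>v\<close> changes a site weight by a factor in \<open>[1, e\<^sup>\<beta>]\<close>.\<close>

lemma site_prob_uniform: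
  assumes v: "v \<in> V" and a: "a \<in> {1..q}"
  shows "\<bar>site_prob v s a - 1 / real q\<bar> <= exp (real \<Delta> * \<beta>) - 1"
proof -
  let ?K = "exp (real \<Delta> * \<beta>)" and ?Z = "\<Sum>c\<in>{1..q}. site_weight v s c"
  have w: "1 <= site_weight v s c" "site_weight v s c <= ?K" for c
  proof -
    have "card {e \<in> mono_edges E (s(v := c)). e \<inter> {v} ~= {}} <= card {e\<in>E. v \<in> e}"
      by (intro card_mono) (use deg[OF v] in \<open>auto simp: mono_edges_def\<close>)
    then have "real (card {e \<in> mono_edges E (s(v := c)). e \<inter> {v} ~= {}}) <= real \<Delta>"
      using deg[OF v] by linarith
    then show "1 <= site_weight v s c" "site_weight v s c <= ?K"
      using beta_pos by (auto simp: site_weight_def potts_weight_def mult.commute[of "real \<Delta>"])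
  qed
  have K: "?K >= 1" using beta_pos by simp
  have Z1: "real q <= ?Z" using sum_mono[of "{1..q}" "\<lambda>_. 1" "site_weight v s"] w by simp
  have Z2: "?Z <= real q * ?K" using sum_mono[of "{1..q}" "site_weight v s" "\<lambda>_. ?K"] w by simp
  have q0: "real q > 0" "real q >= 1" using q2 by auto
  have "site_prob v s a <= ?K / real q"
    unfolding site_prob_def using w[of a] Z1 q0 by (intro frac_le) auto
  then have u: "site_prob v s a - 1 / real q <= (?K - 1) / real q" by (simp add: diff_divide_distrib)
  have "1 / (real q * ?K) <= site_prob v s a"
    unfolding site_prob_def using w[of a] Z1 Z2 q0 by (intro frac_le) auto
  moreover have "1 / real q - 1 / (real q * ?K) <= (?K - 1) / real q"
  proof -
    have "1 / real q - 1 / (real q * ?K) = (1 - 1 / ?K) / real q" using q0 by (simp add: field_simps)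
    also have "... <= (?K - 1) / real q"
    proof (rule divide_right_mono)
      have "(?K - 1) / ?K <= ?K - 1" using K by (simp add: divide_le_eq mult_le_cancel_left1)
      then show "1 - 1 / ?K <= ?K - 1" using K by (simp add: diff_divide_distrib)
    qed simp
    finally show ?thesis .
  qed
  ultimately have l: "1 / real q - site_prob v s a <= (?K - 1) / real q" by linarith
  have "(?K - 1) / real q <= ?K - 1"
    using mult_left_mono[of 1 "real q" "?K - 1"] K q0 by (simp add: divide_le_eq)
  then show ?thesis using u l by linarith
qed

end

subsection \<open>Finite graphs\<close>

text \<open>Both sides are the mean of \<open>h\<close> over a random subset of \<open>M\<close>
  that contains each element independently with probability \<open>x\<close>: the left side expands
  \<open>h\<close> into monomials first.\<close>

lemma sum_submoeb_power:
  fixes x :: real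
  assumes "finite M"
  shows "(\<Sum>F\<in>Pow M. x ^ card F * submoeb h F) = (\<Sum>G\<in>Pow M. h G * (x ^ card G * (1 - x) ^ card (M - G)))"
  using assms
proof (induction M arbitrary: h rule: finite_induct)
  case empty
  then show ?case by (simp add: submoeb_def)
next
  case (insert a M)
  have sub: "finite F" "a \<notin> F" if "F \<in> Pow M" for F using that insert finite_subset by auto
  have l: "(\<Sum>F\<in>Pow M. x ^ card (insert a F) * submoeb h (insert a F)) =
      x * (\<Sum>F\<in>Pow M. x ^ card F * submoeb (\<lambda>G. h (insert a G)) F) - x * (\<Sum>F\<in>Pow M. x ^ card F * submoeb h F)"
    unfolding sum_distrib_left sum_subtractf[symmetric]
    by (intro sum.cong refl) (use sub in \<open>simp add: submoeb_insert algebra_simps\<close>)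
  have r1: "(\<Sum>G\<in>Pow M. h G * (x ^ card G * (1 - x) ^ card (insert a M - G))) =
      (1 - x) * (\<Sum>G\<in>Pow M. h G * (x ^ card G * (1 - x) ^ card (M - G)))"
    unfolding sum_distrib_left
  proof (intro sum.cong refl)
    fix G assume G: "G \<in> Pow M"
    then have "insert a M - G = insert a (M - G)" "a \<notin> M - G" "finite (M - G)" using insert sub by auto
    then show "h G * (x ^ card G * (1 - x) ^ card (insert a M - G)) =
        (1 - x) * (h G * (x ^ card G * (1 - x) ^ card (M - G)))" by simp
  qed
  have r2: "(\<Sum>G\<in>Pow M. h (insert a G) * (x ^ card (insert a G) * (1 - x) ^ card (insert a M - insert a G))) =
      x * (\<Sum>G\<in>Pow M. h (insert a G) * (x ^ card G * (1 - x) ^ card (M - G)))"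
    unfolding sum_distrib_left
  proof (intro sum.cong refl)
    fix G assume G: "G \<in> Pow M"
    then have "insert a M - insert a G = M - G" using insert by auto
    then show "h (insert a G) * (x ^ card (insert a G) * (1 - x) ^ card (insert a M - insert a G)) =
        x * (h (insert a G) * (x ^ card G * (1 - x) ^ card (M - G)))" using sub[OF G] by simp
  qed
  show ?case
    unfolding sum_Pow_insert[OF insert.hyps] l r1 r2
    using insert.IH[of h] insert.IH[of "\<lambda>G. h (insert a G)"] by (simp add: algebra_simps)
qed

section \<open>Gibbs means and covariances on a finite graph, and reversibility of the heat
  baths\<close>

locale fin_sw_graph = sw_graph V E q \<beta> \<Delta>
  for V :: "'v set" and E :: "'v set set" and q :: nat and \<beta> :: real and \<Delta> :: nat +
  assumes finite_V: "finite V"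
begin

lemma finite_E: "finite E"
  by (rule finite_subset[of _ "Pow V"]) (use edge_subset finite_V in auto)

lemma finite_cfg: "finite cfg"
  using finite_V by (intro finite_PiE) auto

lemma cfg_nonempty: "cfg ~= {}"
  using q1 by (simp add: PiE_eq_empty_iff)

definition gibbs_weight :: "'v obs" where
  "gibbs_weight s = exp (\<beta> * real (card (mono_edges E s)))"

definition partition_fn :: real where
  "partition_fn = (\<Sum>s\<in>cfg. gibbs_weight s)"

definition gmean :: "'v obs => real" where
  "gmean f = (\<Sum>s\<in>cfg. gibbs_weight s * f s) / partition_fn"

lemma gibbs_weight_pos: "gibbs_weight s > 0" by (simp add: gibbs_weight_def)

lemma partition_fn_pos: "partition_fn > 0"
  unfolding partition_fn_def by (rule sum_pos[OF finite_cfg cfg_nonempty gibbs_weight_pos])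

lemma gmean_cong: "(\<And>s. s \<in> cfg ==> f s = g s) ==> gmean f = gmean g"
  by (simp add: gmean_def)

lemma gmean_add: "gmean (\<lambda>s. f s + g s) = gmean f + gmean g"
  by (simp add: gmean_def distrib_left sum.distrib add_divide_distrib)

lemma gmean_cmult: "gmean (\<lambda>s. c * f s) = c * gmean f"
  by (simp add: gmean_def sum_distrib_left mult.left_commute)

lemma gmean_diff: "gmean (\<lambda>s. f s - g s) = gmean f - gmean g"
  by (simp add: gmean_def right_diff_distrib sum_subtractf diff_divide_distrib)

lemma gmean_sum: "gmean (\<lambda>s. \<Sum>i\<in>I. f i s) = (\<Sum>i\<in>I. gmean (f i))"
proof -
  have "(\<Sum>s\<in>cfg. gibbs_weight s * (\<Sum>i\<in>I. f i s)) = (\<Sum>i\<in>I. \<Sum>s\<in>cfg. gibbs_weight s * f i s)"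
    unfolding sum_distrib_left by (rule sum.swap)
  then show ?thesis by (simp add: gmean_def sum_divide_distrib)
qed

lemma gmean_const [simp]: "gmean (\<lambda>_. c) = c"
  using partition_fn_pos by (simp add: gmean_def sum_distrib_right[symmetric] partition_fn_def[symmetric])

lemma gmean_mono: "(\<And>s. s \<in> cfg ==> f s <= g s) ==> gmean f <= gmean g"
  unfolding gmean_def using gibbs_weight_pos partition_fn_pos
  by (intro divide_right_mono sum_mono mult_left_mono) (auto intro: less_imp_le)

lemma abs_gmean_le:
  assumes "\<And>s. s \<in> cfg ==> \<bar>f s\<bar> <= M"
  shows "\<bar>gmean f\<bar> <= M"
proof -
  have "gmean f <= gmean (\<lambda>_. M)" by (rule gmean_mono) (use assms in force)
  moreover have "gmean (\<lambda>_. - M) <= gmean f" by (rule gmean_mono) (use assms in force)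
  ultimately show ?thesis by simp
qed

definition gcov :: "'v obs => 'v obs => real" where
  "gcov f g = gmean (\<lambda>s. f s * g s) - gmean f * gmean g"

lemma gcov_sum_const:
  "gcov (\<lambda>s. c + (\<Sum>i\<in>I. a i * f i s)) g = (\<Sum>i\<in>I. a i * gcov (f i) g)"
proof -
  have 1: "gmean (\<lambda>s. (c + (\<Sum>i\<in>I. a i * f i s)) * g s) = c * gmean g + (\<Sum>i\<in>I. a i * gmean (\<lambda>s. f i s * g s))"
    by (simp add: distrib_right sum_distrib_right gmean_add gmean_cmult gmean_sum mult.assoc)
  have 2: "gmean (\<lambda>s. c + (\<Sum>i\<in>I. a i * f i s)) = c + (\<Sum>i\<in>I. a i * gmean (f i))"
    by (simp add: gmean_add gmean_cmult gmean_sum)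
  show ?thesis unfolding gcov_def 1 2
    by (simp add: distrib_right right_diff_distrib sum_subtractf sum_distrib_right mult.assoc)
qed

lemma gcov_commute: "gcov f g = gcov g f"
  by (simp add: gcov_def mult.commute)

lemma gcov_self: "gcov f f = gmean (\<lambda>s. (f s - gmean f)\<^sup>2)"
proof -
  have "gmean (\<lambda>s. (f s - gmean f)\<^sup>2) = gmean (\<lambda>s. f s * f s - 2 * gmean f * f s + gmean f * gmean f)"
    by (rule gmean_cong) (simp add: power2_eq_square algebra_simps)
  also have "... = gmean (\<lambda>s. f s * f s) - 2 * gmean f * gmean f + gmean f * gmean f"
    unfolding gmean_add gmean_diff gmean_cmult by simp
  finally show ?thesis by (simp add: gcov_def)
qed

lemma gcov_self_nonneg: "gcov f f >= 0"
proof -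
  have "gmean (\<lambda>_. 0) <= gmean (\<lambda>s. (f s - gmean f)\<^sup>2)" by (rule gmean_mono) simp
  then show ?thesis by (simp add: gcov_self)
qed

lemma bc_configs_sym: "h \<in> cfg ==> s \<in> bc_configs V q A h \<longleftrightarrow> s \<in> cfg \<and> h \<in> bc_configs V q A s"
  unfolding bc_configs_def by auto

lemma bc_configs_eq: "s \<in> bc_configs V q A h ==> bc_configs V q A s = bc_configs V q A h"
  unfolding bc_configs_def by (intro Collect_cong) auto

lemma finite_bc_configs: "finite (bc_configs V q A h)"
  by (rule finite_subset[OF _ finite_cfg]) (auto simp: bc_configs_def)

lemma gibbs_weight_split:
  "gibbs_weight s = pw A s * exp (\<beta> * real (card {e \<in> mono_edges E s. e \<inter> A = {}}))"
proof -
  have f: "finite (mono_edges E s)" by (rule finite_subset[OF _ finite_E]) (auto simp: mono_edges_def)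
  have "mono_edges E s = {e \<in> mono_edges E s. e \<inter> A ~= {}} \<union> {e \<in> mono_edges E s. e \<inter> A = {}}" by auto
  then have "card (mono_edges E s) = card {e \<in> mono_edges E s. e \<inter> A ~= {}} + card {e \<in> mono_edges E s. e \<inter> A = {}}"
    using f card_Un_disjoint[of "{e \<in> mono_edges E s. e \<inter> A ~= {}}" "{e \<in> mono_edges E s. e \<inter> A = {}}"] by auto
  then show ?thesis by (simp add: gibbs_weight_def potts_weight_def distrib_left exp_add)
qed

text \<open>The two configurations agree off \<open>A\<close>, so the edges that miss
  \<open>A\<close> contribute the same factor to both weights.\<close>

lemma gibbs_weight_swap:
  assumes "s \<in> bc_configs V q A h"
  shows "gibbs_weight h * pw A s = gibbs_weight s * pw A h"
proof -
  have sub: "mono_edges E t \<subseteq> E" for t :: "'v => nat" by (auto simp: mono_edges_def)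
  have "e \<in> mono_edges E s \<longleftrightarrow> e \<in> mono_edges E h" if "e \<in> E" "e \<inter> A = {}" for e
  proof (rule mono_edges_cong)
    fix w assume "w \<in> e"
    then have "w \<in> V - A" using that edge_subset by auto
    then show "s w = h w" using assms by (simp add: bc_configs_def)
  qed
  then have "{e \<in> mono_edges E s. e \<inter> A = {}} = {e \<in> mono_edges E h. e \<inter> A = {}}"
    using sub[of s] sub[of h] by blast
  then show ?thesis by (simp add: gibbs_weight_split[of s A] gibbs_weight_split[of h A])
qed

text \<open>Detailed balance: the kernel weighted by the Gibbs weight is symmetric, because the
  normalisation is the same for all configurations that agree off \<open>A\<close>.\<close>

lemma heat_bath_selfadjoint:
  "gmean (\<lambda>s. heat_bath A f s * g s) = gmean (\<lambda>s. f s * heat_bath A g s)"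
proof -
  define Z where "Z h = (\<Sum>s\<in>bc_configs V q A h. pw A s)" for h
  define K where "K h s = (if s \<in> bc_configs V q A h then gibbs_weight h * pw A s / Z h else 0)" for h s
  have hb: "gibbs_weight h * heat_bath A f h = (\<Sum>s\<in>cfg. K h s * f s)" for f h
  proof -
    have "gibbs_weight h * heat_bath A f h = (\<Sum>s\<in>bc_configs V q A h. K h s * f s)"
      by (simp add: heat_bath_def Z_def K_def sum_distrib_left sum_divide_distrib mult.assoc)
    also have "... = (\<Sum>s\<in>cfg. K h s * f s)"
      by (rule sum.mono_neutral_left[OF finite_cfg]) (auto simp: bc_configs_def K_def)
    finally show ?thesis .
  qed
  have K: "K h s = K s h" if "h \<in> cfg" "s \<in> cfg" for h s
  proof (cases "s \<in> bc_configs V q A h")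
    case True
    have "h \<in> bc_configs V q A s" using bc_configs_sym[OF that(1), of s A] True by blast
    moreover have "Z s = Z h" unfolding Z_def bc_configs_eq[OF True] ..
    ultimately show ?thesis using True gibbs_weight_swap[OF True] by (simp add: K_def)
  next
    case False
    then have "h \<notin> bc_configs V q A s" using bc_configs_sym[OF that(1), of s A] that by blast
    then show ?thesis using False by (simp add: K_def)
  qed
  have "(\<Sum>h\<in>cfg. gibbs_weight h * (heat_bath A f h * g h)) = (\<Sum>h\<in>cfg. \<Sum>s\<in>cfg. K h s * f s * g h)"
    using hb by (simp add: mult.assoc[symmetric] sum_distrib_right)
  also have "... = (\<Sum>s\<in>cfg. \<Sum>h\<in>cfg. K h s * f s * g h)" by (rule sum.swap)
  also have "... = (\<Sum>s\<in>cfg. \<Sum>h\<in>cfg. f s * (K s h * g h))"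
    by (intro sum.cong refl) (simp add: K mult_ac)
  also have "... = (\<Sum>s\<in>cfg. gibbs_weight s * (f s * heat_bath A g s))"
    using hb by (simp add: sum_distrib_left[symmetric] mult.left_commute)
  finally show ?thesis by (simp add: gmean_def)
qed

lemma heat_bath_const: "h \<in> cfg ==> heat_bath A (\<lambda>_. 1) h = 1"
proof -
  assume "h \<in> cfg"
  then have "h \<in> bc_configs V q A h" by (auto simp: bc_configs_def)
  then have "(\<Sum>s\<in>bc_configs V q A h. pw A s) > 0"
    by (intro sum_pos finite_bc_configs potts_weight_pos) auto
  then show ?thesis by (simp add: heat_bath_def)
qed

lemma gmean_heat_bath: "gmean (heat_bath A f) = gmean f"
  using heat_bath_selfadjoint[of A f "\<lambda>_. 1"] gmean_cong[of "\<lambda>s. f s * heat_bath A (\<lambda>_. 1) s" f]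
    heat_bath_const by simp

lemma gmean_site_avg:
  assumes "v \<in> V"
  shows "gmean (site_avg v f) = gmean f"
  using gmean_heat_bath[of "{v}" f] gmean_cong[of "heat_bath {v} f" "site_avg v f"] heat_bath_single[OF assms]
  by simp

lemma site_avg_selfadjoint:
  assumes "v \<in> V"
  shows "gmean (\<lambda>s. site_avg v f s * g s) = gmean (\<lambda>s. f s * site_avg v g s)"
proof -
  have "gmean (\<lambda>s. site_avg v f s * g s) = gmean (\<lambda>s. heat_bath {v} f s * g s)"
    by (rule gmean_cong) (simp only: heat_bath_single[OF assms])
  also have "... = gmean (\<lambda>s. f s * heat_bath {v} g s)" by (rule heat_bath_selfadjoint)
  also have "... = gmean (\<lambda>s. f s * site_avg v g s)"
    by (rule gmean_cong) (simp only: heat_bath_single[OF assms])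
  finally show ?thesis .
qed

lemma site_avg_idem: "site_avg v (site_avg v f) s = site_avg v f s"
proof -
  have "site_avg v (site_avg v f) s = (\<Sum>a\<in>{1..q}. site_prob v s a * site_avg v f s)"
    unfolding site_avg_def[of v "site_avg v f"] site_avg_upd ..
  then show ?thesis by (simp add: sum_distrib_right[symmetric] site_prob_sum)
qed

text \<open>The site average is an orthogonal projection, so the covariance lost by projecting
  \<open>f\<close> is the product of the two complementary parts. It vanishes when \<open>g\<close>
  does not depend on \<open>v\<close>.\<close>

lemma gcov_site_avg:
  assumes v: "v \<in> V"
  shows "gcov f g - gcov (site_avg v f) g = gmean (\<lambda>s. (f s - site_avg v f s) * (g s - site_avg v g s))"
proof -
  have "gmean (\<lambda>s. site_avg v f s * site_avg v g s) = gmean (\<lambda>s. f s * site_avg v g s)"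
    unfolding site_avg_selfadjoint[OF v] site_avg_idem ..
  moreover have "gmean (\<lambda>s. (f s - site_avg v f s) * (g s - site_avg v g s)) =
      gmean (\<lambda>s. f s * g s) - gmean (\<lambda>s. f s * site_avg v g s) - gmean (\<lambda>s. site_avg v f s * g s)
        + gmean (\<lambda>s. site_avg v f s * site_avg v g s)"
    by (simp add: left_diff_distrib right_diff_distrib gmean_diff)
  ultimately show ?thesis unfolding gcov_def gmean_site_avg[OF v] by simp
qed

section \<open>The Swendsen-Wang operator on a finite graph and its bilinear form\<close>

abbreviation sw_op :: "'v obs => ('v => nat) => real" where
  "sw_op f s \<equiv> (\<integral>t. f t \<partial>sw s)"

lemma sw_op_expand:
  assumes "S \<subseteq> V" "depends_on S f"
  shows "sw_op f s = (\<Sum>F\<in>Pow E. sw_coeff q S f F * p ^ card F * mono_ind F s)"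
proof -
  have "(\<lambda>n::nat. \<Sum>F\<in>Pow E. sw_coeff q S f F * p ^ card F * mono_ind F s) \<longlonglongrightarrow> sw_op f s"
    by (rule sw_integral_limit[of S f "\<lambda>_. E"])
      (use assms finite_subset[OF assms(1) finite_V] finite_E in \<open>auto simp: incseq_def\<close>)
  then show ?thesis using LIMSEQ_unique[OF _ tendsto_const] by blast
qed

lemma sw_op_cong: "(\<And>t. t \<in> cfg ==> f t = g t) ==> sw_op f s = sw_op g s"
  by (rule bochner_cong) (auto simp: space_sw)

lemma depends_on_V: "depends_on V (\<lambda>s. f (restrict s V))"
  unfolding depends_on_def by (metis restrict_ext)

text \<open>Only monochromatic edge sets survive in the expansion, and the remaining Moebius sum is
  resummed into the law of the open edges. The function is first restricted to \<open>V\<close>, so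
  that it becomes local on the whole type of configurations.\<close>

lemma sw_op_formula:
  "sw_op f s = (\<Sum>G\<in>Pow (mono_edges E s). color_avg q V f G * (p ^ card G * (1 - p) ^ card (mono_edges E s - G)))"
proof -
  let ?f = "\<lambda>s. f (restrict s V)"
  have sub: "mono_edges E s \<subseteq> E" by (auto simp: mono_edges_def)
  have fin: "finite (mono_edges E s)" by (rule finite_subset[OF sub finite_E])
  have r: "restrict t V = t" if "t \<in> cfg" for t using that by (simp add: PiE_restrict)
  have c: "color_avg q V ?f = color_avg q V f"
  proof
    fix G show "color_avg q V ?f G = color_avg q V f G"
      unfolding color_avg_def by (intro arg_cong2[where f="(/)"] sum.cong refl) (use r in \<open>auto simp: colorings_def\<close>)
  qed
  have "sw_op f s = sw_op ?f s" by (rule sw_op_cong) (simp only: r)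
  also have "... = (\<Sum>F\<in>Pow E. sw_coeff q V ?f F * p ^ card F * mono_ind F s)"
    by (rule sw_op_expand[OF subset_refl depends_on_V])
  also have "... = (\<Sum>F\<in>Pow (mono_edges E s). p ^ card F * submoeb (color_avg q V f) F)"
  proof (rule sum.mono_neutral_cong_right)
    show "\<forall>F\<in>Pow E - Pow (mono_edges E s). sw_coeff q V ?f F * p ^ card F * mono_ind F s = 0"
    proof
      fix F assume F: "F \<in> Pow E - Pow (mono_edges E s)"
      then have "mono_ind F s = 0" using mono_ind_eq[of F s] finite_subset[OF _ finite_E, of F] by simp
      then show "sw_coeff q V ?f F * p ^ card F * mono_ind F s = 0" by simp
    qed
    fix F assume F: "F \<in> Pow (mono_edges E s)"
    then have "F \<subseteq> E" using sub by auto
    then have "mono_ind F s = 1" using mono_ind_eq[of F s] finite_subset[OF _ finite_E, of F] F by simp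
    then show "sw_coeff q V ?f F * p ^ card F * mono_ind F s = p ^ card F * submoeb (color_avg q V f) F"
      by (simp add: sw_coeff_def c)
  qed (use finite_E sub in auto)
  also have "... = (\<Sum>G\<in>Pow (mono_edges E s). color_avg q V f G * (p ^ card G * (1 - p) ^ card (mono_edges E s - G)))"
    by (rule sum_submoeb_power[OF fin])
  finally show ?thesis .
qed

lemma colorings_eq:
  assumes "G \<subseteq> E"
  shows "colorings q V G = {s \<in> cfg. G \<subseteq> mono_edges E s}"
proof -
  have "(\<forall>u\<in>V. \<forall>v\<in>V. (u, v) \<in> conn G --> s u = s v) \<longleftrightarrow> G \<subseteq> mono_edges E s" for s
  proof
    assume a: "\<forall>u\<in>V. \<forall>v\<in>V. (u, v) \<in> conn G --> s u = s v"
    show "G \<subseteq> mono_edges E s"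
    proof
      fix e assume e: "e \<in> G"
      then have eE: "e \<in> E" using assms by blast
      from edgeE[OF eE] obtain u v where uv: "u \<in> V" "v \<in> V" "e = {u, v}" by blast
      have "(u, v) \<in> conn G" by (rule conn_edge) (use e uv in simp)
      then have "s u = s v" using a uv by blast
      then show "e \<in> mono_edges E s" using eE uv by (simp add: mono_edges_def)
    qed
  next
    assume a: "G \<subseteq> mono_edges E s"
    have "s u = s v" if "(u, v) \<in> conn G" for u v
      using that unfolding conn_def
    proof (induction rule: rtrancl_induct)
      case (step y z)
      then have "{y, z} \<in> G" by simp
      then have "{y, z} \<in> mono_edges E s" by (rule subsetD[OF a])
      then have "s y = s z" unfolding mono_edges_def by blast
      then show ?case using step by simp
    qed simp
    then show "\<forall>u\<in>V. \<forall>v\<in>V. (u, v) \<in> conn G --> s u = s v" by blast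
  qed
  then show ?thesis unfolding colorings_def by simp
qed

text \<open>The mean of the product of the two conditional expectations under the random-cluster
  measure: the number of colourings is \<open>q\<close> to the number of clusters, and the weights
  add up to \<open>partition_fn\<close>.\<close>

definition sw_form :: "'v obs => 'v obs => real" where
  "sw_form f g = (\<Sum>G\<in>Pow E. (p / (1 - p)) ^ card G * real (card (colorings q V G)) * (color_avg q V f G * color_avg q V g G)) / partition_fn"

text \<open>The Edwards-Sokal identity: averaging over the colours given the open edges makes the
  bilinear form of the dynamics symmetric and nonnegative.\<close>

lemma gmean_sw_op: "gmean (\<lambda>s. g s * sw_op f s) = sw_form f g"
proof -
  let ?t = "\<lambda>G s. (p / (1 - p)) ^ card G * color_avg q V f G * g s"
  \<comment> \<open>Since \<open>1 - p\<close> equals \<open>exp (- \<beta>)\<close>, the Gibbs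
    weight cancels one factor \<open>1 - p\<close> for every monochromatic edge, and the result no
    longer depends on the configuration.\<close>
  have w: "gibbs_weight s * (p ^ card G * (1 - p) ^ card (mono_edges E s - G)) = (p / (1 - p)) ^ card G"
    if "G \<subseteq> mono_edges E s" for s G
  proof -
    have fin: "finite (mono_edges E s)" by (rule finite_subset[OF _ finite_E]) (auto simp: mono_edges_def)
    have c: "card (mono_edges E s) = card G + card (mono_edges E s - G)"
      using card_Diff_subset[OF finite_subset[OF that fin] that] card_mono[OF fin that] by simp
    have "gibbs_weight s = inverse ((1 - p) ^ card (mono_edges E s))"
      by (simp add: gibbs_weight_def p_def exp_of_nat_mult[symmetric] exp_minus[symmetric] mult.commute)
    then show ?thesis using p_bounds unfolding c by (simp add: power_add power_divide field_simps)
  qed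
  have "(\<Sum>s\<in>cfg. gibbs_weight s * (g s * sw_op f s)) =
      (\<Sum>s\<in>cfg. \<Sum>G\<in>Pow E. if G \<subseteq> mono_edges E s then ?t G s else 0)"
  proof (intro sum.cong refl)
    fix s assume "s \<in> cfg"
    have sub: "mono_edges E s \<subseteq> E" by (auto simp: mono_edges_def)
    have "gibbs_weight s * (g s * sw_op f s) =
        (\<Sum>G\<in>Pow (mono_edges E s). color_avg q V f G * g s * (gibbs_weight s * (p ^ card G * (1 - p) ^ card (mono_edges E s - G))))"
      unfolding sw_op_formula sum_distrib_left by (intro sum.cong refl) (simp add: mult_ac)
    also have "... = (\<Sum>G\<in>Pow (mono_edges E s). ?t G s)"
      by (intro sum.cong refl) (simp add: w mult_ac)
    also have "... = (\<Sum>G\<in>Pow E. if G \<subseteq> mono_edges E s then ?t G s else 0)"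
      by (rule sum.mono_neutral_cong_left) (use finite_E sub in auto)
    finally show "gibbs_weight s * (g s * sw_op f s) = ..." .
  qed
  also have "... = (\<Sum>G\<in>Pow E. \<Sum>s\<in>cfg. if G \<subseteq> mono_edges E s then ?t G s else 0)"
    by (rule sum.swap)
  also have "... = (\<Sum>G\<in>Pow E. (p / (1 - p)) ^ card G * real (card (colorings q V G)) * (color_avg q V f G * color_avg q V g G))"
  proof (intro sum.cong refl)
    fix G assume G: "G \<in> Pow E"
    have "(\<Sum>s\<in>cfg. if G \<subseteq> mono_edges E s then ?t G s else 0) =
        (\<Sum>s\<in>colorings q V G. ?t G s)"
      using G finite_cfg by (simp add: colorings_eq sum.inter_filter)
    also have "... = (p / (1 - p)) ^ card G * color_avg q V f G * (\<Sum>s\<in>colorings q V G. g s)"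
      by (simp add: sum_distrib_left)
    finally have 1: "(\<Sum>s\<in>cfg. if G \<subseteq> mono_edges E s then ?t G s else 0) =
        (p / (1 - p)) ^ card G * color_avg q V f G * (\<Sum>s\<in>colorings q V G. g s)" .
    have 2: "(\<Sum>s\<in>colorings q V G. g s) = real (card (colorings q V G)) * color_avg q V g G"
      using card_colorings_pos[OF q1 finite_V, of G] by (simp add: color_avg_def)
    show "(\<Sum>s\<in>cfg. if G \<subseteq> mono_edges E s then ?t G s else 0) =
        (p / (1 - p)) ^ card G * real (card (colorings q V G)) * (color_avg q V f G * color_avg q V g G)"
      unfolding 1 2 by (simp add: mult_ac)
  qed
  finally show ?thesis by (simp add: gmean_def sw_form_def)
qed

lemma sw_op_selfadjoint: "gmean (\<lambda>s. g s * sw_op f s) = gmean (\<lambda>s. sw_op g s * f s)"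
  using gmean_sw_op[of g f] gmean_sw_op[of f g] by (simp add: sw_form_def mult.commute)

lemma sw_op_nonneg: "gmean (\<lambda>s. f s * sw_op f s) >= 0"
  unfolding gmean_sw_op sw_form_def using p_bounds partition_fn_pos
  by (intro divide_nonneg_pos sum_nonneg mult_nonneg_nonneg[OF mult_nonneg_nonneg zero_le_square]) auto

lemma measure_sw_space [simp]: "measure (sw s) (space (sw s)) = 1"
  by (rule prob_space.prob_space[OF prob_space_sw])

lemma gmean_sw: "gmean (sw_op f) = gmean f"
  using sw_op_selfadjoint[of "\<lambda>_. 1" f] by simp

lemma sw_integrable:
  fixes f :: "'v obs"
  shows "integrable (sw s) f"
proof -
  interpret prob_space "sw s" by (rule prob_space_sw)
  have r: "restrict t V = t" if "t \<in> cfg" for t using that by (simp add: PiE_restrict)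
  have "(\<lambda>t. f (restrict t V)) \<in> borel_measurable sps"
    by (rule depends_on_measurable[OF finite_V subset_refl depends_on_V])
  then have m: "f \<in> borel_measurable (sw s)"
    unfolding measurable_cong_sets[OF sets_sw refl]
    by (rule measurable_cong[THEN iffD1, rotated]) (simp only: space_spin_space r)
  show ?thesis
  proof (rule integrable_const_bound[OF _ m])
    show "AE t in sw s. norm (f t) <= (\<Sum>t\<in>cfg. \<bar>f t\<bar>)"
      using finite_cfg by (intro AE_I2) (auto simp: space_sw intro!: member_le_sum)
  qed
qed

lemma sw_op_sum: "sw_op (\<lambda>t. \<Sum>i\<in>I. a i * f i t) s = (\<Sum>i\<in>I. a i * sw_op (f i) s)"
  by (subst Bochner_Integration.integral_sum) (auto intro: integrable_mult_right sw_integrable)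

lemma sw_op_add: "sw_op (\<lambda>t. f t + g t) s = sw_op f s + sw_op g s"
  by (rule Bochner_Integration.integral_add) (rule sw_integrable)+

lemma sw_op_mono: "(\<And>t. t \<in> cfg ==> f t <= g t) ==> sw_op f s <= sw_op g s"
  by (rule integral_mono[OF sw_integrable sw_integrable]) (simp add: space_sw)

end

subsection \<open>The dynamics on monochromatic indicators\<close>

text \<open>
  The functions \<open>mono_ind F\<close> span a space that is invariant under the dynamics, and \<open>coef\<close> is the
  matrix of the dynamics on it.  In the norm that weights \<open>F\<close> by \<open>W ^ card F\<close> the row of \<open>F\<close>
  is at most \<open>\<kappa> ^ card F\<close> with \<open>\<kappa>\<close> of order \<open>p\<close>, so up to order \<open>p\<^sup>2\<close> only single edges matter.
\<close>

definition max_level :: "('v => nat) => 'v set set => nat" where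
  "max_level D F = Max (insert 0 (D ` \<Union>F))"

text \<open>The bound on \<open>infl\<close> leaves room for Dobrushin weights that double across an
  edge: \<open>infl * \<Delta> * 2\<close> has to stay below one half. The bound on \<open>p\<close>
  is exactly \<open>\<kappa> <= 1 / 2\<close>.\<close>

locale small_sw_graph = fin_sw_graph V E q \<beta> \<Delta>
  for V :: "'v set" and E :: "'v set set" and q :: nat and \<beta> :: real and \<Delta> :: nat +
  assumes Delta_pos: "\<Delta> >= 1"
    and infl_small: "4 * real \<Delta> * infl <= 1"
    and p_small: "128 * real \<Delta> * p <= 1"
begin

text \<open>Chosen so that edge sets with weight \<open>4 * ww\<close> per edge satisfy the counting
  condition: \<open>(1 + 8 * ww) ^ \<Delta>\<close> is at most the square root of e. With
  \<open>W = ww / p\<close> an edge weighs of order \<open>1 / p\<close>, and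
  \<open>\<kappa> * W = 4\<close> because an edge has two vertices, each counted with a factor
  2.\<close>

definition ww :: real where "ww = 1 / (16 * real \<Delta>)"
definition W :: real where "W = ww / p"
definition \<kappa> :: real where "\<kappa> = 4 * p / ww"

lemma ww_pos: "ww > 0" using Delta_pos by (simp add: ww_def)

lemma W_ge: "W >= 2" "W > 0"
proof -
  have "2 * p <= ww" using p_small p_bounds Delta_pos by (simp add: ww_def field_simps)
  then show "W >= 2" using p_bounds by (simp add: W_def field_simps)
  then show "W > 0" by simp
qed

lemma kappa_W: "\<kappa> * W = 4" using p_bounds ww_pos by (simp add: \<kappa>_def W_def)

lemma kappa_bounds: "0 < \<kappa>" "\<kappa> <= 1 / 2"
  using p_small p_bounds Delta_pos by (auto simp: \<kappa>_def ww_def field_simps)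

lemma count_param: "(1 + 2 * (4 * ww)) ^ \<Delta> <= 2"
proof -
  have "1 + 2 * (4 * ww) <= exp (1 / (2 * real \<Delta>))"
    using exp_ge_add_one_self[of "1 / (2 * real \<Delta>)"] by (simp add: ww_def)
  then have "(1 + 2 * (4 * ww)) ^ \<Delta> <= exp (1 / (2 * real \<Delta>)) ^ \<Delta>"
    using ww_pos by (intro power_mono) auto
  also have "... = exp (1 / 2)" using Delta_pos by (simp add: exp_of_nat_mult[symmetric])
  also have "... <= 2" using exp_half_le2 by simp
  finally show ?thesis .
qed

definition coef :: "'v set set => 'v set set => real" where
  "coef G F = sw_coeff q (\<Union>G) (mono_ind G) F * p ^ card F"

abbreviation "NE \<equiv> Pow E - {{}}"

lemma fin_sub: "F \<subseteq> E ==> finite F" using finite_E finite_subset by blast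

lemma finite_NE: "finite NE" using finite_E by simp

lemma finite_Union_sub: "F \<subseteq> E ==> finite (\<Union>F)"
  using fin_sub finite_edge by (auto intro!: finite_Union)

lemma Union_sub_V: "F \<subseteq> E ==> \<Union>F \<subseteq> V" using edge_subset by auto

lemma card_Union_le: "F \<subseteq> E ==> card (\<Union>F) <= 2 * card F"
proof -
  assume F: "F \<subseteq> E"
  have "card (\<Union>F) <= (\<Sum>e\<in>F. card e)" by (rule card_Union_le_sum_card)
  also have "... = (\<Sum>e\<in>F. 2)" using F card_edge by (intro sum.cong) auto
  finally show ?thesis by simp
qed

lemma sw_op_mono_ind:
  assumes "G \<subseteq> E"
  shows "sw_op (mono_ind G) s = (\<Sum>F\<in>Pow E. coef G F * mono_ind F s)"
  unfolding coef_def by (rule sw_op_expand[OF Union_sub_V[OF assms] depends_on_mono_ind])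

text \<open>A function that changes by at most one across an edge, standing for the distance from a
  place of reference. The weight 2 to the power of the level encodes exponential decay; the zero
  level gives the plain norm.\<close>

definition is_level :: "('v => nat) => bool" where
  "is_level D \<longleftrightarrow> (\<forall>e\<in>E. \<forall>u\<in>e. \<forall>v\<in>e. D v <= D u + 1)"

lemma is_level_0: "is_level (\<lambda>_. 0)" by (simp add: is_level_def)

lemma max_level_0 [simp]: "max_level (\<lambda>_. 0) F = 0"
proof -
  have "insert 0 ((\<lambda>_. 0) ` \<Union>F) = {0::nat}" by auto
  then show ?thesis unfolding max_level_def by (simp only: Max_singleton)
qed

lemma max_level_ge: "F \<subseteq> E ==> v \<in> \<Union>F ==> D v <= max_level D F"
  unfolding max_level_def by (intro Max_ge) (use finite_Union_sub in auto)

lemma max_level_le: "F \<subseteq> E ==> (\<And>v. v \<in> \<Union>F ==> D v <= k) ==> max_level D F <= k"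
  unfolding max_level_def by (intro Max.boundedI) (use finite_Union_sub in auto)

lemma max_level_attached:
  assumes "is_level D" "G \<subseteq> E" "F \<subseteq> E" "attached (\<Union>G) F"
  shows "max_level D F <= max_level D G + card F"
proof (rule max_level_le[OF assms(3)])
  fix v assume v: "v \<in> \<Union>F"
  show "D v <= max_level D G + card F"
  proof (rule attached_level[OF fin_sub[OF assms(3)] assms(4) _ _ v])
    show "D u <= max_level D G" if "u \<in> \<Union>G" for u by (rule max_level_ge[OF assms(2) that])
    show "D x <= D u + 1" if "e \<in> F" "u \<in> e" "x \<in> e" for e u x
      using assms(1,3) that unfolding is_level_def by blast
  qed
qed

text \<open>Per edge of \<open>F\<close>, the Moebius bound gives 2, the percolation gives
  \<open>p\<close>, the norm gives \<open>W\<close>, and the rise of the level gives another 2,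
  together \<open>4 * ww\<close>. Counting attached sets then leaves 2 to the number of vertices of
  \<open>G\<close>, at most \<open>4 ^ card G\<close>, which is
  \<open>(\<kappa> * W) ^ card G\<close>.\<close>

lemma coef_bound:
  assumes "is_level D" "G \<subseteq> E"
  shows "(\<Sum>F\<in>Pow E. \<bar>coef G F\<bar> * (W ^ card F * 2 ^ max_level D F)) <=
    \<kappa> ^ card G * (W ^ card G * 2 ^ max_level D G)"
proof -
  let ?S = "\<Union>G"
  have t: "\<bar>coef G F\<bar> * (W ^ card F * 2 ^ max_level D F) <=
      (if attached ?S F then 2 ^ max_level D G * (4 * ww) ^ card F else 0)" if F: "F \<in> Pow E" for F
  proof (cases "attached ?S F")
    case False
    then show ?thesis using sw_coeff_not_attached[OF fin_sub False] F by (simp add: coef_def)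
  next
    case True
    have FE: "F \<subseteq> E" using F by auto
    have "\<bar>sw_coeff q ?S (mono_ind G) F\<bar> <= 2 ^ card F * 1"
      by (rule abs_sw_coeff_le[OF fin_sub[OF FE] finite_Union_sub[OF assms(2)] q1 mono_ind_range(3)])
    then have "\<bar>coef G F\<bar> <= 2 ^ card F * p ^ card F"
      using p_bounds by (simp add: coef_def abs_mult mult_right_mono)
    moreover have "(2::real) ^ max_level D F <= 2 ^ (max_level D G + card F)"
      by (intro power_increasing max_level_attached assms FE True) simp
    ultimately have "\<bar>coef G F\<bar> * (W ^ card F * 2 ^ max_level D F) <=
        (2 ^ card F * p ^ card F) * (W ^ card F * 2 ^ (max_level D G + card F))"
      using W_ge p_bounds by (intro mult_mono) auto
    also have "... = 2 ^ max_level D G * (2 * p * (W * 2)) ^ card F"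
      by (simp only: power_add power_mult_distrib mult_ac)
    finally have "\<bar>coef G F\<bar> * (W ^ card F * 2 ^ max_level D F) <= 2 ^ max_level D G * (2 * p * (W * 2)) ^ card F" .
    moreover have "2 * p * (W * 2) = 4 * ww" using p_bounds by (simp add: W_def)
    ultimately show ?thesis using True by simp
  qed
  have "(\<Sum>F\<in>Pow E. \<bar>coef G F\<bar> * (W ^ card F * 2 ^ max_level D F)) <=
      (\<Sum>F\<in>Pow E. if attached ?S F then 2 ^ max_level D G * (4 * ww) ^ card F else 0)"
    by (intro sum_mono t)
  also have "... = 2 ^ max_level D G * (\<Sum>F\<in>{F\<in>Pow E. attached ?S F}. (4 * ww) ^ card F)"
    using finite_E by (simp add: sum.inter_filter[symmetric] sum_distrib_left)
  also have "... <= 2 ^ max_level D G * 2 ^ card ?S"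
  proof (rule mult_left_mono)
    show "(\<Sum>F\<in>{F\<in>Pow E. attached ?S F}. (4 * ww) ^ card F) <= 2 ^ card ?S"
    proof (rule sum_attached_le[OF finite_E card_edge _ _ count_param finite_Union_sub[OF assms(2)]])
      show "card {e \<in> E. v \<in> e} <= \<Delta>" for v
      proof (cases "v \<in> V")
        case False
        then have *: "{e \<in> E. v \<in> e} = {}" using edge_subset by auto
        show ?thesis unfolding * by simp
      qed (use deg in auto)
    qed (use ww_pos in auto)
  qed simp
  also have "... <= 2 ^ max_level D G * 2 ^ (2 * card G)"
    by (rule mult_left_mono[OF power_increasing[OF card_Union_le[OF assms(2)]]]) auto
  also have "... = 2 ^ max_level D G * (\<kappa> * W) ^ card G" by (simp add: kappa_W power_mult)
  finally show ?thesis by (simp add: power_mult_distrib mult_ac)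
qed

text \<open>The dynamics on coefficient vectors modulo constants: the empty set is dropped, because
  constants are invariant and do not affect oscillations or covariances.\<close>

definition vstep :: "('v set set => real) => 'v set set => real" where
  "vstep a F = (\<Sum>G\<in>NE. a G * coef G F)"

definition vnorm :: "('v => nat) => ('v set set => real) => real" where
  "vnorm D a = (\<Sum>F\<in>NE. \<bar>a F\<bar> * (W ^ card F * 2 ^ max_level D F))"

abbreviation "vnorm0 \<equiv> vnorm (\<lambda>_. 0)"

lemma vnorm_nonneg: "vnorm D a >= 0"
  unfolding vnorm_def using W_ge by (intro sum_nonneg mult_nonneg_nonneg) auto

lemma vnorm_step_le:
  assumes "is_level D"
  shows "vnorm D (vstep a) <= (\<Sum>G\<in>NE. \<bar>a G\<bar> * (\<kappa> ^ card G * (W ^ card G * 2 ^ max_level D G)))"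
proof -
  have "vnorm D (vstep a) <= (\<Sum>F\<in>NE. (\<Sum>G\<in>NE. \<bar>a G\<bar> * \<bar>coef G F\<bar>) * (W ^ card F * 2 ^ max_level D F))"
    unfolding vnorm_def vstep_def
  proof (intro sum_mono mult_right_mono)
    show "\<bar>\<Sum>G\<in>NE. a G * coef G F\<bar> <= (\<Sum>G\<in>NE. \<bar>a G\<bar> * \<bar>coef G F\<bar>)" for F
      using sum_abs[of "\<lambda>G. a G * coef G F" NE] by (simp add: abs_mult)
  qed (use W_ge in auto)
  also have "... = (\<Sum>F\<in>NE. \<Sum>G\<in>NE. \<bar>a G\<bar> * (\<bar>coef G F\<bar> * (W ^ card F * 2 ^ max_level D F)))"
    by (simp add: sum_distrib_right mult.assoc)
  also have "... = (\<Sum>G\<in>NE. \<Sum>F\<in>NE. \<bar>a G\<bar> * (\<bar>coef G F\<bar> * (W ^ card F * 2 ^ max_level D F)))"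
    by (rule sum.swap)
  also have "... <= (\<Sum>G\<in>NE. \<bar>a G\<bar> * (\<kappa> ^ card G * (W ^ card G * 2 ^ max_level D G)))"
  proof (rule sum_mono)
    fix G assume G: "G \<in> NE"
    have "(\<Sum>F\<in>NE. \<bar>coef G F\<bar> * (W ^ card F * 2 ^ max_level D F)) <=
        (\<Sum>F\<in>Pow E. \<bar>coef G F\<bar> * (W ^ card F * 2 ^ max_level D F))"
      using finite_E W_ge by (intro sum_mono2) auto
    also have "... <= \<kappa> ^ card G * (W ^ card G * 2 ^ max_level D G)"
      by (rule coef_bound[OF assms]) (use G in auto)
    finally show "(\<Sum>F\<in>NE. \<bar>a G\<bar> * (\<bar>coef G F\<bar> * (W ^ card F * 2 ^ max_level D F))) <=
        \<bar>a G\<bar> * (\<kappa> ^ card G * (W ^ card G * 2 ^ max_level D G))"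
      unfolding sum_distrib_left[symmetric] by (rule mult_left_mono) simp
  qed
  finally show ?thesis .
qed

lemma card_NE: "F \<in> NE ==> card F >= 1"
  using fin_sub[of F] card_gt_0_iff[of F] by auto

lemma vnorm_step_contract:
  assumes "is_level D"
  shows "vnorm D (vstep a) <= \<kappa> * vnorm D a"
proof -
  have "(\<Sum>G\<in>NE. \<bar>a G\<bar> * (\<kappa> ^ card G * (W ^ card G * 2 ^ max_level D G))) <=
      (\<Sum>G\<in>NE. \<bar>a G\<bar> * (\<kappa> * (W ^ card G * 2 ^ max_level D G)))"
  proof (intro sum_mono mult_left_mono mult_right_mono)
    fix G assume "G \<in> NE"
    then show "\<kappa> ^ card G <= \<kappa>"
      using power_decreasing[of 1 "card G" \<kappa>] card_NE[of G] kappa_bounds by simp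
  qed (use W_ge in auto)
  also have "... = \<kappa> * vnorm D a" by (simp add: vnorm_def sum_distrib_left mult_ac)
  finally show ?thesis using vnorm_step_le[OF assms, of a] by linarith
qed

lemma singletons_sum:
  fixes g :: "'v set set => real"
  shows "(\<Sum>F\<in>{F\<in>NE. card F = 1}. g F) = (\<Sum>e\<in>E. g {e})"
proof -
  have "{F\<in>NE. card F = 1} = (\<lambda>e. {e}) ` E"
  proof
    show "{F\<in>NE. card F = 1} \<subseteq> (\<lambda>e. {e}) ` E"
    proof
      fix F assume F: "F \<in> {F\<in>NE. card F = 1}"
      then obtain e where "F = {e}" by (auto elim: card_1_singletonE)
      then show "F \<in> (\<lambda>e. {e}) ` E" using F by simp
    qed
  qed auto
  then show ?thesis by (simp add: sum.reindex)
qed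

lemma NE_split:
  fixes g :: "'v set set => real"
  shows "(\<Sum>F\<in>NE. g F) = (\<Sum>e\<in>E. g {e}) + (\<Sum>F\<in>{F\<in>NE. card F >= 2}. g F)"
proof -
  have "card F = 1 \<or> card F >= 2" if "F \<in> NE" for F using card_NE[OF that] by linarith
  then have "NE = {F\<in>NE. card F = 1} \<union> {F\<in>NE. card F >= 2}" by blast
  then have "(\<Sum>F\<in>NE. g F) = (\<Sum>F\<in>{F\<in>NE. card F = 1} \<union> {F\<in>NE. card F >= 2}. g F)"
    by (rule arg_cong)
  also have "... = (\<Sum>F\<in>{F\<in>NE. card F = 1}. g F) + (\<Sum>F\<in>{F\<in>NE. card F >= 2}. g F)"
    by (rule sum.union_disjoint) (use finite_NE in auto)
  finally show ?thesis unfolding singletons_sum .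
qed

text \<open>Sets of two or more edges gain \<open>\<kappa>\<^sup>2\<close> in one step and take care
  of themselves. The single edges gain only one \<open>\<kappa>\<close>, which is too weak for a
  sharp rate, so their coefficients are kept and estimated by covariances instead.\<close>

lemma vnorm_step_split:
  "vnorm0 (vstep a) <= \<kappa> * W * (\<Sum>e\<in>E. \<bar>a {e}\<bar>) + \<kappa>\<^sup>2 * vnorm0 a"
proof -
  have "vnorm0 (vstep a) <= (\<Sum>G\<in>NE. \<bar>a G\<bar> * (\<kappa> ^ card G * W ^ card G))"
    using vnorm_step_le[OF is_level_0, of a] by simp
  also have "... = (\<Sum>e\<in>E. \<bar>a {e}\<bar> * (\<kappa> * W)) + (\<Sum>F\<in>{F\<in>NE. card F >= 2}. \<bar>a F\<bar> * (\<kappa> ^ card F * W ^ card F))"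
    by (subst NE_split) simp
  also have "(\<Sum>F\<in>{F\<in>NE. card F >= 2}. \<bar>a F\<bar> * (\<kappa> ^ card F * W ^ card F)) <=
      (\<Sum>F\<in>{F\<in>NE. card F >= 2}. \<bar>a F\<bar> * (\<kappa>\<^sup>2 * W ^ card F))"
  proof (intro sum_mono mult_left_mono mult_right_mono)
    fix F assume "F \<in> {F\<in>NE. card F >= 2}"
    then show "\<kappa> ^ card F <= \<kappa>\<^sup>2" using kappa_bounds by (intro power_decreasing) auto
  qed (use W_ge in auto)
  also have "... <= (\<Sum>F\<in>NE. \<bar>a F\<bar> * (\<kappa>\<^sup>2 * W ^ card F))"
    using finite_NE W_ge by (intro sum_mono2) auto
  also have "... = \<kappa>\<^sup>2 * vnorm0 a" by (simp add: vnorm_def sum_distrib_left mult_ac)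
  finally show ?thesis by (simp add: sum_distrib_left mult_ac)
qed

lemma sw_op_combination:
  "sw_op (\<lambda>t. c + (\<Sum>F\<in>NE. a F * mono_ind F t)) s =
    (c + (\<Sum>F\<in>NE. a F * coef F {})) + (\<Sum>F\<in>NE. vstep a F * mono_ind F s)"
proof -
  have split: "(\<Sum>F\<in>Pow E. g F) = g {} + (\<Sum>F\<in>NE. g F)" for g :: "'v set set => real"
    using finite_E by (subst sum.remove[of _ "{}"]) auto
  have "sw_op (\<lambda>t. c + (\<Sum>F\<in>NE. a F * mono_ind F t)) s = c + (\<Sum>G\<in>NE. a G * sw_op (mono_ind G) s)"
    unfolding sw_op_add sw_op_sum by simp
  also have "(\<Sum>G\<in>NE. a G * sw_op (mono_ind G) s) = (\<Sum>G\<in>NE. a G * coef G {} + (\<Sum>F\<in>NE. a G * coef G F * mono_ind F s))"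
    by (intro sum.cong refl, subst sw_op_mono_ind) (auto simp: split distrib_left sum_distrib_left mult.assoc)
  also have "... = (\<Sum>G\<in>NE. a G * coef G {}) + (\<Sum>F\<in>NE. vstep a F * mono_ind F s)"
    unfolding sum.distrib vstep_def sum_distrib_right by (rule arg_cong2[where f="(+)"], rule refl, rule sum.swap)
  finally show ?thesis by simp
qed

definition sw_iter :: "nat => 'v obs => ('v => nat) => real" where
  "sw_iter t = ((\<lambda>f s. sw_op f s) ^^ t)"

lemma sw_iter_0 [simp]: "sw_iter 0 f = f" by (simp add: sw_iter_def)
lemma sw_iter_Suc: "sw_iter (Suc t) f s = sw_op (sw_iter t f) s" by (simp add: sw_iter_def)

lemma sw_iter_combination:
  "\<exists>c'. \<forall>s. sw_iter t (\<lambda>y. c + (\<Sum>F\<in>NE. a F * mono_ind F y)) s = c' + (\<Sum>F\<in>NE. (vstep ^^ t) a F * mono_ind F s)"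
proof (induction t)
  case (Suc t)
  then obtain c' where "\<And>s. sw_iter t (\<lambda>y. c + (\<Sum>F\<in>NE. a F * mono_ind F y)) s =
      c' + (\<Sum>F\<in>NE. (vstep ^^ t) a F * mono_ind F s)" by blast
  then have eq: "sw_iter t (\<lambda>y. c + (\<Sum>F\<in>NE. a F * mono_ind F y)) =
      (\<lambda>s. c' + (\<Sum>F\<in>NE. (vstep ^^ t) a F * mono_ind F s))" by (rule ext)
  show ?case unfolding sw_iter_Suc eq sw_op_combination by auto
qed auto

definition edge_row :: "'v set => nat => 'v set set => real" where
  "edge_row e t = (vstep ^^ t) (\<lambda>F. of_bool (F = {e}))"

lemma sw_iter_edge:
  assumes "e \<in> E"
  shows "\<exists>c. \<forall>s. sw_iter t (ph e) s = c + (\<Sum>F\<in>NE. edge_row e t F * mono_ind F s)"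
proof -
  have eq: "ph e = (\<lambda>y. 0 + (\<Sum>F\<in>NE. of_bool (F = {e}) * mono_ind F y))"
  proof
    fix y
    have "(\<Sum>F\<in>NE. of_bool (F = {e}) * mono_ind F y) = (\<Sum>F\<in>NE. if F = {e} then mono_ind F y else 0)"
      by (intro sum.cong) auto
    also have "... = ph e y" using assms finite_NE by simp
    finally show "ph e y = 0 + (\<Sum>F\<in>NE. of_bool (F = {e}) * mono_ind F y)" by simp
  qed
  show ?thesis unfolding edge_row_def by (subst eq) (rule sw_iter_combination)
qed

lemma vnorm_delta:
  assumes "F \<in> NE"
  shows "vnorm D (\<lambda>G. of_bool (G = F)) = W ^ card F * 2 ^ max_level D F"
proof -
  have "vnorm D (\<lambda>G. of_bool (G = F)) = (\<Sum>G\<in>NE. if G = F then W ^ card G * 2 ^ max_level D G else 0)"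
    unfolding vnorm_def by (intro sum.cong) auto
  then show ?thesis using assms finite_NE by simp
qed

lemma vnorm_edge_row:
  assumes "is_level D" "e \<in> E"
  shows "vnorm D (edge_row e t) <= \<kappa> ^ t * (W * 2 ^ max_level D {e})"
proof (induction t)
  case 0
  then show ?case using vnorm_delta[of "{e}" D] assms by (simp add: edge_row_def)
next
  case (Suc t)
  have "vnorm D (edge_row e (Suc t)) <= \<kappa> * vnorm D (edge_row e t)"
    using vnorm_step_contract[OF assms(1), of "edge_row e t"] by (simp add: edge_row_def)
  also have "... <= \<kappa> * (\<kappa> ^ t * (W * 2 ^ max_level D {e}))"
    using kappa_bounds Suc by (intro mult_left_mono) auto
  finally show ?case by (simp add: mult_ac)
qed

lemma vstep_linear: "(vstep ^^ t) (\<lambda>F. \<Sum>i\<in>I. c i * a i F) F = (\<Sum>i\<in>I. c i * (vstep ^^ t) (a i) F)"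
proof (induction t arbitrary: F)
  case (Suc t)
  have "(vstep ^^ t) (\<lambda>F. \<Sum>i\<in>I. c i * a i F) = (\<lambda>F. \<Sum>i\<in>I. c i * (vstep ^^ t) (a i) F)"
    by (rule ext) (rule Suc)
  then have "(vstep ^^ Suc t) (\<lambda>F. \<Sum>i\<in>I. c i * a i F) F = (\<Sum>G\<in>NE. \<Sum>i\<in>I. c i * (vstep ^^ t) (a i) G * coef G F)"
    by (simp add: vstep_def sum_distrib_right)
  also have "... = (\<Sum>i\<in>I. \<Sum>G\<in>NE. c i * (vstep ^^ t) (a i) G * coef G F)" by (rule sum.swap)
  also have "... = (\<Sum>i\<in>I. c i * (vstep ^^ Suc t) (a i) F)"
    by (simp add: vstep_def sum_distrib_left mult.assoc)
  finally show ?case .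
qed simp

text \<open>In a weighted l1 norm an operator is bounded by its values on unit vectors. The vector
  is replaced by the combination \<open>a'\<close> of unit vectors, which agrees with it on the
  nonempty sets, the only ones read by the iteration.\<close>

lemma vnorm_iter_combination:
  assumes "\<And>G. G \<in> NE ==> vnorm0 ((vstep ^^ t) (\<lambda>F. of_bool (F = G))) <= B * W ^ card G"
  shows "vnorm0 ((vstep ^^ t) a) <= B * vnorm0 a"
proof -
  let ?r = "\<lambda>G. (vstep ^^ t) (\<lambda>F. of_bool (F = G))"
  define a' where "a' F = (\<Sum>G\<in>NE. a G * of_bool (F = G))" for F
  have a': "a' F = a F" if "F \<in> NE" for F
  proof -
    have "a' F = (\<Sum>G\<in>NE. if G = F then a G else 0)" unfolding a'_def by (intro sum.cong) auto
    then show ?thesis using that finite_NE by simp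
  qed
  have eq: "(vstep ^^ t) a F = (vstep ^^ t) a' F" if "F \<in> NE" for F
    using that
  proof (induction t arbitrary: F)
    case (Suc t)
    then show ?case by (simp add: vstep_def)
  qed (simp add: a')
  have lin: "(vstep ^^ t) a' F = (\<Sum>G\<in>NE. a G * ?r G F)" for F
    unfolding a'_def[abs_def] by (rule vstep_linear)
  have "vnorm0 ((vstep ^^ t) a) = (\<Sum>F\<in>NE. \<bar>\<Sum>G\<in>NE. a G * ?r G F\<bar> * W ^ card F)"
    unfolding vnorm_def by (simp add: eq lin)
  also have "... <= (\<Sum>F\<in>NE. (\<Sum>G\<in>NE. \<bar>a G\<bar> * \<bar>?r G F\<bar>) * W ^ card F)"
  proof (intro sum_mono mult_right_mono)
    show "\<bar>\<Sum>G\<in>NE. a G * ?r G F\<bar> <= (\<Sum>G\<in>NE. \<bar>a G\<bar> * \<bar>?r G F\<bar>)" for F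
      using sum_abs[of "\<lambda>G. a G * ?r G F" NE] by (simp add: abs_mult)
  qed (use W_ge in auto)
  also have "... = (\<Sum>F\<in>NE. \<Sum>G\<in>NE. \<bar>a G\<bar> * (\<bar>?r G F\<bar> * W ^ card F))"
    by (simp add: sum_distrib_right mult.assoc)
  also have "... = (\<Sum>G\<in>NE. \<Sum>F\<in>NE. \<bar>a G\<bar> * (\<bar>?r G F\<bar> * W ^ card F))"
    by (rule sum.swap)
  also have "... = (\<Sum>G\<in>NE. \<bar>a G\<bar> * vnorm0 (?r G))"
    by (simp add: vnorm_def sum_distrib_left)
  also have "... <= (\<Sum>G\<in>NE. \<bar>a G\<bar> * (B * W ^ card G))"
    by (intro sum_mono mult_left_mono assms) auto
  also have "... = B * vnorm0 a" by (simp add: vnorm_def sum_distrib_left mult_ac)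
  finally show ?thesis .
qed

text \<open>Only the rows of single edges need a sharp bound, since the first step from \<open>card F >= 2\<close>
  already gains a factor \<open>\<kappa>\<^sup>2\<close>.\<close>

lemma vnorm_rows:
  assumes "\<And>s e. s <= t ==> e \<in> E ==> vnorm0 (edge_row e s) <= b s * W"
    and "\<And>s. \<kappa>\<^sup>2 * b s <= b (Suc s)" "\<And>s. 1 <= b s \<or> s > 0" "\<And>s. 0 <= b s"
    and "F \<in> NE"
  shows "vnorm0 ((vstep ^^ t) (\<lambda>G. of_bool (G = F))) <= b t * W ^ card F"
  using assms(1,5)
proof (induction t arbitrary: F)
  case 0
  have "1 <= b 0" using assms(3)[of 0] by simp
  then show ?case using vnorm_delta[OF 0(2), of "\<lambda>_. 0"] W_ge mult_right_mono[of 1 "b 0" "W ^ card F"] by simp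
next
  case (Suc t)
  show ?case
  proof (cases "card F >= 2")
    case False
    then have "card F = 1" using card_NE[OF Suc.prems(2)] by linarith
    then obtain e where F: "F = {e}" by (rule card_1_singletonE)
    have e: "F = {e}" "e \<in> E" using F Suc.prems(2) by auto
    show ?thesis using Suc.prems(1)[OF order_refl e(2)] by (simp add: e edge_row_def)
  next
    case True
    let ?d = "\<lambda>G. of_bool (G = F) :: real"
    have fe: "vstep ?d G = coef F G" for G
    proof -
      have "vstep ?d G = (\<Sum>H\<in>NE. if H = F then coef H G else 0)" unfolding vstep_def by (intro sum.cong) auto
      then show ?thesis using Suc.prems(2) finite_NE by simp
    qed
    have "vnorm0 ((vstep ^^ Suc t) ?d) = vnorm0 ((vstep ^^ t) (vstep ?d))"
      by (simp add: funpow_swap1)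
    also have "... <= b t * vnorm0 (vstep ?d)"
    proof (rule vnorm_iter_combination)
      show "vnorm0 ((vstep ^^ t) (\<lambda>F. of_bool (F = G))) <= b t * W ^ card G" if "G \<in> NE" for G
        by (rule Suc.IH[OF _ that]) (use Suc.prems(1) in simp)
    qed
    also have "... <= b t * (\<kappa>\<^sup>2 * W ^ card F)"
    proof (rule mult_left_mono[OF _ assms(4)])
      have "vnorm0 (vstep ?d) <= (\<Sum>G\<in>NE. \<bar>?d G\<bar> * (\<kappa> ^ card G * W ^ card G))"
        using vnorm_step_le[OF is_level_0, of ?d] by simp
      also have "... = (\<Sum>G\<in>NE. if G = F then \<kappa> ^ card G * W ^ card G else 0)" by (intro sum.cong) auto
      also have "... = \<kappa> ^ card F * W ^ card F" using Suc.prems(2) finite_NE by simp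
      also have "... <= \<kappa>\<^sup>2 * W ^ card F"
        using True kappa_bounds W_ge by (intro mult_right_mono power_decreasing) auto
      finally show "vnorm0 (vstep ?d) <= \<kappa>\<^sup>2 * W ^ card F" .
    qed
    also have "... = (\<kappa>\<^sup>2 * b t) * W ^ card F" by simp
    also have "... <= b (Suc t) * W ^ card F" using assms(2)[of t] W_ge by (intro mult_right_mono) auto
    finally show ?thesis .
  qed
qed

lemma osc_combination:
  "\<bar>(c + (\<Sum>F\<in>NE. a F * mono_ind F s)) - (c + (\<Sum>F\<in>NE. a F * mono_ind F t))\<bar> <= vnorm0 a"
proof -
  have "(c + (\<Sum>F\<in>NE. a F * mono_ind F s)) - (c + (\<Sum>F\<in>NE. a F * mono_ind F t)) =
      (\<Sum>F\<in>NE. a F * (mono_ind F s - mono_ind F t))"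
    by (simp add: sum_subtractf right_diff_distrib)
  moreover have "\<bar>\<Sum>F\<in>NE. a F * (mono_ind F s - mono_ind F t)\<bar> <= (\<Sum>F\<in>NE. \<bar>a F * (mono_ind F s - mono_ind F t)\<bar>)"
    by (rule sum_abs)
  moreover have "... <= (\<Sum>F\<in>NE. \<bar>a F\<bar> * (W ^ card F * 2 ^ max_level (\<lambda>_. 0) F))"
    unfolding abs_mult
  proof (intro sum_mono mult_left_mono)
    fix F
    have "\<bar>mono_ind F s - mono_ind F t\<bar> <= 1"
      using mono_ind_range(1,2)[of F s] mono_ind_range(1,2)[of F t] by linarith
    also have "1 <= W ^ card F" using W_ge by simp
    finally show "\<bar>mono_ind F s - mono_ind F t\<bar> <= W ^ card F * 2 ^ max_level (\<lambda>_. 0) F" by simp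
  qed simp
  ultimately show ?thesis unfolding vnorm_def by linarith
qed

text \<open>For a nonzero eigenvalue the eigenfunction is \<open>1 / lam\<close> times its image,
  hence a combination of monochromatic indicators although it was arbitrary. After \<open>k\<close>
  blocks of \<open>t\<close> steps its oscillation is at most a constant times
  \<open>(B / lam ^ t) ^ k\<close>, which would tend to zero if \<open>B < lam ^ t\<close>.\<close>

theorem eigenvalue_bound:
  assumes eig: "\<And>s. s \<in> cfg ==> sw_op f s = lam * f s"
    and nonconst: "s \<in> cfg" "y \<in> cfg" "f s ~= f y" and lam: "lam > 0"
    and rows: "\<And>G. G \<in> NE ==> vnorm0 ((vstep ^^ t) (\<lambda>F. of_bool (F = G))) <= B * W ^ card G"
  shows "lam ^ t <= B"
proof (rule ccontr)
  assume "\<not> lam ^ t <= B"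
  then have Blt: "B < lam ^ t" by simp
  define f' where "f' s = f (restrict s V)" for s
  have f': "f' s = f s" if "s \<in> cfg" for s using that by (simp add: f'_def PiE_restrict)
  define a where "a F = sw_coeff q V f' F * p ^ card F / lam" for F
  have fe: "f s = a {} + (\<Sum>F\<in>NE. a F * mono_ind F s)" if "s \<in> cfg" for s
  proof -
    have "lam * f s = sw_op f' s" using eig[OF that] sw_op_cong[of f' f s] f' by simp
    also have "... = (\<Sum>F\<in>Pow E. sw_coeff q V f' F * p ^ card F * mono_ind F s)"
      by (rule sw_op_expand[OF subset_refl]) (unfold f'_def[abs_def], rule depends_on_V)
    also have "... = lam * (\<Sum>F\<in>Pow E. a F * mono_ind F s)"
      using lam by (simp add: a_def sum_distrib_left)
    finally have "f s = (\<Sum>F\<in>Pow E. a F * mono_ind F s)" using lam by simp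
    also have "... = a {} * mono_ind {} s + (\<Sum>F\<in>NE. a F * mono_ind F s)"
      using finite_E by (subst sum.remove[of _ "{}"]) auto
    finally show ?thesis by simp
  qed
  let ?g = "\<lambda>y. a {} + (\<Sum>F\<in>NE. a F * mono_ind F y)"
  have it: "sw_iter n ?g s = lam ^ n * f s" if "s \<in> cfg" for n s
    using that
  proof (induction n arbitrary: s)
    case (Suc n)
    have "sw_iter (Suc n) ?g s = sw_op (\<lambda>s. lam ^ n * f s) s"
      unfolding sw_iter_Suc by (rule sw_op_cong) (rule Suc.IH)
    also have "... = lam ^ n * sw_op f s" by simp
    finally show ?case using eig[OF Suc.prems] by simp
  qed (simp add: fe)
  have B0: "B >= 0"
  proof -
    obtain e where "e \<in> E" using nonconst fe by (cases "E = {}") auto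
    then have "0 <= B * W ^ card {e}"
      using rows[of "{e}"] vnorm_nonneg[of "\<lambda>_. 0" "(vstep ^^ t) (\<lambda>F. of_bool (F = {e}))"] by fastforce
    then show "0 <= B" using W_ge by (simp add: zero_le_mult_iff)
  qed
  have nb: "vnorm0 ((vstep ^^ (k * t)) a) <= B ^ k * vnorm0 a" for k
  proof (induction k)
    case (Suc k)
    have "vnorm0 ((vstep ^^ (Suc k * t)) a) = vnorm0 ((vstep ^^ t) ((vstep ^^ (k * t)) a))"
      by (simp add: funpow_add)
    also have "... <= B * vnorm0 ((vstep ^^ (k * t)) a)" by (rule vnorm_iter_combination[OF rows])
    also have "... <= B * (B ^ k * vnorm0 a)"
      by (rule mult_left_mono[OF Suc B0])
    finally show ?case by (simp add: mult_ac)
  qed simp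
  have key: "\<bar>f s - f y\<bar> <= (B / lam ^ t) ^ k * vnorm0 a" for k
  proof -
    obtain c where c: "\<And>s. sw_iter (k * t) ?g s = c + (\<Sum>F\<in>NE. (vstep ^^ (k * t)) a F * mono_ind F s)"
      using sw_iter_combination[of "k * t" "a {}" a] by blast
    have "\<bar>sw_iter (k * t) ?g s - sw_iter (k * t) ?g y\<bar> <= vnorm0 ((vstep ^^ (k * t)) a)"
      unfolding c by (rule osc_combination)
    then have "\<bar>lam ^ (k * t) * f s - lam ^ (k * t) * f y\<bar> <= B ^ k * vnorm0 a"
      using nb[of k] it nonconst by simp
    then have "(lam ^ t) ^ k * \<bar>f s - f y\<bar> <= B ^ k * vnorm0 a"
      using lam by (simp add: right_diff_distrib[symmetric] abs_mult power_mult[symmetric] mult.commute[of k])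
    then show ?thesis using lam by (simp add: power_divide field_simps)
  qed
  have "(\<lambda>k. (B / lam ^ t) ^ k * vnorm0 a) \<longlonglongrightarrow> 0 * vnorm0 a"
    using Blt B0 lam by (intro tendsto_mult_right LIMSEQ_power_zero) (simp add: field_simps)
  then have "\<bar>f s - f y\<bar> <= 0 * vnorm0 a" by (rule LIMSEQ_le_const) (use key in blast)
  then show False using nonconst by simp
qed

end

subsection \<open>Covariances of monochromatic indicators\<close>

context small_sw_graph
begin

lemma levelD: "is_level D ==> e \<in> E ==> u \<in> e ==> v \<in> e ==> D v <= D u + 1"
  unfolding is_level_def by blast

lemma gcov_shift: "gcov f g = gmean (\<lambda>s. (f s - c) * g s) - gmean (\<lambda>s. f s - c) * gmean g"
  by (simp add: gcov_def left_diff_distrib gmean_diff gmean_cmult)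

lemma gcov_le_osc:
  assumes o: "osc_bound S b f" and g: "\<And>s. s \<in> cfg ==> \<bar>g s\<bar> <= 1"
  shows "\<bar>gcov f g\<bar> <= 2 * (\<Sum>v\<in>S. b v)"
proof -
  obtain s0 where s0: "s0 \<in> cfg" using cfg_nonempty by blast
  let ?M = "\<Sum>v\<in>S. b v"
  let ?h = "\<lambda>s. f s - f s0"
  have h: "\<bar>?h s\<bar> <= ?M" if "s \<in> cfg" for s by (rule osc_bound_total[OF o that s0])
  have M0: "?M >= 0" using h[OF s0] by simp
  have "gcov f g = gmean (\<lambda>s. ?h s * g s) - gmean ?h * gmean g"
    by (rule gcov_shift)
  moreover have "\<bar>gmean (\<lambda>s. ?h s * g s)\<bar> <= ?M"
  proof (rule abs_gmean_le)
    fix s assume "s \<in> cfg"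
    then have "\<bar>?h s\<bar> * \<bar>g s\<bar> <= ?M * 1" using h g M0 by (intro mult_mono) auto
    then show "\<bar>?h s * g s\<bar> <= ?M" by (simp add: abs_mult)
  qed
  moreover have "\<bar>gmean ?h * gmean g\<bar> <= ?M * 1"
    unfolding abs_mult using abs_gmean_le[OF h] abs_gmean_le[OF g] M0 by (intro mult_mono) auto
  ultimately show ?thesis by linarith
qed

lemma osc_bound_edge: "e \<in> E ==> osc_bound e (\<lambda>_. 1) (ph e)"
  using osc_bound_mono_ind[of "{e}"] by simp

lemma level_edge:
  assumes "is_level D" "e \<in> E" "v \<in> e"
  shows "max_level D {e} <= D v + 1"
  by (rule max_level_le) (use assms in \<open>auto simp: is_level_def\<close>)

text \<open>The loss of covariance is the mean of the product of the complementary parts, and the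
  part belonging to the edge vanishes unless the edge contains \<open>v\<close>.\<close>

lemma gcov_mono_ind_site:
  assumes o: "osc_bound S b f" and v: "v \<in> S" and e: "e \<in> E"
  shows "\<bar>gcov f (ph e)\<bar> <= \<bar>gcov (site_avg v f) (ph e)\<bar> + (if v \<in> e then b v else 0)"
proof -
  let ?g = "ph e"
  have vV: "v \<in> V" using v osc_boundD(2)[OF o] by auto
  have "\<bar>gmean (\<lambda>s. (f s - site_avg v f s) * (?g s - site_avg v ?g s))\<bar> <= (if v \<in> e then b v else 0)"
  proof (rule abs_gmean_le)
    fix s assume s: "s \<in> cfg"
    show "\<bar>(f s - site_avg v f s) * (?g s - site_avg v ?g s)\<bar> <= (if v \<in> e then b v else 0)"
    proof (cases "v \<in> e")
      case True
      have "\<bar>f s - site_avg v f s\<bar> * \<bar>?g s - site_avg v ?g s\<bar> <= b v * 1"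
        by (intro mult_mono site_avg_diff[OF o v s] site_avg_diff[OF osc_bound_edge[OF e] True s] osc_boundD(4)[OF o]) simp
      then show ?thesis using True by (simp add: abs_mult)
    next
      case False
      have "site_avg v ?g s = ?g s"
        by (rule site_avg_not_dep[OF depends_on_mono_ind]) (use False in simp)
      then show ?thesis using False by simp
    qed
  qed
  then show ?thesis using gcov_site_avg[OF vV, of f ?g] by linarith
qed

text \<open>Dobrushin's method applied to the sum of all weighted covariances at once, with site
  weights 2 to the power of the level. Treating the sum as one functional yields exponential decay
  with a constant free of the size of the graph. The weights at most double across an edge.\<close>

lemma gcov_weighted_sum:
  assumes D: "is_level D" and F: "F \<subseteq> E"
  shows "(\<Sum>e\<in>E. 2 ^ max_level D {e} * \<bar>gcov (mono_ind F) (ph e)\<bar>) <= 4 * real \<Delta> * (\<Sum>v\<in>\<Union>F. 2 ^ D v)"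
proof -
  let ?L = "\<lambda>e. (2::real) ^ max_level D {e}"
  let ?\<Phi> = "\<lambda>f. \<Sum>e\<in>E. ?L e * \<bar>gcov f (ph e)\<bar>"
  let ?b = "\<lambda>v. \<Sum>e\<in>{e\<in>E. v \<in> e}. ?L e"
  have "?\<Phi> (mono_ind F) <= 2 * (2 * real \<Delta>) * (\<Sum>v\<in>\<Union>F. 2 ^ D v * 1)"
  proof (rule dobrushin[where b = ?b and c = "2 * (\<Sum>e\<in>E. ?L e)" and D = ?\<Phi>])
    fix v assume v: "v \<in> V"
    have "(\<Sum>u\<in>nbrs v. (2::real) ^ D u) <= (\<Sum>u\<in>nbrs v. 2 * 2 ^ D v)"
    proof (rule sum_mono)
      fix u assume "u \<in> nbrs v"
      then have "{u, v} \<in> E" using nbrs_edge by simp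
      then have "D u <= D v + 1" using levelD[OF D, of "{u, v}" v u] by simp
      then have "(2::real) ^ D u <= 2 ^ (D v + 1)" by (intro power_increasing) auto
      also have "... = 2 * 2 ^ D v" by (simp add: power_add)
      finally show "(2::real) ^ D u <= 2 * 2 ^ D v" .
    qed
    also have "... <= real \<Delta> * (2 * 2 ^ D v)"
      using card_nbrs[OF v] by (simp add: mult_right_mono)
    finally have "infl * (\<Sum>u\<in>nbrs v. (2::real) ^ D u) <= infl * (real \<Delta> * (2 * 2 ^ D v))"
      using infl_nonneg by (intro mult_left_mono)
    also have "... = (4 * real \<Delta> * infl) * (2 ^ D v / 2)" by simp
    also have "... <= 1 * (2 ^ D v / 2)" by (rule mult_right_mono[OF infl_small]) simp
    finally show "infl * (\<Sum>u\<in>nbrs v. (2::real) ^ D u) <= 2 ^ D v / 2" by simp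
    have "?b v <= (\<Sum>e\<in>{e\<in>E. v \<in> e}. 2 * 2 ^ D v)"
    proof (rule sum_mono)
      fix e assume "e \<in> {e\<in>E. v \<in> e}"
      then have "max_level D {e} <= D v + 1" using level_edge[OF D] by auto
      then have "?L e <= 2 ^ (D v + 1)" by (intro power_increasing) auto
      also have "... = 2 * 2 ^ D v" by (simp add: power_add)
      finally show "?L e <= 2 * 2 ^ D v" .
    qed
    also have "... <= real \<Delta> * (2 * 2 ^ D v)"
      using deg[OF v] by (simp add: mult_right_mono)
    finally show "?b v <= 2 * real \<Delta> * 2 ^ D v" by simp
  next
    fix S h f assume o: "osc_bound S h f"
    have "?\<Phi> f <= (\<Sum>e\<in>E. ?L e * (2 * (\<Sum>v\<in>S. 2 ^ D v * h v)))"
    proof (intro sum_mono mult_left_mono)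
      fix e
      have "\<bar>gcov f (ph e)\<bar> <= 2 * (\<Sum>v\<in>S. h v)" by (rule gcov_le_osc[OF o mono_ind_range(3)])
      moreover have "(\<Sum>v\<in>S. h v) <= (\<Sum>v\<in>S. 2 ^ D v * h v)"
      proof (rule sum_mono)
        fix v show "h v <= 2 ^ D v * h v"
          using mult_right_mono[OF one_le_power[of "2::real" "D v"] osc_boundD(4)[OF o, of v]] by simp
      qed
      ultimately show "\<bar>gcov f (ph e)\<bar> <= 2 * (\<Sum>v\<in>S. 2 ^ D v * h v)" by simp
    qed simp
    also have "... = (\<Sum>e\<in>E. ?L e) * (2 * (\<Sum>v\<in>S. 2 ^ D v * h v))" by (rule sum_distrib_right[symmetric])
    finally show "?\<Phi> f <= 2 * (\<Sum>e\<in>E. ?L e) * (\<Sum>v\<in>S. 2 ^ D v * h v)" by (simp add: mult_ac)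
    fix v assume v: "v \<in> S"
    have "?\<Phi> f <= (\<Sum>e\<in>E. ?L e * (\<bar>gcov (site_avg v f) (ph e)\<bar> + (if v \<in> e then h v else 0)))"
      by (intro sum_mono mult_left_mono gcov_mono_ind_site[OF o v]) auto
    also have "... = ?\<Phi> (site_avg v f) + (\<Sum>e\<in>E. if v \<in> e then ?L e * h v else 0)"
      by (simp add: distrib_left sum.distrib if_distrib[of "\<lambda>x. _ * x"] cong: if_cong)
    also have "... = ?\<Phi> (site_avg v f) + h v * ?b v"
      using finite_E by (simp add: sum.inter_filter[symmetric] sum_distrib_left mult.commute)
    finally show "?\<Phi> f <= ?\<Phi> (site_avg v f) + h v * ?b v" .
  qed (use osc_bound_mono_ind[OF fin_sub[OF F] F] in auto)
  then show ?thesis by simp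
qed

lemma gcov_weighted_sum':
  assumes D: "is_level D" and F: "F \<subseteq> E"
  shows "(\<Sum>e\<in>E. 2 ^ max_level D {e} * \<bar>gcov (mono_ind F) (ph e)\<bar>) <=
    8 * real \<Delta> * (real (card F) * 2 ^ max_level D F)"
proof -
  have "(\<Sum>v\<in>\<Union>F. (2::real) ^ D v) <= (\<Sum>v\<in>\<Union>F. 2 ^ max_level D F)"
    by (intro sum_mono power_increasing max_level_ge[OF F]) auto
  also have "... <= 2 * real (card F) * 2 ^ max_level D F"
    using card_Union_le[OF F] by (simp add: mult_right_mono)
  finally have "4 * real \<Delta> * (\<Sum>v\<in>\<Union>F. (2::real) ^ D v) <= 4 * real \<Delta> * (2 * real (card F) * 2 ^ max_level D F)"
    by (rule mult_left_mono) simp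
  then show ?thesis using gcov_weighted_sum[OF D F] by simp
qed

section \<open>Weak coupling: single spins are nearly uniform and single edges nearly
  independent\<close>

definition unif_err :: real where "unif_err = exp (real \<Delta> * \<beta>) - 1"

lemma site_avg_edge:
  assumes e: "{v, w} \<in> E" "v ~= w" and s: "s \<in> cfg"
  shows "\<bar>site_avg v (mono_ind {{v, w}}) s - 1 / real q\<bar> <= unif_err"
proof -
  have V: "v \<in> V" "w \<in> V" using edge_subset[OF e(1)] by auto
  have sw: "s w \<in> {1..q}" by (rule PiE_mem[OF s V(2)])
  have m: "mono_ind {{v, w}} (s(v := a)) = of_bool (a = s w)" for a
    using e(2) by (auto simp: mono_ind_def)
  have "site_avg v (mono_ind {{v, w}}) s = (\<Sum>a\<in>{1..q}. if a = s w then site_prob v s a else 0)"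
    unfolding site_avg_def m by (intro sum.cong) auto
  also have "... = site_prob v s (s w)" using sw by simp
  finally show ?thesis using site_prob_uniform[OF V(1) sw, of s] by (simp add: unif_err_def)
qed

lemma gmean_edge:
  assumes "e \<in> E"
  shows "\<bar>gmean (ph e) - 1 / real q\<bar> <= unif_err"
proof -
  obtain v w where e: "v \<in> V" "w \<in> V" "v ~= w" "e = {v, w}" using edgeE[OF assms] by blast
  have "gmean (ph e) - 1 / real q = gmean (\<lambda>s. site_avg v (ph e) s - 1 / real q)"
    by (simp add: gmean_diff gmean_site_avg[OF e(1)])
  moreover have "\<bar>gmean (\<lambda>s. site_avg v (ph e) s - 1 / real q)\<bar> <= unif_err"
    by (rule abs_gmean_le) (use site_avg_edge e assms in simp)
  ultimately show ?thesis by simp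
qed

text \<open>Two distinct edges cannot contain each other, so \<open>e'\<close> has a vertex
  \<open>v\<close> outside \<open>e\<close>. Averaging at \<open>v\<close> leaves the indicator of
  \<open>e\<close> alone and turns that of \<open>e'\<close> into the constant \<open>1 / q\<close>
  up to \<open>unif_err\<close>.\<close>

lemma gcov_distinct_edges:
  assumes e: "e \<in> E" "e' \<in> E" "e ~= e'"
  shows "\<bar>gcov (ph e) (ph e')\<bar> <= 2 * unif_err"
proof -
  have "\<not> e' \<subseteq> e"
    using card_subset_eq[of e e'] card_edge[OF e(1)] card_edge[OF e(2)] finite_edge[OF e(1)] e(3) by auto
  then obtain v where v: "v \<in> e'" "v \<notin> e" by blast
  have vV: "v \<in> V" using v(1) edge_subset[OF e(2)] by auto
  obtain a b where ab: "a ~= b" "e' = {a, b}" using edgeE[OF e(2)] by blast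
  obtain w where w: "v ~= w" "e' = {v, w}"
  proof (cases "v = a")
    case True
    then show ?thesis using that[of b] ab by auto
  next
    case False
    then have "v = b" using v ab by auto
    then show ?thesis using that[of a] ab by auto
  qed
  let ?f = "ph e'" and ?g = "ph e"
  let ?h = "\<lambda>s. site_avg v ?f s - 1 / real q"
  have h: "\<bar>?h s\<bar> <= unif_err" if "s \<in> cfg" for s
    using site_avg_edge[of v w s] that w e(2) by simp
  have u0: "unif_err >= 0" using beta_pos by (simp add: unif_err_def)
  have gs: "site_avg v ?g s = ?g s" for s
    by (rule site_avg_not_dep[OF depends_on_mono_ind]) (use v in simp)
  have "gcov ?f ?g = gcov (site_avg v ?f) ?g"
    using gcov_site_avg[OF vV, of ?f ?g] by (simp add: gs)
  also have "... = gmean (\<lambda>s. ?h s * ?g s) - gmean ?h * gmean ?g"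
    by (rule gcov_shift)
  finally have eq: "gcov ?f ?g = gmean (\<lambda>s. ?h s * ?g s) - gmean ?h * gmean ?g" .
  have 1: "\<bar>gmean (\<lambda>s. ?h s * ?g s)\<bar> <= unif_err"
  proof (rule abs_gmean_le)
    fix s assume "s \<in> cfg"
    then have "\<bar>?h s\<bar> * \<bar>?g s\<bar> <= unif_err * 1" using h mono_ind_range(3) u0 by (intro mult_mono) auto
    then show "\<bar>?h s * ?g s\<bar> <= unif_err" by (simp add: abs_mult)
  qed
  have "\<bar>gmean ?h\<bar> * \<bar>gmean ?g\<bar> <= unif_err * 1"
  proof (intro mult_mono)
    show "\<bar>gmean ?h\<bar> <= unif_err" by (rule abs_gmean_le) (rule h)
    show "\<bar>gmean ?g\<bar> <= 1" by (rule abs_gmean_le) (rule mono_ind_range)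
  qed (use u0 in auto)
  then have 2: "\<bar>gmean ?h * gmean ?g\<bar> <= unif_err" by (simp add: abs_mult)
  have "\<bar>gcov ?f ?g\<bar> <= 2 * unif_err" unfolding eq using 1 2 by linarith
  then show ?thesis by (simp add: gcov_commute)
qed

lemma gcov_edge_self:
  assumes e: "e \<in> E" and small: "4 * real q * unif_err <= 1"
  shows "gcov (ph e) (ph e) >= 1 / (4 * real q)"
proof -
  let ?m = "gmean (ph e)"
  have q: "real q >= 2" using q2 by simp
  have u: "unif_err <= 1 / (4 * real q)" using small q by (simp add: field_simps)
  have m: "3 / (4 * real q) <= ?m" "?m <= 5 / (4 * real q)"
  proof -
    have "1 / real q - 1 / (4 * real q) = 3 / (4 * real q)" "1 / real q + 1 / (4 * real q) = 5 / (4 * real q)"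
      using q by (auto simp: field_simps)
    then show "3 / (4 * real q) <= ?m" "?m <= 5 / (4 * real q)" using gmean_edge[OF e] u by linarith+
  qed
  have "5 / (4 * real q) <= 5 / 8" using q by (simp add: field_simps)
  then have m1: "3 / 8 <= 1 - ?m" using m by linarith
  \<comment> \<open>The indicator equals its own square, so the variance is that of a Bernoulli
    variable whose mean is close to \<open>1 / q\<close>.\<close>
  have "gcov (ph e) (ph e) = ?m * (1 - ?m)"
    by (simp add: gcov_def mono_ind_mult right_diff_distrib)
  also have "... >= 3 / (4 * real q) * (3 / 8)"
    by (intro mult_mono m(1) m1) (use m q in auto)
  finally have "gcov (ph e) (ph e) >= 3 / (4 * real q) * (3 / 8)" .
  moreover have "3 / (4 * real q) * (3 / 8) >= 1 / (4 * real q)" using q by (simp add: field_simps)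
  ultimately show ?thesis by linarith
qed

text \<open>The first condition makes the variances of single edges at least
  \<open>1 / (4 * real q)\<close>; the second keeps the off-diagonal row sums of the covariance
  matrix below half of that. The matrix is then invertible in l1, uniformly in the size of the
  graph.\<close>

definition diag_dominant :: bool where
  "diag_dominant \<longleftrightarrow> 4 * real q * unif_err <= 1 \<and>
     (\<forall>e\<in>E. (\<Sum>e'\<in>E - {e}. \<bar>gcov (ph e) (ph e')\<bar>) <= 1 / (8 * real q))"

lemma sum_far_le:
  assumes "\<And>e. 0 <= c e"
  shows "(\<Sum>e\<in>{e\<in>E. R < max_level D {e}}. c e) <= (1/2) ^ R * (\<Sum>e\<in>E. 2 ^ max_level D {e} * (c e :: real))"
proof -
  have "(\<Sum>e\<in>{e\<in>E. R < max_level D {e}}. c e) <= (\<Sum>e\<in>{e\<in>E. R < max_level D {e}}. (1/2) ^ R * (2 ^ max_level D {e} * c e))"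
  proof (rule sum_mono)
    fix e assume "e \<in> {e\<in>E. R < max_level D {e}}"
    then have "(2::real) ^ R <= 2 ^ max_level D {e}" by (intro power_increasing) auto
    then have "(1/2) ^ R * 2 ^ R * c e <= (1/2) ^ R * 2 ^ max_level D {e} * c e"
      using assms by (intro mult_right_mono mult_left_mono) auto
    moreover have "(1/2) ^ R * 2 ^ R = (1::real)" by (simp add: power_mult_distrib[symmetric])
    ultimately show "c e <= (1/2) ^ R * (2 ^ max_level D {e} * c e)" by (simp add: mult.assoc)
  qed
  also have "... <= (\<Sum>e\<in>E. (1/2) ^ R * (2 ^ max_level D {e} * c e))"
    using finite_E assms by (intro sum_mono2) auto
  finally show ?thesis by (simp only: sum_distrib_left)
qed

text \<open>Far edges are handled by exponential decay with a fixed radius \<open>R\<close>, and the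
  at most \<open>n0\<close> near edges by \<open>unif_err\<close>, which is small with
  \<open>\<beta>\<close>. The levels are centred anew at each edge.\<close>

lemma diag_dominantI:
  assumes small: "4 * real q * unif_err <= 1"
    and D: "\<And>e. e \<in> E ==> is_level (D e)" "\<And>e. e \<in> E ==> max_level (D e) {e} <= 1"
    and n0: "\<And>e. e \<in> E ==> card {e'\<in>E. max_level (D e) {e'} <= R} <= n0"
    and bnd: "real n0 * (2 * unif_err) + (1/2) ^ R * (16 * real \<Delta>) <= 1 / (8 * real q)"
  shows diag_dominant
  unfolding diag_dominant_def
proof (intro conjI ballI small)
  fix e assume e: "e \<in> E"
  let ?G = "\<lambda>e'. \<bar>gcov (ph e) (ph e')\<bar>"
  let ?N = "{e'\<in>E. max_level (D e) {e'} <= R}" and ?F = "{e'\<in>E. R < max_level (D e) {e'}}"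
  have u0: "unif_err >= 0" using beta_pos by (simp add: unif_err_def)
  have "(\<Sum>e'\<in>E - {e}. ?G e') <= (\<Sum>e'\<in>(?N - {e}) \<union> ?F. ?G e')"
    by (rule sum_mono2) (use finite_E in auto)
  also have "... = (\<Sum>e'\<in>?N - {e}. ?G e') + (\<Sum>e'\<in>?F. ?G e')"
    by (rule sum.union_disjoint) (use finite_E in auto)
  finally have 1: "(\<Sum>e'\<in>E - {e}. ?G e') <= ..." .
  have "(\<Sum>e'\<in>?N - {e}. ?G e') <= (\<Sum>e'\<in>?N - {e}. 2 * unif_err)"
    using e by (intro sum_mono gcov_distinct_edges) auto
  also have "... <= (\<Sum>e'\<in>?N. 2 * unif_err)" using finite_E u0 by (intro sum_mono2) auto
  also have "... <= real n0 * (2 * unif_err)" using n0[OF e] u0 by (simp add: mult_right_mono)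
  finally have 2: "(\<Sum>e'\<in>?N - {e}. ?G e') <= real n0 * (2 * unif_err)" .
  have "(\<Sum>e'\<in>E. 2 ^ max_level (D e) {e'} * ?G e') <= 8 * real \<Delta> * (real (card {e}) * 2 ^ max_level (D e) {e})"
    by (rule gcov_weighted_sum'[OF D(1)[OF e]]) (use e in simp)
  also have "... <= 8 * real \<Delta> * (1 * 2 ^ 1)"
    by (intro mult_left_mono mult_mono power_increasing D(2)[OF e]) auto
  finally have "(1/2) ^ R * (\<Sum>e'\<in>E. 2 ^ max_level (D e) {e'} * ?G e') <= (1/2) ^ R * (16 * real \<Delta>)"
    by (intro mult_left_mono) auto
  then show "(\<Sum>e'\<in>E - {e}. ?G e') <= 1 / (8 * real q)"
    using 1 2 bnd sum_far_le[where c = ?G and R = R and D = "D e", OF abs_ge_zero] by linarith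
qed

text \<open>Diagonal dominance recovers a coefficient vector from its covariances:
  \<open>1 / (4 * real q)\<close> from the diagonal minus \<open>1 / (8 * real q)\<close> from the
  rest.\<close>

lemma extract_singles:
  assumes dd: diag_dominant
  shows "1 / (8 * real q) * (\<Sum>e\<in>E. \<bar>x e\<bar>) <= (\<Sum>e'\<in>E. \<bar>\<Sum>e\<in>E. x e * gcov (ph e) (ph e')\<bar>)"
proof -
  let ?u = "1 / (4 * real q)" and ?v = "1 / (8 * real q)"
  let ?G = "\<lambda>e e'. gcov (ph e) (ph e')"
  let ?t = "\<lambda>e e'. \<bar>x e\<bar> * \<bar>?G e e'\<bar>"
  have small: "4 * real q * unif_err <= 1" using dd by (simp add: diag_dominant_def)
  have "?u * (\<Sum>e\<in>E. \<bar>x e\<bar>) - (\<Sum>e'\<in>E. \<Sum>e\<in>E - {e'}. ?t e e') =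
      (\<Sum>e'\<in>E. ?u * \<bar>x e'\<bar> - (\<Sum>e\<in>E - {e'}. ?t e e'))"
    by (simp only: sum_distrib_left sum_subtractf)
  also have "... <= (\<Sum>e'\<in>E. \<bar>\<Sum>e\<in>E. x e * ?G e e'\<bar>)"
  proof (rule sum_mono)
    fix e' assume e': "e' \<in> E"
    have "(\<Sum>e\<in>E. x e * ?G e e') = x e' * ?G e' e' + (\<Sum>e\<in>E - {e'}. x e * ?G e e')"
      using e' finite_E by (rule sum.remove[rotated])
    moreover have "\<bar>\<Sum>e\<in>E - {e'}. x e * ?G e e'\<bar> <= (\<Sum>e\<in>E - {e'}. ?t e e')"
      using sum_abs[of "\<lambda>e. x e * ?G e e'" "E - {e'}"] by (simp add: abs_mult)
    moreover have "?u * \<bar>x e'\<bar> <= \<bar>x e' * ?G e' e'\<bar>"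
    proof -
      have g: "?u <= ?G e' e'" by (rule gcov_edge_self[OF e' small])
      then have "?u <= \<bar>?G e' e'\<bar>" by linarith
      from mult_right_mono[OF this abs_ge_zero[of "x e'"]] show ?thesis by (simp add: abs_mult mult.commute)
    qed
    ultimately show "?u * \<bar>x e'\<bar> - (\<Sum>e\<in>E - {e'}. ?t e e') <= \<bar>\<Sum>e\<in>E. x e * ?G e e'\<bar>"
      by linarith
  qed
  finally have 1: "?u * (\<Sum>e\<in>E. \<bar>x e\<bar>) - (\<Sum>e'\<in>E. \<Sum>e\<in>E - {e'}. ?t e e') <=
      (\<Sum>e'\<in>E. \<bar>\<Sum>e\<in>E. x e * ?G e e'\<bar>)" .
  have off: "(\<Sum>e\<in>E - {e'}. g e) = (\<Sum>e\<in>E. if e = e' then 0 else g e)" if "e' \<in> E" for g :: "'v set => real" and e'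
    by (rule sum.mono_neutral_cong_left) (use finite_E in auto)
  \<comment> \<open>Extending by zeros makes both index sets the full \<open>E\<close>, so that the
    sums can be exchanged and the off-diagonal row sums appear.\<close>
  have "(\<Sum>e'\<in>E. \<Sum>e\<in>E - {e'}. ?t e e') = (\<Sum>e'\<in>E. \<Sum>e\<in>E. if e = e' then 0 else ?t e e')"
    by (intro sum.cong refl off)
  also have "... = (\<Sum>e\<in>E. \<Sum>e'\<in>E. if e = e' then 0 else ?t e e')" by (rule sum.swap)
  also have "... = (\<Sum>e\<in>E. \<Sum>e'\<in>E - {e}. ?t e e')"
  proof (rule sum.cong[OF refl])
    fix e
    show "(\<Sum>e'\<in>E. if e = e' then 0 else ?t e e') = (\<Sum>e'\<in>E - {e}. ?t e e')"
      by (rule sum.mono_neutral_cong_right) (use finite_E in auto)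
  qed
  also have "... <= (\<Sum>e\<in>E. \<bar>x e\<bar> * (?v))"
    unfolding sum_distrib_left[symmetric] using dd
    by (intro sum_mono mult_left_mono) (auto simp: diag_dominant_def)
  also have "... = ?v * (\<Sum>e\<in>E. \<bar>x e\<bar>)"
    unfolding sum_distrib_right[symmetric] by (rule mult.commute)
  finally have 2: "(\<Sum>e'\<in>E. \<Sum>e\<in>E - {e'}. ?t e e') <= ?v * (\<Sum>e\<in>E. \<bar>x e\<bar>)" .
  have "?u * (\<Sum>e\<in>E. \<bar>x e\<bar>) = ?v * (\<Sum>e\<in>E. \<bar>x e\<bar>) + ?v * (\<Sum>e\<in>E. \<bar>x e\<bar>)"
    by (simp add: field_simps)
  then show ?thesis using 1 2 by linarith
qed

lemma card_le_W: "real k <= W ^ k"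
proof -
  have "real k < 2 ^ k" by (rule of_nat_less_two_power)
  also have "... <= W ^ k" using W_ge by (intro power_mono) auto
  finally show ?thesis by simp
qed

text \<open>The number of edges is absorbed by the norm while a factor \<open>1 / W\<^sup>2\<close>,
  of order \<open>p\<^sup>2\<close>, is gained.\<close>

lemma card_le_W2:
  assumes "k >= 2"
  shows "real k * W\<^sup>2 <= 2 * W ^ k"
proof -
  obtain j where j: "k = j + 2" using assms le_Suc_ex[of 2 k] by (auto simp: add.commute)
  have "real j < 2 ^ j" by (rule of_nat_less_two_power)
  moreover have "(1::real) <= 2 ^ j" by simp
  ultimately have "real k <= 2 * 2 ^ j + 1" unfolding j by linarith
  have "j + 2 <= 2 * 2 ^ j" by (induction j) auto
  then have "real (j + 2) <= real (2 * 2 ^ j)" by (rule of_nat_mono)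
  also have "... <= 2 * W ^ j" using W_ge by (simp add: power_mono)
  finally have "real k * W\<^sup>2 <= 2 * W ^ j * W\<^sup>2" unfolding j by (intro mult_right_mono) auto
  then show ?thesis unfolding j power_add by (simp only: mult.assoc)
qed

text \<open>The covariance of an edge set with all edges is proportional to its cardinality, and
  sets of two or more edges weigh at least \<open>W\<^sup>2\<close> in the norm. Their contribution
  is therefore an error of relative order \<open>p\<^sup>2\<close>, and the rest is diagonal
  dominance.\<close>

lemma extract_combination:
  assumes dd: diag_dominant
    and f: "\<And>s. f s = c + (\<Sum>F\<in>NE. a F * mono_ind F s)"
  shows "1 / (8 * real q) * (\<Sum>e\<in>E. \<bar>a {e}\<bar>) <= (\<Sum>e'\<in>E. \<bar>gcov f (ph e')\<bar>) + 16 * real \<Delta> / W\<^sup>2 * vnorm0 a"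
proof -
  let ?B = "{F\<in>NE. card F >= 2}"
  let ?g = "\<lambda>F e'. gcov (mono_ind F) (ph e')"
  have f': "f = (\<lambda>s. c + (\<Sum>F\<in>NE. a F * mono_ind F s))" by (rule ext) (rule f)
  have dec: "gcov f (ph e') = (\<Sum>e\<in>E. a {e} * ?g {e} e') + (\<Sum>F\<in>?B. a F * ?g F e')" for e'
    unfolding f' gcov_sum_const by (rule NE_split)
  have "(\<Sum>e'\<in>E. \<bar>\<Sum>e\<in>E. a {e} * ?g {e} e'\<bar>) <= (\<Sum>e'\<in>E. \<bar>gcov f (ph e')\<bar> + \<bar>\<Sum>F\<in>?B. a F * ?g F e'\<bar>)"
    using dec by (intro sum_mono) (smt (verit))
  also have "... = (\<Sum>e'\<in>E. \<bar>gcov f (ph e')\<bar>) + (\<Sum>e'\<in>E. \<bar>\<Sum>F\<in>?B. a F * ?g F e'\<bar>)" by (rule sum.distrib)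
  finally have 1: "(\<Sum>e'\<in>E. \<bar>\<Sum>e\<in>E. a {e} * ?g {e} e'\<bar>) <=
      (\<Sum>e'\<in>E. \<bar>gcov f (ph e')\<bar>) + (\<Sum>e'\<in>E. \<bar>\<Sum>F\<in>?B. a F * ?g F e'\<bar>)" .
  have "(\<Sum>e'\<in>E. \<bar>\<Sum>F\<in>?B. a F * ?g F e'\<bar>) <= (\<Sum>e'\<in>E. \<Sum>F\<in>?B. \<bar>a F\<bar> * \<bar>?g F e'\<bar>)"
    using sum_abs[of "\<lambda>F. a F * ?g F _" ?B] by (intro sum_mono) (simp add: abs_mult)
  also have "... = (\<Sum>F\<in>?B. \<Sum>e'\<in>E. \<bar>a F\<bar> * \<bar>?g F e'\<bar>)" by (rule sum.swap)
  also have "... <= (\<Sum>F\<in>?B. \<bar>a F\<bar> * (16 * real \<Delta> / W\<^sup>2 * W ^ card F))"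
    unfolding sum_distrib_left[symmetric]
  proof (intro sum_mono mult_left_mono)
    fix F assume F: "F \<in> ?B"
    have "(\<Sum>e'\<in>E. \<bar>?g F e'\<bar>) <= 8 * real \<Delta> * real (card F)"
      using gcov_weighted_sum'[OF is_level_0, of F] F by simp
    also have "... <= 8 * real \<Delta> * (2 * W ^ card F / W\<^sup>2)"
      using card_le_W2[of "card F"] F W_ge by (intro mult_left_mono) (auto simp: field_simps)
    finally show "(\<Sum>e'\<in>E. \<bar>?g F e'\<bar>) <= 16 * real \<Delta> / W\<^sup>2 * W ^ card F" by simp
  qed simp
  also have "... <= (\<Sum>F\<in>NE. \<bar>a F\<bar> * (16 * real \<Delta> / W\<^sup>2 * W ^ card F))"
    using finite_NE W_ge by (intro sum_mono2) auto
  also have "... = 16 * real \<Delta> / W\<^sup>2 * vnorm0 a" by (simp add: vnorm_def sum_distrib_left mult_ac)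
  finally show ?thesis using 1 extract_singles[OF dd, of "\<lambda>e. a {e}"] by linarith
qed

text \<open>The norm with levels records how far the coefficients spread, and covariances of
  indicators decay in the same level, so a Markov-type bound beyond level \<open>R\<close> gains
  \<open>2 ^ R\<close>.\<close>

lemma far_covariance:
  assumes D: "is_level D" and f: "\<And>s. f s = c + (\<Sum>F\<in>NE. a F * mono_ind F s)"
  shows "(\<Sum>e'\<in>{e'\<in>E. R < max_level D {e'}}. \<bar>gcov f (ph e')\<bar>) <= (1/2) ^ R * (8 * real \<Delta> * vnorm D a)"
proof -
  let ?c = "\<lambda>e'. \<bar>gcov f (ph e')\<bar>" and ?l = "\<lambda>e. (2::real) ^ max_level D {e}"
  let ?g = "\<lambda>F e'. gcov (mono_ind F) (ph e')"
  have f': "f = (\<lambda>s. c + (\<Sum>F\<in>NE. a F * mono_ind F s))" by (rule ext) (rule f)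
  have "(\<Sum>e'\<in>E. ?l e' * ?c e') <=
      (\<Sum>e'\<in>E. \<Sum>F\<in>NE. \<bar>a F\<bar> * (?l e' * \<bar>?g F e'\<bar>))"
  proof (rule sum_mono)
    fix e'
    have "?c e' <= (\<Sum>F\<in>NE. \<bar>a F\<bar> * \<bar>?g F e'\<bar>)"
      unfolding f' gcov_sum_const using sum_abs[of "\<lambda>F. a F * ?g F e'" NE] by (simp add: abs_mult)
    then have "?l e' * ?c e' <= ?l e' * (\<Sum>F\<in>NE. \<bar>a F\<bar> * \<bar>?g F e'\<bar>)"
      by (intro mult_left_mono) auto
    then show "?l e' * ?c e' <= (\<Sum>F\<in>NE. \<bar>a F\<bar> * (?l e' * \<bar>?g F e'\<bar>))"
      by (simp add: sum_distrib_left mult.left_commute)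
  qed
  also have "... = (\<Sum>F\<in>NE. \<Sum>e'\<in>E. \<bar>a F\<bar> * (?l e' * \<bar>?g F e'\<bar>))" by (rule sum.swap)
  also have "... <= (\<Sum>F\<in>NE. \<bar>a F\<bar> * (8 * real \<Delta> * (W ^ card F * 2 ^ max_level D F)))"
    unfolding sum_distrib_left[symmetric]
  proof (intro sum_mono mult_left_mono)
    fix F assume F: "F \<in> NE"
    have "(\<Sum>e'\<in>E. ?l e' * \<bar>?g F e'\<bar>) <= 8 * real \<Delta> * (real (card F) * 2 ^ max_level D F)"
      by (rule gcov_weighted_sum'[OF D]) (use F in auto)
    also have "... <= 8 * real \<Delta> * (W ^ card F * 2 ^ max_level D F)"
      by (intro mult_left_mono mult_right_mono card_le_W) auto
    finally show "(\<Sum>e'\<in>E. ?l e' * \<bar>?g F e'\<bar>) <= 8 * real \<Delta> * (W ^ card F * 2 ^ max_level D F)" .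
  qed simp
  also have "... = 8 * real \<Delta> * vnorm D a" by (simp add: vnorm_def sum_distrib_left mult_ac)
  finally have "(1/2) ^ R * (\<Sum>e'\<in>E. ?l e' * ?c e') <= (1/2) ^ R * (8 * real \<Delta> * vnorm D a)"
    by (intro mult_left_mono) auto
  then show ?thesis using sum_far_le[where c = ?c and R = R and D = D, OF abs_ge_zero] by linarith
qed

text \<open>One step costs \<open>\<kappa> * W = 4\<close> on single edges, whose coefficients are
  recovered from covariances at the price \<open>8 * real q\<close>. The coefficient of the row
  itself collects the two errors of order \<open>p\<^sup>2\<close>: the larger sets in this step and
  the larger sets in the recovery. Near covariances stay as they are, to be compared with the
  lattice.\<close>

theorem row_recursion:
  assumes dd: diag_dominant and e: "e \<in> E" and D: "is_level D" "max_level D {e} <= 1"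
  shows "vnorm0 (edge_row e (Suc t)) <=
    32 * real q * ((\<Sum>e'\<in>{e'\<in>E. max_level D {e'} <= R}. \<bar>gcov (sw_iter t (ph e)) (ph e')\<bar>)
      + (1/2) ^ R * (16 * real \<Delta> * (\<kappa> ^ t * W)))
    + (512 * real q * real \<Delta> / W\<^sup>2 + \<kappa>\<^sup>2) * vnorm0 (edge_row e t)"
proof -
  let ?N = "{e'\<in>E. max_level D {e'} <= R}" and ?F = "{e'\<in>E. R < max_level D {e'}}"
  let ?far = "(1/2) ^ R * (16 * real \<Delta> * (\<kappa> ^ t * W))"
  let ?f = "sw_iter t (ph e)" and ?a = "edge_row e t"
  obtain c where f: "\<And>s. ?f s = c + (\<Sum>F\<in>NE. ?a F * mono_ind F s)" using sw_iter_edge[OF e, of t] by blast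
  let ?b = "16 * real \<Delta> / W\<^sup>2 * vnorm0 ?a"
  let ?C = "\<lambda>e'. \<bar>gcov ?f (ph e')\<bar>"
  let ?near = "\<Sum>e'\<in>?N. ?C e'"
  let ?x = "\<Sum>e\<in>E. \<bar>?a {e}\<bar>"
  have q: "real q > 0" using q2 by simp
  have "?N \<union> ?F = E" by auto
  moreover have "?N \<inter> ?F = {}" by auto
  ultimately have split: "(\<Sum>e'\<in>E. ?C e') = ?near + (\<Sum>e'\<in>?F. ?C e')"
    using sum.union_disjoint[of "?N" "?F" ?C] finite_E by simp
  have "vnorm D ?a <= \<kappa> ^ t * (W * 2 ^ max_level D {e})" by (rule vnorm_edge_row[OF D(1) e])
  also have "... <= \<kappa> ^ t * (W * 2 ^ 1)"
    using kappa_bounds W_ge by (intro mult_left_mono power_increasing D(2)) auto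
  finally have "(1/2) ^ R * (8 * real \<Delta> * vnorm D ?a) <= (1/2) ^ R * (8 * real \<Delta> * (\<kappa> ^ t * (W * 2)))"
    by (intro mult_left_mono) auto
  moreover have "(1/2) ^ R * (8 * real \<Delta> * (\<kappa> ^ t * (W * 2))) = ?far" by simp
  ultimately have far: "(\<Sum>e'\<in>?F. ?C e') <= ?far"
    using far_covariance[OF D(1) f, of R] by linarith
  have "1 / (8 * real q) * ?x <= ?near + ?far + ?b"
    using extract_combination[OF dd f] split far by linarith
  then have "8 * real q * (1 / (8 * real q) * ?x) <=
      8 * real q * (?near + ?far + ?b)"
    using q by (intro mult_left_mono) auto
  then have x: "?x <= 8 * real q * (?near + ?far + ?b)"
    using q by simp
  have "vnorm0 (edge_row e (Suc t)) <= 4 * ?x + \<kappa>\<^sup>2 * vnorm0 ?a"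
    using vnorm_step_split[of ?a] by (simp add: edge_row_def kappa_W)
  also have "... <= 4 * (8 * real q * (?near + ?far + ?b))
      + \<kappa>\<^sup>2 * vnorm0 ?a" using x by linarith
  also have "... = 32 * real q * (?near + ?far)
    + (512 * real q * real \<Delta> / W\<^sup>2 + \<kappa>\<^sup>2) * vnorm0 ?a"
    by (simp add: distrib_left distrib_right mult.assoc)
  finally show ?thesis .
qed

section \<open>The leading order of the dynamics on a single edge\<close>

lemma color_avg_edge:
  assumes e: "e \<in> E"
  shows "color_avg q e (ph e) {e} = 1" "color_avg q e (ph e) {} <= 1 / 2"
proof -
  have fin: "finite e" by (rule finite_edge[OF e])
  obtain u v where uv: "u ~= v" "e = {u, v}" using edgeE[OF e] by blast
  have "ph e t = 1" if "t \<in> colorings q e {e}" for t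
  proof -
    have "t u = t v" using that conn_edge[of u v "{e}"] uv unfolding colorings_def by simp
    then show ?thesis using uv by (simp add: mono_ind_def)
  qed
  then show "color_avg q e (ph e) {e} = 1"
    using card_colorings_pos[OF q1 fin, of "{e}"] by (simp add: color_avg_def)
  have "(x, y) \<in> conn {} \<longleftrightarrow> x = y" for x y :: 'v by (simp add: conn_def)
  then have c0: "colorings q e {} = spins q e" by (auto simp: colorings_def)
  have card: "card (spins q e) = q\<^sup>2" using fin card_edge[OF e] by (simp add: card_PiE)
  let ?M = "{t \<in> spins q e. t u = t v}"
  have "?M \<subseteq> (\<lambda>a. \<lambda>x\<in>e. a) ` {1..q}"
  proof
    fix t assume t: "t \<in> ?M"
    have "t = (\<lambda>x\<in>e. t u)"
      using t uv by (auto simp: fun_eq_iff restrict_def PiE_def extensional_def)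
    moreover have "t u \<in> {1..q}" using t uv by auto
    ultimately show "t \<in> (\<lambda>a. \<lambda>x\<in>e. a) ` {1..q}" by blast
  qed
  then have "card ?M <= q"
    using card_mono[of "(\<lambda>a. \<lambda>x\<in>e. a) ` {1..q}" ?M] card_image_le[of "{1..q}" "\<lambda>a. \<lambda>x\<in>e. a"] by simp
  moreover have "(\<Sum>t\<in>spins q e. ph e t) = real (card ?M)"
  proof -
    have m: "ph e t = (if t u = t v then 1 else 0)" for t using uv by (auto simp: mono_ind_def)
    have "finite (spins q e)" using fin by (intro finite_PiE) auto
    then show ?thesis unfolding m by (simp add: sum.inter_filter[symmetric])
  qed
  ultimately have "color_avg q e (ph e) {} <= real q / real (q\<^sup>2)"
    unfolding color_avg_def c0 card by (intro divide_right_mono) auto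
  also have "... <= 1 / 2" using q2 by (simp add: power2_eq_square field_simps)
  finally show "color_avg q e (ph e) {} <= 1 / 2" .
qed

lemma sw_coeff_singleton: "sw_coeff q S f {e} = color_avg q S f {e} - color_avg q S f {}"
  using submoeb_insert[of "{}" e "color_avg q S f"] by (simp add: sw_coeff_def submoeb_def)

text \<open>Opening \<open>e\<close> raises the probability of a monochromatic edge from at most one
  half to 1. A different single edge never joins the two ends of \<open>e\<close>, so to first order
  in \<open>p\<close> no other single edge appears.\<close>

lemma coef_edges:
  assumes e: "e \<in> E" "e' \<in> E"
  shows "p / 2 <= coef {e} {e}" "e' ~= e ==> coef {e} {e'} = 0"
proof -
  have "1 / 2 <= sw_coeff q e (ph e) {e}"
    using color_avg_edge[OF e(1)] by (simp add: sw_coeff_singleton)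
  then show "p / 2 <= coef {e} {e}" using p_bounds by (simp add: coef_def)
  assume ne: "e' ~= e"
  have "(x, y) \<in> conn {e'} \<longleftrightarrow> (x, y) \<in> conn {}" if "x \<in> e" "y \<in> e" for x y
  proof -
    have "(x, y) \<in> conn {e'} ==> x = y \<or> {x, y} = e'"
      unfolding conn_def
    proof (induction rule: rtrancl_induct)
      case (step y z)
      obtain a b where ab: "a ~= b" "e' = {a, b}" using edgeE[OF e(2)] by blast
      then show ?case using step by (auto simp: doubleton_eq_iff)
    qed simp
    moreover have "{x, y} = e" if "x ~= y"
      using card_subset_eq[OF finite_edge[OF e(1)], of "{x, y}"] card_edge[OF e(1)] that \<open>x \<in> e\<close> \<open>y \<in> e\<close> by simp
    ultimately have "(x, y) \<in> conn {e'} ==> x = y" using ne by auto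
    moreover have "(x, y) \<in> conn {} \<longleftrightarrow> x = y" by (simp add: conn_def)
    ultimately show ?thesis by auto
  qed
  then have "color_avg q e (ph e) {e'} = color_avg q e (ph e) {}" by (rule color_avg_cong)
  then show "coef {e} {e'} = 0" by (simp add: coef_def sw_coeff_singleton)
qed

text \<open>To first order the operator multiplies the indicator of an edge by at least
  \<open>p / 2\<close>. The larger sets contribute at most the coefficient bound of a single edge
  divided by \<open>W\<^sup>2\<close>, and \<open>\<kappa> * W = 4\<close> gives the
  constant.\<close>

lemma gcov_sw_edge:
  assumes e: "e \<in> E"
  shows "p / 2 * gcov (ph e) (ph e) - 4 / W\<^sup>2 <= gcov (\<lambda>s. sw_op (ph e) s) (ph e)"
proof -
  let ?m = "ph e" and ?H = "{F\<in>NE. card F >= 2}"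
  let ?g = "\<lambda>F. gcov (mono_ind F) ?m"
  have eq: "(\<lambda>s. sw_op ?m s) = (\<lambda>s. coef {e} {} + (\<Sum>F\<in>NE. coef {e} F * mono_ind F s))"
  proof
    fix s
    have "sw_op ?m s = (\<Sum>F\<in>Pow E. coef {e} F * mono_ind F s)"
      by (rule sw_op_mono_ind) (use e in simp)
    also have "... = coef {e} {} * mono_ind {} s + (\<Sum>F\<in>NE. coef {e} F * mono_ind F s)"
      using finite_E by (subst sum.remove[of _ "{}"]) auto
    finally show "sw_op ?m s = coef {e} {} + (\<Sum>F\<in>NE. coef {e} F * mono_ind F s)" by simp
  qed
  have "gcov (\<lambda>s. sw_op ?m s) ?m = (\<Sum>F\<in>NE. coef {e} F * ?g F)"
    unfolding eq by (rule gcov_sum_const)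
  also have "... = (\<Sum>e'\<in>E. coef {e} {e'} * ?g {e'}) + (\<Sum>F\<in>?H. coef {e} F * ?g F)"
    by (rule NE_split)
  finally have 1: "gcov (\<lambda>s. sw_op ?m s) ?m = ..." .
  have "(\<Sum>e'\<in>E. coef {e} {e'} * ?g {e'}) = (\<Sum>e'\<in>E. if e' = e then coef {e} {e} * ?g {e} else 0)"
    by (intro sum.cong refl) (use coef_edges(2)[OF e] in auto)
  also have "... = coef {e} {e} * ?g {e}" using e finite_E by simp
  finally have 2: "(\<Sum>e'\<in>E. coef {e} {e'} * ?g {e'}) = coef {e} {e} * ?g {e}" .
  have 3: "p / 2 * ?g {e} <= coef {e} {e} * ?g {e}"
    by (rule mult_right_mono[OF coef_edges(1)[OF e e] gcov_self_nonneg])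
  have g1: "\<bar>?g F\<bar> <= 1" for F
  proof -
    have "0 <= gmean (mono_ind G) \<and> gmean (mono_ind G) <= 1" for G
    proof -
      have "gmean (\<lambda>_. 0) <= gmean (mono_ind G)" by (rule gmean_mono) (rule mono_ind_range)
      moreover have "gmean (mono_ind G) <= gmean (\<lambda>_. 1)" by (rule gmean_mono) (rule mono_ind_range)
      ultimately show ?thesis by simp
    qed
    note m = this
    have "0 <= gmean (mono_ind F) * gmean ?m" "gmean (mono_ind F) * gmean ?m <= 1"
      using m[of F] m[of "{e}"] by (auto intro: mult_le_one)
    then show ?thesis unfolding gcov_def mono_ind_mult using m[of "F \<union> {e}"] by linarith
  qed
  have "\<bar>\<Sum>F\<in>?H. coef {e} F * ?g F\<bar> <= (\<Sum>F\<in>?H. \<bar>coef {e} F * ?g F\<bar>)"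
    by (rule sum_abs)
  also have "... <= (\<Sum>F\<in>?H. \<bar>coef {e} F\<bar> * (W ^ card F / W\<^sup>2))"
    unfolding abs_mult
  proof (intro sum_mono mult_left_mono)
    fix F assume "F \<in> ?H"
    then have "W\<^sup>2 <= W ^ card F" using W_ge by (intro power_increasing) auto
    then have "1 <= W ^ card F / W\<^sup>2" using W_ge by simp
    then show "\<bar>?g F\<bar> <= W ^ card F / W\<^sup>2" using g1[of F] by linarith
  qed simp
  also have "... <= (\<Sum>F\<in>Pow E. \<bar>coef {e} F\<bar> * (W ^ card F / W\<^sup>2))"
    using finite_E W_ge by (intro sum_mono2) auto
  also have "... = (\<Sum>F\<in>Pow E. \<bar>coef {e} F\<bar> * (W ^ card F * 2 ^ max_level (\<lambda>_. 0) F)) / W\<^sup>2"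
    by (simp add: sum_divide_distrib)
  also have "... <= (\<kappa> ^ card {e} * (W ^ card {e} * 2 ^ max_level (\<lambda>_. 0) {e})) / W\<^sup>2"
    by (intro divide_right_mono coef_bound[OF is_level_0]) (use e in auto)
  also have "... = 4 / W\<^sup>2" by (simp add: kappa_W)
  finally show ?thesis using 1 2 3 by linarith
qed

end

subsection \<open>The spectral gap of a finite reversible chain\<close>

text \<open>Real roots are divided out one at a time. This guarantees that the list of real
  eigenvalues is complete, so that its last index is meaningful.\<close>

lemma size_proots_real_roots:
  fixes r :: "real poly"
  assumes "r ~= 0" "\<And>z. poly (map_poly complex_of_real r) z = 0 ==> z \<in> \<real>"
  shows "size (proots r) = degree r"
  using assms
proof (induction "degree r" arbitrary: r)
  case 0
  then obtain c where "r = [:c:]" by (metis degree_eq_zeroE)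
  then show ?case by simp
next
  case (Suc n)
  have "degree (map_poly complex_of_real r) = degree r" by simp
  then have "\<not> constant (poly (map_poly complex_of_real r))"
    using Suc.hyps(2) constant_degree by (metis nat.simps(3))
  then obtain z where z: "poly (map_poly complex_of_real r) z = 0"
    using fundamental_theorem_of_algebra by blast
  then obtain a where a: "z = complex_of_real a" using Suc.prems(2) by (auto elim: Reals_cases)
  have "complex_of_real (poly r a) = 0" using z unfolding a by (simp add: of_real_hom.poly_map_poly)
  then have "poly r a = 0" by simp
  then obtain s where s: "r = [:- a, 1:] * s" by (auto simp: poly_eq_0_iff_dvd)
  have s0: "s ~= 0" using s Suc.prems(1) by auto
  have "degree r = degree [:- a, 1:] + degree s"
    unfolding s by (rule degree_mult_eq) (use s0 in auto)
  then have deg: "degree r = Suc (degree s)" by simp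
  have "size (proots s) = degree s"
  proof (rule Suc.hyps(1))
    show "n = degree s" using deg Suc.hyps(2) by simp
    show "s ~= 0" by (rule s0)
    fix w assume "poly (map_poly complex_of_real s) w = 0"
    interpret m: map_poly_comm_ring_hom complex_of_real ..
    have "poly (map_poly complex_of_real r) w = 0"
      using \<open>poly (map_poly complex_of_real s) w = 0\<close> unfolding s m.hom_mult by simp
    then show "w \<in> \<real>" by (rule Suc.prems(2))
  qed
  moreover have "proots r = {#a#} + proots s"
    unfolding s by (subst proots_mult) (use s0 in auto)
  ultimately show ?case using deg by simp
qed

text \<open>Positivity of the form makes all eigenvalues nonnegative, so the absolute value of the
  smallest one never decides the spectral gap.\<close>

locale rev_chain =
  fixes S :: "'s set" and P :: "'s => 's => real" and \<pi> :: "'s => real"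
  assumes fin: "finite S" and card: "card S >= 2"
    and pos: "x \<in> S ==> \<pi> x > 0" and total: "(\<Sum>x\<in>S. \<pi> x) = 1"
    and stoch: "x \<in> S ==> (\<Sum>y\<in>S. P x y) = 1"
    and P_nonneg: "0 <= P x y"
    and rev: "x \<in> S ==> y \<in> S ==> \<pi> x * P x y = \<pi> y * P y x"
    and psd: "(\<Sum>x\<in>S. \<Sum>y\<in>S. \<pi> x * P x y * f x * f y) >= 0"
begin

definition app :: "('s => real) => 's => real" where "app f x = (\<Sum>y\<in>S. P x y * f y)"
definition ip :: "('s => real) => ('s => real) => real" where "ip f g = (\<Sum>x\<in>S. \<pi> x * (f x * g x))"
definition nonconst :: "('s => real) => bool" where "nonconst g \<longleftrightarrow> (\<exists>x\<in>S. \<exists>y\<in>S. g x ~= g y)"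
text \<open>Eigenvalues on functions modulo constants: the value 1 occurs here only if it has an
  eigenfunction besides the constants.\<close>

definition eig :: "real => bool" where "eig m \<longleftrightarrow> (\<exists>g. nonconst g \<and> (\<forall>x\<in>S. app g x = m * g x))"

lemma ip_app: "ip f (app g) = (\<Sum>x\<in>S. \<Sum>y\<in>S. \<pi> x * P x y * f x * g y)"
  unfolding ip_def app_def by (simp add: sum_distrib_left mult_ac)

lemma ip_app_sym: "ip f (app g) = ip g (app f)"
proof -
  have "ip f (app g) = (\<Sum>y\<in>S. \<Sum>x\<in>S. \<pi> x * P x y * f x * g y)" unfolding ip_app by (rule sum.swap)
  also have "... = (\<Sum>y\<in>S. \<Sum>x\<in>S. \<pi> y * P y x * g y * f x)"
    by (intro sum.cong refl) (simp add: rev mult_ac)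
  finally show ?thesis unfolding ip_app .
qed

lemma ip_commute: "ip f g = ip g f" by (simp add: ip_def mult.commute)

lemma ip_app_one: "ip (\<lambda>_. 1) (app f) = ip (\<lambda>_. 1) f"
proof -
  have "ip (\<lambda>_. 1) (app f) = ip f (app (\<lambda>_. 1))" by (rule ip_app_sym)
  also have "... = ip (\<lambda>_. 1) f"
    unfolding ip_def by (intro sum.cong refl) (simp add: app_def stoch)
  finally show ?thesis .
qed

lemma ip_app_nonneg: "ip f (app f) >= 0" unfolding ip_app by (rule psd)

lemma ip_app_le: "ip f (app f) <= ip f f"
proof -
  have "0 <= (\<Sum>x\<in>S. \<Sum>y\<in>S. \<pi> x * P x y * (f x - f y)\<^sup>2)"
    using pos P_nonneg by (intro sum_nonneg mult_nonneg_nonneg) (auto intro: less_imp_le)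
  also have "... = (\<Sum>x\<in>S. \<Sum>y\<in>S. \<pi> x * P x y * (f x)\<^sup>2) + (\<Sum>x\<in>S. \<Sum>y\<in>S. \<pi> x * P x y * (f y)\<^sup>2)
      - 2 * (\<Sum>x\<in>S. \<Sum>y\<in>S. \<pi> x * P x y * f x * f y)"
    by (simp add: power2_diff sum.distrib sum_subtractf sum_distrib_left algebra_simps)
  also have "(\<Sum>x\<in>S. \<Sum>y\<in>S. \<pi> x * P x y * (f x)\<^sup>2) = (\<Sum>x\<in>S. \<pi> x * (f x)\<^sup>2 * (\<Sum>y\<in>S. P x y))"
    unfolding sum_distrib_left by (intro sum.cong refl) (simp add: mult_ac)
  also have "... = ip f f" unfolding ip_def by (intro sum.cong refl) (simp add: stoch power2_eq_square)
  also have "(\<Sum>x\<in>S. \<Sum>y\<in>S. \<pi> x * P x y * (f y)\<^sup>2) = (\<Sum>y\<in>S. \<Sum>x\<in>S. \<pi> x * P x y * (f y)\<^sup>2)" by (rule sum.swap)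
  also have "... = (\<Sum>y\<in>S. \<pi> y * (f y)\<^sup>2 * (\<Sum>x\<in>S. P y x))"
    unfolding sum_distrib_left by (intro sum.cong refl) (simp add: rev mult_ac)
  also have "... = ip f f" unfolding ip_def by (intro sum.cong refl) (simp add: stoch power2_eq_square)
  finally show ?thesis unfolding ip_app by simp
qed

lemma ip_nonneg: "ip f f >= 0"
  unfolding ip_def by (intro sum_nonneg mult_nonneg_nonneg[OF less_imp_le[OF pos] zero_le_square])

lemma ip_pos:
  assumes "x \<in> S" "f x ~= 0"
  shows "ip f f > 0"
  unfolding ip_def
proof (rule sum_pos2[OF fin assms(1)])
  show "0 < \<pi> x * (f x * f x)"
    using pos[OF assms(1)] assms(2) by (auto intro!: mult_pos_pos simp: zero_less_mult_iff neq_iff)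
  show "0 <= \<pi> y * (f y * f y)" if "y \<in> S" for y
    by (rule mult_nonneg_nonneg[OF less_imp_le[OF pos[OF that]] zero_le_square])
qed

lemma eig_range:
  assumes "eig m"
  shows "0 <= m" "m <= 1"
proof -
  obtain g where g: "nonconst g" "\<And>x. x \<in> S ==> app g x = m * g x" using assms unfolding eig_def by blast
  then obtain x where "x \<in> S" "g x ~= 0" unfolding nonconst_def by metis
  then have pg: "ip g g > 0" by (rule ip_pos)
  have eq: "ip g (app g) = m * ip g g"
    unfolding ip_def by (simp add: g(2) sum_distrib_left mult_ac)
  show "0 <= m" using ip_app_nonneg[of g] pg unfolding eq by (simp add: zero_le_mult_iff)
  show "m <= 1" using ip_app_le[of g] pg unfolding eq by simp
qed

abbreviation "N \<equiv> card S"
abbreviation "st \<equiv> from_nat_into S"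

lemma st_bij: "bij_betw st {..<N} S" by (rule bij_betw_from_nat_into_finite[OF fin])

lemma st_in: "i < N ==> st i \<in> S" using st_bij by (auto simp: bij_betw_def)

lemma sum_st: "(\<Sum>x\<in>S. g x) = (\<Sum>i<N. g (st i))"
  by (rule sum.reindex_bij_betw[OF st_bij, symmetric])

lemma st_surj: "x \<in> S ==> \<exists>i<N. x = st i" using st_bij by (auto simp: bij_betw_def)

definition tm :: "real mat" where "tm = transition_matrix S P"

lemma tm_carrier: "tm \<in> carrier_mat N N" by (simp add: tm_def transition_matrix_def)

lemma tm_index: "i < N ==> j < N ==> tm $$ (i, j) = P (st i) (st j)"
  by (simp add: tm_def transition_matrix_def)

lemma complex_roots_real:
  assumes "poly (map_poly complex_of_real (char_poly tm)) z = 0"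
  shows "z \<in> \<real>"
proof -
  let ?B = "map_mat complex_of_real tm"
  have B: "?B \<in> carrier_mat N N" using tm_carrier by simp
  have "poly (char_poly ?B) z = 0" by (subst of_real_hom.char_poly_hom[OF tm_carrier]) (rule assms)
  then have "eigenvalue ?B z" using eigenvalue_root_char_poly[OF B] by simp
  then obtain v where v: "v \<in> carrier_vec N" "v ~= 0\<^sub>v N" "?B *\<^sub>v v = z \<cdot>\<^sub>v v"
    using B unfolding eigenvalue_def eigenvector_def by auto
  have ev: "(\<Sum>j<N. complex_of_real (P (st i) (st j)) * v $ j) = z * v $ i" if i: "i < N" for i
  proof -
    have "(?B *\<^sub>v v) $ i = (\<Sum>j<N. complex_of_real (P (st i) (st j)) * v $ j)"
      using i v(1) tm_carrier by (auto simp: scalar_prod_def tm_index lessThan_atLeast0 intro!: sum.cong)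
    then show ?thesis unfolding v(3) using i v by simp
  qed
  let ?c = "\<lambda>i j. complex_of_real (\<pi> (st i) * P (st i) (st j))"
  \<comment> \<open>By reversibility this Hermitian form is real. Evaluated at the eigenvector it
    equals \<open>z\<close> times the positive number \<open>n\<close>, hence \<open>z\<close> is
    real.\<close>
  define H where "H = (\<Sum>i<N. \<Sum>j<N. ?c i j * (cnj (v $ i) * v $ j))"
  define n where "n = (\<Sum>i<N. \<pi> (st i) * (cmod (v $ i))\<^sup>2)"
  have "H = (\<Sum>i<N. complex_of_real (\<pi> (st i)) * cnj (v $ i) * (\<Sum>j<N. complex_of_real (P (st i) (st j)) * v $ j))"
    unfolding H_def sum_distrib_left by (simp add: mult_ac)
  also have "... = (\<Sum>i<N. z * (complex_of_real (\<pi> (st i)) * (v $ i * cnj (v $ i))))"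
  proof (intro sum.cong refl)
    fix i assume "i \<in> {..<N}"
    then have i: "i < N" by simp
    show "complex_of_real (\<pi> (st i)) * cnj (v $ i) * (\<Sum>j<N. complex_of_real (P (st i) (st j)) * v $ j) =
        z * (complex_of_real (\<pi> (st i)) * (v $ i * cnj (v $ i)))"
      unfolding ev[OF i] by (simp add: mult_ac)
  qed
  also have "... = z * complex_of_real n"
    unfolding n_def by (simp add: sum_distrib_left complex_norm_square[symmetric] flip: of_real_power of_real_mult)
  finally have Hz: "H = z * complex_of_real n" .
  have "cnj H = (\<Sum>i<N. \<Sum>j<N. ?c i j * (v $ i * cnj (v $ j)))" by (simp add: H_def)
  also have "... = (\<Sum>j<N. \<Sum>i<N. ?c i j * (v $ i * cnj (v $ j)))" by (rule sum.swap)
  also have "... = H" unfolding H_def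
    by (intro sum.cong refl) (use rev st_in in \<open>simp add: mult.commute\<close>)
  finally have "H \<in> \<real>" by (simp add: Reals_cnj_iff)
  moreover have "n > 0"
  proof -
    obtain i where "i < N" "v $ i ~= 0" using v(1,2) by (metis eq_vecI index_zero_vec carrier_vecD)
    then show ?thesis unfolding n_def
      by (intro sum_pos2[of _ i]) (auto intro!: mult_pos_pos mult_nonneg_nonneg pos less_imp_le[OF pos] st_in)
  qed
  ultimately have "H / complex_of_real n \<in> \<real>" by (intro Reals_divide) auto
  then show ?thesis using \<open>n > 0\<close> unfolding Hz by simp
qed

definition dm :: "real mat" where
  "dm = Matrix.mat (N - 1) (N - 1) (\<lambda>(i, j). P (st (Suc i)) (st (Suc j)) - P (st 0) (st (Suc j)))"

lemma dm_carrier: "dm \<in> carrier_mat (N - 1) (N - 1)" by (simp add: dm_def)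

lemma sum_delta_lt: "i < (n::nat) ==> (\<Sum>k<n. (if k = i then g k else 0)) = (g i :: real)"
  "i < (n::nat) ==> (\<Sum>k<n. (if i = k then g k else 0)) = (g i :: real)" by auto

text \<open>Changing the first basis vector to the constant function splits off the eigenvalue \<open>1\<close>;
  \<open>dm\<close> is the action on functions modulo constants, normalised to vanish at the first state.\<close>

lemma char_poly_tm: "char_poly tm = [:- 1, 1:] * char_poly dm"
proof -
  define R where "R = Matrix.mat N N (\<lambda>(i, j). if j = 0 then 1 else if i = j then 1 else (0::real))"
  define Q where "Q = Matrix.mat N N (\<lambda>(i, j). if j = 0 then (if i = 0 then 1 else - 1) else if i = j then 1 else (0::real))"
  define C where "C = four_block_mat (Matrix.mat 1 1 (\<lambda>_. 1)) (Matrix.mat 1 (N - 1) (\<lambda>(i, j). P (st 0) (st (Suc j)))) (0\<^sub>m (N - 1) 1) dm"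
  have N0: "0 < N" using card by simp
  have car: "R \<in> carrier_mat N N" "Q \<in> carrier_mat N N" "C \<in> carrier_mat N N"
    using N0 dm_carrier by (auto simp: R_def Q_def C_def)
  have R: "R $$ (i, j) = (if j = 0 then 1 else if i = j then 1 else 0)" if "i < N" "j < N" for i j
    using that by (simp add: R_def)
  have Q: "Q $$ (i, j) = (if j = 0 then (if i = 0 then 1 else - 1) else if i = j then 1 else 0)" if "i < N" "j < N" for i j
    using that by (simp add: Q_def)
  have mult: "(X * Y) $$ (i, j) = (\<Sum>k<N. X $$ (i, k) * Y $$ (k, j))"
    if "X \<in> carrier_mat N N" "Y \<in> carrier_mat N N" "i < N" "j < N" for X Y :: "real mat" and i j
    using that by (auto simp: scalar_prod_def lessThan_atLeast0 intro!: sum.cong)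
  have Qm: "(Q * Y) $$ (i, j) = (if i = 0 then Y $$ (0, j) else Y $$ (i, j) - Y $$ (0, j))"
    if Y: "Y \<in> carrier_mat N N" "i < N" "j < N" for Y i j
  proof -
    have "(Q * Y) $$ (i, j) = (\<Sum>k<N. (if k = i then Y $$ (k, j) else 0) - (if k = 0 then (if i = 0 then 0 else Y $$ (k, j)) else 0))"
      unfolding mult[OF car(2) Y] by (intro sum.cong refl) (use Y in \<open>auto simp: Q\<close>)
    also have "... = Y $$ (i, j) - (if i = 0 then 0 else Y $$ (0, j))"
      unfolding sum_subtractf sum_delta_lt(1)[OF Y(2)] sum_delta_lt(1)[OF N0] ..
    finally show ?thesis by simp
  qed
  have QR: "Q * R = 1\<^sub>m N"
  proof (rule eq_matI)
    fix i j assume ij: "i < dim_row (1\<^sub>m N :: real mat)" "j < dim_col (1\<^sub>m N :: real mat)"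
    then show "(Q * R) $$ (i, j) = 1\<^sub>m N $$ (i, j)"
      using N0 by (simp add: Qm[OF car(1)] R del: index_mult_mat)
  qed (use car in auto)
  have RQ: "R * Q = 1\<^sub>m N" by (rule mat_mult_left_right_inverse[OF car(2,1) QR])
  have "tm = R * C * Q"
  proof -
    have AR: "(tm * R) $$ (i, j) = (if j = 0 then 1 else P (st i) (st j))" if ij: "i < N" "j < N" for i j
    proof (cases "j = 0")
      case True
      have "(tm * R) $$ (i, j) = (\<Sum>k<N. P (st i) (st k))"
        unfolding mult[OF tm_carrier car(1) ij] by (intro sum.cong refl) (use ij True in \<open>auto simp: tm_index R\<close>)
      also have "... = 1" using stoch[OF st_in[OF ij(1)]] by (simp add: sum_st)
      finally show ?thesis using True by simp
    next
      case False
      have "(tm * R) $$ (i, j) = (\<Sum>k<N. if k = j then P (st i) (st k) else 0)"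
        unfolding mult[OF tm_carrier car(1) ij] by (intro sum.cong refl) (use ij False in \<open>auto simp: tm_index R\<close>)
      then show ?thesis using ij False by simp
    qed
    have car': "tm * R \<in> carrier_mat N N" using tm_carrier car by simp
    have "Q * (tm * R) = C"
    proof (rule eq_matI)
      fix i j assume "i < dim_row C" "j < dim_col C"
      then have ij: "i < N" "j < N" using car by auto
      have "(Q * (tm * R)) $$ (i, j) = (if i = 0 then (tm * R) $$ (0, j) else (tm * R) $$ (i, j) - (tm * R) $$ (0, j))"
        by (rule Qm[OF car' ij])
      also have "... = C $$ (i, j)"
        using ij N0 unfolding AR[OF ij] AR[OF N0 ij(2)] C_def dm_def
        by (cases i; cases j) auto
      finally show "(Q * (tm * R)) $$ (i, j) = C $$ (i, j)" .
    qed (use car tm_carrier in auto)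
    then have "R * C * Q = R * (Q * (tm * R)) * Q" by simp
    also have "R * (Q * (tm * R)) = (R * Q) * (tm * R)" using assoc_mult_mat[OF car(1,2) car'] by simp
    also have "... = tm * R" unfolding RQ by (rule left_mult_one_mat[OF car'])
    also have "tm * R * Q = tm * (R * Q)" using assoc_mult_mat[OF tm_carrier car(1,2)] .
    finally show ?thesis unfolding RQ using tm_carrier by simp
  qed
  then have "similar_mat tm C"
    using similar_matI[of tm C R Q N] RQ QR car tm_carrier by auto
  then have "char_poly tm = char_poly C" by (rule char_poly_similar)
  also have "... = char_poly (Matrix.mat 1 1 (\<lambda>_. 1::real)) * char_poly dm"
    unfolding C_def by (rule char_poly_four_block_zeros_col[OF _ _ dm_carrier]) auto
  also have "char_poly (Matrix.mat 1 1 (\<lambda>_. 1::real)) = [:- 1, 1:]"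
    by (simp add: char_poly_defs det_def sign_def One_nat_def)
  finally show ?thesis .
qed

text \<open>An eigenvector of \<open>dm\<close> satisfies the eigenvalue equation up to a constant
  \<open>c\<close>. For \<open>m\<close> different from 1 the constant is removed by adding
  \<open>c / (m - 1)\<close>; for \<open>m = 1\<close> the invariance of the reversible measure
  forces \<open>c = 0\<close>.\<close>

lemma dm_root_iff: "poly (char_poly dm) m = 0 \<longleftrightarrow> eig m"
proof -
  have N0: "0 < N" using card by simp
  have NS: "N = Suc (N - 1)" using N0 by simp
  have split: "(\<Sum>k<N. g k) = g 0 + (\<Sum>k<N - 1. g (Suc k))" for g :: "nat => real"
    by (subst NS) (rule sum.lessThan_Suc_shift)
  have appst: "app g (st i) = (\<Sum>k<N. P (st i) (st k) * g (st k))" for g i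
    unfolding app_def by (rule sum_st)
  have dmv: "(dm *\<^sub>v v) $ i = (\<Sum>j<N - 1. (P (st (Suc i)) (st (Suc j)) - P (st 0) (st (Suc j))) * v $ j)"
    if "v \<in> carrier_vec (N - 1)" "i < N - 1" for v i
    using that by (auto simp: dm_def scalar_prod_def lessThan_atLeast0 intro!: sum.cong)
  show ?thesis
  proof
    assume "poly (char_poly dm) m = 0"
    then have "eigenvalue dm m" using eigenvalue_root_char_poly[OF dm_carrier] by simp
    then obtain v where v: "v \<in> carrier_vec (N - 1)" "v ~= 0\<^sub>v (N - 1)" "dm *\<^sub>v v = m \<cdot>\<^sub>v v"
      using dm_carrier unfolding eigenvalue_def eigenvector_def by auto
    define u where "u i = (if i = 0 then 0 else v $ (i - 1))" for i
    define f where "f x = u (inv_into {..<N} st x)" for x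
    have fst: "f (st i) = u i" if "i < N" for i
      using that st_bij by (simp add: f_def bij_betw_def inv_into_f_f)
    define c where "c = app f (st 0)"
    have Pf: "app f x = m * f x + c" if x: "x \<in> S" for x
    proof -
      obtain i where i: "i < N" "x = st i" using st_surj[OF x] by blast
      show ?thesis
      proof (cases i)
        case 0
        then show ?thesis using fst[OF N0] i by (simp add: c_def u_def)
      next
        case (Suc j)
        then have j: "j < N - 1" using i by simp
        have "app f x - c = (\<Sum>k<N. (P (st i) (st k) - P (st 0) (st k)) * f (st k))"
          unfolding i(2) c_def appst by (simp add: left_diff_distrib sum_subtractf)
        also have "... = (\<Sum>k<N. (P (st i) (st k) - P (st 0) (st k)) * u k)"
          by (intro sum.cong refl) (simp add: fst)
        also have "... = (\<Sum>k<N - 1. (P (st (Suc j)) (st (Suc k)) - P (st 0) (st (Suc k))) * v $ k)"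
          by (subst split) (simp add: u_def Suc)
        also have "... = m * v $ j" using dmv[OF v(1) j] j v(1) unfolding v(3) by simp
        also have "... = m * f x" unfolding i(2) fst[OF i(1)] by (simp add: u_def Suc)
        finally show ?thesis by simp
      qed
    qed
    have nc: "nonconst f"
    proof -
      obtain j where "j < N - 1" "v $ j ~= 0" using v(1,2) by (metis eq_vecI index_zero_vec carrier_vecD)
      then have "f (st (Suc j)) ~= f (st 0)" "Suc j < N" using fst[of "Suc j"] fst[OF N0] by (auto simp: u_def)
      then show ?thesis unfolding nonconst_def using st_in N0 by blast
    qed
    show "eig m"
    proof (cases "m = 1")
      case True
      note ip_app_one[of f]
      moreover have "ip (\<lambda>_. 1) (app f) = ip (\<lambda>_. 1) f + c"
        unfolding ip_def using total
        by (simp add: Pf True distrib_left sum.distrib sum_distrib_right[symmetric])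
      ultimately have "c = 0" by simp
      then show ?thesis unfolding eig_def using nc Pf by auto
    next
      case False
      define d where "d = c / (m - 1)"
      have d: "c + d = m * d" using False by (simp add: d_def field_simps)
      have "app (\<lambda>x. f x + d) x = m * (f x + d)" if x: "x \<in> S" for x
      proof -
        have "app (\<lambda>x. f x + d) x = app f x + d"
          unfolding app_def by (simp add: distrib_left sum.distrib sum_distrib_right[symmetric] stoch[OF x])
        then show ?thesis using Pf[OF x] d by (simp add: distrib_left)
      qed
      moreover have "nonconst (\<lambda>x. f x + d)" using nc by (simp add: nonconst_def)
      ultimately show ?thesis unfolding eig_def by blast
    qed
  next
    assume "eig m"
    then obtain g where g: "nonconst g" "\<And>x. x \<in> S ==> app g x = m * g x" unfolding eig_def by blast
    define v where "v = Matrix.vec (N - 1) (\<lambda>i. g (st (Suc i)) - g (st 0))"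
    have v: "v \<in> carrier_vec (N - 1)" by (simp add: v_def)
    have "v ~= 0\<^sub>v (N - 1)"
    proof
      assume v0: "v = 0\<^sub>v (N - 1)"
      have "g (st i) = g (st 0)" if "i < N" for i
      proof (cases i)
        case (Suc j)
        then have "v $ j = 0" using v0 that by simp
        then show ?thesis using Suc that by (simp add: v_def)
      qed simp
      then show False using g(1) st_surj unfolding nonconst_def by metis
    qed
    moreover have "dm *\<^sub>v v = m \<cdot>\<^sub>v v"
    proof (rule eq_vecI)
      fix i assume "i < dim_vec (m \<cdot>\<^sub>v v)"
      then have i: "i < N - 1" using v by simp
      let ?d = "\<lambda>k. P (st (Suc i)) (st k) - P (st 0) (st k)"
      have "(dm *\<^sub>v v) $ i = (\<Sum>j<N - 1. ?d (Suc j) * (g (st (Suc j)) - g (st 0)))"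
        unfolding dmv[OF v i] by (intro sum.cong refl) (simp add: v_def)
      also have "... = (\<Sum>k<N. ?d k * (g (st k) - g (st 0)))" by (subst split) simp
      also have "... = (app g (st (Suc i)) - app g (st 0)) - ((\<Sum>k<N. P (st (Suc i)) (st k)) - (\<Sum>k<N. P (st 0) (st k))) * g (st 0)"
        unfolding appst by (simp add: algebra_simps sum.distrib sum_subtractf sum_distrib_left)
      also have "... = m * g (st (Suc i)) - m * g (st 0)"
        using g(2)[OF st_in, of "Suc i"] g(2)[OF st_in[OF N0]] stoch[OF st_in, of "Suc i"] stoch[OF st_in[OF N0]] i
        by (simp add: sum_st)
      also have "... = (m \<cdot>\<^sub>v v) $ i" using i by (simp add: v_def right_diff_distrib)
      finally show "(dm *\<^sub>v v) $ i = (m \<cdot>\<^sub>v v) $ i" .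
    qed (use v dm_carrier in auto)
    ultimately have "eigenvalue dm m" unfolding eigenvalue_def eigenvector_def using v dm_carrier by auto
    then show "poly (char_poly dm) m = 0" using eigenvalue_root_char_poly[OF dm_carrier] by simp
  qed
qed

text \<open>All values are at most 1, so the split-off eigenvalue 1 can be placed first in the
  descending list and index 1 holds the maximum over \<open>eig\<close>. The last entry lies between
  0 and that maximum.\<close>

lemma gap_eq_Max:
  shows "finite {m. eig m}" "{m. eig m} ~= {}" "finite_spectral_gap S P = 1 - Max {m. eig m}"
proof -
  have dmon: "degree (char_poly dm) = N - 1 \<and> coeff (char_poly dm) (N - 1) = 1"
    by (rule degree_monic_char_poly[OF dm_carrier])
  have tmon: "degree (char_poly tm) = N \<and> coeff (char_poly tm) N = 1"
    by (rule degree_monic_char_poly[OF tm_carrier])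
  have d0: "char_poly dm ~= 0" using dmon by auto
  have t0: "char_poly tm ~= 0" using tmon by auto
  define M where "M = proots (char_poly dm)"
  have pt: "proots (char_poly tm) = add_mset 1 M"
    unfolding char_poly_tm M_def by (subst proots_mult) (use d0 in auto)
  have "size (proots (char_poly tm)) = N"
    using size_proots_real_roots[OF t0 complex_roots_real] tmon by simp
  then have sM: "size M = N - 1" unfolding pt by simp
  have set: "set_mset M = {m. eig m}" unfolding M_def using d0 dm_root_iff by simp
  show fin': "finite {m. eig m}" unfolding set[symmetric] by simp
  have "M ~= {#}" using sM card by auto
  then show ne: "{m. eig m} ~= {}" unfolding set[symmetric] by simp
  define l where "l = sorted_list_of_multiset M"
  have l: "sorted l" "mset l = M" "set l = {m. eig m}" "length l = N - 1"
    using sM set unfolding l_def by (auto simp flip: size_mset)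
  have "sorted_list_of_multiset (add_mset 1 M) = l @ [1]"
  proof -
    have "sorted (l @ [1])" using l eig_range(2) by (auto simp: sorted_append)
    then have "sorted_list_of_multiset (mset (l @ [1])) = l @ [1]"
      unfolding sorted_list_of_multiset_mset by (rule sorted_sort_id)
    then show ?thesis using l by simp
  qed
  then have L: "eigenvalue_list S P = 1 # rev l"
    unfolding eigenvalue_list_def tm_def[symmetric] pt by simp
  have lne: "l ~= []" using l ne by auto
  have "last l = Max (set l)"
  proof (rule Max_eqI[symmetric])
    fix y assume "y \<in> set l"
    then obtain i where i: "i < length l" "y = l ! i" by (auto simp: in_set_conv_nth)
    then have "l ! i <= l ! (length l - 1)" using l(1) by (intro sorted_nth_mono) auto
    then show "y <= last l" using i lne by (simp add: last_conv_nth)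
  qed (use lne in auto)
  then have L1: "eigenvalue_list S P ! 1 = Max {m. eig m}"
    unfolding L using lne l(3) by (simp add: nth_Cons' hd_rev[symmetric] hd_conv_nth)
  have "eigenvalue_list S P ! (N - 1) \<in> {m. eig m}"
  proof -
    have "eigenvalue_list S P ! (N - 1) = rev l ! (N - 1 - 1)" unfolding L using card by (simp add: nth_Cons')
    also have "... \<in> set (rev l)" using l(4) lne card by (intro nth_mem) auto
    finally show ?thesis using l(3) by simp
  qed
  then have "\<bar>eigenvalue_list S P ! (N - 1)\<bar> <= Max {m. eig m}"
    using eig_range(1) Max_ge[OF fin'] by auto
  then show "finite_spectral_gap S P = 1 - Max {m. eig m}"
    unfolding finite_spectral_gap_def L1 by (simp add: max_def)
qed

text \<open>The supremum of the Rayleigh quotient over mean zero functions is attained by compactness,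
  and a maximiser is an eigenfunction.\<close>

lemma rayleigh_eig:
  obtains m where "eig m" "\<And>f. ip (\<lambda>_. 1) f = 0 ==> ip f (app f) <= m * ip f f"
proof -
  define B where "B = 1 + (\<Sum>x\<in>S. 1 / \<pi> x)"
  have pB: "1 / \<pi> x <= B" "1 <= B" if "x \<in> S" for x
  proof -
    have "1 / \<pi> x <= (\<Sum>x\<in>S. 1 / \<pi> x)" by (rule member_le_sum) (use that fin pos in \<open>auto intro: less_imp_le\<close>)
    moreover have "0 <= 1 / \<pi> x" using pos[OF that] by simp
    moreover have "0 <= (\<Sum>x\<in>S. 1 / \<pi> x)" using pos by (intro sum_nonneg) (simp add: less_imp_le)
    ultimately show "1 / \<pi> x <= B" "1 <= B" by (auto simp: B_def)
  qed
  \<comment> \<open>Functions are defined on the whole type, so coordinates outside \<open>S\<close>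
    are pinned to zero; on \<open>S\<close> the normalisation bounds the square of a value by
    \<open>1 / \<pi> x\<close>. The set is then compact in the product topology.\<close>
  define K where "K = (\<Pi>\<^sub>E x\<in>(UNIV::'s set). if x \<in> S then {- B..B} else {0::real})"
  define X where "X = K \<inter> {f. ip (\<lambda>_. 1) f = 0} \<inter> {f. ip f f = 1}"
  have "compactin (product_topology (\<lambda>_. euclidean) UNIV) K"
    unfolding K_def by (subst compactin_PiE) auto
  then have K: "compact K" by (simp add: euclidean_product_topology)
  have c1: "continuous_on UNIV (\<lambda>f. ip (\<lambda>_. 1) f)" and c2: "continuous_on UNIV (\<lambda>f. ip f f)"
    and c3: "continuous_on UNIV (\<lambda>f. ip f (app f))"
    unfolding ip_def app_def by (intro continuous_intros continuous_on_product_coordinates)+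
  have "closed {f. ip (\<lambda>_. 1) f = 0}" "closed {f. ip f f = 1}"
    using c1 c2 by (auto intro!: closed_Collect_eq continuous_on_const)
  then have X: "compact X" unfolding X_def by (intro compact_Int_closed K)
  have norm: "\<exists>f'\<in>X. \<exists>c>0. ip f (app f) = c * ip f' (app f') \<and> ip f f = c"
    if f: "ip (\<lambda>_. 1) f = 0" "ip f f > 0" for f
  proof -
    define s where "s = sqrt (ip f f)"
    have s: "s > 0" "s * s = ip f f" using f by (auto simp: s_def)
    define f' where "f' x = (if x \<in> S then f x / s else 0)" for x
    have i1: "ip (\<lambda>_. 1) f' = ip (\<lambda>_. 1) f / s" unfolding ip_def f'_def by (simp add: sum_divide_distrib)
    have i2: "ip f' f' = ip f f / (s * s)" unfolding ip_def f'_def by (simp add: sum_divide_distrib)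
    have "app f' x = app f x / s" for x unfolding app_def f'_def by (simp add: sum_divide_distrib)
    then have i3: "ip f' (app f') = ip f (app f) / (s * s)" unfolding ip_def by (simp add: f'_def sum_divide_distrib)
    have "f' \<in> K"
    proof -
      have "\<bar>f' x\<bar> <= B" if x: "x \<in> S" for x
      proof -
        have "\<pi> x * (f' x * f' x) <= ip f' f'"
          unfolding ip_def by (rule member_le_sum[of x S "\<lambda>x. \<pi> x * (f' x * f' x)"]) (use x fin mult_nonneg_nonneg[OF less_imp_le[OF pos] zero_le_square] in auto)
        then have "\<pi> x * (f' x * f' x) <= 1" using i2 s f by simp
        then have "f' x * f' x <= 1 / \<pi> x" using pos[OF x] by (simp add: field_simps)
        then have "f' x * f' x <= B" using pB[OF x] by linarith
        moreover have "B <= B * B" using pB(2)[OF x] mult_left_mono[of 1 B B] by simp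
        ultimately have "(f' x)\<^sup>2 <= B\<^sup>2" unfolding power2_eq_square by linarith
        then show ?thesis using pB(2)[OF x] abs_le_square_iff[of "f' x" B] by simp
      qed
      note bd = this
      show ?thesis unfolding K_def
      proof (rule PiE_I)
        fix x show "f' x \<in> (if x \<in> S then {- B..B} else {0})"
          using bd[of x] by (cases "x \<in> S") (simp_all add: abs_le_iff, simp add: f'_def)
      qed simp
    qed
    then have "f' \<in> X" unfolding X_def using i1 i2 s f by simp
    then show ?thesis using i3 s f by (intro bexI[of _ f'] exI[of _ "ip f f"]) auto
  qed
  have "X ~= {}"
  proof -
    have "\<not> S \<subseteq> {st 0}" using card card_mono[of "{st 0}" S] by auto
    then obtain y where y: "y \<in> S" "y ~= st 0" by blast
    define f where "f x = of_bool (x = y) - \<pi> y" for x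
    have "ip (\<lambda>_. 1) f = (\<Sum>x\<in>S. (if x = y then \<pi> x else 0) - \<pi> x * \<pi> y)"
      unfolding ip_def f_def by (intro sum.cong refl) (auto simp: algebra_simps)
    also have "... = 0" using y fin total by (simp add: sum_subtractf sum_distrib_right[symmetric])
    finally have f0: "ip (\<lambda>_. 1) f = 0" .
    have "f (st 0) ~= 0" using y pos[OF y(1)] by (simp add: f_def)
    then have "ip f f > 0" using card by (intro ip_pos[of "st 0"] st_in) auto
    from norm[OF f0 this] show ?thesis by blast
  qed
  then obtain h where h: "h \<in> X" "\<And>f. f \<in> X ==> ip f (app f) <= ip h (app h)"
    using continuous_attains_sup[OF X _ continuous_on_subset[OF c3]] by auto
  define m where "m = ip h (app h)"
  have h0: "ip (\<lambda>_. 1) h = 0" "ip h h = 1" using h(1) by (auto simp: X_def)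
  have ray: "ip f (app f) <= m * ip f f" if f: "ip (\<lambda>_. 1) f = 0" for f
  proof (cases "ip f f > 0")
    case True
    from norm[OF f True] obtain f' c where "f' \<in> X" "c > 0" "ip f (app f) = c * ip f' (app f')" "ip f f = c" by blast
    then show ?thesis using h(2)[of f'] by (simp add: m_def mult.commute)
  next
    case False
    then have "f x = 0" if "x \<in> S" for x using ip_pos[OF that] by blast
    then have "ip f (app f) = 0" "ip f f = 0" by (auto simp: ip_def)
    then show ?thesis by simp
  qed
  let ?k = "\<lambda>(f :: 's => real) t g x. f x + t * g x"
  have lin: "ip (?k f t g) (app (?k f t g)) = ip f (app f) + 2 * t * ip g (app f) + t\<^sup>2 * ip g (app g)"
    "ip (?k f t g) (?k f t g) = ip f f + 2 * t * ip g f + t\<^sup>2 * ip g g"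
    "ip (\<lambda>_. 1) (?k f t g) = ip (\<lambda>_. 1) f + t * ip (\<lambda>_. 1) g" for f g t
  proof -
    have a: "app (?k f t g) x = app f x + t * app g x" for x
      unfolding app_def by (simp add: distrib_left sum.distrib sum_distrib_left mult_ac)
    have "ip (?k f t g) (app (?k f t g)) = ip f (app f) + t * ip f (app g) + t * ip g (app f) + t\<^sup>2 * ip g (app g)"
      unfolding ip_def a by (simp add: algebra_simps sum.distrib sum_distrib_left power2_eq_square)
    then show "ip (?k f t g) (app (?k f t g)) = ip f (app f) + 2 * t * ip g (app f) + t\<^sup>2 * ip g (app g)"
      using ip_app_sym[of f g] by simp
    have "ip (?k f t g) (?k f t g) = ip f f + t * ip f g + t * ip g f + t\<^sup>2 * ip g g"
      unfolding ip_def by (simp add: algebra_simps sum.distrib sum_distrib_left power2_eq_square)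
    then show "ip (?k f t g) (?k f t g) = ip f f + 2 * t * ip g f + t\<^sup>2 * ip g g"
      using ip_commute[of f g] by simp
    show "ip (\<lambda>_. 1) (?k f t g) = ip (\<lambda>_. 1) f + t * ip (\<lambda>_. 1) g"
      unfolding ip_def by (simp add: algebra_simps sum.distrib sum_distrib_left)
  qed
  text \<open>The first variation at the maximiser, in the direction \<open>app h - m * h\<close>.\<close>
  define g where "g x = app h x - m * h x" for x
  have g0: "ip (\<lambda>_. 1) g = 0"
    using lin(3)[of "app h" "- m" h] ip_app_one[of h] h0 by (simp add: g_def[abs_def])
  have gg: "ip g (app h) - m * ip g h = ip g g"
    unfolding ip_def g_def by (simp add: algebra_simps sum_subtractf sum_distrib_left sum.distrib)
  have var: "2 * t * ip g g <= t\<^sup>2 * (m * ip g g)" for t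
  proof -
    have "ip (?k h t g) (app (?k h t g)) <= m * ip (?k h t g) (?k h t g)"
      by (rule ray) (simp add: lin(3) h0 g0)
    then have "m + 2 * t * ip g (app h) + t\<^sup>2 * ip g (app g) <= m * (1 + 2 * t * ip g h + t\<^sup>2 * ip g g)"
      unfolding lin h0 by (simp add: m_def)
    moreover have "0 <= t\<^sup>2 * ip g (app g)" by (intro mult_nonneg_nonneg ip_app_nonneg) simp
    moreover have "2 * t * ip g g = 2 * t * ip g (app h) - m * (2 * t * ip g h)"
      unfolding gg[symmetric] by (simp add: algebra_simps)
    ultimately show ?thesis by (simp add: algebra_simps)
  qed
  have "ip g g = 0"
  proof (rule ccontr)
    assume "ip g g ~= 0"
    moreover have "ip g g >= 0" by (rule ip_nonneg)
    ultimately have p: "ip g g > 0" by simp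
    have m0: "m >= 0" unfolding m_def by (rule ip_app_nonneg)
    \<comment> \<open>So small that the quadratic term \<open>t * m\<close> stays below 1; the
      linear term, proportional to \<open>ip g g\<close>, would then violate the maximality of
      \<open>h\<close>.\<close>
    define t where "t = 1 / (1 + m)"
    have t: "t > 0" "t * m < 1" using m0 by (auto simp: t_def field_simps)
    have "2 * t * ip g g <= (t * m) * (t * ip g g)" using var[of t] by (simp add: power2_eq_square mult_ac)
    also have "... <= 1 * (t * ip g g)" using t p by (intro mult_right_mono) auto
    finally show False using t p by simp
  qed
  then have "g x = 0" if "x \<in> S" for x using ip_pos[OF that, of g] by auto
  then have eh: "app h x = m * h x" if "x \<in> S" for x using that by (simp add: g_def)
  have "nonconst h"
  proof (rule ccontr)
    assume "\<not> nonconst h"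
    then have c: "h x = h (st 0)" if "x \<in> S" for x
    proof -
      have "st 0 \<in> S" using st_in[of 0] card by simp
      then show ?thesis using \<open>\<not> nonconst h\<close> that unfolding nonconst_def by blast
    qed
    have "ip (\<lambda>_. 1) h = (\<Sum>x\<in>S. \<pi> x * h (st 0))" unfolding ip_def by (intro sum.cong refl) (simp add: c)
    then have "h (st 0) = 0" using h0 total by (simp add: sum_distrib_right[symmetric])
    then have "ip h h = 0" unfolding ip_def using c by simp
    then show False using h0 by simp
  qed
  then have "eig m" unfolding eig_def using eh by blast
  then show thesis using ray by (rule that)
qed

theorem spectral_gap_characterisation:
  obtains lam where "finite_spectral_gap S P = 1 - lam" "0 <= lam" "eig lam"
    "\<And>f. ip (\<lambda>_. 1) f = 0 ==> ip f (app f) <= lam * ip f f"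
proof
  let ?lam = "Max {m. eig m}"
  show "finite_spectral_gap S P = 1 - ?lam" by (rule gap_eq_Max)
  have "?lam \<in> {m. eig m}" by (rule Max_in[OF gap_eq_Max(1,2)])
  then show e: "eig ?lam" by simp
  show "0 <= ?lam" by (rule eig_range(1)[OF e])
  obtain m where m: "eig m" "\<And>f. ip (\<lambda>_. 1) f = 0 ==> ip f (app f) <= m * ip f f" by (rule rayleigh_eig) (rule that)
  fix f assume f: "ip (\<lambda>_. 1) f = 0"
  have "m <= ?lam" by (rule Max_ge[OF gap_eq_Max(1)]) (use m(1) in simp)
  moreover have "0 <= ip f f" by (rule ip_nonneg)
  ultimately have "m * ip f f <= ?lam * ip f f" by (rule mult_right_mono)
  then show "ip f (app f) <= ?lam * ip f f" using m(2)[OF f] by linarith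
qed

end

context fin_sw_graph
begin

lemma sets_sps: "sets sps = Pow cfg"
proof -
  have "sps = count_space cfg"
    unfolding spin_space_def by (rule count_space_PiM_finite) (use finite_V in auto)
  then show ?thesis by simp
qed

lemma sw_op_measure: "sw_op f s = (\<Sum>t\<in>cfg. measure (sw s) {t} * f t)"
proof -
  have "sw_op f s = sw_op (\<lambda>t. \<Sum>r\<in>cfg. f r * indicator {r} t) s"
  proof (rule sw_op_cong)
    fix t assume t: "t \<in> cfg"
    have "(\<Sum>r\<in>cfg. f r * indicator {r} t) = (\<Sum>r\<in>cfg. if r = t then f r else 0)"
      by (intro sum.cong refl) (simp add: indicator_def)
    then show "f t = (\<Sum>r\<in>cfg. f r * indicator {r} t)" using t finite_cfg by simp
  qed
  also have "... = (\<Sum>r\<in>cfg. f r * sw_op (indicator {r}) s)" by (rule sw_op_sum)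
  also have "... = (\<Sum>t\<in>cfg. measure (sw s) {t} * f t)"
  proof (intro sum.cong refl)
    fix t assume "t \<in> cfg"
    then have "{t} \<in> sets (sw s)" by (simp add: sets_sw sets_sps)
    then show "f t * sw_op (indicator {t}) s = measure (sw s) {t} * f t" by simp
  qed
  finally show ?thesis .
qed

theorem sw_gap_characterisation:
  assumes "V ~= {}"
  obtains lam where "finite_spectral_gap cfg (\<lambda>s t. measure (sw s) {t}) = 1 - lam" "0 <= lam"
    "\<exists>f. (\<exists>s\<in>cfg. \<exists>t\<in>cfg. f s ~= f t) \<and> (\<forall>s\<in>cfg. sw_op f s = lam * f s)"
    "\<And>f. gcov f (\<lambda>s. sw_op f s) <= lam * gcov f f"
proof -
  let ?P = "\<lambda>s t. measure (sw s) {t}" and ?\<pi> = "\<lambda>s. gibbs_weight s / partition_fn"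
  have gm: "gmean f = (\<Sum>s\<in>cfg. ?\<pi> s * f s)" for f
    by (simp add: gmean_def sum_divide_distrib)
  have form: "(\<Sum>s\<in>cfg. \<Sum>t\<in>cfg. ?\<pi> s * ?P s t * f s * g t) = gmean (\<lambda>s. f s * sw_op g s)" for f g
    unfolding gm sw_op_measure by (simp add: sum_distrib_left mult_ac)
  interpret C: rev_chain cfg ?P ?\<pi>
  proof
    show "finite cfg" by (rule finite_cfg)
    have "2 ^ 1 <= q ^ card V"
    proof -
      have "1 <= card V" using assms finite_V by (simp add: Suc_leI card_gt_0_iff One_nat_def)
      then have "(2::nat) ^ 1 <= 2 ^ card V" by (intro power_increasing) auto
      also have "... <= q ^ card V" using q2 by (intro power_mono) auto
      finally show ?thesis .
    qed
    then show "2 <= card cfg" using finite_V by (simp add: card_PiE)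
    show "0 < ?\<pi> s" for s using gibbs_weight_pos partition_fn_pos by simp
    show "(\<Sum>s\<in>cfg. ?\<pi> s) = 1" using gm[of "\<lambda>_. 1"] by simp
    show "(\<Sum>t\<in>cfg. ?P s t) = 1" for s using sw_op_measure[where f = "\<lambda>_. 1"] by simp
    show "?\<pi> s * ?P s t = ?\<pi> t * ?P t s" if st: "s \<in> cfg" "t \<in> cfg" for s t
    proof -
      let ?I = "\<lambda>r s. of_bool (s = r) :: real"
      have e: "gmean (\<lambda>s'. ?I r s' * sw_op (?I r') s') = ?\<pi> r * ?P r r'" if "r \<in> cfg" "r' \<in> cfg" for r r'
      proof -
        have "sw_op (?I r') s' = ?P s' r'" for s'
        proof -
          have "sw_op (?I r') s' = (\<Sum>t\<in>cfg. if t = r' then ?P s' t else 0)"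
            unfolding sw_op_measure by (intro sum.cong refl) simp
          then show ?thesis using that finite_cfg by simp
        qed
        then have "gmean (\<lambda>s'. ?I r s' * sw_op (?I r') s') = (\<Sum>s'\<in>cfg. if s' = r then ?\<pi> s' * ?P s' r' else 0)"
          unfolding gm by (intro sum.cong refl) simp
        then show ?thesis using that finite_cfg by simp
      qed
      have "gmean (\<lambda>s'. ?I s s' * sw_op (?I t) s') = gmean (\<lambda>s'. ?I t s' * sw_op (?I s) s')"
        by (subst sw_op_selfadjoint) (simp add: mult.commute)
      then show ?thesis unfolding e[OF st] e[OF st(2,1)] .
    qed
    show "0 <= (\<Sum>s\<in>cfg. \<Sum>t\<in>cfg. ?\<pi> s * ?P s t * f s * f t)" for f
      unfolding form by (rule sw_op_nonneg)
  qed simp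
  have app: "C.app f s = sw_op f s" for f s unfolding C.app_def sw_op_measure ..
  have ip: "C.ip f g = gmean (\<lambda>s. f s * g s)" for f g unfolding C.ip_def gm ..
  obtain lam where lam: "finite_spectral_gap cfg ?P = 1 - lam" "0 <= lam" "C.eig lam"
    "\<And>f. C.ip (\<lambda>_. 1) f = 0 ==> C.ip f (C.app f) <= lam * C.ip f f"
    by (rule C.spectral_gap_characterisation) (rule that)
  show thesis
  proof (rule that[OF lam(1,2)])
    show "\<exists>f. (\<exists>s\<in>cfg. \<exists>t\<in>cfg. f s ~= f t) \<and> (\<forall>s\<in>cfg. sw_op f s = lam * f s)"
      using lam(3) unfolding C.eig_def C.nonconst_def app .
    fix f
    let ?m = "gmean f"
    let ?h = "\<lambda>s. f s - ?m"
    have h: "sw_op ?h s = sw_op f s - ?m" for s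
      by (subst Bochner_Integration.integral_diff) (auto intro: sw_integrable)
    have 0: "C.ip (\<lambda>_. 1) ?h = 0" unfolding ip by (simp add: gmean_diff)
    have 1: "C.ip ?h (C.app ?h) = gcov f (\<lambda>s. sw_op f s)"
    proof -
      have "gmean (\<lambda>s. ?h s * (sw_op f s - ?m)) = gmean (\<lambda>s. f s * sw_op f s) - ?m * gmean f - (?m * gmean (\<lambda>s. sw_op f s) - ?m * ?m)"
      proof -
        have "gmean (\<lambda>s. ?h s * (sw_op f s - ?m)) = gmean (\<lambda>s. (f s * sw_op f s - ?m * f s) - (?m * sw_op f s - ?m * ?m))"
          by (rule gmean_cong) (simp add: algebra_simps)
        then show ?thesis by (simp only: gmean_diff gmean_cmult gmean_const)
      qed
      then show ?thesis unfolding ip app h gcov_def by (simp add: gmean_sw)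
    qed
    have 2: "C.ip ?h ?h = gcov f f" unfolding ip gcov_self by (simp add: power2_eq_square)
    show "gcov f (\<lambda>s. sw_op f s) <= lam * gcov f f" using lam(4)[OF 0] unfolding 1 2 .
  qed
qed

end

subsection \<open>Torus and lattice\<close>

text \<open>The covering map from the lattice to the torus, translated so that the origin lands on
  the base point \<open>a\<close>.\<close>

definition tproj :: "nat => nat => (nat => int) => (nat => int) => nat => int" where
  "tproj d n a x = (\<lambda>i\<in>{..<d}. (x i + a i) mod int n)"

definition box :: "nat => nat => (nat => int) set" where
  "box d r = {..<d} \<rightarrow>\<^sub>E {- int r..int r}"

definition edge_box :: "nat => nat => (nat => int) set set" where
  "edge_box d r = {e \<in> lattice_edges d. e \<subseteq> box d r}"

lemma finite_box: "finite (box d r)"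
  unfolding box_def by (intro finite_PiE) auto

lemma box_mono: "r <= s ==> box d r \<subseteq> box d s"
  unfolding box_def by (intro PiE_mono) auto

lemma box_sub: "box d r \<subseteq> lattice_verts d"
  unfolding box_def lattice_verts_def by (intro PiE_mono) auto

lemma box_coord: "x \<in> box d r ==> i < d ==> x i \<in> {- int r..int r}"
  using PiE_mem[of x "{..<d}" "\<lambda>_. {- int r..int r}" i] unfolding box_def by simp

lemma torus_coord: "x \<in> torus_verts d n ==> i < d ==> x i \<in> {0..<int n}"
  using PiE_mem[of x "{..<d}" "\<lambda>_. {0..<int n}" i] unfolding torus_verts_def by simp

lemma finite_edge_box: "finite (edge_box d r)"
  unfolding edge_box_def by (rule finite_subset[of _ "Pow (box d r)"]) (auto simp: finite_box)

lemma edge_box_sub: "edge_box d r \<subseteq> lattice_edges d"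
  by (auto simp: edge_box_def)

lemma edge_box_mono: "r <= s ==> edge_box d r \<subseteq> edge_box d s"
  using box_mono by (force simp: edge_box_def)

lemma lattice_upd: "x \<in> lattice_verts d ==> i < d ==> x(i := c) \<in> lattice_verts d"
  by (auto simp: lattice_verts_def PiE_def extensional_def)

lemma lattice_edgeE:
  assumes "{x, y} \<in> lattice_edges d" "x \<in> lattice_verts d"
  obtains i s where "i < d" "s = 1 \<or> s = - 1" "y = x(i := x i + s)"
proof -
  obtain z i where z: "{x, y} = {z, z(i := z i + 1)}" "z \<in> lattice_verts d" "i < d"
    using assms(1) unfolding lattice_edges_def by blast
  then consider "x = z" "y = z(i := z i + 1)" | "x = z(i := z i + 1)" "y = z" by (auto simp: doubleton_eq_iff)
  then show thesis
  proof cases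
    case 1
    then show ?thesis using z by (intro that[of i 1]) auto
  next
    case 2
    then show ?thesis using z by (intro that[of i "- 1"]) auto
  qed
qed

lemma lattice_edgeI:
  assumes "x \<in> lattice_verts d" "i < d" "s = 1 \<or> s = - 1"
  shows "{x, x(i := x i + s)} \<in> lattice_edges d"
  using assms(3)
proof
  assume "s = 1"
  then show ?thesis using assms unfolding lattice_edges_def by blast
next
  assume s: "s = - 1"
  let ?z = "x(i := x i + s)"
  have "{x, ?z} = {?z, ?z(i := ?z i + 1)}" using s by auto
  moreover have "?z \<in> lattice_verts d" by (rule lattice_upd) fact+
  ultimately show ?thesis using assms(2) unfolding lattice_edges_def by blast
qed

lemma lattice_edge_ends:
  assumes "e \<in> lattice_edges d"
  shows "\<exists>u\<in>lattice_verts d. \<exists>v\<in>lattice_verts d. u ~= v \<and> e = {u, v}"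
proof -
  obtain x i where x: "e = {x, x(i := x i + 1)}" "x \<in> lattice_verts d" "i < d"
    using assms unfolding lattice_edges_def by blast
  have "x ~= x(i := x i + 1)" by (auto simp: fun_eq_iff)
  then show ?thesis using x lattice_upd by blast
qed

lemma card_signed_dirs: "card ({..<d} \<times> {1, - 1 :: int}) = 2 * d"
  by (simp add: card_cartesian_product)

lemma lattice_degree:
  assumes "v \<in> lattice_verts d"
  shows "finite {e \<in> lattice_edges d. v \<in> e} \<and> card {e \<in> lattice_edges d. v \<in> e} <= 2 * d"
proof -
  let ?f = "\<lambda>(i, s). {v, v(i := v i + s)}"
  have sub: "{e \<in> lattice_edges d. v \<in> e} \<subseteq> ?f ` ({..<d} \<times> {1, - 1})"
  proof
    fix e assume e: "e \<in> {e \<in> lattice_edges d. v \<in> e}"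
    then have eE: "e \<in> lattice_edges d" "v \<in> e" by auto
    obtain y where y: "e = {v, y}" using lattice_edge_ends[OF eE(1)] eE(2) by blast
    obtain i s where "i < d" "s = 1 \<or> s = - 1" "y = v(i := v i + s)"
      by (rule lattice_edgeE[OF eE(1)[unfolded y] assms]) (rule that)
    then show "e \<in> ?f ` ({..<d} \<times> {1, - 1})" unfolding y by (intro image_eqI[of _ _ "(i, s)"]) auto
  qed
  have fin: "finite (?f ` ({..<d} \<times> {1, - 1}))" by simp
  have "card (?f ` ({..<d} \<times> {1, - 1})) <= 2 * d"
    using card_image_le[of "{..<d} \<times> {1, - 1}" ?f] card_signed_dirs[of d] by simp
  then show ?thesis using finite_subset[OF sub fin] card_mono[OF fin sub] by linarith
qed

section \<open>The covering of the torus by the lattice, and torus distances\<close>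

lemma tproj_torus: "n > 0 ==> tproj d n a x \<in> torus_verts d n"
  by (auto simp: tproj_def torus_verts_def)

lemma tproj_upd:
  assumes "i < d"
  shows "tproj d n a (x(i := x i + s)) = (tproj d n a x)(i := (tproj d n a x i + s) mod int n)"
  using assms by (auto simp: tproj_def fun_eq_iff mod_simps algebra_simps)

lemma torus_upd:
  assumes "z \<in> torus_verts d n" "i < d" "n > 0"
  shows "z(i := c mod int n) \<in> torus_verts d n"
  using assms by (auto simp: torus_verts_def PiE_def extensional_def)

lemma torus_edgeE:
  assumes "{x, y} \<in> torus_edges d n" "x \<in> torus_verts d n" and n: "n > 0"
  obtains i s where "i < d" "s = 1 \<or> s = - 1" "y = x(i := (x i + s) mod int n)"
proof -
  obtain z i where z: "{x, y} = {z, z(i := (z i + 1) mod int n)}" "z \<in> torus_verts d n" "i < d"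
    using assms(1) unfolding torus_edges_def by blast
  then consider "x = z" "y = z(i := (z i + 1) mod int n)" | "x = z(i := (z i + 1) mod int n)" "y = z"
    by (auto simp: doubleton_eq_iff)
  then show thesis
  proof cases
    case 1
    then show ?thesis using z by (intro that[of i 1]) auto
  next
    case 2
    have zi: "z i \<in> {0..<int n}" using z torus_coord by blast
    have "((z i + 1) mod int n + - 1) mod int n = (z i + 1 - 1) mod int n"
      by (metis mod_diff_left_eq uminus_add_conv_diff add.commute)
    then have "((z i + 1) mod int n + - 1) mod int n = z i" using zi by simp
    then show ?thesis using z 2 by (intro that[of i "- 1"]) (auto simp: fun_eq_iff)
  qed
qed

lemma tproj_edge:
  assumes "e \<in> lattice_edges d" "n > 0"
  shows "tproj d n a ` e \<in> torus_edges d n"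
proof -
  obtain x i where x: "e = {x, x(i := x i + 1)}" "x \<in> lattice_verts d" "i < d"
    using assms unfolding lattice_edges_def by blast
  have "tproj d n a ` e = {tproj d n a x, (tproj d n a x)(i := (tproj d n a x i + 1) mod int n)}"
    unfolding x(1) using tproj_upd[OF x(3), of n a x 1] by simp
  then show ?thesis using x tproj_torus[OF assms(2)] unfolding torus_edges_def by blast
qed

lemma box_step:
  assumes "x \<in> box d r" "i < d" "s = 1 \<or> s = - 1"
  shows "x(i := x i + s) \<in> box d (r + 1)"
proof -
  have b: "x j \<in> {- int r..int r}" if "j < d" for j by (rule box_coord[OF assms(1) that])
  have "x(i := x i + s) \<in> extensional {..<d}"
    using lattice_upd[OF subsetD[OF box_sub assms(1)] assms(2)] by (auto simp: lattice_verts_def PiE_def)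
  moreover have "(x(i := x i + s)) j \<in> {- int (r + 1)..int (r + 1)}" if "j < d" for j
    using b[OF that] assms(3) by (cases "j = i") auto
  ultimately show ?thesis unfolding box_def by (intro PiE_I) (auto simp: extensional_def)
qed

text \<open>Edges lift along the covering from any chosen preimage of an endpoint, and the lift
  leaves a box by at most one unit.\<close>

lemma tproj_lift:
  assumes e: "{tproj d n a x, y} \<in> torus_edges d n" and x: "x \<in> lattice_verts d" and n: "n > 0"
  obtains y' where "tproj d n a y' = y" "{x, y'} \<in> lattice_edges d" "\<And>r. x \<in> box d r ==> y' \<in> box d (r + 1)"
proof -
  have "\<exists>i s. i < d \<and> (s = 1 \<or> s = - 1) \<and> y = (tproj d n a x)(i := (tproj d n a x i + s) mod int n)"
    using torus_edgeE[OF e tproj_torus[OF n] n] by metis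
  then obtain i s where s: "i < d" "s = 1 \<or> s = - 1" "y = (tproj d n a x)(i := (tproj d n a x i + s) mod int n)"
    by blast
  have y: "tproj d n a (x(i := x i + s)) = y" unfolding s(3) by (rule tproj_upd[OF s(1)])
  show thesis
    by (rule that[OF y lattice_edgeI[OF x s(1,2)] box_step[OF _ s(1,2)]])
qed

lemma tproj_inj:
  assumes "2 * r < n"
  shows "inj_on (tproj d n a) (box d r)"
proof (rule inj_onI)
  fix x y assume xy: "x \<in> box d r" "y \<in> box d r" and eq: "tproj d n a x = tproj d n a y"
  show "x = y"
  proof (rule PiE_ext[OF xy[unfolded box_def]])
    fix i assume i: "i \<in> {..<d}"
    have "(x i + a i) mod int n = (y i + a i) mod int n"
      using fun_cong[OF eq, of i] i by (simp add: tproj_def)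
    then have dv: "int n dvd (x i - y i)" by (simp add: mod_eq_dvd_iff)
    have "x i \<in> {- int r..int r}" "y i \<in> {- int r..int r}" using box_coord xy i by auto
    then have "\<bar>x i - y i\<bar> < int n" using assms by auto
    then have "x i - y i = 0" using dv dvd_imp_le_int[of "x i - y i" "int n"] by linarith
    then show "x i = y i" by simp
  qed
qed

lemma lattice_in_box:
  assumes "x \<in> lattice_verts d"
  shows "\<exists>r. x \<in> box d r"
proof -
  have "x \<in> box d (nat (\<Sum>i<d. \<bar>x i\<bar>))"
  proof -
    have "\<bar>x i\<bar> <= (\<Sum>i<d. \<bar>x i\<bar>)" if "i < d" for i
      by (rule member_le_sum) (use that in auto)
    moreover have "0 <= (\<Sum>i<d. \<bar>x i\<bar>)" by (rule sum_nonneg) simp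
    ultimately have "x i \<in> {- int (nat (\<Sum>i<d. \<bar>x i\<bar>))..int (nat (\<Sum>i<d. \<bar>x i\<bar>))}" if "i < d" for i
      using that by (auto simp: abs_le_iff intro: minus_le_iff[THEN iffD1])
    then show ?thesis using assms by (auto simp: box_def lattice_verts_def PiE_def)
  qed
  then show ?thesis ..
qed

lemma finite_sub_box:
  assumes "finite S" "S \<subseteq> lattice_verts d"
  shows "\<exists>r. S \<subseteq> box d r"
  using assms
proof (induction S rule: finite_induct)
  case (insert x S)
  then obtain r s where "S \<subseteq> box d r" "x \<in> box d s" using lattice_in_box[of x d] by auto
  then have "insert x S \<subseteq> box d (max r s)" using box_mono[of r "max r s" d] box_mono[of s "max r s" d] by auto
  then show ?case by blast
qed auto

lemma tproj_surj:
  assumes "y \<in> torus_verts d n"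
  shows "\<exists>x r. x \<in> box d r \<and> tproj d n a x = y"
proof -
  define x where "x = (\<lambda>i\<in>{..<d}. y i - a i)"
  have "x \<in> lattice_verts d" by (auto simp: x_def lattice_verts_def)
  moreover have "tproj d n a x i = y i" for i
    using torus_coord[OF assms, of i] PiE_arb[OF assms[unfolded torus_verts_def], of i]
    by (cases "i < d") (auto simp: tproj_def x_def)
  ultimately show ?thesis using lattice_in_box by blast
qed

text \<open>The distance of \<open>v\<close> from the base point \<open>a\<close> in the maximum
  norm, measured by the smallest box that contains a preimage.\<close>

definition torus_level :: "nat => nat => (nat => int) => (nat => int) => nat" where
  "torus_level d n a v = (LEAST k. \<exists>x\<in>box d k. tproj d n a x = v)"

lemma torus_level_le: "x \<in> box d k ==> torus_level d n a (tproj d n a x) <= k"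
  unfolding torus_level_def by (rule Least_le) blast

lemma torus_level_box:
  assumes "v \<in> torus_verts d n"
  shows "\<exists>x\<in>box d (torus_level d n a v). tproj d n a x = v"
  unfolding torus_level_def by (rule LeastI_ex) (use tproj_surj[OF assms] in blast)

lemma torus_level_step:
  assumes "{u, v} \<in> torus_edges d n" "u \<in> torus_verts d n" "n > 0"
  shows "torus_level d n a v <= torus_level d n a u + 1"
proof -
  obtain x where x: "x \<in> box d (torus_level d n a u)" "tproj d n a x = u" using torus_level_box[OF assms(2)] by blast
  have xl: "x \<in> lattice_verts d" using x(1) box_sub by blast
  obtain y' where "tproj d n a y' = v" "y' \<in> box d (torus_level d n a u + 1)"
    using tproj_lift[OF assms(1)[folded x(2)] xl assms(3)] x(1) by metis
  then show ?thesis using torus_level_le by blast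
qed

lemma torus_edge_near:
  assumes e: "{u, v} \<in> torus_edges d n" "u \<in> torus_verts d n" "n > 0" and k: "torus_level d n a u <= k"
  shows "{u, v} \<in> (`) (tproj d n a) ` edge_box d (k + 1)"
proof -
  obtain x where x: "x \<in> box d (torus_level d n a u)" "tproj d n a x = u" using torus_level_box[OF e(2)] by blast
  have xk: "x \<in> box d k" using x(1) box_mono[OF k] by blast
  have xl: "x \<in> lattice_verts d" using x(1) box_sub by blast
  obtain y' where y': "tproj d n a y' = v" "{x, y'} \<in> lattice_edges d" "y' \<in> box d (k + 1)"
    using tproj_lift[OF e(1)[folded x(2)] xl e(3)] xk by metis
  have "x \<in> box d (k + 1)" using xk box_mono[of k "k + 1" d] by auto
  then have "{x, y'} \<in> edge_box d (k + 1)" using y' by (simp add: edge_box_def)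
  moreover have "{u, v} = tproj d n a ` {x, y'}" using x y' by simp
  ultimately show ?thesis by blast
qed

lemma torus_edge_ends:
  assumes "e \<in> torus_edges d n" "n >= 2"
  shows "\<exists>u\<in>torus_verts d n. \<exists>v\<in>torus_verts d n. u ~= v \<and> e = {u, v}"
proof -
  obtain x i where x: "e = {x, x(i := (x i + 1) mod int n)}" "x \<in> torus_verts d n" "i < d"
    using assms unfolding torus_edges_def by blast
  have xi: "x i \<in> {0..<int n}" using x torus_coord by blast
  have "(x i + 1) mod int n ~= x i"
  proof
    assume "(x i + 1) mod int n = x i"
    then have "(x i + 1) mod int n = x i mod int n" using xi by simp
    then have "int n dvd 1" by (simp add: mod_eq_dvd_iff)
    then show False using assms(2) by simp
  qed
  then have "x ~= x(i := (x i + 1) mod int n)" by (auto simp: fun_eq_iff)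
  moreover have "x(i := (x i + 1) mod int n) \<in> torus_verts d n" using x assms(2) by (intro torus_upd) auto
  ultimately show ?thesis using x by blast
qed

lemma torus_degree:
  assumes "v \<in> torus_verts d n" "n >= 2"
  shows "finite {e \<in> torus_edges d n. v \<in> e} \<and> card {e \<in> torus_edges d n. v \<in> e} <= 2 * d"
proof -
  let ?f = "\<lambda>(i, s). {v, v(i := (v i + s) mod int n)}"
  have sub: "{e \<in> torus_edges d n. v \<in> e} \<subseteq> ?f ` ({..<d} \<times> {1, - 1})"
  proof
    fix e assume e: "e \<in> {e \<in> torus_edges d n. v \<in> e}"
    then have eE: "e \<in> torus_edges d n" "v \<in> e" by auto
    obtain y where y: "e = {v, y}" using torus_edge_ends[OF eE(1) assms(2)] eE(2) by blast
    obtain i s where "i < d" "s = 1 \<or> s = - 1" "y = v(i := (v i + s) mod int n)"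
      using torus_edgeE[OF eE(1)[unfolded y] assms(1)] assms(2) by (metis (no_types) gr0I not_numeral_le_zero)
    then show "e \<in> ?f ` ({..<d} \<times> {1, - 1})" unfolding y by (intro image_eqI[of _ _ "(i, s)"]) auto
  qed
  have fin: "finite (?f ` ({..<d} \<times> {1, - 1}))" by simp
  have "card (?f ` ({..<d} \<times> {1, - 1})) <= 2 * d"
    using card_image_le[of "{..<d} \<times> {1, - 1}" ?f] card_signed_dirs[of d] by simp
  then show ?thesis using finite_subset[OF sub fin] card_mono[OF fin sub] by linarith
qed

subsection \<open>Relabelling vertices\<close>

lemma conn_image:
  assumes inj: "inj_on h U" and F: "\<Union>F \<subseteq> U" and uv: "u \<in> U" "v \<in> U"
  shows "(h u, h v) \<in> conn ((`) h ` F) \<longleftrightarrow> (u, v) \<in> conn F"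
proof
  assume "(h u, h v) \<in> conn ((`) h ` F)"
  then have "\<exists>w\<in>U. h w = h v \<and> (u, w) \<in> conn F"
    unfolding conn_def
  proof (induction rule: rtrancl_induct)
    case base
    then show ?case using uv by auto
  next
    case (step y z)
    then obtain w where w: "w \<in> U" "h w = y" "(u, w) \<in> {(x, y). {x, y} \<in> F}\<^sup>*" by blast
    obtain e where e: "e \<in> F" "{y, z} = h ` e" using step by auto
    have eU: "e \<subseteq> U" using e(1) F by auto
    have "z \<in> h ` e" using e(2) by auto
    then obtain z' where z': "z' \<in> e" "z = h z'" by blast
    have "w \<in> e"
    proof -
      have "y \<in> h ` e" using e(2) by auto
      then obtain w' where "w' \<in> e" "y = h w'" by blast
      then show ?thesis using w inj eU by (metis inj_onD subsetD)
    qed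
    moreover have "x = w \<or> x = z'" if "x \<in> e" for x
    proof -
      have "h x \<in> {y, z}" using that e(2) by auto
      then show ?thesis using w z' inj eU that by (auto dest: inj_onD)
    qed
    ultimately have "e = {w, z'}" using z' by blast
    then have "(w, z') \<in> {(x, y). {x, y} \<in> F}" using e by simp
    then have "(u, z') \<in> {(x, y). {x, y} \<in> F}\<^sup>*" using w(3) by (rule rtrancl_into_rtrancl[rotated])
    then show ?case using z' eU by blast
  qed
  then show "(u, v) \<in> conn F" using inj uv by (metis inj_onD)
next
  assume "(u, v) \<in> conn F"
  then show "(h u, h v) \<in> conn ((`) h ` F)"
    unfolding conn_def
  proof (induction rule: rtrancl_induct)
    case (step y z)
    then have "{h y, h z} \<in> (`) h ` F" by (auto intro!: image_eqI[of _ _ "{y, z}"])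
    then show ?case using step by (auto intro: rtrancl_into_rtrancl)
  qed simp
qed

lemma PiE_relabel:
  assumes inj: "inj_on h S"
  shows "bij_betw (\<lambda>t. restrict (t \<circ> h) S) (h ` S \<rightarrow>\<^sub>E B) (S \<rightarrow>\<^sub>E B)"
proof (rule bij_betw_byWitness[where f' = "\<lambda>s. \<lambda>y\<in>h ` S. s (inv_into S h y)"])
  show "\<forall>t\<in>h ` S \<rightarrow>\<^sub>E B. (\<lambda>y\<in>h ` S. restrict (t \<circ> h) S (inv_into S h y)) = t"
  proof
    fix t assume t: "t \<in> h ` S \<rightarrow>\<^sub>E B"
    show "(\<lambda>y\<in>h ` S. restrict (t \<circ> h) S (inv_into S h y)) = t"
    proof
      fix y show "(\<lambda>y\<in>h ` S. restrict (t \<circ> h) S (inv_into S h y)) y = t y"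
        using PiE_arb[OF t, of y] by (cases "y \<in> h ` S") (auto simp: inv_into_f_f[OF inj])
    qed
  qed
  show "\<forall>s\<in>S \<rightarrow>\<^sub>E B. restrict ((\<lambda>y\<in>h ` S. s (inv_into S h y)) \<circ> h) S = s"
  proof
    fix s assume s: "s \<in> S \<rightarrow>\<^sub>E B"
    show "restrict ((\<lambda>y\<in>h ` S. s (inv_into S h y)) \<circ> h) S = s"
    proof
      fix x show "restrict ((\<lambda>y\<in>h ` S. s (inv_into S h y)) \<circ> h) S x = s x"
        using PiE_arb[OF s, of x] by (cases "x \<in> S") (auto simp: inv_into_f_f[OF inj])
    qed
  qed
  show "(\<lambda>t. restrict (t \<circ> h) S) ` (h ` S \<rightarrow>\<^sub>E B) \<subseteq> S \<rightarrow>\<^sub>E B"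
    by (auto simp: PiE_iff)
  show "(\<lambda>s. \<lambda>y\<in>h ` S. s (inv_into S h y)) ` (S \<rightarrow>\<^sub>E B) \<subseteq> h ` S \<rightarrow>\<^sub>E B"
    by (auto simp: PiE_iff inv_into_f_f[OF inj])
qed

lemma color_avg_image:
  assumes inj: "inj_on h U" and F: "\<Union>F \<subseteq> U" and S: "S \<subseteq> U" and g: "depends_on S g"
  shows "color_avg q (h ` S) (\<lambda>t. g (t \<circ> h)) ((`) h ` F) = color_avg q S g F"
proof -
  let ?R = "\<lambda>t. restrict (t \<circ> h) S"
  have injS: "inj_on h S" by (rule inj_on_subset[OF inj S])
  note b = PiE_relabel[OF injS, of "{1..q}"]
  have iff: "t \<in> colorings q (h ` S) ((`) h ` F) \<longleftrightarrow> ?R t \<in> colorings q S F"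
    if t: "t \<in> spins q (h ` S)" for t
  proof -
    have c: "(h u, h v) \<in> conn ((`) h ` F) \<longleftrightarrow> (u, v) \<in> conn F" if "u \<in> S" "v \<in> S" for u v
      by (rule conn_image[OF inj F]) (use that S in auto)
    have "?R t \<in> spins q S" using bij_betw_apply[OF b t] .
    then show ?thesis unfolding colorings_def using t c by simp
  qed
  have bij: "bij_betw ?R (colorings q (h ` S) ((`) h ` F)) (colorings q S F)"
    using bij_betw_Collect[OF b, of "\<lambda>t. t \<in> colorings q S F" "\<lambda>t. t \<in> colorings q (h ` S) ((`) h ` F)"] iff
    unfolding colorings_def by (simp add: conj_ac cong: conj_cong)
  have "(\<Sum>t\<in>colorings q (h ` S) ((`) h ` F). g (t \<circ> h)) = (\<Sum>t\<in>colorings q (h ` S) ((`) h ` F). g (?R t))"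
    using depends_on_restrict[OF g] by simp
  also have "... = (\<Sum>s\<in>colorings q S F. g s)" by (rule sum.reindex_bij_betw[OF bij])
  finally show ?thesis unfolding color_avg_def bij_betw_same_card[OF bij] by simp
qed

lemma inj_on_image_edges:
  assumes "inj_on h U" "\<Union>F \<subseteq> U"
  shows "inj_on ((`) h) F"
proof (rule inj_onI)
  fix e e' assume "e \<in> F" "e' \<in> F" "h ` e = h ` e'"
  then show "e = e'" using inj_on_image_eq_iff[OF assms(1), of e e'] assms(2) by auto
qed

text \<open>A coefficient depends only on the isomorphism type of the edge set together with the
  local function. Through the covering map, injective on boxes, the torus and the lattice share the
  same coefficients near a base point.\<close>

lemma sw_coeff_image:
  assumes inj: "inj_on h U" and F: "\<Union>F \<subseteq> U" and S: "S \<subseteq> U" and g: "depends_on S g"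
  shows "sw_coeff q (h ` S) (\<lambda>t. g (t \<circ> h)) ((`) h ` F) = sw_coeff q S g F"
  unfolding sw_coeff_def
proof (rule submoeb_image)
  show "inj_on ((`) h) F" by (rule inj_on_image_edges[OF inj F])
  fix G assume "G \<subseteq> F"
  then show "color_avg q (h ` S) (\<lambda>t. g (t \<circ> h)) ((`) h ` G) = color_avg q S g G"
    using F by (intro color_avg_image[OF inj _ S g]) auto
qed

lemma mono_ind_image: "mono_ind ((`) h ` F) t = mono_ind F (t \<circ> h)"
  unfolding mono_ind_def by simp

definition glue :: "'v set => ('v => nat) => ('v => nat) => 'v => nat" where
  "glue A k h = (\<lambda>x. if x \<in> A then k x else h x)"

section \<open>Truncated expansions, and the comparison of torus and lattice\<close>

context sw_graph
begin

text \<open>Each edge of a discarded set contributes at most \<open>2 * p\<close>, hence at most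
  \<open>x / 16\<close>. The powers of \<open>x\<close> pay for counting attached sets and the
  factor \<open>1 / 16\<close> is left over for each of the at least \<open>k\<close> edges.\<close>

lemma sw_tail:
  assumes A: "finite A" "A \<subseteq> E" "finite S" "\<And>t. t \<in> spins q S ==> \<bar>f t\<bar> <= M" "0 <= M"
    and N: "N \<subseteq> Pow A" and far: "\<And>F. F \<in> Pow A ==> F \<notin> N ==> attached S F ==> k <= card F"
    and x: "0 <= x" "(1 + 2 * x) ^ \<Delta> <= 2" "32 * p <= x"
  shows "\<bar>(\<Sum>F\<in>Pow A. sw_coeff q S f F * p ^ card F * mono_ind F s)
      - (\<Sum>F\<in>N. sw_coeff q S f F * p ^ card F * mono_ind F s)\<bar> <= M * 2 ^ card S * (1/16) ^ k"
proof -
  let ?c = "\<lambda>F. sw_coeff q S f F * p ^ card F * mono_ind F s"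
  have fin: "finite (Pow A)" using A by simp
  have "(\<Sum>F\<in>Pow A. ?c F) - (\<Sum>F\<in>N. ?c F) = (\<Sum>F\<in>Pow A - N. ?c F)"
    by (rule sum_diff[OF fin N, symmetric])
  then have "\<bar>(\<Sum>F\<in>Pow A. ?c F) - (\<Sum>F\<in>N. ?c F)\<bar> <= (\<Sum>F\<in>Pow A - N. \<bar>?c F\<bar>)" by (simp add: sum_abs)
  also have "... <= (\<Sum>F\<in>Pow A - N. if attached S F then M * (1/16) ^ k * x ^ card F else 0)"
  proof (rule sum_mono)
    fix F assume F: "F \<in> Pow A - N"
    then have finF: "finite F" using A finite_subset by blast
    show "\<bar>?c F\<bar> <= (if attached S F then M * (1/16) ^ k * x ^ card F else 0)"
    proof (cases "attached S F")
      case True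
      have k: "k <= card F" using far F True by blast
      have c: "\<bar>sw_coeff q S f F\<bar> <= 2 ^ card F * M" by (rule abs_sw_coeff_le[OF finF A(3) q1 A(4)])
      have "\<bar>?c F\<bar> = \<bar>sw_coeff q S f F\<bar> * p ^ card F * \<bar>mono_ind F s\<bar>"
        using p_bounds by (simp add: abs_mult)
      also have "... <= (2 ^ card F * M) * p ^ card F * 1"
        using c p_bounds A(5) mono_ind_range[of F s] by (intro mult_mono) auto
      also have "... = M * (2 * p) ^ card F" by (simp add: power_mult_distrib)
      also have "... <= M * (x * (1/16)) ^ card F"
        using x p_bounds A(5) by (intro mult_left_mono power_mono) auto
      also have "... = M * ((1/16) ^ card F * x ^ card F)" by (simp only: power_mult_distrib mult_ac)
      also have "... <= M * ((1/16) ^ k * x ^ card F)"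
        using x A(5) k by (intro mult_left_mono mult_right_mono power_decreasing) auto
      finally show ?thesis using True by (simp add: mult_ac)
    next
      case False
      then show ?thesis using sw_coeff_not_attached[OF finF] by simp
    qed
  qed
  also have "... <= (\<Sum>F\<in>Pow A. if attached S F then M * (1/16) ^ k * x ^ card F else 0)"
    using x A(5) by (intro sum_mono2[OF fin]) auto
  also have "... = (\<Sum>F\<in>{F\<in>Pow A. attached S F}. M * (1/16) ^ k * x ^ card F)"
    by (rule sum.inter_filter[OF fin, symmetric])
  also have "... = M * (1/16) ^ k * (\<Sum>F\<in>{F\<in>Pow A. attached S F}. x ^ card F)"
    by (simp add: sum_distrib_left)
  also have "... <= M * (1/16) ^ k * 2 ^ card S"
  proof (rule mult_left_mono[OF sum_attached_le[OF A(1) _ _ x(1,2) A(3)]])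
    show "card e = 2" if "e \<in> A" for e using card_edge that A by blast
    show "card {e \<in> A. v \<in> e} <= \<Delta>" for v
    proof (cases "v \<in> V")
      case True
      have "card {e \<in> A. v \<in> e} <= card {e \<in> E. v \<in> e}"
        using deg[OF True] A(2) by (intro card_mono) auto
      then show ?thesis using deg[OF True] by linarith
    next
      case False
      then have *: "{e \<in> A. v \<in> e} = {}" using edge_subset A by auto
      show ?thesis unfolding * by simp
    qed
  qed (use A(5) in simp)
  finally show ?thesis by (simp add: mult_ac)
qed

lemma glue_bij:
  assumes "A \<subseteq> V" "h \<in> cfg"
  shows "bij_betw (\<lambda>k. glue A k h) (spins q A) (bc_configs V q A h)"
proof (rule bij_betw_byWitness[where f' = "\<lambda>y. restrict y A"])
  show "\<forall>k\<in>spins q A. restrict (glue A k h) A = k"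
  proof
    fix k assume k: "k \<in> spins q A"
    show "restrict (glue A k h) A = k"
    proof
      fix x show "restrict (glue A k h) A x = k x"
        using PiE_arb[OF k, of x] by (cases "x \<in> A") (auto simp: glue_def)
    qed
  qed
  show "\<forall>y\<in>bc_configs V q A h. glue A (restrict y A) h = y"
  proof
    fix y assume "y \<in> bc_configs V q A h"
    then have s: "y \<in> cfg" "\<And>v. v \<in> V ==> v \<notin> A ==> y v = h v" unfolding bc_configs_def by auto
    show "glue A (restrict y A) h = y"
    proof
      fix x show "glue A (restrict y A) h x = y x"
        using s(2)[of x] PiE_arb[OF s(1), of x] PiE_arb[OF assms(2), of x] assms(1)
        by (cases "x \<in> V") (auto simp: glue_def)
    qed
  qed
  show "(\<lambda>k. glue A k h) ` (spins q A) \<subseteq> bc_configs V q A h"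
  proof
    fix y assume "y \<in> (\<lambda>k. glue A k h) ` (spins q A)"
    then obtain k where k: "k \<in> spins q A" and y: "y = glue A k h" by blast
    have "y \<in> cfg"
    proof (rule PiE_I)
      show "y x \<in> {1..q}" if "x \<in> V" for x
        using PiE_mem[OF k, of x] PiE_mem[OF assms(2) that] unfolding y glue_def by auto
      show "y x = undefined" if "x \<notin> V" for x
        using PiE_arb[OF assms(2) that] that assms(1) unfolding y glue_def by auto
    qed
    then show "y \<in> bc_configs V q A h" unfolding bc_configs_def y glue_def by auto
  qed
  show "(\<lambda>y. restrict y A) ` bc_configs V q A h \<subseteq> spins q A"
  proof
    fix k assume "k \<in> (\<lambda>y. restrict y A) ` bc_configs V q A h"
    then obtain y where s: "y \<in> cfg" "k = restrict y A" unfolding bc_configs_def by blast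
    show "k \<in> spins q A" unfolding s(2) using PiE_mem[OF s(1)] assms(1) by auto
  qed
qed

lemma heat_bath_glue:
  assumes "A \<subseteq> V" "h \<in> cfg"
  shows "heat_bath A f h =
    (\<Sum>k\<in>spins q A. pw A (glue A k h) * f (glue A k h)) /
    (\<Sum>k\<in>spins q A. pw A (glue A k h))"
  unfolding heat_bath_def
    sum.reindex_bij_betw[OF glue_bij[OF assms], symmetric, where g = "\<lambda>s. pw A s * f s"]
    sum.reindex_bij_betw[OF glue_bij[OF assms], symmetric, where g = "pw A"] ..

end

text \<open>An attached set reaches levels at most its cardinality beyond the support, and an edge
  at such a level is the image of an edge of a slightly larger box. Used in contrapositive form:
  sets outside that image have at least \<open>k\<close> edges.\<close>

lemma torus_attached_far:
  assumes F: "F \<subseteq> torus_edges d n" "finite F" and n: "n >= 2"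
    and a: "attached (tproj d n a ` box d r) F" and k: "card F < k"
  shows "F \<subseteq> (`) (tproj d n a) ` edge_box d (r + k)"
proof
  fix e assume e: "e \<in> F"
  have n0: "n > 0" using n by simp
  have ends: "\<exists>u\<in>torus_verts d n. \<exists>v\<in>torus_verts d n. u ~= v \<and> e = {u, v}" if "e \<in> F" for e
    by (rule torus_edge_ends[OF _ n]) (use that F in blast)
  obtain u v where uv: "u \<in> torus_verts d n" "e = {u, v}" using ends[OF e] by blast
  have "torus_level d n a u <= r + card F"
  proof (rule attached_level[OF F(2) a])
    show "torus_level d n a v <= r" if "v \<in> tproj d n a ` box d r" for v
      using that torus_level_le by auto
    fix e u v assume e: "e \<in> F" "u \<in> e" "v \<in> e"
    obtain x y where xy: "x \<in> torus_verts d n" "y \<in> torus_verts d n" "e = {x, y}" using ends[OF e(1)] by blast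
    have te: "{x, y} \<in> torus_edges d n" "{y, x} \<in> torus_edges d n" using e(1) F xy by (auto simp: insert_commute)
    consider "u = v" | "u = x" "v = y" | "u = y" "v = x" using e xy by blast
    then show "torus_level d n a v <= torus_level d n a u + 1"
      using torus_level_step[OF te(1) xy(1) n0] torus_level_step[OF te(2) xy(2) n0] by cases auto
  qed (use e uv in blast)
  moreover have "{u, v} \<in> torus_edges d n" using e F uv by blast
  ultimately have "e \<in> (`) (tproj d n a) ` edge_box d (r + card F + 1)"
    using torus_edge_near[OF _ uv(1) n0] uv by blast
  then show "e \<in> (`) (tproj d n a) ` edge_box d (r + k)"
    using edge_box_mono[of "r + card F + 1" "r + k" d] k by auto
qed

lemma lattice_attached_far:
  assumes F: "F \<subseteq> lattice_edges d" "finite F" and a: "attached (box d r) F" and k: "card F < k"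
  shows "F \<subseteq> edge_box d (r + k)"
proof
  fix e assume e: "e \<in> F"
  define D where "D = (\<lambda>v. LEAST j. v \<in> box d j)"
  have Dbox: "v \<in> box d (D v)" if "v \<in> lattice_verts d" for v
    unfolding D_def by (rule LeastI_ex) (rule lattice_in_box[OF that])
  have Dle: "D v <= j" if "v \<in> box d j" for v j unfolding D_def by (rule Least_le) (rule that)
  have ends: "u \<in> lattice_verts d" if "e \<in> F" "u \<in> e" for e u
    using lattice_edge_ends[of e d] that F by blast
  have lev: "D u <= r + card F" if u: "u \<in> \<Union>F" for u
  proof (rule attached_level[OF F(2) a _ _ u])
    show "D v <= r" if "v \<in> box d r" for v using that Dle by auto
    fix e u v assume e: "e \<in> F" "u \<in> e" "v \<in> e"
    show "D v <= D u + 1"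
    proof (cases "u = v")
      case False
      have uL: "u \<in> lattice_verts d" by (rule ends[OF e(1,2)])
      have "e = {u, v}" using lattice_edge_ends[of e d] e F False by blast
      then have uv: "{u, v} \<in> lattice_edges d" using e F by blast
      obtain i s where "i < d" "s = 1 \<or> s = - 1" "v = u(i := u i + s)"
        by (rule lattice_edgeE[OF uv uL]) (rule that)
      then show ?thesis using box_step[OF Dbox[OF uL]] Dle by blast
    qed simp
  qed
  have "v \<in> box d (r + k)" if "v \<in> e" for v
  proof -
    have "D v <= r + k" using lev[OF UnionI[OF e that]] k by linarith
    then show ?thesis using Dbox[OF ends[OF e that]] box_mono by blast
  qed
  then show "e \<in> edge_box d (r + k)" using e F by (auto simp: edge_box_def)
qed

text \<open>The smallness conditions are those of \<open>small_sw_graph\<close> for the degree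
  \<open>2 * d\<close>, written in terms of \<open>\<beta>\<close>.\<close>

locale sw_lattice =
  fixes d q :: nat and \<beta> :: real
  assumes d1: "d >= 1" and q_ge_2: "q >= 2" and beta_gt_0: "\<beta> > 0"
    and beta_infl: "8 * real d * (exp (2 * \<beta>) - 1) <= 1"
    and beta_p: "256 * real d * (1 - exp (- \<beta>)) <= 1"

sublocale sw_lattice \<subseteq> L: sw_graph "lattice_verts d" "lattice_edges d" q \<beta> "2 * d"
proof
  show "countable (lattice_verts d)" unfolding lattice_verts_def by (intro countable_PiE) auto
qed (use lattice_edge_ends lattice_degree q_ge_2 beta_gt_0 in blast)+

lemma finite_torus_verts: "finite (torus_verts d n)"
  unfolding torus_verts_def by (intro finite_PiE) auto

text \<open>The shift by 3 excludes once and for all the degenerate sides, where loops or merged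
  double edges occur. Limits in the side length are not affected.\<close>

sublocale sw_lattice \<subseteq> T: small_sw_graph "torus_verts d (n + 3)" "torus_edges d (n + 3)" q \<beta> "2 * d" for n
proof
  show g: "e \<in> torus_edges d (n + 3) ==> \<exists>u\<in>torus_verts d (n + 3). \<exists>v\<in>torus_verts d (n + 3). u ~= v \<and> e = {u, v}" for e
    by (rule torus_edge_ends) auto
  show dg: "v \<in> torus_verts d (n + 3) ==> finite {e \<in> torus_edges d (n + 3). v \<in> e} \<and> card {e \<in> torus_edges d (n + 3). v \<in> e} <= 2 * d" for v
    by (rule torus_degree) auto
  show "countable (torus_verts d (n + 3))" by (intro countable_finite finite_torus_verts)
  interpret sw_graph "torus_verts d (n + 3)" "torus_edges d (n + 3)" q \<beta> "2 * d"
    by unfold_locales (use g dg q_ge_2 beta_gt_0 in \<open>auto intro: countable_finite finite_torus_verts\<close>)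
  show "4 * real (2 * d) * infl <= 1" using beta_infl by (simp add: infl_def)
  show "128 * real (2 * d) * p <= 1" using beta_p by (simp add: p_def)
qed (use q_ge_2 beta_gt_0 finite_torus_verts d1 in auto)

context sw_lattice
begin

abbreviation "TV n \<equiv> torus_verts d (n + 3)"
abbreviation "TE n \<equiv> torus_edges d (n + 3)"
abbreviation "tp n \<equiv> tproj d (n + 3)"

abbreviation "LV \<equiv> lattice_verts d"
abbreviation "LE \<equiv> lattice_edges d"

text \<open>The periodic lattice configuration obtained by unrolling a torus configuration as seen
  from \<open>a\<close>. Functions on the lattice are evaluated on tori through it.\<close>

definition per :: "nat => (nat => int) => ((nat => int) => nat) => (nat => int) => nat" where
  "per n a t = (\<lambda>x\<in>LV. t (tp n a x))"

lemma per_cfg: "t \<in> T.cfg n ==> per n a t \<in> L.cfg"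
  unfolding per_def using tproj_torus[of "n + 3" d a] by (auto simp: PiE_iff)

lemma per_local:
  assumes "depends_on S f" "S \<subseteq> LV"
  shows "f (per n a t) = f (t \<circ> tp n a)"
  using assms unfolding depends_on_def per_def by (metis comp_apply restrict_apply' subsetD)

text \<open>The expansion of the dynamics cut off at distance \<open>k\<close>. It is one and the
  same local function that approximates the torus operator and the lattice operator.\<close>

definition swQ :: "nat => (nat => int) obs => nat => (nat => int) obs" where
  "swQ r g k s = (\<Sum>F\<in>Pow (edge_box d (r + k)). sw_coeff q (box d r) g F * L.p ^ card F * mono_ind F s)"

lemma count_ok: "0 <= 1 / (8 * real d)" "(1 + 2 * (1 / (8 * real d))) ^ (2 * d) <= 2" "32 * L.p <= 1 / (8 * real d)"
proof -
  show "(1 + 2 * (1 / (8 * real d))) ^ (2 * d) <= 2"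
    using T.count_param unfolding T.ww_def by simp
  show "32 * L.p <= 1 / (8 * real d)" using beta_p d1 by (simp add: L.p_def field_simps)
qed simp

lemma edge_box_vertices: "\<Union>(edge_box d r) \<subseteq> box d r"
  by (auto simp: edge_box_def)

text \<open>The covering map is injective on the box of radius \<open>r + k\<close>, so the terms
  inside correspond one to one with equal coefficients; all others have at least \<open>k\<close>
  edges. The error depends neither on the torus nor on the base point.\<close>

lemma sw_compare_torus:
  assumes g: "depends_on (box d r) g" "\<And>s. s \<in> spins q (box d r) ==> \<bar>g s\<bar> <= M" "0 <= M"
    and n: "2 * (r + k) < n + 3"
  shows "\<bar>T.sw_op n (\<lambda>t. g (per n a t)) t - swQ r g k (per n a t)\<bar> <= M * 2 ^ card (box d r) * (1/16) ^ k"
proof -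
  let ?h = "tp n a"
  let ?S = "?h ` box d r" and ?U = "box d (r + k)" and ?f = "\<lambda>t. g (t \<circ> tp n a)"
  have inj: "inj_on ?h ?U" by (rule tproj_inj[OF n])
  have rU: "box d r \<subseteq> ?U" by (rule box_mono) simp
  have injr: "inj_on ?h (box d r)" by (rule inj_on_subset[OF inj rU])
  have S: "finite ?S" "?S \<subseteq> TV n" using finite_box tproj_torus[of "n + 3" d a] by auto
  have dep: "depends_on ?S ?f" using g(1) unfolding depends_on_def by auto
  have fM: "\<bar>?f t\<bar> <= M" if "t \<in> spins q ?S" for t
    using g(2)[OF bij_betw_apply[OF PiE_relabel[OF injr] that]] depends_on_restrict[OF g(1)] by simp
  have injE: "inj_on ((`) ?h) (edge_box d (r + k))"
    by (rule inj_on_image_edges[OF inj edge_box_vertices])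
  have Npow: "Pow ((`) ?h ` edge_box d (r + k)) = (\<lambda>F. (`) ?h ` F) ` Pow (edge_box d (r + k))"
    by (rule image_Pow_surj[OF refl, symmetric])
  have "(\<Sum>F\<in>Pow ((`) ?h ` edge_box d (r + k)). sw_coeff q ?S ?f F * L.p ^ card F * mono_ind F t)
    = (\<Sum>F\<in>Pow (edge_box d (r + k)). sw_coeff q ?S ?f ((`) ?h ` F) * L.p ^ card ((`) ?h ` F) * mono_ind ((`) ?h ` F) t)"
    unfolding Npow by (subst sum.reindex[OF inj_on_image_Pow[OF injE]]) simp
  also have "... = swQ r g k (per n a t)"
    unfolding swQ_def
  proof (rule sum.cong[OF refl])
    fix F assume F: "F \<in> Pow (edge_box d (r + k))"
    have FU: "\<Union>F \<subseteq> ?U" using F edge_box_vertices[of "r + k"] by blast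
    have 1: "sw_coeff q ?S ?f ((`) ?h ` F) = sw_coeff q (box d r) g F"
      by (rule sw_coeff_image[OF inj FU rU g(1)])
    have 2: "card ((`) ?h ` F) = card F" by (rule card_image[OF inj_on_subset[OF injE]]) (use F in blast)
    have 3: "mono_ind ((`) ?h ` F) t = mono_ind F (per n a t)"
      unfolding mono_ind_image using FU box_sub by (intro per_local[OF depends_on_mono_ind, symmetric]) blast
    show "sw_coeff q ?S ?f ((`) ?h ` F) * L.p ^ card ((`) ?h ` F) * mono_ind ((`) ?h ` F) t
      = sw_coeff q (box d r) g F * L.p ^ card F * mono_ind F (per n a t)" unfolding 1 2 3 ..
  qed
  finally have near: "(\<Sum>F\<in>Pow ((`) ?h ` edge_box d (r + k)). sw_coeff q ?S ?f F * L.p ^ card F * mono_ind F t)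
    = swQ r g k (per n a t)" .
  have op: "T.sw_op n (\<lambda>t. g (per n a t)) t
      = (\<Sum>F\<in>Pow (TE n). sw_coeff q ?S ?f F * L.p ^ card F * mono_ind F t)"
    unfolding per_local[OF g(1) box_sub] by (rule T.sw_op_expand[OF S(2) dep])
  have "\<bar>(\<Sum>F\<in>Pow (TE n). sw_coeff q ?S ?f F * L.p ^ card F * mono_ind F t)
     - (\<Sum>F\<in>Pow ((`) ?h ` edge_box d (r + k)). sw_coeff q ?S ?f F * L.p ^ card F * mono_ind F t)\<bar>
    <= M * 2 ^ card ?S * (1/16) ^ k"
  proof (rule T.sw_tail[OF T.finite_E order_refl S(1) fM g(3) _ _ count_ok])
    show "Pow ((`) ?h ` edge_box d (r + k)) \<subseteq> Pow (TE n)"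
    proof (intro Pow_mono image_subsetI)
      fix e assume "e \<in> edge_box d (r + k)"
      then have "e \<in> LE" using edge_box_sub by blast
      then show "?h ` e \<in> TE n" by (rule tproj_edge) simp
    qed
    fix F assume F: "F \<in> Pow (TE n)" "F \<notin> Pow ((`) ?h ` edge_box d (r + k))" "attached ?S F"
    have "finite F" using F(1) T.finite_E finite_subset by blast
    then show "k <= card F" using torus_attached_far[of F d "n + 3" a r k] F by fastforce
  qed
  then show ?thesis unfolding op near card_image[OF injr] .
qed

text \<open>On the infinite graph the expansion is only a limit, so the tail estimate is applied to
  each larger finite box and carried over to the limit.\<close>

lemma sw_compare_lattice:
  assumes g: "depends_on (box d r) g" "\<And>x. x \<in> spins q (box d r) ==> \<bar>g x\<bar> <= M" "0 <= M"
  shows "\<bar>(\<integral>t. g t \<partial>L.sw x) - swQ r g k x\<bar> <= M * 2 ^ card (box d r) * (1/16) ^ k"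
proof (rule LIMSEQ_le_const2)
  let ?A = "\<lambda>n. edge_box d (r + k + n)"
  let ?s = "\<lambda>n. \<Sum>F\<in>Pow (?A n). sw_coeff q (box d r) g F * L.p ^ card F * mono_ind F x"
  have un: "(\<Union>n. ?A n) = LE"
  proof
    show "(\<Union>n. ?A n) \<subseteq> LE" using edge_box_sub by blast
    show "LE \<subseteq> (\<Union>n. ?A n)"
    proof
      fix e assume e: "e \<in> LE"
      have "\<exists>s. e \<subseteq> box d s" by (rule finite_sub_box) (use L.finite_edge[OF e] L.edge_subset[OF e] in auto)
      then obtain s where "e \<subseteq> box d s" ..
      then have "e \<subseteq> box d (r + k + s)" using box_mono[of s "r + k + s" d] by auto
      then show "e \<in> (\<Union>n. ?A n)" using e by (auto simp: edge_box_def)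
    qed
  qed
  have "?s \<longlonglongrightarrow> (\<integral>t. g t \<partial>L.sw x)"
    by (rule L.sw_integral_limit[OF finite_box box_sub g(1) _ finite_edge_box un])
       (auto simp: incseq_def intro!: edge_box_mono)
  then show "(\<lambda>n. \<bar>?s n - swQ r g k x\<bar>) \<longlonglongrightarrow> \<bar>(\<integral>t. g t \<partial>L.sw x) - swQ r g k x\<bar>"
    by (intro tendsto_intros)
  have "\<bar>?s n - swQ r g k x\<bar> <= M * 2 ^ card (box d r) * (1/16) ^ k" for n
    unfolding swQ_def
  proof (rule L.sw_tail[OF finite_edge_box edge_box_sub finite_box g(2,3) _ _ count_ok])
    show "Pow (edge_box d (r + k)) \<subseteq> Pow (?A n)" by (intro Pow_mono edge_box_mono) simp
    fix F assume F: "F \<in> Pow (?A n)" "F \<notin> Pow (edge_box d (r + k))" "attached (box d r) F"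
    have "finite F" using F(1) finite_edge_box finite_subset by blast
    moreover have "F \<subseteq> LE" using F(1) edge_box_sub by blast
    ultimately show "k <= card F" using lattice_attached_far[of F d r k] F by fastforce
  qed
  then show "\<exists>N. \<forall>n\<ge>N. \<bar>?s n - swQ r g k x\<bar> <= M * 2 ^ card (box d r) * (1/16) ^ k" by blast
qed

text \<open>A heat bath sees only its region and the edges meeting it, all inside a box on which the
  covering map is injective. The agreement is therefore exact, without an error term, as soon as the
  torus is large.\<close>

lemma heat_bath_compare:
  assumes Y: "Y \<subseteq> box d r" and f: "depends_on (box d r) f" and n: "2 * (r + 1) < n + 3"
    and w: "w \<in> T.cfg n"
  shows "L.heat_bath Y f (per n a w)
    = T.heat_bath n (tp n a ` Y) (\<lambda>w. f (w \<circ> tp n a)) w"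
proof -
  let ?j = "tp n a" and ?U = "box d (r + 1)"
  let ?R = "\<lambda>k. restrict (k \<circ> ?j) Y"
  let ?s = "\<lambda>k. glue Y (?R k) (per n a w)" and ?t = "\<lambda>k. glue (?j ` Y) k w"
  have inj: "inj_on ?j ?U" by (rule tproj_inj[OF n])
  have rU: "box d r \<subseteq> ?U" by (rule box_mono) simp
  have YU: "Y \<subseteq> ?U" using Y rU by blast
  have bij: "bij_betw ?R (spins q (?j ` Y)) (spins q Y)"
    by (rule PiE_relabel[OF inj_on_subset[OF inj YU]])
  have agree: "?s k z = ?t k (?j z)" if "z \<in> ?U" for k z
  proof (cases "z \<in> Y")
    case True
    then show ?thesis by (simp add: glue_def)
  next
    case False
    have "?j z \<notin> ?j ` Y" using inj_on_image_mem_iff[OF inj that YU] False by simp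
    moreover have "z \<in> LV" using that box_sub by blast
    ultimately show ?thesis using False by (simp add: glue_def per_def)
  qed
  have f_eq: "f (?s k) = f (?t k \<circ> ?j)" for k
  proof -
    have "\<forall>v\<in>box d r. ?s k v = (?t k \<circ> ?j) v" using agree rU by auto
    then show ?thesis using f unfolding depends_on_def by blast
  qed
  have w_eq: "potts_weight LE \<beta> Y (?s k) = potts_weight (TE n) \<beta> (?j ` Y) (?t k)" for k
  proof -
    let ?A = "{e \<in> mono_edges LE (?s k). e \<inter> Y ~= {}}"
    let ?B = "{e \<in> mono_edges (TE n) (?t k). e \<inter> ?j ` Y ~= {}}"
    have AU: "e \<subseteq> ?U" if h: "e \<in> LE" "x \<in> e" "x \<in> Y" for e x
    proof -
      have xr: "x \<in> box d r" using h(3) Y by blast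
      obtain y where y: "e = {x, y}" using L.edgeE[OF h(1)] h(2) by blast
      have xy: "{x, y} \<in> LE" using h(1) y by simp
      have xL: "x \<in> LV" using xr box_sub by blast
      obtain i s where "i < d" "s = 1 \<or> s = - 1" "y = x(i := x i + s)"
        by (rule lattice_edgeE[OF xy xL]) (rule that)
      then have "y \<in> ?U" using box_step xr by blast
      then show ?thesis using y h(3) YU by blast
    qed
    have "inj_on ((`) ?j) ?A"
      by (rule inj_on_image_edges[OF inj]) (use AU in \<open>auto simp: mono_edges_def\<close>)
    moreover have "(`) ?j ` ?A = ?B"
    proof
      show "(`) ?j ` ?A \<subseteq> ?B"
      proof
        fix e' assume "e' \<in> (`) ?j ` ?A"
        then obtain e where e: "e \<in> ?A" "e' = ?j ` e" by blast
        then have eE: "e \<in> LE" "e \<inter> Y ~= {}" unfolding mono_edges_def by auto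
        have eU: "e \<subseteq> ?U" using AU eE by blast
        have mono: "?s k u = ?s k v" if "u \<in> e" "v \<in> e" for u v
          using e(1) that unfolding mono_edges_def by blast
        have "?t k u = ?t k v" if uv: "u \<in> e'" "v \<in> e'" for u v
        proof -
          obtain x y where "x \<in> e" "y \<in> e" "u = ?j x" "v = ?j y" using uv e(2) by blast
          then show ?thesis using mono[of x y] agree[of x k] agree[of y k] eU by (metis subsetD)
        qed
        moreover have "e' \<in> TE n" unfolding e(2) by (rule tproj_edge[OF eE(1)]) simp
        moreover have "e' \<inter> ?j ` Y ~= {}" using eE(2) e(2) by blast
        ultimately show "e' \<in> ?B" unfolding mono_edges_def by blast
      qed
      show "?B \<subseteq> (`) ?j ` ?A"
      proof
        fix e' assume e': "e' \<in> ?B"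
        then obtain x where x: "x \<in> Y" "?j x \<in> e'" by blast
        have e'E: "e' \<in> TE n" using e' unfolding mono_edges_def by blast
        obtain y' where y': "e' = {?j x, y'}" using T.edgeE[OF e'E] x(2) by blast
        have xr: "x \<in> box d r" using x(1) Y by blast
        have xL: "x \<in> LV" using xr box_sub by blast
        have y1: "{?j x, y'} \<in> TE n" using e'E y' by simp
        obtain y where y: "?j y = y'" "{x, y} \<in> LE" "y \<in> ?U"
          using tproj_lift[OF y1 xL] xr by (metis add_gr_0 zero_less_numeral)
        have e: "?j ` {x, y} = e'" using y y' by simp
        have sub: "{x, y} \<subseteq> ?U" using y xr rU by blast
        have "?s k u = ?s k v" if "u \<in> {x, y}" "v \<in> {x, y}" for u v
        proof -
          have "?j u \<in> e'" "?j v \<in> e'" using that e by blast+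
          then have "?t k (?j u) = ?t k (?j v)" using e' unfolding mono_edges_def by blast
          then show ?thesis using agree[of u k] agree[of v k] that sub by auto
        qed
        then have "{x, y} \<in> ?A" using y(2) x(1) unfolding mono_edges_def by blast
        then show "e' \<in> (`) ?j ` ?A" using e by blast
      qed
    qed
    ultimately have "card ?A = card ?B" using card_image[of "(`) ?j" ?A] by argo
    then show ?thesis unfolding potts_weight_def by simp
  qed
  have YV: "Y \<subseteq> LV" "?j ` Y \<subseteq> TV n"
    using Y box_sub tproj_torus[of "n + 3" d a] by auto
  show ?thesis
    unfolding L.heat_bath_glue[OF YV(1) per_cfg[OF w]] T.heat_bath_glue[OF YV(2) w]
    unfolding sum.reindex_bij_betw[OF bij, symmetric, where g = "\<lambda>k. potts_weight LE \<beta> Y (glue Y k (per n a w)) * f (glue Y k (per n a w))"]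
      sum.reindex_bij_betw[OF bij, symmetric, where g = "\<lambda>k. potts_weight LE \<beta> Y (glue Y k (per n a w))"]
      w_eq f_eq ..
qed

end

section \<open>Measures and kernels tested on local functions\<close>

context sw_graph
begin

lemma measure_eqI_local:
  assumes M: "prob_space M" "sets M = sets sps" and N: "prob_space N" "sets N = sets sps"
    and eq: "\<And>S f. finite S ==> S \<subseteq> V ==> depends_on S f ==> (\<integral>s. f s \<partial>M) = (\<integral>s. f s \<partial>N)"
  shows "M = N"
proof (rule measure_eqI_PiM_infinite[where I = V and M = "\<lambda>_. count_space {1..q}"])
  show "sets M = sets (PiM V (\<lambda>_. count_space {1..q}))" "sets N = sets (PiM V (\<lambda>_. count_space {1..q}))"
    using M N unfolding spin_space_def by auto
  interpret prob_space M by fact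
  show "finite_measure M" by unfold_locales
  fix X J assume J: "finite J" "J \<subseteq> V" "\<And>i. i \<in> J ==> X i \<in> sets (count_space {1..q})"
  have "(\<integral>s. of_bool (\<forall>v\<in>J. s v \<in> X v) \<partial>M :: real) = (\<integral>s. of_bool (\<forall>v\<in>J. s v \<in> X v) \<partial>N)"
    by (rule eq[OF J(1,2)]) (auto simp: depends_on_def)
  then show "emeasure M (prod_emb V (\<lambda>_. count_space {1..q}) J (Pi\<^sub>E J X)) =
      emeasure N (prod_emb V (\<lambda>_. count_space {1..q}) J (Pi\<^sub>E J X))"
    using emeasure_cylinder[OF M J] emeasure_cylinder[OF N J] by simp
qed

lemma local_integrable:
  assumes M: "prob_space M" "sets M = sets sps" and S: "finite S" "S \<subseteq> V" "depends_on S f"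
  shows "integrable M f"
proof -
  interpret prob_space M by fact
  obtain B where B: "B >= 0" "\<And>s. s \<in> spins q S ==> \<bar>f s\<bar> <= B" "\<And>s. s \<in> cfg ==> \<bar>f s\<bar> <= B"
    by (rule local_bounded[OF S(1,3,2)]) (rule that)
  show ?thesis
  proof (rule integrable_const_bound[where B = B])
    show "f \<in> borel_measurable M"
      unfolding measurable_cong_sets[OF M(2) refl] by (rule depends_on_measurable[OF S])
    show "AE x in M. norm (f x) <= B" using B(3) sets_eq_imp_space_eq[OF M(2)] by (intro AE_I2) auto
  qed
qed

lemma integral_bind_local:
  assumes M: "prob_space M" "sets M = sets sps" and K: "K \<in> sps \<rightarrow>\<^sub>M prob_algebra sps"
    and f: "f \<in> borel_measurable sps" "\<And>s. s \<in> cfg ==> \<bar>f s\<bar> <= (B::real)"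
  shows "(\<integral>s. f s \<partial>(M \<bind> K)) = (\<integral>s. (\<integral>t. f t \<partial>K s) \<partial>M)"
proof (rule integral_bind[where K = sps and B = B and B' = 1])
  interpret prob_space M by fact
  have K': "K \<in> M \<rightarrow>\<^sub>M prob_algebra sps" using K measurable_cong_sets[OF M(2) refl] by blast
  then show "K \<in> M \<rightarrow>\<^sub>M subprob_algebra sps" by (rule measurable_prob_algebraD)
  show "AE x in M. emeasure (K x) (space (K x)) <= ennreal 1"
    using measurable_space[OF K'] by (intro AE_I2) (auto simp: space_prob_algebra prob_space.emeasure_space_1)
  show "finite_measure M" by unfold_locales
qed (use f in auto)

lemma bind_props:
  assumes M: "prob_space M" "sets M = sets sps" and K: "K \<in> sps \<rightarrow>\<^sub>M prob_algebra sps"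
  shows "prob_space (M \<bind> K)" "sets (M \<bind> K) = sets sps"
proof -
  interpret prob_space M by fact
  have K': "K \<in> M \<rightarrow>\<^sub>M prob_algebra sps" using K measurable_cong_sets[OF M(2) refl] by blast
  have MM: "M \<in> space (prob_algebra M)" using M by (simp add: space_prob_algebra)
  show "prob_space (M \<bind> K)" by (rule prob_space_bind'[OF MM K'])
  show "sets (M \<bind> K) = sets sps" by (rule sets_bind'[OF MM K'])
qed

lemma bind_eqI:
  assumes M: "prob_space M" "sets M = sets sps" and K: "K \<in> sps \<rightarrow>\<^sub>M prob_algebra sps"
    and eq: "\<And>S f. finite S ==> S \<subseteq> V ==> depends_on S f ==> (\<integral>s. (\<integral>t. f t \<partial>K s) \<partial>M) = (\<integral>s. f s \<partial>M)"
  shows "M \<bind> K = M"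
proof (rule measure_eqI_local[OF bind_props[OF M K] M])
  fix S f assume S: "finite S" "S \<subseteq> V" "depends_on S f"
  obtain B where B: "B >= 0" "\<And>s. s \<in> spins q S ==> \<bar>f s\<bar> <= B" "\<And>s. s \<in> cfg ==> \<bar>f s\<bar> <= B"
    by (rule local_bounded[OF S(1,3,2)]) (rule that)
  show "(\<integral>s. f s \<partial>(M \<bind> K)) = (\<integral>s. f s \<partial>M)"
    by (rule trans[OF integral_bind_local[OF M K depends_on_measurable[OF S] B(3)] eq[OF S]])
qed

subsection \<open>Gibbs measures as invariant measures\<close>

definition hb_weight :: "'v set => ('v => nat) => ('v => nat) => real" where
  "hb_weight A k h = pw A (glue A k h) / (\<Sum>k\<in>spins q A. pw A (glue A k h))"

text \<open>The finite-volume specification as a Markov kernel, realised as the image of a finite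
  law on the spins in \<open>A\<close>.\<close>

definition hb_kernel :: "'v set => ('v => nat) => ('v => nat) measure" where
  "hb_kernel A h = distr (point_measure (spins q A) (\<lambda>k. ennreal (hb_weight A k h))) sps (\<lambda>k. glue A k h)"

lemma finite_spins: "finite A ==> finite (spins q A)" by (intro finite_PiE) auto

lemma spins_nonempty: "spins q A ~= {}" using q1 by (auto simp: PiE_eq_empty_iff)

lemma hb_weight_sum:
  assumes "finite A"
  shows "0 <= hb_weight A k h" "(\<Sum>k\<in>spins q A. hb_weight A k h) = 1"
proof -
  have pos: "(\<Sum>k\<in>spins q A. pw A (glue A k h)) > 0"
    by (rule sum_pos[OF finite_spins[OF assms] spins_nonempty]) (rule potts_weight_pos)
  show "0 <= hb_weight A k h" unfolding hb_weight_def using pos potts_weight_pos[of A]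
    by (intro divide_nonneg_nonneg) (auto intro: less_imp_le)
  show "(\<Sum>k\<in>spins q A. hb_weight A k h) = 1"
    unfolding hb_weight_def sum_divide_distrib[symmetric] using pos by simp
qed

lemma glue_cfg:
  assumes "A \<subseteq> V" "h \<in> cfg" "k \<in> spins q A"
  shows "glue A k h \<in> cfg"
  using bij_betw_apply[OF glue_bij[OF assms(1,2)] assms(3)] unfolding bc_configs_def by blast

lemma heat_bath_weight:
  assumes "A \<subseteq> V" "h \<in> cfg"
  shows "heat_bath A f h = (\<Sum>k\<in>spins q A. hb_weight A k h * f (glue A k h))"
  unfolding heat_bath_glue[OF assms] hb_weight_def by (simp add: sum_divide_distrib)

lemma hb_kernel_props:
  assumes A: "finite A" "A \<subseteq> V" and h: "h \<in> cfg"
  shows "prob_space (hb_kernel A h)" "sets (hb_kernel A h) = sets sps"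
    and "f \<in> borel_measurable sps ==> (\<integral>s. f s \<partial>hb_kernel A h) = heat_bath A f h"
proof -
  let ?C = "spins q A"
  let ?P = "point_measure ?C (\<lambda>k. ennreal (hb_weight A k h))"
  have m: "(\<lambda>k. glue A k h) \<in> ?P \<rightarrow>\<^sub>M sps"
    unfolding measurable_point_measure_eq1 using glue_cfg[OF A(2) h] by auto
  have "emeasure ?P (space ?P) = ennreal (\<Sum>k\<in>?C. hb_weight A k h)"
    using finite_spins[OF A(1)] hb_weight_sum(1)[OF A(1)]
    by (simp add: space_point_measure emeasure_point_measure_finite sum_ennreal)
  then have "prob_space ?P" unfolding hb_weight_sum(2)[OF A(1)] by (intro prob_spaceI) simp
  then show "prob_space (hb_kernel A h)" unfolding hb_kernel_def by (rule prob_space.prob_space_distr) (rule m)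
  show "sets (hb_kernel A h) = sets sps" by (simp add: hb_kernel_def)
  assume f: "f \<in> borel_measurable sps"
  have "(\<integral>s. f s \<partial>hb_kernel A h) = (\<integral>k. f (glue A k h) \<partial>?P)"
    unfolding hb_kernel_def by (rule integral_distr[OF m f])
  also have "... = (\<Sum>k\<in>?C. hb_weight A k h *\<^sub>R f (glue A k h))"
    by (rule lebesgue_integral_point_measure_finite[OF finite_spins[OF A(1)] hb_weight_sum(1)[OF A(1)]])
  finally show "(\<integral>s. f s \<partial>hb_kernel A h) = heat_bath A f h" unfolding heat_bath_weight[OF A(2) h] by simp
qed

lemma potts_weight_depends:
  "(\<And>e v. e \<in> E ==> e \<inter> A ~= {} ==> v \<in> e ==> s v = t v) ==> pw A s = pw A t"
proof -
  assume eq: "\<And>e v. e \<in> E ==> e \<inter> A ~= {} ==> v \<in> e ==> s v = t v"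
  have "e \<in> mono_edges E s \<longleftrightarrow> e \<in> mono_edges E t" if "e \<in> E" "e \<inter> A ~= {}" for e
    by (rule mono_edges_cong) (rule eq[OF that])
  then have "{e \<in> mono_edges E s. e \<inter> A ~= {}} = {e \<in> mono_edges E t. e \<inter> A ~= {}}"
    unfolding mono_edges_def by blast
  then show ?thesis unfolding potts_weight_def by simp
qed

definition star :: "'v set => 'v set" where
  "star A = \<Union>{e\<in>E. e \<inter> A ~= {}}"

lemma star_props:
  assumes "finite A" "A \<subseteq> V"
  shows "finite (star A)" "star A \<subseteq> V"
proof -
  have "{e\<in>E. e \<inter> A ~= {}} = (\<Union>v\<in>A. {e\<in>E. v \<in> e})" by blast
  then have "finite {e\<in>E. e \<inter> A ~= {}}" using assms deg by auto
  then show "finite (star A)" unfolding star_def using finite_edge by blast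
  show "star A \<subseteq> V" unfolding star_def using edge_subset by blast
qed

lemma hb_weight_depends: "depends_on (star A) (hb_weight A k)"
  unfolding depends_on_def
proof (intro allI impI)
  fix s t :: "'v => nat" assume eq: "\<forall>v\<in>star A. s v = t v"
  have "pw A (glue A k s) = pw A (glue A k t)" for k
    by (rule potts_weight_depends) (use eq in \<open>auto simp: glue_def star_def\<close>)
  then show "hb_weight A k s = hb_weight A k t" unfolding hb_weight_def by simp
qed

lemma glue_depends: "depends_on S f ==> depends_on S (\<lambda>h. f (glue A k h))"
  unfolding depends_on_def glue_def by simp

lemma hb_sum_depends:
  assumes "depends_on S f"
  shows "depends_on (S \<union> star A) (\<lambda>h. \<Sum>k\<in>spins q A. hb_weight A k h * f (glue A k h))"
  unfolding depends_on_def
proof (intro allI impI sum.cong refl arg_cong2[where f = "(*)"])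
  fix s t k :: "'v => nat" assume eq: "\<forall>v\<in>S \<union> star A. s v = t v"
  show "hb_weight A k s = hb_weight A k t"
    using hb_weight_depends[of A k] eq unfolding depends_on_def by blast
  show "f (glue A k s) = f (glue A k t)"
    using glue_depends[OF assms, of A k] eq unfolding depends_on_def by blast
qed

lemma hb_kernel_measurable:
  assumes A: "finite A" "A \<subseteq> V"
  shows "hb_kernel A \<in> sps \<rightarrow>\<^sub>M prob_algebra sps"
proof (rule kernel_measurableI)
  fix S and f :: "'v obs" assume S: "finite S" "S \<subseteq> V" "depends_on S f"
  let ?g = "\<lambda>h. \<Sum>k\<in>spins q A. hb_weight A k h * f (glue A k h)"
  have eq: "(\<integral>s. f s \<partial>hb_kernel A h) = ?g h" if "h \<in> space sps" for h
    using hb_kernel_props(3)[OF A _ depends_on_measurable[OF S, of q]] heat_bath_weight[OF A(2)] that by simp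
  have "?g \<in> borel_measurable sps"
    by (rule depends_on_measurable[OF _ _ hb_sum_depends[OF S(3)]]) (use S star_props[OF A] in auto)
  then show "(\<lambda>h. \<integral>s. f s \<partial>hb_kernel A h) \<in> borel_measurable sps"
    by (subst measurable_cong[OF eq])
qed (use hb_kernel_props[OF A] in auto)

lemma heat_bath_indicator:
  assumes "finite B" "B \<subseteq> V" "h \<in> cfg"
  shows "potts_bc_prob V E q \<beta> B h A = heat_bath B (indicator A) h"
proof -
  have fin: "finite (bc_configs V q B h)"
    using bij_betw_finite[OF glue_bij[OF assms(2,3)]] finite_spins[OF assms(1)] by simp
  show ?thesis
    unfolding potts_bc_prob_def heat_bath_def sum.inter_restrict[OF fin]
    by (intro arg_cong2[where f = "(/)"] sum.cong refl) (auto simp: indicator_def)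
qed

text \<open>The DLR equation for a region says that one heat-bath step there leaves the measure
  invariant. In this form it can be tested on local functions and passes to limits.\<close>

lemma potts_gibbs_iff:
  "potts_gibbs V E q \<beta> M \<longleftrightarrow> prob_space M \<and> sets M = sets sps \<and>
    (\<forall>B. finite B --> B \<subseteq> V --> M \<bind> hb_kernel B = M)"
proof -
  have *: "measure (M \<bind> hb_kernel B) A = (\<integral>h. potts_bc_prob V E q \<beta> B h A \<partial>M)"
    if M: "prob_space M" "sets M = sets sps" and B: "finite B" "B \<subseteq> V" and A: "A \<in> sets sps" for B A
  proof -
    interpret prob_space M by fact
    have K: "hb_kernel B \<in> M \<rightarrow>\<^sub>M prob_algebra sps"
      using hb_kernel_measurable[OF B] measurable_cong_sets[OF M(2) refl] by blast
    have "measure (M \<bind> hb_kernel B) A = (\<integral>h. measure (hb_kernel B h) A \<partial>M)"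
      by (rule measure_bind[OF measurable_prob_algebraD[OF K] A])
    also have "... = (\<integral>h. potts_bc_prob V E q \<beta> B h A \<partial>M)"
    proof (rule bochner_cong[OF refl])
      fix h assume "h \<in> space M"
      then have h: "h \<in> cfg" using sets_eq_imp_space_eq[OF M(2)] by simp
      have sp: "space (hb_kernel B h) = cfg" using sets_eq_imp_space_eq[OF hb_kernel_props(2)[OF B h]] by simp
      have "measure (hb_kernel B h) A = (\<integral>x. indicator A x \<partial>hb_kernel B h)"
        using sets.sets_into_space[OF A] sp by (simp add: Int_absorb2)
      also have "... = heat_bath B (indicator A) h" by (rule hb_kernel_props(3)[OF B h]) (use A in simp)
      finally show "measure (hb_kernel B h) A = potts_bc_prob V E q \<beta> B h A"
        unfolding heat_bath_indicator[OF B h] .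
    qed
    finally show ?thesis .
  qed
  show ?thesis
  proof
    assume g: "potts_gibbs V E q \<beta> M"
    then have M: "prob_space M" "sets M = sets sps" unfolding potts_gibbs_def by auto
    have "M \<bind> hb_kernel B = M" if B: "finite B" "B \<subseteq> V" for B
    proof (rule measure_eqI)
      interpret M: prob_space M by fact
      interpret N: prob_space "M \<bind> hb_kernel B" by (rule bind_props[OF M hb_kernel_measurable[OF B]])
      show s: "sets (M \<bind> hb_kernel B) = sets M" using bind_props(2)[OF M hb_kernel_measurable[OF B]] M(2) by simp
      fix A assume "A \<in> sets (M \<bind> hb_kernel B)"
      then have A: "A \<in> sets sps" using s M(2) by simp
      have "measure (M \<bind> hb_kernel B) A = measure M A"
        using *[OF M B A] g B A unfolding potts_gibbs_def by simp
      then show "emeasure (M \<bind> hb_kernel B) A = emeasure M A"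
        by (simp add: M.emeasure_eq_measure N.emeasure_eq_measure)
    qed
    then show "prob_space M \<and> sets M = sets sps \<and> (\<forall>B. finite B --> B \<subseteq> V --> M \<bind> hb_kernel B = M)"
      using M by blast
  next
    assume g: "prob_space M \<and> sets M = sets sps \<and> (\<forall>B. finite B --> B \<subseteq> V --> M \<bind> hb_kernel B = M)"
    then have M: "prob_space M" "sets M = sets sps" by auto
    have "measure M A = (\<integral>h. potts_bc_prob V E q \<beta> B h A \<partial>M)"
      if "finite B" "B \<subseteq> V" "A \<in> sets sps" for B A
      using *[OF M that] g that by simp
    then show "potts_gibbs V E q \<beta> M" unfolding potts_gibbs_def using M by blast
  qed
qed

lemma gibbs_heat_bath:
  assumes g: "potts_gibbs V E q \<beta> M" and A: "finite A" "A \<subseteq> V" and S: "finite S" "S \<subseteq> V" "depends_on S f"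
  shows "(\<integral>h. heat_bath A f h \<partial>M) = (\<integral>h. f h \<partial>M)"
proof -
  have M: "prob_space M" "sets M = sets sps" and b: "M \<bind> hb_kernel A = M"
    using g A unfolding potts_gibbs_iff by auto
  obtain B where B: "B >= 0" "\<And>s. s \<in> spins q S ==> \<bar>f s\<bar> <= B" "\<And>s. s \<in> cfg ==> \<bar>f s\<bar> <= B"
    by (rule local_bounded[OF S(1,3,2)]) (rule that)
  have "(\<integral>h. f h \<partial>M) = (\<integral>h. f h \<partial>(M \<bind> hb_kernel A))" unfolding b ..
  also have "... = (\<integral>h. (\<integral>s. f s \<partial>hb_kernel A h) \<partial>M)"
    by (rule integral_bind_local[OF M hb_kernel_measurable[OF A] depends_on_measurable[OF S, of q] B(3)])
  also have "... = (\<integral>h. heat_bath A f h \<partial>M)"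
    by (intro bochner_cong refl hb_kernel_props(3)[OF A _ depends_on_measurable[OF S, of q]])
       (use sets_eq_imp_space_eq[OF M(2)] in simp)
  finally show ?thesis by simp
qed

lemma gibbsI:
  assumes M: "prob_space M" "sets M = sets sps"
    and eq: "\<And>A S f. finite A ==> A \<subseteq> V ==> finite S ==> S \<subseteq> V ==> depends_on S f ==>
      (\<integral>h. heat_bath A f h \<partial>M) = (\<integral>h. f h \<partial>M)"
  shows "potts_gibbs V E q \<beta> M"
  unfolding potts_gibbs_iff
proof (intro conjI M allI impI)
  fix A assume A: "finite A" "A \<subseteq> V"
  show "M \<bind> hb_kernel A = M"
  proof (rule bind_eqI[OF M hb_kernel_measurable[OF A]])
    fix S f assume S: "finite S" "S \<subseteq> V" "depends_on S f"
    have "(\<integral>h. (\<integral>s. f s \<partial>hb_kernel A h) \<partial>M) = (\<integral>h. heat_bath A f h \<partial>M)"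
      by (intro bochner_cong refl hb_kernel_props(3)[OF A _ depends_on_measurable[OF S, of q]])
         (use sets_eq_imp_space_eq[OF M(2)] in simp)
    also have "... = (\<integral>h. f h \<partial>M)" by (rule eq[OF A S])
    finally show "(\<integral>h. (\<integral>s. f s \<partial>hb_kernel A h) \<partial>M) = (\<integral>h. f h \<partial>M)" .
  qed
qed

lemma integral_near_value:
  assumes M: "prob_space M" "sets M = sets sps" and o: "osc_bound S c f" and s: "s \<in> cfg"
  shows "\<bar>(\<integral>h. f h \<partial>M) - f s\<bar> <= (\<Sum>v\<in>S. c v)"
proof -
  interpret prob_space M by fact
  have S: "finite S" "S \<subseteq> V" "depends_on S f" using o unfolding osc_bound_def by auto
  have int: "integrable M f" by (rule local_integrable[OF M S])
  have b: "\<bar>f h - f s\<bar> <= (\<Sum>v\<in>S. c v)" if "h \<in> space M" for h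
    using osc_bound_total[OF o _ s] that sets_eq_imp_space_eq[OF M(2)] by simp
  have "(\<integral>h. f h \<partial>M) <= (\<integral>h. f s + (\<Sum>v\<in>S. c v) \<partial>M)"
    by (rule integral_mono[OF int]) (use b in \<open>auto simp: abs_le_iff field_simps\<close>)
  moreover have "(\<integral>h. f s - (\<Sum>v\<in>S. c v) \<partial>M) <= (\<integral>h. f h \<partial>M)"
    by (rule integral_mono[OF _ int]) (use b in \<open>auto simp: abs_le_iff field_simps\<close>)
  ultimately show ?thesis by (simp add: prob_space abs_le_iff)
qed

text \<open>Both measures are invariant under site averages, so the difference of their expectations
  has no error term. Dobrushin's method with \<open>B = 0\<close> then forces it to vanish on every
  local function.\<close>

theorem gibbs_unique:
  assumes small: "2 * real \<Delta> * infl <= 1" and M: "potts_gibbs V E q \<beta> M" and N: "potts_gibbs V E q \<beta> N"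
  shows "M = N"
proof -
  note M' = conjunct1[OF M[unfolded potts_gibbs_def]] conjunct1[OF conjunct2[OF M[unfolded potts_gibbs_def]]]
  note N' = conjunct1[OF N[unfolded potts_gibbs_def]] conjunct1[OF conjunct2[OF N[unfolded potts_gibbs_def]]]
  have "\<exists>s. s \<in> cfg" using spins_nonempty[of V] by (rule ex_in_conv[THEN iffD2])
  then obtain s where s: "s \<in> cfg" ..
  have inf0: "infl >= 0" using beta_pos by (simp add: infl_def)
  show ?thesis
  proof (rule measure_eqI_local[OF M' N'])
    fix S f assume S: "finite S" "S \<subseteq> V" "depends_on S f"
    let ?D = "\<lambda>f. \<bar>(\<integral>h. f h \<partial>M) - (\<integral>h. f h \<partial>N)\<bar>"
    obtain k where o: "osc_bound S k f" by (rule osc_bound_exists[OF S]) (rule that)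
    have "?D f <= 2 * 0 * (\<Sum>v\<in>S. 1 * k v)"
    proof (rule dobrushin[where \<theta> = "\<lambda>_. 1" and b = "\<lambda>_. 0" and c = 2, OF _ _ _ _ _ _ o])
      show "infl * (\<Sum>u\<in>nbrs v. 1) <= 1 / 2" if "v \<in> V" for v
      proof -
        have "infl * real (card (nbrs v)) <= infl * real \<Delta>"
          using card_nbrs[OF that] inf0 by (intro mult_left_mono) auto
        then show ?thesis using small by (simp add: algebra_simps)
      qed
      show "?D f <= 2 * (\<Sum>v\<in>S. 1 * k v)" if "osc_bound S k f" for S k f
        using integral_near_value[OF M' that s] integral_near_value[OF N' that s] by simp
      show "?D f <= ?D (site_avg v f) + k v * 0" if o: "osc_bound S k f" and v: "v \<in> S" for S k f v
      proof -
        have S: "finite S" "S \<subseteq> V" "depends_on S f" using o unfolding osc_bound_def by auto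
        have vV: "v \<in> V" "finite {v}" "{v} \<subseteq> V" using v S by auto
        have "(\<integral>h. site_avg v f h \<partial>L) = (\<integral>h. f h \<partial>L)" if L: "potts_gibbs V E q \<beta> L" for L
        proof -
          have "space L = cfg" using L sets_eq_imp_space_eq[of L sps] unfolding potts_gibbs_def by simp
          then have "(\<integral>h. site_avg v f h \<partial>L) = (\<integral>h. heat_bath {v} f h \<partial>L)"
            by (intro bochner_cong refl heat_bath_single[OF vV(1), symmetric])
               simp
          then show ?thesis using gibbs_heat_bath[OF L vV(2,3) S] by simp
        qed
        then show ?thesis using M N by simp
      qed
    qed auto
    then show "(\<integral>s. f s \<partial>M) = (\<integral>s. f s \<partial>N)" by simp
  qed
qed

end

subsection \<open>Measures from functionals on local functions\<close>

context sw_graph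
begin

text \<open>Kolmogorov's extension: the values of \<open>l\<close> on cylinder indicators are
  consistent finite-dimensional laws. The extension is carried out over the reals, so spins are
  encoded as real numbers and decoded afterwards.\<close>

lemma local_functional_measure:
  fixes l :: "'v obs => real"
  assumes cong: "\<And>f g. (\<And>s. s \<in> cfg ==> f s = g s) ==> l f = l g"
    and lsum: "\<And>S I c f. finite S ==> S \<subseteq> V ==> (\<And>i. depends_on S (f i)) ==>
      l (\<lambda>s. \<Sum>i\<in>I. c i * f i s) = (\<Sum>i\<in>(I :: ('v => nat) set). c i * l (f i))"
    and pos: "\<And>S f. finite S ==> S \<subseteq> V ==> depends_on S f ==> (\<And>s. 0 <= f s) ==> 0 <= l f"
    and one: "l (\<lambda>_. 1) = 1"
  obtains M where "prob_space M" "sets M = sets sps"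
    "\<And>S f. finite S ==> S \<subseteq> V ==> depends_on S f ==> (\<integral>s. f s \<partial>M) = l f"
proof -
  let ?B = "\<lambda>J :: 'v set. PiM J (\<lambda>_. borel :: real measure)"
  define cy where "cy J k s = (of_bool (\<forall>v\<in>J. s v = k v) :: real)" for J :: "'v set" and k s :: "'v => nat"
  have dcy: "depends_on J (cy J k)" for J k unfolding depends_on_def cy_def by auto
  define m where "m J k = l (cy J k)" for J k
  have m0: "0 <= m J k" if "finite J" "J \<subseteq> V" for J k
    unfolding m_def by (rule pos[OF that dcy]) (simp add: cy_def)
  have dec: "f s = (\<Sum>k\<in>spins q J. f k * cy J k s)"
    if J: "finite J" "J \<subseteq> V" "depends_on J f" and s: "s \<in> cfg" for J s and f :: "'v obs"
  proof -
    have r: "restrict s J \<in> spins q J" using J(2) PiE_mem[OF s] by auto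
    have e: "cy J k s = of_bool (k = restrict s J)" if "k \<in> spins q J" for k
    proof -
      have "(\<forall>v\<in>J. s v = k v) \<longleftrightarrow> k = restrict s J"
        using PiE_arb[OF that] by (auto simp: fun_eq_iff)
      then show ?thesis unfolding cy_def by simp
    qed
    have "(\<Sum>k\<in>spins q J. f k * cy J k s) = (\<Sum>k\<in>spins q J. if k = restrict s J then f k else 0)"
      by (intro sum.cong refl) (simp add: e)
    also have "... = f (restrict s J)" using r finite_spins[OF J(1)] by (simp add: sum.delta')
    finally show ?thesis using depends_on_restrict[OF J(3)] by simp
  qed
  have formula: "l f = (\<Sum>k\<in>spins q J. f k * m J k)" if J: "finite J" "J \<subseteq> V" "depends_on J f" for J f
  proof -
    have "l f = l (\<lambda>s. \<Sum>k\<in>spins q J. f k * cy J k s)" by (rule cong) (rule dec[OF J])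
    also have "... = (\<Sum>k\<in>spins q J. f k * m J k)" unfolding m_def by (rule lsum[OF J(1,2) dcy])
    finally show ?thesis .
  qed
  \<comment> \<open>The real-valued encoding of the spins on \<open>J\<close>; the
    finite-dimensional law of a larger set projects to that of \<open>J\<close> because both
    reproduce \<open>l\<close>.\<close>
  define enc where "enc J s = (\<lambda>v\<in>J. real (s v))" for J :: "'v set" and s :: "'v => nat"
  define pm where "pm J = point_measure (spins q J) (\<lambda>k. ennreal (m J k))" for J
  define P where "P J = distr (pm J) (?B J) (enc J)" for J
  have enc_m: "enc J \<in> pm H \<rightarrow>\<^sub>M ?B J" for J H
    unfolding pm_def measurable_point_measure_eq1 enc_def by (auto simp: space_PiM)
  have emP: "emeasure (distr (pm H) (?B J) (enc J)) A = ennreal (l (\<lambda>s. of_bool (enc J s \<in> A)))"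
    if H: "finite H" "H \<subseteq> V" "J \<subseteq> H" and A: "A \<in> sets (?B J)" for H J A
  proof -
    have fin: "finite (spins q H)" by (rule finite_spins[OF H(1)])
    have dep: "depends_on H (\<lambda>s. of_bool (enc J s \<in> A))"
      unfolding depends_on_def
    proof (intro allI impI)
      fix s t :: "'v => nat" assume "\<forall>v\<in>H. s v = t v"
      then have "enc J s = enc J t" using H(3) unfolding enc_def by (intro restrict_ext) auto
      then show "of_bool (enc J s \<in> A) = (of_bool (enc J t \<in> A) :: real)" by simp
    qed
    have sp: "enc J -` A \<inter> space (pm H) = {k \<in> spins q H. enc J k \<in> A}"
      unfolding pm_def space_point_measure by blast
    have "emeasure (distr (pm H) (?B J) (enc J)) A = emeasure (pm H) {k \<in> spins q H. enc J k \<in> A}"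
      unfolding emeasure_distr[OF enc_m A] sp ..
    also have "... = (\<Sum>k\<in>{k \<in> spins q H. enc J k \<in> A}. ennreal (m H k))"
      unfolding pm_def by (rule emeasure_point_measure_finite[OF fin]) blast
    also have "... = (\<Sum>k\<in>spins q H. ennreal (of_bool (enc J k \<in> A) * m H k))"
      unfolding sum.inter_filter[OF fin] by (intro sum.cong refl) simp
    also have "... = ennreal (\<Sum>k\<in>spins q H. of_bool (enc J k \<in> A) * m H k)"
      using m0[OF H(1,2)] by (intro sum_ennreal) simp
    also have "(\<Sum>k\<in>spins q H. of_bool (enc J k \<in> A) * m H k) = l (\<lambda>s. of_bool (enc J s \<in> A))"
      by (rule formula[OF H(1,2) dep, symmetric])
    finally show ?thesis .
  qed
  interpret Q: polish_projective V P
  proof (rule polish_projective.intro, rule projective_family.intro)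
    fix J H :: "'v set" assume JH: "J \<subseteq> H" "finite H" "H \<subseteq> V"
    have J: "finite J" "J \<subseteq> V" using JH finite_subset by auto
    have "distr (P H) (?B J) (\<lambda>f. restrict f J) = distr (pm H) (?B J) ((\<lambda>f. restrict f J) \<circ> enc H)"
      unfolding P_def by (rule distr_distr[OF measurable_restrict_subset[OF JH(1)] enc_m])
    also have "(\<lambda>f. restrict f J) \<circ> enc H = enc J" using JH(1) by (auto simp: enc_def fun_eq_iff)
    finally have e: "distr (P H) (?B J) (\<lambda>f. restrict f J) = distr (pm H) (?B J) (enc J)" .
    show "P J = distr (P H) (?B J) (\<lambda>f. restrict f J)"
      unfolding e
    proof (rule measure_eqI)
      fix A assume "A \<in> sets (P J)"
      then have A: "A \<in> sets (?B J)" by (simp add: P_def)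
      show "emeasure (P J) A = emeasure (distr (pm H) (?B J) (enc J)) A"
        unfolding P_def emP[OF J order_refl A] emP[OF JH(2,3,1) A] ..
    qed (simp add: P_def)
  next
    fix J :: "'v set" assume J: "finite J" "J \<subseteq> V"
    have enc_sp: "enc J s \<in> space (?B J)" for s
      unfolding enc_def space_PiM by auto
    have "emeasure (P J) (space (P J)) = ennreal (l (\<lambda>s. of_bool (enc J s \<in> space (?B J))))"
      unfolding P_def space_distr by (rule emP[OF J order_refl sets.top])
    also have "... = 1" using enc_sp one by simp
    finally show "prob_space (P J)" by (rule prob_spaceI)
  qed
  \<comment> \<open>Rounding down and clamping gives a measurable map defined on all reals that
    always yields an admissible spin and inverts the encoding on spins.\<close>
  define h :: "real => nat" where "h x = nat (max 1 (min (int q) \<lfloor>x\<rfloor>))" for x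
  have h_range: "h x \<in> {1..q}" for x using q1 unfolding h_def by (simp add: nat_le_iff le_nat_iff)
  have h_real: "h (real j) = j" if "j \<in> {1..q}" for j using that unfolding h_def by simp
  have h_m: "h \<in> borel \<rightarrow>\<^sub>M count_space {1..q}"
  proof -
    have "(\<lambda>i::int. nat (max 1 (min (int q) i))) \<in> count_space UNIV \<rightarrow>\<^sub>M count_space {1..q}"
      using q1 by (auto simp: nat_le_iff le_nat_iff)
    from measurable_compose[OF measurable_real_floor this] show ?thesis unfolding h_def .
  qed
  define dc where "dc u = (\<lambda>v\<in>V. h (u v))" for u
  have dc_m: "dc \<in> Q.lim \<rightarrow>\<^sub>M sps"
    unfolding measurable_cong_sets[OF Q.sets_lim refl] dc_def spin_space_def
    by (intro measurable_restrict measurable_compose[OF _ h_m] measurable_component_singleton)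
  define M where "M = distr Q.lim sps dc"
  have M: "prob_space M" "sets M = sets sps"
    unfolding M_def by (auto intro: Q.P.prob_space_distr[OF dc_m])
  have icy: "(\<integral>s. cy J k s \<partial>M) = m J k" if J: "finite J" "J \<subseteq> V" for J k
  proof -
    let ?X = "{x \<in> space (?B J). \<forall>v\<in>J. h (x v) = k v}"
    let ?E = "prod_emb V (\<lambda>_. borel) J ?X"
    have X: "?X \<in> sets (?B J)"
    proof (rule sets.sets_Collect_finite_All[OF _ J(1)])
      fix v assume "v \<in> J"
      then have "(\<lambda>x. h (x v)) \<in> ?B J \<rightarrow>\<^sub>M count_space {1..q}"
        by (intro measurable_compose[OF _ h_m] measurable_component_singleton)
      then have "(\<lambda>x. h (x v)) \<in> ?B J \<rightarrow>\<^sub>M count_space UNIV"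
        by (rule measurable_compose) simp
      then show "{x \<in> space (?B J). h (x v) = k v} \<in> sets (?B J)"
        by measurable
    qed
    have "(\<integral>s. cy J k s \<partial>M) = (\<integral>u. cy J k (dc u) \<partial>Q.lim)"
      unfolding M_def by (rule integral_distr[OF dc_m depends_on_measurable[OF J dcy]])
    also have "... = (\<integral>u. indicator ?E u \<partial>Q.lim)"
    proof (rule bochner_cong[OF refl])
      fix u assume "u \<in> space Q.lim"
      then have "u \<in> space (?B V)" using sets_eq_imp_space_eq[OF Q.sets_lim] by simp
      then have w: "u \<in> extensional V" by (simp add: space_PiM PiE_def)
      have "u \<in> ?E \<longleftrightarrow> (\<forall>v\<in>J. h (u v) = k v)"
        using w by (auto simp: prod_emb_def space_PiM PiE_def)
      moreover have "(\<forall>v\<in>J. dc u v = k v) \<longleftrightarrow> (\<forall>v\<in>J. h (u v) = k v)"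
        using J(2) unfolding dc_def by auto
      ultimately show "cy J k (dc u) = indicator ?E u"
        unfolding cy_def indicator_def by simp
    qed
    also have "... = measure Q.lim ?E"
      by (simp add: Int_absorb2 Q.space_lim prod_emb_def space_PiM)
    also have "... = measure (P J) ?X" by (rule Q.measure_lim_emb[OF J(2,1) X])
    also have "... = l (\<lambda>s. of_bool (enc J s \<in> ?X))"
    proof -
      have "0 <= l (\<lambda>s. of_bool (enc J s \<in> ?X))"
        by (rule pos[OF J]) (auto simp: depends_on_def enc_def cong: restrict_cong)
      then show ?thesis using emP[OF J order_refl X] by (simp add: measure_def P_def)
    qed
    also have "... = m J k"
      unfolding m_def
    proof (rule cong)
      fix s assume s: "s \<in> cfg"
      have "h (enc J s v) = s v" if "v \<in> J" for v
        using h_real[OF PiE_mem[OF s, of v]] that J(2) unfolding enc_def by auto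
      moreover have "enc J s \<in> space (?B J)" unfolding enc_def space_PiM by auto
      ultimately show "of_bool (enc J s \<in> ?X) = cy J k s" unfolding cy_def by simp
    qed
    finally show ?thesis .
  qed
  show thesis
  proof (rule that[OF M])
    fix S f assume S: "finite S" "S \<subseteq> V" "depends_on S f"
    have "(\<integral>s. f s \<partial>M) = (\<integral>s. (\<Sum>k\<in>spins q S. f k * cy S k s) \<partial>M)"
      by (rule bochner_cong[OF refl], rule dec[OF S])
         (use sets_eq_imp_space_eq[OF M(2)] in simp)
    also have "... = (\<Sum>k\<in>spins q S. \<integral>s. f k * cy S k s \<partial>M)"
      by (rule Bochner_Integration.integral_sum)
         (intro integrable_mult_right local_integrable[OF M S(1,2) dcy])
    also have "... = (\<Sum>k\<in>spins q S. f k * m S k)"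
      by (intro sum.cong refl) (simp add: icy[OF S(1,2)])
    also have "... = l f" by (rule formula[OF S, symmetric])
    finally show "(\<integral>s. f s \<partial>M) = l f" .
  qed
qed

end

subsection \<open>The infinite-volume limit\<close>

context sw_lattice
begin

definition tm :: "nat => (nat => int) => (nat => int) obs => real" where
  "tm n a f = T.gmean n (\<lambda>t. f (per n a t))"

lemma tm_cong: "(\<And>s. s \<in> L.cfg ==> f s = g s) ==> tm n a f = tm n a g"
  unfolding tm_def by (rule T.gmean_cong) (simp add: per_cfg)

lemma tm_heat_bath:
  assumes "finite A" "A \<subseteq> LV" "finite S" "S \<subseteq> LV" "depends_on S f"
  shows "\<forall>\<^sub>F n in sequentially. \<forall>a. tm n a (L.heat_bath A f) = tm n a f"
proof -
  have "finite (A \<union> S)" "A \<union> S \<subseteq> LV" using assms by auto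
  then obtain r where r: "A \<union> S \<subseteq> box d r" using finite_sub_box by blast
  have f: "depends_on (box d r) f" using assms(5) r unfolding depends_on_def by blast
  have "tm n a (L.heat_bath A f) = tm n a f" if n: "2 * (r + 1) <= n" for n a
  proof -
    have "tm n a (L.heat_bath A f) = T.gmean n (T.heat_bath n (tp n a ` A) (\<lambda>t. f (t \<circ> tp n a)))"
      unfolding tm_def by (rule T.gmean_cong, rule heat_bath_compare[OF _ f]) (use r n in auto)
    also have "... = T.gmean n (\<lambda>t. f (t \<circ> tp n a))" by (rule T.gmean_heat_bath)
    also have "... = tm n a f" unfolding tm_def per_local[OF assms(5,4)] ..
    finally show ?thesis .
  qed
  then show ?thesis unfolding eventually_sequentially by blast
qed

lemma tm_site_avg:
  assumes "v \<in> LV" "finite S" "S \<subseteq> LV" "depends_on S f"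
  shows "\<forall>\<^sub>F n in sequentially. \<forall>a. tm n a (L.site_avg v f) = tm n a f"
proof -
  have "tm n a (L.heat_bath {v} f) = tm n a (L.site_avg v f)" for n a
    by (rule tm_cong) (rule L.heat_bath_single[OF assms(1)])
  then show ?thesis using tm_heat_bath[of "{v}", OF _ _ assms(2-4)] assms(1) by simp
qed

lemma tm_near_value:
  assumes o: "L.osc_bound S b f" and s: "s \<in> L.cfg"
  shows "\<bar>tm n a f - f s\<bar> <= (\<Sum>v\<in>S. b v)"
proof -
  have "tm n a f - f s = T.gmean n (\<lambda>t. f (per n a t) - f s)"
    unfolding tm_def T.gmean_diff T.gmean_const ..
  then show ?thesis using T.abs_gmean_le[of n "\<lambda>t. f (per n a t) - f s"] L.osc_bound_total[OF o per_cfg s] by simp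
qed

lemma L_cfg_ex: "\<exists>s. s \<in> L.cfg"
  using L.spins_nonempty[of LV] by (rule ex_in_conv[THEN iffD2])

lemma infl_lat: "2 * real (2 * d) * L.infl <= 1"
  using beta_infl d1 beta_gt_0 unfolding L.infl_def by (simp add: algebra_simps)

text \<open>The eventual bounds for the oscillation of torus means over pairs of sizes and base
  points; the infimum is the asymptotic oscillation. Ranging over all base points takes the place of
  translation invariance.\<close>

definition osc_set :: "(nat => int) obs => real set" where
  "osc_set f = {e. 0 <= e \<and> (\<exists>n0. \<forall>n\<ge>n0. \<forall>m\<ge>n0. \<forall>a b. \<bar>tm n a f - tm m b f\<bar> <= e)}"

lemma osc_set_bdd: "bdd_below (osc_set f)"
  unfolding osc_set_def by (rule bdd_belowI[of _ 0]) blast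

lemma osc_set_mem:
  assumes "L.osc_bound S c f"
  shows "2 * (\<Sum>v\<in>S. c v) \<in> osc_set f"
proof -
  obtain s where s: "s \<in> L.cfg" using L_cfg_ex ..
  have "\<bar>tm n a f - tm m b f\<bar> <= 2 * (\<Sum>v\<in>S. c v)" for n m a b
    using tm_near_value[OF assms s, of n a] tm_near_value[OF assms s, of m b] by simp
  moreover have "0 <= (\<Sum>v\<in>S. c v)" using assms unfolding L.osc_bound_def by (intro sum_nonneg) blast
  ultimately show ?thesis unfolding osc_set_def by simp
qed

lemma osc_set_site_avg:
  assumes o: "L.osc_bound S c f" and v: "v \<in> S"
  shows "osc_set (L.site_avg v f) \<subseteq> osc_set f"
proof
  fix e assume "e \<in> osc_set (L.site_avg v f)"
  then obtain n0 where e: "0 <= e"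
    and n0: "\<And>n m a b. n0 <= n ==> n0 <= m ==> \<bar>tm n a (L.site_avg v f) - tm m b (L.site_avg v f)\<bar> <= e"
    unfolding osc_set_def by blast
  have S: "finite S" "S \<subseteq> LV" "depends_on S f" using o unfolding L.osc_bound_def by auto
  obtain n1 where n1: "\<And>n a. n1 <= n ==> tm n a (L.site_avg v f) = tm n a f"
    using tm_site_avg[OF subsetD[OF S(2) v] S] unfolding eventually_sequentially by blast
  have "\<bar>tm n a f - tm m b f\<bar> <= e" if "max n0 n1 <= n" "max n0 n1 <= m" for n m a b
    using n0[of n m a b] n1[of n a] n1[of m b] that by simp
  then show "e \<in> osc_set f" unfolding osc_set_def using e by blast
qed

text \<open>A site average leaves the torus mean exactly unchanged once the torus is large, so it
  does not increase the asymptotic oscillation. Dobrushin's method with \<open>B = 0\<close>,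
  applied to this nonlinear functional, shows that it is at most zero.\<close>

lemma tm_cauchy:
  assumes S: "finite S" "S \<subseteq> LV" "depends_on S f" and e: "e > 0"
  shows "\<exists>n0. \<forall>n\<ge>n0. \<forall>m\<ge>n0. \<forall>a b. \<bar>tm n a f - tm m b f\<bar> <= e"
proof -
  obtain h where o: "L.osc_bound S h f" by (rule L.osc_bound_exists[OF S]) (rule that)
  have inf0: "L.infl >= 0" using beta_gt_0 by (simp add: L.infl_def)
  have "Inf (osc_set f) <= 2 * 0 * (\<Sum>v\<in>S. 1 * h v)"
  proof (rule L.dobrushin[where \<theta> = "\<lambda>_. 1" and b = "\<lambda>_. 0" and c = 2 and D = "\<lambda>f. Inf (osc_set f)", OF _ _ _ _ _ _ o])
    show "L.infl * (\<Sum>u\<in>L.nbrs v. 1) <= 1 / 2" if "v \<in> LV" for v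
    proof -
      have "L.infl * real (card (L.nbrs v)) <= L.infl * real (2 * d)"
        using L.card_nbrs[OF that] inf0 by (intro mult_left_mono) (auto simp: of_nat_le_iff[symmetric] simp del: of_nat_le_iff)
      then show ?thesis using infl_lat by (simp add: algebra_simps)
    qed
    show "Inf (osc_set f) <= 2 * (\<Sum>v\<in>S. 1 * h v)" if "L.osc_bound S h f" for S h f
      using cInf_lower[OF osc_set_mem[OF that] osc_set_bdd] by simp
    show "Inf (osc_set f) <= Inf (osc_set (L.site_avg v f)) + h v * 0" if o: "L.osc_bound S h f" and v: "v \<in> S" for S h f v
    proof -
      have "osc_set (L.site_avg v f) ~= {}" using osc_set_mem[OF L.osc_bound_site_avg[OF o v]] by blast
      then show ?thesis using cInf_superset_mono[OF _ osc_set_bdd osc_set_site_avg[OF o v]] by simp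
    qed
  qed auto
  then have "Inf (osc_set f) < e" using e by simp
  moreover have "osc_set f ~= {}" using osc_set_mem[OF o] by blast
  ultimately obtain x where "x \<in> osc_set f" "x < e" using cInf_lessD by blast
  then obtain n0 where "\<forall>n\<ge>n0. \<forall>m\<ge>n0. \<forall>a b. \<bar>tm n a f - tm m b f\<bar> <= x" unfolding osc_set_def by blast
  then have "\<forall>n\<ge>n0. \<forall>m\<ge>n0. \<forall>a b. \<bar>tm n a f - tm m b f\<bar> <= e"
    using \<open>x < e\<close> by (meson less_imp_le order_trans)
  then show ?thesis ..
qed

definition lm :: "(nat => int) obs => real" where
  "lm f = lim (\<lambda>n. tm n (\<lambda>_. 0) f)"

lemma tm_lim:
  assumes S: "finite S" "S \<subseteq> LV" "depends_on S f"
  shows "(\<lambda>n. tm n (\<lambda>_. 0) f) \<longlonglongrightarrow> lm f"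
proof -
  have "Cauchy (\<lambda>n. tm n (\<lambda>_. 0) f)"
  proof (rule CauchyI')
    fix e :: real assume "e > 0"
    then have "e / 2 > 0" by simp
    then obtain n0 where n0: "\<And>n m a b. n0 <= n ==> n0 <= m ==> \<bar>tm n a f - tm m b f\<bar> <= e / 2"
      using tm_cauchy[OF S] by blast
    have "dist (tm m (\<lambda>_. 0) f) (tm n (\<lambda>_. 0) f) < e" if "n0 <= m" "m < n" for m n
      using n0[of m n "\<lambda>_. 0" "\<lambda>_. 0"] that \<open>e > 0\<close> by (simp add: dist_real_def)
    then show "\<exists>M. \<forall>m\<ge>M. \<forall>n>m. dist (tm m (\<lambda>_. 0) f) (tm n (\<lambda>_. 0) f) < e" by blast
  qed
  then show ?thesis unfolding lm_def using Cauchy_convergent convergent_LIMSEQ_iff by blast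
qed

lemma tm_lim_unif:
  assumes S: "finite S" "S \<subseteq> LV" "depends_on S f" and e: "e > 0"
  shows "\<forall>\<^sub>F n in sequentially. \<forall>a. \<bar>tm n a f - lm f\<bar> <= e"
proof -
  obtain n0 where n0: "\<And>n m a b. n0 <= n ==> n0 <= m ==> \<bar>tm n a f - tm m b f\<bar> <= e"
    using tm_cauchy[OF S e] by blast
  have "\<bar>tm n a f - lm f\<bar> <= e" if "n0 <= n" for n a
  proof (rule LIMSEQ_le_const2)
    show "(\<lambda>m. \<bar>tm n a f - tm m (\<lambda>_. 0) f\<bar>) \<longlonglongrightarrow> \<bar>tm n a f - lm f\<bar>"
      by (intro tendsto_intros tm_lim[OF S])
    show "\<exists>N. \<forall>m\<ge>N. \<bar>tm n a f - tm m (\<lambda>_. 0) f\<bar> <= e" using n0[OF that] by blast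
  qed
  then show ?thesis unfolding eventually_sequentially by blast
qed

lemma lm_unique:
  assumes S: "finite S" "S \<subseteq> LV" "depends_on S f" and S': "finite S'" "S' \<subseteq> LV" "depends_on S' g"
    and eq: "\<forall>\<^sub>F n in sequentially. tm n (\<lambda>_. 0) f = tm n (\<lambda>_. 0) g"
  shows "lm f = lm g"
proof (rule LIMSEQ_unique[OF tm_lim[OF S]])
  show "(\<lambda>n. tm n (\<lambda>_. 0) f) \<longlonglongrightarrow> lm g"
    using tm_lim[OF S'] tendsto_cong[OF eq] by blast
qed

lemma infinite_volume_measure:
  obtains M where "prob_space M" "sets M = sets L.sps"
    "\<And>S f. finite S ==> S \<subseteq> LV ==> depends_on S f ==> (\<integral>s. f s \<partial>M) = lm f"
proof (rule L.local_functional_measure[of lm])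
  show "lm f = lm g" if "\<And>s. s \<in> L.cfg ==> f s = g s" for f g
    unfolding lm_def using tm_cong[OF that] by simp
  show "lm (\<lambda>s. \<Sum>i\<in>I. c i * f i s) = (\<Sum>i\<in>I. c i * lm (f i))"
    if S: "finite S" "S \<subseteq> LV" "\<And>i. depends_on S (f i)" for S I c and f :: "((nat => int) => nat) => _"
    unfolding lm_def[of "\<lambda>s. \<Sum>i\<in>I. c i * f i s"]
  proof (rule limI)
    have "(\<lambda>n. \<Sum>i\<in>I. c i * tm n (\<lambda>_. 0) (f i)) \<longlonglongrightarrow> (\<Sum>i\<in>I. c i * lm (f i))"
      by (intro tendsto_intros tm_lim[OF S(1,2) S(3)])
    then show "(\<lambda>n. tm n (\<lambda>_. 0) (\<lambda>s. \<Sum>i\<in>I. c i * f i s)) \<longlonglongrightarrow> (\<Sum>i\<in>I. c i * lm (f i))"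
      unfolding tm_def T.gmean_sum T.gmean_cmult .
  qed
  show "0 <= lm f" if S: "finite S" "S \<subseteq> LV" "depends_on S f" and f: "\<And>s. 0 <= f s" for S f
  proof (rule LIMSEQ_le_const[OF tm_lim[OF S]])
    have "0 <= tm n (\<lambda>_. 0) f" for n
      using T.gmean_mono[of n "\<lambda>_. 0" "\<lambda>t. f (per n (\<lambda>_. 0) t)"] f unfolding tm_def by simp
    then show "\<exists>N. \<forall>n\<ge>N. 0 <= tm n (\<lambda>_. 0) f" by blast
  qed
  show "lm (\<lambda>_. 1) = 1" unfolding lm_def tm_def by simp
qed (rule that)

definition mu :: "((nat => int) => nat) measure" where
  "mu = the_potts_gibbs LV LE q \<beta>"

text \<open>The measure built from the limits of torus means satisfies the DLR equations, since
  these hold exactly on large tori. Uniqueness identifies it with the measure selected by the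
  definite description.\<close>

theorem mu_props:
  shows "potts_gibbs LV LE q \<beta> mu"
    and "finite S ==> S \<subseteq> LV ==> depends_on S f ==> (\<integral>s. f s \<partial>mu) = lm f"
proof -
  obtain M where M: "prob_space M" "sets M = sets L.sps"
    and int: "\<And>S f. finite S ==> S \<subseteq> LV ==> depends_on S f ==> (\<integral>s. f s \<partial>M) = lm f"
    by (rule infinite_volume_measure) (rule that)
  have g: "potts_gibbs LV LE q \<beta> M"
  proof (rule L.gibbsI[OF M])
    fix A S f assume A: "finite A" "A \<subseteq> LV" and S: "finite S" "S \<subseteq> LV" "depends_on S f"
    let ?g = "\<lambda>h. \<Sum>k\<in>spins q A. L.hb_weight A k h * f (glue A k h)"
    have g: "finite (S \<union> L.star A)" "S \<union> L.star A \<subseteq> LV" "depends_on (S \<union> L.star A) ?g"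
      using S L.star_props[OF A] L.hb_sum_depends[OF S(3)] by auto
    have "(\<integral>h. L.heat_bath A f h \<partial>M) = (\<integral>h. ?g h \<partial>M)"
      by (intro bochner_cong refl L.heat_bath_weight[OF A(2)])
         (use sets_eq_imp_space_eq[OF M(2)] in simp)
    also have "... = lm ?g" by (rule int[OF g])
    also have "... = lm f"
    proof (rule lm_unique[OF g S])
      have "tm n a (L.heat_bath A f) = tm n a ?g" for n a
        by (rule tm_cong) (rule L.heat_bath_weight[OF A(2)])
      then show "\<forall>\<^sub>F n in sequentially. tm n (\<lambda>_. 0) ?g = tm n (\<lambda>_. 0) f"
        using tm_heat_bath[OF A S] by (auto elim: eventually_mono)
    qed
    also have "... = (\<integral>h. f h \<partial>M)" by (rule int[OF S, symmetric])
    finally show "(\<integral>h. L.heat_bath A f h \<partial>M) = (\<integral>h. f h \<partial>M)" .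
  qed
  have "mu = M"
    unfolding mu_def the_potts_gibbs_def
    by (rule the_equality[where P = "potts_gibbs LV LE q \<beta>", OF g]) (rule L.gibbs_unique[OF infl_lat _ g])
  then show "potts_gibbs LV LE q \<beta> mu"
    and "finite S ==> S \<subseteq> LV ==> depends_on S f ==> (\<integral>s. f s \<partial>mu) = lm f"
    using g int by auto
qed

lemma mu_prob: "prob_space mu" and mu_sets: "sets mu = sets L.sps"
  using conjunct1[OF mu_props(1)[unfolded potts_gibbs_def]]
    conjunct1[OF conjunct2[OF mu_props(1)[unfolded potts_gibbs_def]]] .

lemma mu_space: "space mu = L.cfg"
  using sets_eq_imp_space_eq[OF mu_sets] by simp

lemma tm_converges:
  assumes S: "finite S" "S \<subseteq> LV" "depends_on S f" and e: "e > 0"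
  shows "\<forall>\<^sub>F n in sequentially. \<forall>a. \<bar>tm n a f - (\<integral>s. f s \<partial>mu)\<bar> <= e"
  unfolding mu_props(2)[OF S] by (rule tm_lim_unif[OF S e])

end

subsection \<open>Uniform limits of local functions\<close>

lemma (in fin_sw_graph) sw_op_close:
  assumes "\<And>t. t \<in> cfg ==> \<bar>f t - g t\<bar> <= e"
  shows "\<bar>sw_op f s - sw_op g s\<bar> <= e"
proof -
  interpret S: prob_space "sw s" by (rule prob_space_sw)
  have c: "sw_op (\<lambda>t. e) s = e" by (simp add: S.prob_space)
  have "sw_op f s <= sw_op (\<lambda>t. g t + e) s" by (rule sw_op_mono) (use assms in \<open>force simp: abs_le_iff\<close>)
  moreover have "sw_op g s <= sw_op (\<lambda>t. f t + e) s" by (rule sw_op_mono) (use assms in \<open>force simp: abs_le_iff\<close>)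
  ultimately show ?thesis unfolding sw_op_add c by (simp add: abs_le_iff)
qed

context sw_lattice
begin

abbreviation Pop :: "(nat => int) obs => (nat => int) obs" where
  "Pop f s \<equiv> (\<integral>t. f t \<partial>L.sw s)"

text \<open>Uniform local approximation: \<open>F n a\<close> lives on the torus of side \<open>n + 3\<close> and corresponds to \<open>f\<close> seen from
  the site \<open>a\<close>; the approximation has to be uniform in \<open>a\<close>.\<close>

definition lapprox ::
  "(nat => (nat => int) => (nat => int) obs) => (nat => int) obs => bool" where
  "lapprox F f \<longleftrightarrow> (\<forall>e>0. \<exists>r g. depends_on (box d r) g \<and> (\<forall>s\<in>L.cfg. \<bar>f s - g s\<bar> <= e) \<and>
     (\<forall>\<^sub>F n in sequentially. \<forall>a. \<forall>t\<in>T.cfg n. \<bar>F n a t - g (per n a t)\<bar> <= e))"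

lemma lapproxE:
  assumes "lapprox F f" "e > 0"
  obtains r g where "depends_on (box d r) g" "\<And>s. s \<in> L.cfg ==> \<bar>f s - g s\<bar> <= e"
    "\<forall>\<^sub>F n in sequentially. \<forall>a. \<forall>t\<in>T.cfg n. \<bar>F n a t - g (per n a t)\<bar> <= e"
proof -
  have "\<exists>r g. depends_on (box d r) g \<and> (\<forall>s\<in>L.cfg. \<bar>f s - g s\<bar> <= e) \<and>
     (\<forall>\<^sub>F n in sequentially. \<forall>a. \<forall>t\<in>T.cfg n. \<bar>F n a t - g (per n a t)\<bar> <= e)"
    using assms unfolding lapprox_def by blast
  then obtain r g where g: "depends_on (box d r) g" "\<forall>s\<in>L.cfg. \<bar>f s - g s\<bar> <= e"
     "\<forall>\<^sub>F n in sequentially. \<forall>a. \<forall>t\<in>T.cfg n. \<bar>F n a t - g (per n a t)\<bar> <= e" by blast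
  show thesis by (rule that[OF g(1) bspec[OF g(2)] g(3)])
qed

lemma lapprox_local:
  assumes "finite S" "S \<subseteq> LV" "depends_on S f"
  shows "lapprox (\<lambda>n a t. f (per n a t)) f"
proof -
  obtain r where "S \<subseteq> box d r" using finite_sub_box[OF assms(1,2)] by blast
  then have "depends_on (box d r) f" using assms(3) unfolding depends_on_def by blast
  then show ?thesis unfolding lapprox_def by (intro allI impI exI[of _ r] exI[of _ f]) auto
qed

lemma lapprox_const: "lapprox (\<lambda>n a t. c) (\<lambda>_. c)"
  using lapprox_local[of "{}" "\<lambda>_. c"] by (simp add: depends_on_def)

lemma box_local_bounded:
  assumes "depends_on (box d r) g"
  obtains B where "B >= 0" "\<And>s. s \<in> spins q (box d r) ==> \<bar>g s\<bar> <= B" "\<And>s. s \<in> L.cfg ==> \<bar>g s\<bar> <= B"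
  by (rule L.local_bounded[OF finite_box assms box_sub]) (rule that)

lemma lapprox_bounded:
  assumes "lapprox F f"
  obtains B where "B >= 1" "\<And>s. s \<in> L.cfg ==> \<bar>f s\<bar> <= B"
proof -
  obtain r g where g: "depends_on (box d r) g" "\<And>s. s \<in> L.cfg ==> \<bar>f s - g s\<bar> <= 1"
    "\<forall>\<^sub>F n in sequentially. \<forall>a. \<forall>t\<in>T.cfg n. \<bar>F n a t - g (per n a t)\<bar> <= 1"
    by (rule lapproxE[OF assms, of 1]) (simp, rule that)
  obtain B where B: "B >= 0" "\<And>s. s \<in> spins q (box d r) ==> \<bar>g s\<bar> <= B" "\<And>s. s \<in> L.cfg ==> \<bar>g s\<bar> <= B"
    by (rule box_local_bounded[OF g(1)]) (rule that)
  have f: "\<bar>f s\<bar> <= B + 1" if "s \<in> L.cfg" for s using g(2)[OF that] B(3)[OF that] by linarith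
  have B1: "B + 1 >= 1" using B(1) by simp
  show thesis by (rule that[OF B1 f])
qed

lemma lapprox_measurable:
  assumes "lapprox F f"
  shows "f \<in> borel_measurable L.sps"
proof -
  have "\<exists>g. (\<exists>r. depends_on (box d r) g) \<and> (\<forall>s\<in>L.cfg. \<bar>f s - g s\<bar> <= inverse (real (Suc i)))" for i
  proof -
    have "inverse (real (Suc i)) > 0" by simp
    then show ?thesis using assms unfolding lapprox_def by blast
  qed
  then obtain g where g: "\<And>i. \<exists>r. depends_on (box d r) (g i)"
    "\<And>i s. s \<in> L.cfg ==> \<bar>f s - g i s\<bar> <= inverse (real (Suc i))" by metis
  show ?thesis
  proof (rule borel_measurable_LIMSEQ_real)
    show "g i \<in> borel_measurable L.sps" for i
      using g(1)[of i] depends_on_measurable[OF finite_box box_sub] by blast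
    fix s assume "s \<in> space L.sps"
    then have "s \<in> L.cfg" by simp
    then have "(\<lambda>i. f s - g i s) \<longlonglongrightarrow> 0"
      using g(2) by (intro Lim_null_comparison[OF _ LIMSEQ_inverse_real_of_nat] eventuallyI) auto
    then show "(\<lambda>i. g i s) \<longlonglongrightarrow> f s"
      using tendsto_diff[OF tendsto_const[of "f s"]] by force
  qed
qed

lemma depends_on_box_comb:
  assumes "depends_on (box d r) f" "depends_on (box d s) g"
  shows "depends_on (box d (max r s)) (\<lambda>x. h (f x) (g x))"
  unfolding depends_on_def
proof (intro allI impI)
  fix x t :: "(nat => int) => nat" assume eq: "\<forall>v\<in>box d (max r s). x v = t v"
  have "f x = f t" using assms(1) eq box_mono[of r "max r s" d] unfolding depends_on_def by auto
  moreover have "g x = g t" using assms(2) eq box_mono[of s "max r s" d] unfolding depends_on_def by auto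
  ultimately show "h (f x) (g x) = h (f t) (g t)" by simp
qed

lemma lapprox_comb:
  fixes h :: "real => real => real"
  assumes "lapprox F f" "lapprox G g" and h: "continuous_on UNIV (\<lambda>(x, y). h x y)"
  shows "lapprox (\<lambda>n a t. h (F n a t) (G n a t)) (\<lambda>z. h (f z) (g z))"
  unfolding lapprox_def
proof (intro allI impI)
  fix e :: real assume e: "e > 0"
  obtain B1 where B1: "B1 >= 1" "\<And>z. z \<in> L.cfg ==> \<bar>f z\<bar> <= B1" by (rule lapprox_bounded[OF assms(1)]) (rule that)
  obtain B2 where B2: "B2 >= 1" "\<And>z. z \<in> L.cfg ==> \<bar>g z\<bar> <= B2" by (rule lapprox_bounded[OF assms(2)]) (rule that)
  define B where "B = max B1 B2"
  have Bm: "B1 <= B" "B2 <= B" by (auto simp: B_def)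
  \<comment> \<open>The local approximants exceed the bound \<open>B\<close> by at most
    \<open>c\<close>, and the torus functions by at most \<open>2 * c\<close>; with \<open>c\<close>
    at most 1 all arguments stay in this interval, where the function is uniformly
    continuous.\<close>
  define C where "C = {- (B + 2)..B + 2}"
  have "compact (C \<times> C)" unfolding C_def by (intro compact_Times compact_Icc)
  then have "uniformly_continuous_on (C \<times> C) (\<lambda>(x, y). h x y)"
    by (intro compact_uniformly_continuous continuous_on_subset[OF h]) auto
  then obtain b where b: "b > 0" "\<And>u v. u \<in> C \<times> C ==> v \<in> C \<times> C ==> dist v u < b ==> dist (case v of (x, y) => h x y) (case u of (x, y) => h x y) < e"
    using e unfolding uniformly_continuous_on_def by metis
  define c where "c = min 1 (b / 3)"
  have c: "c > 0" "c <= 1" "c <= b / 3" using b(1) by (auto simp: c_def)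
  have key: "\<bar>h x y - h x' y'\<bar> <= e"
    if "\<bar>x - x'\<bar> <= c" "\<bar>y - y'\<bar> <= c" "\<bar>x'\<bar> <= B + c" "\<bar>y'\<bar> <= B + c" for x y x' y' :: real
  proof -
    have "(x, y) \<in> C \<times> C" "(x', y') \<in> C \<times> C" using that c(2) unfolding C_def by auto
    moreover have "dist (x, y) (x', y') < b"
      using sqrt_sum_squares_le_sum_abs[of "x - x'" "y - y'"] that(1,2) c(3) b(1) by (simp add: dist_Pair_Pair dist_real_def)
    ultimately show ?thesis using b(2)[of "(x', y')" "(x, y)"] by (simp add: dist_real_def)
  qed
  obtain r f' where f': "depends_on (box d r) f'" "\<And>z. z \<in> L.cfg ==> \<bar>f z - f' z\<bar> <= c"
    and F: "\<forall>\<^sub>F n in sequentially. \<forall>a. \<forall>t\<in>T.cfg n. \<bar>F n a t - f' (per n a t)\<bar> <= c"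
    by (rule lapproxE[OF assms(1) c(1)]) (rule that)
  obtain s g' where g': "depends_on (box d s) g'" "\<And>z. z \<in> L.cfg ==> \<bar>g z - g' z\<bar> <= c"
    and G: "\<forall>\<^sub>F n in sequentially. \<forall>a. \<forall>t\<in>T.cfg n. \<bar>G n a t - g' (per n a t)\<bar> <= c"
    by (rule lapproxE[OF assms(2) c(1)]) (rule that)
  have bd: "\<bar>f' z\<bar> <= B + c" "\<bar>g' z\<bar> <= B + c" if "z \<in> L.cfg" for z
    using f'(2)[OF that] g'(2)[OF that] B1(2)[OF that] B2(2)[OF that] Bm by linarith+
  show "\<exists>r k. depends_on (box d r) k \<and> (\<forall>z\<in>L.cfg. \<bar>h (f z) (g z) - k z\<bar> <= e) \<and>
      (\<forall>\<^sub>F n in sequentially. \<forall>a. \<forall>t\<in>T.cfg n. \<bar>h (F n a t) (G n a t) - k (per n a t)\<bar> <= e)"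
  proof (intro exI conjI ballI)
    show "depends_on (box d (max r s)) (\<lambda>z. h (f' z) (g' z))" by (rule depends_on_box_comb[OF f'(1) g'(1)])
    show "\<bar>h (f z) (g z) - h (f' z) (g' z)\<bar> <= e" if "z \<in> L.cfg" for z
      by (rule key[OF f'(2)[OF that] g'(2)[OF that] bd[OF that]])
    show "\<forall>\<^sub>F n in sequentially. \<forall>a. \<forall>t\<in>T.cfg n. \<bar>h (F n a t) (G n a t) - h (f' (per n a t)) (g' (per n a t))\<bar> <= e"
      using F G by eventually_elim (intro allI ballI key bd per_cfg, auto)
  qed
qed

lemma lapprox_mult: "lapprox F f ==> lapprox G g ==> lapprox (\<lambda>n a t. F n a t * G n a t) (\<lambda>s. f s * g s)"
  by (rule lapprox_comb) (auto simp: split_beta intro!: continuous_intros)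

lemma lapprox_add: "lapprox F f ==> lapprox G g ==> lapprox (\<lambda>n a t. F n a t + G n a t) (\<lambda>s. f s + g s)"
  by (rule lapprox_comb) (auto simp: split_beta intro!: continuous_intros)

lemma lapprox_cmult: "lapprox F f ==> lapprox (\<lambda>n a t. c * F n a t) (\<lambda>s. c * f s)"
  using lapprox_mult[OF lapprox_const] .

lemma lapprox_integrable:
  assumes "lapprox F f" "prob_space M" "sets M = sets L.sps"
  shows "integrable M f"
proof -
  interpret prob_space M by fact
  obtain B where B: "B >= 1" "\<And>s. s \<in> L.cfg ==> \<bar>f s\<bar> <= B" by (rule lapprox_bounded[OF assms(1)]) (rule that)
  show ?thesis
  proof (rule integrable_const_bound[where B = B])
    show "f \<in> borel_measurable M"
      unfolding measurable_cong_sets[OF assms(3) refl] by (rule lapprox_measurable[OF assms(1)])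
    show "AE x in M. norm (f x) <= B" using B(2) sets_eq_imp_space_eq[OF assms(3)] by (intro AE_I2) auto
  qed
qed

lemma integral_close:
  fixes f g :: "(nat => int) obs"
  assumes "prob_space M" "sets M = sets L.sps" "integrable M f" "integrable M g"
    and "\<And>s. s \<in> L.cfg ==> \<bar>f s - g s\<bar> <= e"
  shows "\<bar>(\<integral>s. f s \<partial>M) - (\<integral>s. g s \<partial>M)\<bar> <= e"
proof -
  interpret prob_space M by fact
  have sp: "space M = L.cfg" using sets_eq_imp_space_eq[OF assms(2)] by simp
  have "(\<integral>s. f s \<partial>M) <= (\<integral>s. g s + e \<partial>M)"
  proof (rule integral_mono[OF assms(3)])
    show "f s <= g s + e" if "s \<in> space M" for s using assms(5)[of s] that sp by (simp add: abs_le_iff)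
  qed (use assms(4) in simp)
  moreover have "(\<integral>s. g s \<partial>M) <= (\<integral>s. f s + e \<partial>M)"
  proof (rule integral_mono[OF assms(4)])
    show "g s <= f s + e" if "s \<in> space M" for s using assms(5)[of s] that sp by (simp add: abs_le_iff)
  qed (use assms(3) in simp)
  ultimately show ?thesis using assms(3,4) by (simp add: abs_le_iff prob_space)
qed

lemma swQ_depends: "depends_on (box d (r + k)) (swQ r g k)"
  unfolding depends_on_def
proof (intro allI impI)
  fix s t :: "(nat => int) => nat" assume eq: "\<forall>v\<in>box d (r + k). s v = t v"
  have "mono_ind F s = mono_ind F t" if "F \<in> Pow (edge_box d (r + k))" for F
  proof -
    have "\<Union>F \<subseteq> box d (r + k)" using that edge_box_vertices[of "r + k"] by blast
    then show ?thesis using depends_on_mono_ind[of F] eq unfolding depends_on_def by blast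
  qed
  then show "swQ r g k s = swQ r g k t" unfolding swQ_def by simp
qed

text \<open>The operator does not increase the supremum norm, so half of the error comes from
  approximating \<open>f\<close> by a local function. The other half comes from the truncated
  expansion, which is the same local function on the tori and on the lattice.\<close>

lemma lapprox_sw:
  assumes "lapprox F f"
  shows "lapprox (\<lambda>n a t. T.sw_op n (F n a) t) (Pop f)"
  unfolding lapprox_def
proof (intro allI impI)
  fix e :: real assume e: "e > 0"
  then have e2: "e / 2 > 0" by simp
  obtain r g where g: "depends_on (box d r) g" "\<And>s. s \<in> L.cfg ==> \<bar>f s - g s\<bar> <= e / 2"
    and F: "\<forall>\<^sub>F n in sequentially. \<forall>a. \<forall>t\<in>T.cfg n. \<bar>F n a t - g (per n a t)\<bar> <= e / 2"
    by (rule lapproxE[OF assms(1) e2]) (rule that)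
  obtain M where M: "M >= 0" "\<And>s. s \<in> spins q (box d r) ==> \<bar>g s\<bar> <= M" "\<And>s. s \<in> L.cfg ==> \<bar>g s\<bar> <= M"
    by (rule box_local_bounded[OF g(1)]) (rule that)
  have "(\<lambda>k. M * 2 ^ card (box d r) * (1/16::real) ^ k) \<longlonglongrightarrow> M * 2 ^ card (box d r) * 0"
    by (intro tendsto_intros LIMSEQ_power_zero) simp
  then have "\<forall>\<^sub>F k in sequentially. M * 2 ^ card (box d r) * (1/16::real) ^ k < e / 2"
    using e2 by (intro order_tendstoD(2)[where a = "e / 2"]) auto
  then obtain k where k: "M * 2 ^ card (box d r) * (1/16::real) ^ k < e / 2"
    unfolding eventually_sequentially by blast
  show "\<exists>r g. depends_on (box d r) g \<and> (\<forall>s\<in>L.cfg. \<bar>Pop f s - g s\<bar> <= e) \<and>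
      (\<forall>\<^sub>F n in sequentially. \<forall>a. \<forall>t\<in>T.cfg n. \<bar>T.sw_op n (F n a) t - g (per n a t)\<bar> <= e)"
  proof (intro exI conjI ballI)
    show "depends_on (box d (r + k)) (swQ r g k)" by (rule swQ_depends)
    show "\<bar>Pop f s - swQ r g k s\<bar> <= e" if "s \<in> L.cfg" for s
    proof -
      have "\<bar>Pop f s - Pop g s\<bar> <= e / 2"
        by (rule integral_close[OF L.prob_space_sw L.sets_sw lapprox_integrable[OF assms L.prob_space_sw L.sets_sw]
            L.local_integrable[OF L.prob_space_sw L.sets_sw finite_box box_sub g(1)] g(2)])
      then show ?thesis using sw_compare_lattice[OF g(1) M(2,1), of s k] k by linarith
    qed
    show "\<forall>\<^sub>F n in sequentially. \<forall>a. \<forall>t\<in>T.cfg n. \<bar>T.sw_op n (F n a) t - swQ r g k (per n a t)\<bar> <= e"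
      using F eventually_ge_at_top[of "2 * (r + k)"]
    proof eventually_elim
      case (elim n)
      show ?case
      proof (intro allI ballI)
        fix a t assume t: "t \<in> T.cfg n"
        have 1: "\<bar>T.sw_op n (F n a) t - T.sw_op n (\<lambda>t. g (per n a t)) t\<bar> <= e / 2"
          by (rule T.sw_op_close) (use elim in blast)
        have 2: "\<bar>T.sw_op n (\<lambda>t. g (per n a t)) t - swQ r g k (per n a t)\<bar> <= M * 2 ^ card (box d r) * (1/16) ^ k"
          by (rule sw_compare_torus[OF g(1) M(2,1)]) (use elim in auto)
        show "\<bar>T.sw_op n (F n a) t - swQ r g k (per n a t)\<bar> <= e" using 1 2 k by linarith
      qed
    qed
  qed
qed

lemma lapprox_mean:
  assumes "lapprox F f" "e > 0"
  shows "\<forall>\<^sub>F n in sequentially. \<forall>a. \<bar>T.gmean n (F n a) - (\<integral>s. f s \<partial>mu)\<bar> <= e"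
proof -
  have e3: "e / 3 > 0" using assms(2) by simp
  obtain r g where g: "depends_on (box d r) g" "\<And>s. s \<in> L.cfg ==> \<bar>f s - g s\<bar> <= e / 3"
    and F: "\<forall>\<^sub>F n in sequentially. \<forall>a. \<forall>t\<in>T.cfg n. \<bar>F n a t - g (per n a t)\<bar> <= e / 3"
    by (rule lapproxE[OF assms(1) e3]) (rule that)
  have 1: "\<bar>(\<integral>s. f s \<partial>mu) - (\<integral>s. g s \<partial>mu)\<bar> <= e / 3"
    by (rule integral_close[OF mu_prob mu_sets lapprox_integrable[OF assms(1) mu_prob mu_sets]
        L.local_integrable[OF mu_prob mu_sets finite_box box_sub g(1)] g(2)])
  show ?thesis
    using F tm_converges[OF finite_box box_sub g(1) e3]
  proof eventually_elim
    case (elim n)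
    show ?case
    proof
      fix a
      have "\<bar>T.gmean n (\<lambda>t. F n a t - g (per n a t))\<bar> <= e / 3"
        by (rule T.abs_gmean_le) (use elim(1) in blast)
      then have "\<bar>T.gmean n (F n a) - tm n a g\<bar> <= e / 3" unfolding T.gmean_diff tm_def .
      moreover have "\<bar>tm n a g - (\<integral>s. g s \<partial>mu)\<bar> <= e / 3" using elim(2) by blast
      ultimately show "\<bar>T.gmean n (F n a) - (\<integral>s. f s \<partial>mu)\<bar> <= e" using 1 by linarith
    qed
  qed
qed

lemma lapprox_mean_lim:
  assumes "lapprox F f"
  shows "(\<lambda>n. T.gmean n (F n (a n))) \<longlonglongrightarrow> (\<integral>s. f s \<partial>mu)"
proof (rule tendstoI)
  fix e :: real assume "e > 0"
  then have "e / 2 > 0" by simp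
  from lapprox_mean[OF assms this] show "\<forall>\<^sub>F n in sequentially. dist (T.gmean n (F n (a n))) (\<integral>s. f s \<partial>mu) < e"
  proof eventually_elim
    case (elim n)
    then have "\<bar>T.gmean n (F n (a n)) - (\<integral>s. f s \<partial>mu)\<bar> <= e / 2" by blast
    then show ?case using \<open>e > 0\<close> by (simp add: dist_real_def)
  qed
qed

definition mcov :: "(nat => int) obs => (nat => int) obs => real" where
  "mcov f g = (\<integral>s. f s * g s \<partial>mu) - (\<integral>s. f s \<partial>mu) * (\<integral>s. g s \<partial>mu)"

lemma lapprox_cov_lim:
  assumes "lapprox F f" "lapprox G g"
  shows "(\<lambda>n. T.gcov n (F n (a n)) (G n (a n))) \<longlonglongrightarrow> mcov f g"
  unfolding T.gcov_def mcov_def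
  by (intro tendsto_intros lapprox_mean_lim[OF lapprox_mult[OF assms]] lapprox_mean_lim[OF assms(1)] lapprox_mean_lim[OF assms(2)])

lemma lapprox_cov:
  assumes F: "lapprox F f" and G: "lapprox G g" and e: "e > 0"
  shows "\<forall>\<^sub>F n in sequentially. \<forall>a. \<bar>T.gcov n (F n a) (G n a) - mcov f g\<bar> <= e"
proof -
  let ?P = "\<lambda>n a. \<bar>T.gcov n (F n a) (G n a) - mcov f g\<bar> <= e"
  \<comment> \<open>For each size a base point at which the bound fails, if there is one.
    Convergence along this worst sequence gives the uniformity over all base points.\<close>
  define c where "c n = (SOME a. \<not> ?P n a)" for n
  have c: "\<forall>a. ?P n a" if "?P n (c n)" for n
    using that someI[of "\<lambda>a. \<not> ?P n a"] unfolding c_def by blast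
  have "\<forall>\<^sub>F n in sequentially. dist (T.gcov n (F n (c n)) (G n (c n))) (mcov f g) < e"
    by (rule tendstoD[OF lapprox_cov_lim[OF F G] e])
  then show ?thesis by eventually_elim (rule c, simp add: dist_real_def)
qed

end

subsection \<open>Square integrable functions\<close>

context sw_lattice
begin

abbreviation "sqi \<equiv> square_integrable mu"

lemma mu_meas: "borel_measurable mu = borel_measurable L.sps"
  by (rule measurable_cong_sets[OF mu_sets refl])

lemma sqi_add:
  assumes "sqi u" "sqi v"
  shows "sqi (\<lambda>x. u x + v x)" and "(\<integral>x. (u x + v x)\<^sup>2 \<partial>mu) <= 2 * (\<integral>x. (u x)\<^sup>2 \<partial>mu) + 2 * (\<integral>x. (v x)\<^sup>2 \<partial>mu)"
proof -
  have m: "u \<in> borel_measurable mu" "v \<in> borel_measurable mu"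
    and i: "integrable mu (\<lambda>x. (u x)\<^sup>2)" "integrable mu (\<lambda>x. (v x)\<^sup>2)"
    using assms unfolding square_integrable_def by auto
  have le: "(u x + v x)\<^sup>2 <= 2 * (u x)\<^sup>2 + 2 * (v x)\<^sup>2" for x
    using zero_le_power2[of "u x - v x"] by (simp add: power2_eq_square algebra_simps)
  have int: "integrable mu (\<lambda>x. 2 * (u x)\<^sup>2 + 2 * (v x)\<^sup>2)" using i by simp
  have "integrable mu (\<lambda>x. (u x + v x)\<^sup>2)"
    by (rule Bochner_Integration.integrable_bound[OF int]) (use m le in \<open>auto intro!: AE_I2\<close>)
  then show "sqi (\<lambda>x. u x + v x)" unfolding square_integrable_def using m by simp
  have "(\<integral>x. (u x + v x)\<^sup>2 \<partial>mu) <= (\<integral>x. 2 * (u x)\<^sup>2 + 2 * (v x)\<^sup>2 \<partial>mu)"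
    by (rule integral_mono[OF \<open>integrable mu (\<lambda>x. (u x + v x)\<^sup>2)\<close> int]) (rule le)
  then show "(\<integral>x. (u x + v x)\<^sup>2 \<partial>mu) <= 2 * (\<integral>x. (u x)\<^sup>2 \<partial>mu) + 2 * (\<integral>x. (v x)\<^sup>2 \<partial>mu)" using i by simp
qed

lemma sqi_cmult: "sqi u ==> sqi (\<lambda>x. c * u x)"
  unfolding square_integrable_def by (auto simp: power_mult_distrib intro: borel_measurable_times)

lemma sqi_diff: "sqi u ==> sqi v ==> sqi (\<lambda>x. u x - v x)"
  using sqi_add(1)[OF _ sqi_cmult[of v "- 1"]] by simp

lemma sqi_bound:
  assumes "sqi u" "v \<in> borel_measurable mu" "\<And>x. x \<in> space mu ==> \<bar>v x\<bar> <= \<bar>u x\<bar>"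
  shows "sqi v"
proof -
  have i: "integrable mu (\<lambda>x. (u x)\<^sup>2)" using assms unfolding square_integrable_def by auto
  have "integrable mu (\<lambda>x. (v x)\<^sup>2)"
  proof (rule Bochner_Integration.integrable_bound[OF i])
    show "AE x in mu. norm ((v x)\<^sup>2) <= norm ((u x)\<^sup>2)"
      using assms(3) by (intro AE_I2) (simp add: abs_le_square_iff)
  qed (use assms(2) in simp)
  then show ?thesis unfolding square_integrable_def using assms(2) by simp
qed

lemma sqi_local:
  assumes "finite S" "S \<subseteq> LV" "depends_on S g"
  shows "sqi g"
proof -
  have "depends_on S (\<lambda>x. (g x)\<^sup>2)" using assms(3) unfolding depends_on_def by metis
  then show ?thesis
    unfolding square_integrable_def mu_meas
    using depends_on_measurable[OF assms] L.local_integrable[OF mu_prob mu_sets assms(1,2)] by blast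
qed

lemma sqi_box: "depends_on (box d r) g ==> sqi g"
  by (rule sqi_local[OF finite_box box_sub])

lemma integrable_of_square:
  fixes u :: "'a => real"
  assumes "prob_space M" "u \<in> borel_measurable M" "integrable M (\<lambda>x. (u x)\<^sup>2)"
  shows "integrable M u"
proof -
  interpret prob_space M by fact
  have i: "integrable M (\<lambda>x. 1 + (u x)\<^sup>2)" using assms by simp
  show ?thesis
  proof (rule Bochner_Integration.integrable_bound[OF i assms(2)], intro AE_I2)
    fix x
    have "\<bar>u x\<bar> <= 1 + (u x)\<^sup>2" using zero_le_power2[of "\<bar>u x\<bar> - 1"] by (simp add: power2_eq_square algebra_simps)
    then show "norm (u x) <= norm (1 + (u x)\<^sup>2)" by simp
  qed
qed

lemma sqi_integrable: "sqi u ==> integrable mu u"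
  by (rule integrable_of_square[OF mu_prob]) (auto simp: square_integrable_def)

text \<open>The closure of the local functions in the space of square integrable functions; the goal
  is that it is the whole space.\<close>

definition apx :: "(nat => int) obs => bool" where
  "apx u \<longleftrightarrow> sqi u \<and> (\<forall>e>0. \<exists>r g. depends_on (box d r) g \<and> (\<integral>x. (u x - g x)\<^sup>2 \<partial>mu) <= e)"

lemma apx_box: "depends_on (box d r) g ==> apx g"
  unfolding apx_def using sqi_box by (auto intro!: exI[of _ r] exI[of _ g])

lemma apx_lim:
  assumes "sqi u" and v: "\<And>e. e > 0 ==> \<exists>v. apx v \<and> (\<integral>x. (u x - v x)\<^sup>2 \<partial>mu) <= e"
  shows "apx u"
  unfolding apx_def
proof (intro conjI assms(1) allI impI)
  fix e :: real assume "e > 0"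
  then have e4: "e / 4 > 0" by simp
  obtain v where v: "apx v" "(\<integral>x. (u x - v x)\<^sup>2 \<partial>mu) <= e / 4" using v[OF e4] by blast
  obtain r g where g: "depends_on (box d r) g" "(\<integral>x. (v x - g x)\<^sup>2 \<partial>mu) <= e / 4"
    using v(1) e4 unfolding apx_def by blast
  have sv: "sqi v" using v(1) unfolding apx_def by blast
  have "(\<integral>x. (u x - g x)\<^sup>2 \<partial>mu) = (\<integral>x. ((u x - v x) + (v x - g x))\<^sup>2 \<partial>mu)" by simp
  also have "... <= 2 * (\<integral>x. (u x - v x)\<^sup>2 \<partial>mu) + 2 * (\<integral>x. (v x - g x)\<^sup>2 \<partial>mu)"
    by (rule sqi_add(2)[OF sqi_diff[OF assms(1) sv] sqi_diff[OF sv sqi_box[OF g(1)]]])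
  also have "... <= e" using v(2) g(2) by simp
  finally show "\<exists>r g. depends_on (box d r) g \<and> (\<integral>x. (u x - g x)\<^sup>2 \<partial>mu) <= e" using g(1) by blast
qed

lemma apx_add:
  assumes "apx u" "apx v"
  shows "apx (\<lambda>x. u x + v x)"
proof -
  have s: "sqi u" "sqi v" using assms unfolding apx_def by auto
  show ?thesis
    unfolding apx_def
  proof (intro conjI allI impI sqi_add(1)[OF s])
    fix e :: real assume "e > 0"
    then have e4: "e / 4 > 0" by simp
    obtain r f where f: "depends_on (box d r) f" "(\<integral>x. (u x - f x)\<^sup>2 \<partial>mu) <= e / 4"
      using assms(1) e4 unfolding apx_def by blast
    obtain r' g where g: "depends_on (box d r') g" "(\<integral>x. (v x - g x)\<^sup>2 \<partial>mu) <= e / 4"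
      using assms(2) e4 unfolding apx_def by blast
    have "(\<integral>x. (u x + v x - (f x + g x))\<^sup>2 \<partial>mu) = (\<integral>x. ((u x - f x) + (v x - g x))\<^sup>2 \<partial>mu)" by (simp add: algebra_simps)
    also have "... <= 2 * (\<integral>x. (u x - f x)\<^sup>2 \<partial>mu) + 2 * (\<integral>x. (v x - g x)\<^sup>2 \<partial>mu)"
      by (rule sqi_add(2)[OF sqi_diff[OF s(1) sqi_box[OF f(1)]] sqi_diff[OF s(2) sqi_box[OF g(1)]]])
    also have "... <= e" using f(2) g(2) by simp
    finally show "\<exists>r g. depends_on (box d r) g \<and> (\<integral>x. (u x + v x - g x)\<^sup>2 \<partial>mu) <= e"
      using depends_on_box_comb[OF f(1) g(1), of "(+)"] by blast
  qed
qed

lemma apx_cmult: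
  assumes "apx u"
  shows "apx (\<lambda>x. c * u x)"
proof -
  have s: "sqi u" using assms unfolding apx_def by auto
  show ?thesis
    unfolding apx_def
  proof (intro conjI allI impI sqi_cmult[OF s])
    fix e :: real assume "e > 0"
    then have "e / (c\<^sup>2 + 1) > 0" by (simp add: add_nonneg_pos)
    then obtain r f where f: "depends_on (box d r) f" "(\<integral>x. (u x - f x)\<^sup>2 \<partial>mu) <= e / (c\<^sup>2 + 1)"
      using assms unfolding apx_def by blast
    have "(\<integral>x. (c * u x - c * f x)\<^sup>2 \<partial>mu) = c\<^sup>2 * (\<integral>x. (u x - f x)\<^sup>2 \<partial>mu)"
      by (simp add: power_mult_distrib right_diff_distrib[symmetric])
    also have "... <= (c\<^sup>2 + 1) * (e / (c\<^sup>2 + 1))"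
      using f(2) by (intro mult_mono) auto
    also have "... = e"
    proof -
      have "c\<^sup>2 + 1 ~= 0" using zero_le_power2[of c] by linarith
      then show ?thesis by simp
    qed
    finally have "(\<integral>x. (c * u x - c * f x)\<^sup>2 \<partial>mu) <= e" .
    moreover have "depends_on (box d r) (\<lambda>x. c * f x)" using f(1) unfolding depends_on_def by metis
    ultimately show "\<exists>r g. depends_on (box d r) g \<and> (\<integral>x. (c * u x - g x)\<^sup>2 \<partial>mu) <= e" by blast
  qed
qed

lemma apx_seq:
  assumes u: "sqi u" and U: "\<And>i. apx (U i)" "\<And>i x. x \<in> space mu ==> 0 <= U i x \<and> U i x <= u x"
    and lim: "\<And>x. x \<in> space mu ==> (\<lambda>i. U i x) \<longlonglongrightarrow> u x"
  shows "apx u"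
proof (rule apx_lim[OF u])
  fix e :: real assume e: "e > 0"
  have m: "u \<in> borel_measurable mu" "\<And>i. U i \<in> borel_measurable mu"
    using u U(1) unfolding apx_def square_integrable_def by auto
  have "(\<lambda>i. \<integral>x. (u x - U i x)\<^sup>2 \<partial>mu) \<longlonglongrightarrow> (\<integral>x. 0 \<partial>mu)"
  proof (rule integral_dominated_convergence[where w = "\<lambda>x. (u x)\<^sup>2"])
    show "integrable mu (\<lambda>x. (u x)\<^sup>2)" using u unfolding square_integrable_def by auto
    show "AE x in mu. (\<lambda>i. (u x - U i x)\<^sup>2) \<longlonglongrightarrow> 0"
    proof (intro AE_I2)
      fix x assume "x \<in> space mu"
      then have "(\<lambda>i. (u x - U i x)\<^sup>2) \<longlonglongrightarrow> (u x - u x)\<^sup>2" by (intro tendsto_intros lim)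
      then show "(\<lambda>i. (u x - U i x)\<^sup>2) \<longlonglongrightarrow> 0" by simp
    qed
    show "AE x in mu. norm ((u x - U i x)\<^sup>2) <= (u x)\<^sup>2" for i
    proof (intro AE_I2)
      fix x assume x: "x \<in> space mu"
      have "(u x - U i x)\<^sup>2 <= (u x)\<^sup>2" using U(2)[OF x, of i] by (intro power_mono) auto
      then show "norm ((u x - U i x)\<^sup>2) <= (u x)\<^sup>2" by simp
    qed
  qed (use m in auto)
  then have "\<forall>\<^sub>F i in sequentially. (\<integral>x. (u x - U i x)\<^sup>2 \<partial>mu) < e"
    using e by (intro order_tendstoD(2)[where a = e]) auto
  then obtain i where "(\<integral>x. (u x - U i x)\<^sup>2 \<partial>mu) < e" unfolding eventually_sequentially by blast
  then show "\<exists>v. apx v \<and> (\<integral>x. (u x - v x)\<^sup>2 \<partial>mu) <= e" using U(1) by (intro exI[of _ "U i"]) auto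
qed

lemma apx_cong:
  assumes "apx u" "\<And>x. x \<in> space mu ==> u x = v x"
  shows "apx v"
proof -
  have s: "sqi u" using assms(1) unfolding apx_def by blast
  have m: "v \<in> borel_measurable mu" using s measurable_cong[of mu u v borel] assms(2) unfolding square_integrable_def by auto
  have sv: "sqi v" by (rule sqi_bound[OF s m]) (use assms(2) in simp)
  show ?thesis
  proof (rule apx_lim[OF sv])
    fix e :: real assume "e > 0"
    have "(\<integral>x. (v x - u x)\<^sup>2 \<partial>mu) = (\<integral>x. 0 \<partial>mu)"
      by (rule bochner_cong) (use assms(2) in auto)
    then show "\<exists>w. apx w \<and> (\<integral>x. (v x - w x)\<^sup>2 \<partial>mu) <= e" using assms(1) \<open>e > 0\<close> by (intro exI[of _ u]) auto
  qed
qed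

lemma sqi_indicator:
  assumes "A \<in> sets mu"
  shows "sqi (indicator A)"
  by (rule sqi_bound[OF sqi_local[of "{}" "\<lambda>_. 1"]]) (use assms in \<open>auto simp: depends_on_def indicator_def\<close>)

lemma apx_sum:
  assumes "finite I" "\<And>i. i \<in> I ==> apx (u i)"
  shows "apx (\<lambda>x. \<Sum>i\<in>I. u i x)"
  using assms
proof (induction I)
  case empty
  have "depends_on (box d 0) (\<lambda>_. 0)" by (simp add: depends_on_def)
  then show ?case using apx_box by simp
next
  case (insert i I)
  then show ?case using apx_add[of "u i" "\<lambda>x. \<Sum>i\<in>I. u i x"] by simp
qed

text \<open>Cylinder indicators are local, and the sets whose indicators are approximable form a
  Dynkin class because disjoint unions are dominated limits. Stability of cylinders under
  intersection then gives all measurable sets.\<close>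

lemma apx_indicator:
  assumes "A \<in> sets mu"
  shows "apx (indicator A)"
proof -
  let ?G = "prod_algebra LV (\<lambda>_. count_space {1..q})"
  have s: "sets mu = sigma_sets L.cfg ?G" unfolding mu_sets spin_space_def sets_PiM by simp
  have sub: "?G \<subseteq> Pow L.cfg"
    using prod_algebra_sets_into_space[of LV "\<lambda>_. count_space {1..q}"] by simp
  have one: "apx (\<lambda>_. 1)" using apx_box[of 0 "\<lambda>_. 1"] by (simp add: depends_on_def)
  from assms[unfolded s] show ?thesis
  proof (induction rule: sigma_sets_induct_disjoint[OF Int_stable_prod_algebra sub, consumes 1, case_names basic empty compl union])
    case (basic A)
    then obtain J X where A: "A = prod_emb LV (\<lambda>_. count_space {1..q}) J (\<Pi>\<^sub>E j\<in>J. X j)" "finite J" "J \<subseteq> LV"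
      by (rule prod_algebraE) blast
    obtain r where r: "J \<subseteq> box d r" using finite_sub_box[OF A(2,3)] by blast
    have "apx (\<lambda>y. of_bool (\<forall>v\<in>J. y v \<in> X v))"
    proof (rule apx_box[of r], unfold depends_on_def, intro allI impI)
      fix y t :: "(nat => int) => nat" assume "\<forall>v\<in>box d r. y v = t v"
      then have "(\<forall>v\<in>J. y v \<in> X v) \<longleftrightarrow> (\<forall>v\<in>J. t v \<in> X v)" using r by (metis subsetD)
      then show "of_bool (\<forall>v\<in>J. y v \<in> X v) = (of_bool (\<forall>v\<in>J. t v \<in> X v) :: real)" by simp
    qed
    then show ?case
      by (rule apx_cong) (simp add: A(1) mu_space L.prod_emb_indicator[OF A(3)])
  next
    case empty
    show ?case by (rule apx_cong[OF apx_cmult[OF one, of 0]]) simp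
  next
    case (compl A)
    have "apx (\<lambda>x. 1 + - 1 * indicator A x)" by (rule apx_add[OF one apx_cmult[OF compl(2)]])
    then show ?case by (rule apx_cong) (auto simp: mu_space indicator_def)
  next
    case (union A)
    have meas: "A i \<in> sets mu" for i using union(2) unfolding s by blast
    then have um: "(\<Union>i. A i) \<in> sets mu" by blast
    show ?case
    proof (rule apx_seq[OF sqi_indicator[OF um]])
      show "apx (\<lambda>x. \<Sum>i\<in>{..<n}. indicator (A i) x)" for n by (rule apx_sum) (use union(3) in auto)
      have e: "(\<Sum>i\<in>{..<n}. indicator (A i) x) = (indicator (\<Union>i<n. A i) x :: real)" for n x
        by (rule indicator_UN_disjoint[symmetric]) (use union(1) in \<open>auto simp: disjoint_family_on_def\<close>)
      show "(0::real) <= (\<Sum>i\<in>{..<n}. indicator (A i) x) \<and> (\<Sum>i\<in>{..<n}. indicator (A i) x) <= (indicator (\<Union>i. A i) x :: real)" for n x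
        unfolding e by (auto simp: indicator_def)
      show "(\<lambda>n. \<Sum>i\<in>{..<n}. indicator (A i) x) \<longlonglongrightarrow> (indicator (\<Union>i. A i) x :: real)" for x
        unfolding e by (rule LIMSEQ_indicator_UN)
    qed
  qed
qed

text \<open>Stated as an implication for the sake of the induction: summands and members of the
  increasing sequence are dominated by the function itself, so square integrability is inherited
  downwards when the hypothesis is applied.\<close>

lemma apx_nonneg:
  assumes "u \<in> borel_measurable mu" "\<And>x. 0 <= u x"
  shows "sqi u --> apx u"
  using assms
proof (induction rule: borel_measurable_induct_real)
  case (set A)
  then show ?case using apx_indicator by blast
next
  case (mult u c)
  show ?case
  proof (cases "c = 0")
    case True
    then show ?thesis using apx_box[of 0 "\<lambda>_. 0"] by (simp add: depends_on_def)
  next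
    case False
    show ?thesis
    proof
      assume "sqi (\<lambda>x. c * u x)"
      then have "sqi (\<lambda>x. (1 / c) * (c * u x))" by (rule sqi_cmult)
      then have "sqi u" using False by simp
      then show "apx (\<lambda>x. c * u x)" using mult apx_cmult by blast
    qed
  qed
next
  case (add u v)
  show ?case
  proof
    assume s: "sqi (\<lambda>x. v x + u x)"
    have "sqi u" by (rule sqi_bound[OF s add.hyps(1)]) (use add in \<open>auto simp: add_nonneg_nonneg\<close>)
    moreover have "sqi v" by (rule sqi_bound[OF s add.hyps(3)]) (use add in \<open>auto simp: add_nonneg_nonneg\<close>)
    ultimately show "apx (\<lambda>x. v x + u x)" using add apx_add by blast
  qed
next
  case (seq U)
  show ?case
  proof
    assume s: "sqi u"
    have le: "U i x <= u x" if "x \<in> space mu" for i x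
      using incseq_le[OF _ seq.hyps(4)[OF that]] seq.hyps(3) by (auto simp: incseq_def le_fun_def)
    show "apx u"
    proof (rule apx_seq[OF s _ _ seq.hyps(4)])
      show "apx (U i)" for i
      proof -
        have "sqi (U i)" by (rule sqi_bound[OF s seq.hyps(1)]) (use le seq.hyps(2) in \<open>simp add: order_trans[OF seq.hyps(2) le]\<close>)
        then show ?thesis using seq.IH by blast
      qed
      show "0 <= U i x \<and> U i x <= u x" if "x \<in> space mu" for i x using le[OF that] seq.hyps(2) by blast
    qed
  qed
qed

theorem local_dense:
  assumes "sqi f" "e > 0"
  shows "\<exists>r g. depends_on (box d r) g \<and> (\<integral>x. (f x - g x)\<^sup>2 \<partial>mu) <= e"
proof -
  have m: "f \<in> borel_measurable mu" using assms unfolding square_integrable_def by auto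
  let ?p = "\<lambda>x. max 0 (f x)" and ?n = "\<lambda>x. max 0 (- f x)"
  have pm: "?p \<in> borel_measurable mu" "?n \<in> borel_measurable mu" using m by auto
  have "sqi ?p" by (rule sqi_bound[OF assms(1) pm(1)]) (auto simp: max_def)
  moreover have "sqi ?n" by (rule sqi_bound[OF assms(1) pm(2)]) (auto simp: max_def)
  ultimately have "apx ?p" "apx ?n" using apx_nonneg[OF pm(1)] apx_nonneg[OF pm(2)] by auto
  then have "apx (\<lambda>x. ?p x + - 1 * ?n x)" by (intro apx_add apx_cmult)
  then have "apx f" by (rule apx_cong) (auto simp: max_def)
  then show ?thesis using assms(2) unfolding apx_def by blast
qed

end

subsection \<open>The Dirichlet form in infinite volume\<close>

context sw_lattice
begin

definition good :: "(nat => int) obs => bool" where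
  "good f \<longleftrightarrow> (\<exists>F. lapprox F f)"

lemma good_local: "finite S ==> S \<subseteq> LV ==> depends_on S f ==> good f"
  unfolding good_def using lapprox_local by blast

lemma good_const: "good (\<lambda>_. c)"
  unfolding good_def using lapprox_const by blast

lemma good_mult: "good f ==> good g ==> good (\<lambda>s. f s * g s)"
  unfolding good_def using lapprox_mult by blast

lemma good_add: "good f ==> good g ==> good (\<lambda>s. f s + g s)"
  unfolding good_def using lapprox_add by blast

lemma good_cmult: "good f ==> good (\<lambda>s. c * f s)"
  unfolding good_def using lapprox_cmult by blast

lemma good_Pop: "good f ==> good (Pop f)"
  unfolding good_def using lapprox_sw by blast

lemma good_integrable:
  assumes "good f"
  shows "integrable mu f" "integrable (L.sw s) f"
  using assms lapprox_integrable[OF _ mu_prob mu_sets] lapprox_integrable[OF _ L.prob_space_sw L.sets_sw]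
  unfolding good_def by blast+

lemma good_sqi: "good f ==> sqi f"
  using good_integrable(1)[of f] good_integrable(1)[OF good_mult[of f f]]
  unfolding square_integrable_def power2_eq_square by auto

lemma Pop_sym:
  assumes "good f" "good g"
  shows "(\<integral>s. g s * Pop f s \<partial>mu) = (\<integral>s. Pop g s * f s \<partial>mu)"
proof -
  obtain F G where FG: "lapprox F f" "lapprox G g" using assms unfolding good_def by blast
  have "(\<lambda>n. T.gmean n (\<lambda>t. G n (\<lambda>_. 0) t * T.sw_op n (F n (\<lambda>_. 0)) t)) \<longlonglongrightarrow> (\<integral>s. g s * Pop f s \<partial>mu)"
    by (rule lapprox_mean_lim[OF lapprox_mult[OF FG(2) lapprox_sw[OF FG(1)]]])
  moreover have "(\<lambda>n. T.gmean n (\<lambda>t. T.sw_op n (G n (\<lambda>_. 0)) t * F n (\<lambda>_. 0) t)) \<longlonglongrightarrow> (\<integral>s. Pop g s * f s \<partial>mu)"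
    by (rule lapprox_mean_lim[OF lapprox_mult[OF lapprox_sw[OF FG(2)] FG(1)]])
  ultimately show ?thesis unfolding T.sw_op_selfadjoint by (rule LIMSEQ_unique)
qed

lemma Pop_nonneg:
  assumes "good f"
  shows "0 <= (\<integral>s. f s * Pop f s \<partial>mu)"
proof -
  obtain F where F: "lapprox F f" using assms unfolding good_def by blast
  have "(\<lambda>n. T.gmean n (\<lambda>t. F n (\<lambda>_. 0) t * T.sw_op n (F n (\<lambda>_. 0)) t)) \<longlonglongrightarrow> (\<integral>s. f s * Pop f s \<partial>mu)"
    by (rule lapprox_mean_lim[OF lapprox_mult[OF F lapprox_sw[OF F]]])
  then show ?thesis by (rule LIMSEQ_le_const) (use T.sw_op_nonneg in blast)
qed

lemma Pop_mean:
  assumes "good f"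
  shows "(\<integral>s. Pop f s \<partial>mu) = (\<integral>s. f s \<partial>mu)"
proof -
  interpret prob_space "L.sw s" for s by (rule L.prob_space_sw)
  have "Pop (\<lambda>_. 1) s = 1" for s by (simp add: prob_space)
  then show ?thesis using Pop_sym[OF assms good_const[of 1]] by simp
qed

lemma mu_bind: "mu \<bind> L.sw = mu"
  by (rule L.bind_eqI[OF mu_prob mu_sets L.sw_kernel_measurable]) (rule Pop_mean[OF good_local])

lemma sw_subprob: "L.sw \<in> mu \<rightarrow>\<^sub>M subprob_algebra L.sps"
  using measurable_prob_algebraD[OF L.sw_kernel_measurable] measurable_cong_sets[OF mu_sets refl] by blast

lemma Pop_meas:
  assumes "u \<in> borel_measurable mu"
  shows "Pop u \<in> borel_measurable mu"
  by (rule measurable_compose[OF sw_subprob integral_measurable_subprob_algebra]) (use assms in \<open>unfold mu_meas\<close>)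

text \<open>Invariance of \<open>mu\<close> is used with extended nonnegative integrals, which
  presuppose no integrability. Finiteness of the total integral then yields integrability under
  almost every transition law.\<close>

lemma Pop_integral:
  assumes u: "integrable mu u" "\<And>x. 0 <= u x"
  shows "AE s in mu. integrable (L.sw s) u" "integrable mu (Pop u)" "(\<integral>s. Pop u s \<partial>mu) = (\<integral>s. u s \<partial>mu)"
proof -
  have m: "u \<in> borel_measurable mu" using u by auto
  have ms: "u \<in> borel_measurable (L.sw s)" for s
    using m unfolding mu_meas measurable_cong_sets[OF L.sets_sw refl] .
  have mn: "(\<lambda>x. ennreal (u x)) \<in> borel_measurable L.sps" using m unfolding mu_meas by simp
  have b: "(\<integral>\<^sup>+s. (\<integral>\<^sup>+t. ennreal (u t) \<partial>L.sw s) \<partial>mu) = (\<integral>\<^sup>+s. ennreal (u s) \<partial>mu)"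
    using nn_integral_bind[OF mn sw_subprob] unfolding mu_bind by simp
  also have fin: "... = ennreal (\<integral>s. u s \<partial>mu)" by (rule nn_integral_eq_integral[OF u(1)]) (use u(2) in simp)
  finally have e: "(\<integral>\<^sup>+s. (\<integral>\<^sup>+t. ennreal (u t) \<partial>L.sw s) \<partial>mu) = ennreal (\<integral>s. u s \<partial>mu)" .
  have mm: "(\<lambda>s. \<integral>\<^sup>+t. ennreal (u t) \<partial>L.sw s) \<in> borel_measurable mu"
    by (rule measurable_compose[OF sw_subprob nn_integral_measurable_subprob_algebra[OF mn]])
  have "AE s in mu. (\<integral>\<^sup>+t. ennreal (u t) \<partial>L.sw s) ~= \<infinity>"
    by (rule nn_integral_PInf_AE[OF mm]) (simp add: e)
  then show ae: "AE s in mu. integrable (L.sw s) u"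
    by eventually_elim (use ms u(2) in \<open>auto intro!: integrableI_nonneg simp: top.not_eq_extremum\<close>)
  have eq: "AE s in mu. (\<integral>\<^sup>+t. ennreal (u t) \<partial>L.sw s) = ennreal (Pop u s)"
    using ae by eventually_elim (rule nn_integral_eq_integral, auto simp: u(2))
  have e2: "(\<integral>\<^sup>+s. ennreal (Pop u s) \<partial>mu) = ennreal (\<integral>s. u s \<partial>mu)"
    using nn_integral_cong_AE[OF eq] e by simp
  have nn: "0 <= Pop u s" for s by (rule bochner_nonneg) (rule u(2))
  show "integrable mu (Pop u)"
    by (rule integrableI_nonneg[OF Pop_meas[OF m]]) (use nn e2 in auto)
  show "(\<integral>s. Pop u s \<partial>mu) = (\<integral>s. u s \<partial>mu)"
    unfolding integral_eq_nn_integral[OF Pop_meas[OF m] AE_I2[OF nn]] e2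
    by (rule enn2real_ennreal) (rule bochner_nonneg, rule u(2))
qed

section \<open>Energy and variance of square integrable functions\<close>

abbreviation "Var \<equiv> variance_of mu"
abbreviation "Dir \<equiv> dirichlet_form mu L.sw"

definition jump :: "(nat => int) obs => (nat => int) obs" where
  "jump f s = (\<integral>t. (f s - f t)\<^sup>2 \<partial>L.sw s)"

lemma dirichlet_jump: "Dir f = 1/2 * (\<integral>s. jump f s \<partial>mu)"
  unfolding dirichlet_form_def jump_def ..

lemma jump_nonneg: "0 <= jump f s"
  unfolding jump_def by (rule bochner_nonneg) simp

lemma jump_expand:
  assumes "integrable (L.sw s) f" "integrable (L.sw s) (\<lambda>t. (f t)\<^sup>2)"
  shows "jump f s = (f s)\<^sup>2 - 2 * f s * Pop f s + Pop (\<lambda>t. (f t)\<^sup>2) s"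
    and "integrable (L.sw s) (\<lambda>t. (f s - f t)\<^sup>2)"
proof -
  interpret prob_space "L.sw s" by (rule L.prob_space_sw)
  have e: "(\<lambda>t. (f s - f t)\<^sup>2) = (\<lambda>t. ((f s)\<^sup>2 - 2 * f s * f t) + (f t)\<^sup>2)"
    by (auto simp: power2_eq_square algebra_simps)
  have i: "integrable (L.sw s) (\<lambda>t. (f s)\<^sup>2 - 2 * f s * f t)" using assms(1) by simp
  show "integrable (L.sw s) (\<lambda>t. (f s - f t)\<^sup>2)" unfolding e using i assms(2) by simp
  have "jump f s = (\<integral>t. (f s)\<^sup>2 - 2 * f s * f t \<partial>L.sw s) + Pop (\<lambda>t. (f t)\<^sup>2) s"
    unfolding jump_def e by (rule Bochner_Integration.integral_add[OF i assms(2)])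
  also have "(\<integral>t. (f s)\<^sup>2 - 2 * f s * f t \<partial>L.sw s) = (f s)\<^sup>2 - 2 * f s * Pop f s"
    using assms(1) by (simp add: prob_space)
  finally show "jump f s = (f s)\<^sup>2 - 2 * f s * Pop f s + Pop (\<lambda>t. (f t)\<^sup>2) s" .
qed

lemma dirichlet_good:
  assumes f: "good f"
  shows "Dir f = (\<integral>s. (f s)\<^sup>2 \<partial>mu) - (\<integral>s. f s * Pop f s \<partial>mu)"
proof -
  have f2: "good (\<lambda>t. (f t)\<^sup>2)" using good_mult[OF f f] by (simp add: power2_eq_square)
  have i1: "integrable mu (\<lambda>s. (f s)\<^sup>2)" "integrable mu (\<lambda>s. f s * Pop f s)" "integrable mu (Pop (\<lambda>t. (f t)\<^sup>2))"
    by (intro good_integrable(1) f2 good_mult good_Pop f)+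
  have "(\<integral>s. jump f s \<partial>mu) = (\<integral>s. ((f s)\<^sup>2 - 2 * (f s * Pop f s)) + Pop (\<lambda>t. (f t)\<^sup>2) s \<partial>mu)"
    using jump_expand(1)[OF good_integrable(2)[OF f] good_integrable(2)[OF f2]] by (simp add: mult.assoc)
  also have "... = (\<integral>s. (f s)\<^sup>2 \<partial>mu) - 2 * (\<integral>s. f s * Pop f s \<partial>mu) + (\<integral>s. (f s)\<^sup>2 \<partial>mu)"
    using i1 Pop_mean[OF f2] by simp
  finally show ?thesis unfolding dirichlet_jump by simp
qed

lemma variance_sqi:
  assumes "sqi f"
  shows "Var f = (\<integral>s. (f s)\<^sup>2 \<partial>mu) - (\<integral>s. f s \<partial>mu)\<^sup>2"
proof -
  interpret prob_space mu by (rule mu_prob)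
  show ?thesis unfolding variance_of_def
    by (rule variance_eq) (use sqi_integrable[OF assms] assms in \<open>auto simp: square_integrable_def\<close>)
qed

lemma variance_le:
  assumes "sqi f"
  shows "Var f <= (\<integral>s. (f s - c)\<^sup>2 \<partial>mu)"
proof -
  interpret prob_space mu by (rule mu_prob)
  have i: "integrable mu f" "integrable mu (\<lambda>s. (f s)\<^sup>2)"
    using sqi_integrable[OF assms] assms by (auto simp: square_integrable_def)
  have "(\<integral>s. (f s - c)\<^sup>2 \<partial>mu) = (\<integral>s. (f s)\<^sup>2 - 2 * c * f s + c\<^sup>2 \<partial>mu)"
    by (rule bochner_cong) (auto simp: power2_eq_square algebra_simps)
  also have "... = (\<integral>s. (f s)\<^sup>2 \<partial>mu) - 2 * c * (\<integral>s. f s \<partial>mu) + c\<^sup>2" using i by (simp add: prob_space)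
  finally show ?thesis
    unfolding variance_sqi[OF assms] using zero_le_power2[of "(\<integral>s. f s \<partial>mu) - c"]
    by (simp add: power2_eq_square algebra_simps)
qed

lemma mcov_self: "sqi f ==> mcov f f = Var f"
  unfolding mcov_def variance_sqi by (simp add: power2_eq_square)

lemma dirichlet_cov:
  assumes "good f"
  shows "Dir f = Var f - mcov f (Pop f)"
  unfolding dirichlet_good[OF assms] variance_sqi[OF good_sqi[OF assms]] mcov_def Pop_mean[OF assms]
  by (simp add: power2_eq_square)

text \<open>The squared increment is at most \<open>2 * (f s)\<^sup>2 + 2 * (f t)\<^sup>2\<close>,
  and by invariance the second term has the same integral as the first.\<close>

lemma jump_sqi:
  assumes f: "sqi f"
  shows "AE s in mu. integrable (L.sw s) f \<and> integrable (L.sw s) (\<lambda>t. (f t)\<^sup>2)" "integrable mu (jump f)"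
proof -
  have m: "f \<in> borel_measurable mu" and i: "integrable mu (\<lambda>s. (f s)\<^sup>2)"
    using f unfolding square_integrable_def by auto
  have ms: "f \<in> borel_measurable (L.sw s)" for s
    using m unfolding mu_meas measurable_cong_sets[OF L.sets_sw refl] .
  note P2 = Pop_integral[OF i zero_le_power2]
  show ae: "AE s in mu. integrable (L.sw s) f \<and> integrable (L.sw s) (\<lambda>t. (f t)\<^sup>2)"
    using P2(1) by eventually_elim (use integrable_of_square[OF L.prob_space_sw ms] in blast)
  let ?J = "\<lambda>s. (f s)\<^sup>2 - 2 * f s * Pop f s + Pop (\<lambda>t. (f t)\<^sup>2) s"
  have mJ: "?J \<in> borel_measurable mu" using m Pop_meas[OF m] P2(2) by measurable
  have aeJ: "AE s in mu. jump f s = ?J s" using ae by eventually_elim (use jump_expand(1) in blast)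
  have iJ: "integrable mu ?J"
  proof (rule Bochner_Integration.integrable_bound[OF _ mJ])
    show "integrable mu (\<lambda>s. 2 * (f s)\<^sup>2 + 2 * Pop (\<lambda>t. (f t)\<^sup>2) s)" using i P2(2) by simp
    show "AE s in mu. norm (?J s) <= norm (2 * (f s)\<^sup>2 + 2 * Pop (\<lambda>t. (f t)\<^sup>2) s)"
      using ae aeJ
    proof eventually_elim
      case (elim s)
      interpret prob_space "L.sw s" by (rule L.prob_space_sw)
      have "jump f s <= (\<integral>t. 2 * (f s)\<^sup>2 + 2 * (f t)\<^sup>2 \<partial>L.sw s)"
        unfolding jump_def
      proof (rule integral_mono)
        show "integrable (L.sw s) (\<lambda>t. (f s - f t)\<^sup>2)" using elim jump_expand(2) by blast
        show "(f s - f t)\<^sup>2 <= 2 * (f s)\<^sup>2 + 2 * (f t)\<^sup>2" for t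
          using zero_le_power2[of "f s + f t"] by (simp add: power2_eq_square algebra_simps)
      qed (use elim in simp)
      also have "... = 2 * (f s)\<^sup>2 + 2 * Pop (\<lambda>t. (f t)\<^sup>2) s" using elim by (simp add: prob_space)
      finally show ?case using elim(2) jump_nonneg[of f s] by simp
    qed
  qed
  \<comment> \<open>The expanded formula holds only almost everywhere, so measurability is derived
    from the nonnegative integral of a jointly measurable function.\<close>
  have mP: "jump f \<in> borel_measurable mu"
  proof -
    have fs: "f \<in> borel_measurable L.sps" using m unfolding mu_meas .
    have "(\<lambda>(s, t). ennreal ((f s - f t)\<^sup>2)) \<in> borel_measurable (mu \<Otimes>\<^sub>M L.sps)"
      using m fs by measurable
    then have *: "(\<lambda>s. \<integral>\<^sup>+t. ennreal ((f s - f t)\<^sup>2) \<partial>L.sw s) \<in> borel_measurable mu"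
      by (rule nn_integral_measurable_subprob_algebra2[OF _ sw_subprob])
    have "jump f = (\<lambda>s. enn2real (\<integral>\<^sup>+t. ennreal ((f s - f t)\<^sup>2) \<partial>L.sw s))"
      unfolding jump_def using ms by (intro ext integral_eq_nn_integral) auto
    then show ?thesis using borel_measurable_enn2real[OF *] by simp
  qed
  show "integrable mu (jump f)"
    using integrable_cong_AE[OF mP mJ aeJ] iJ by simp
qed

text \<open>Variance and energy change little when \<open>f\<close> is replaced by a local
  \<open>g\<close> close in mean square. The comparison uses squares of sums weighted with a
  parameter \<open>z\<close>; letting the approximation error \<open>c\<close> tend to zero first
  and \<open>z\<close> afterwards removes all constants.\<close>

lemma gap_local_to_sqi:
  assumes lam: "0 <= lam" "lam <= 1"
    and loc: "\<And>r g. depends_on (box d r) g ==> mcov g (Pop g) <= lam * mcov g g"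
    and f: "sqi f"
  shows "(1 - lam) * Var f <= Dir f"
proof -
  have D0: "0 <= Dir f" unfolding dirichlet_jump using bochner_nonneg[of mu "jump f"] jump_nonneg by simp
  have step: "(1 - lam) * Var f <= (1 + z) * ((1 + z) * Dir f + (1 + 1 / z) * (2 * c)) + (1 + 1 / z) * c"
    if z: "z > 0" and c: "c > 0" for z c :: real
  proof -
    obtain r g where g: "depends_on (box d r) g" and gd: "(\<integral>x. (f x - g x)\<^sup>2 \<partial>mu) <= c"
      using local_dense[OF f c] by blast
    have gg: "good g" by (rule good_local[OF finite_box box_sub g])
    have gs: "sqi g" by (rule good_sqi[OF gg])
    let ?h = "\<lambda>x. f x - g x"
    have hs: "sqi ?h" by (rule sqi_diff[OF f gs])
    \<comment> \<open>The coefficient of the main term tends to 1 with \<open>z\<close>, while the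
      large coefficient multiplies only the approximation error.\<close>
    have young: "(a + b)\<^sup>2 <= (1 + z) * a\<^sup>2 + (1 + 1 / z) * b\<^sup>2" for a b :: real
    proof -
      have "0 <= (z * a - b)\<^sup>2 / z" using z by simp
      also have "... = z * a\<^sup>2 - 2 * a * b + b\<^sup>2 / z" using z by (simp add: power2_eq_square field_simps)
      finally show ?thesis by (simp add: power2_eq_square algebra_simps)
    qed
    have ig: "integrable mu (\<lambda>x. (g x - m)\<^sup>2)" "integrable mu (\<lambda>x. (?h x)\<^sup>2)" "integrable mu (\<lambda>x. (f x - m)\<^sup>2)" for m
      using sqi_diff[OF gs good_sqi[OF good_const[of m]]] sqi_diff[OF f good_sqi[OF good_const[of m]]] hs
      unfolding square_integrable_def by auto
    have V: "Var f <= (1 + z) * Var g + (1 + 1 / z) * c"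
    proof -
      let ?m = "\<integral>y. g y \<partial>mu"
      have "Var f <= (\<integral>x. (f x - ?m)\<^sup>2 \<partial>mu)" by (rule variance_le[OF f])
      also have "... <= (\<integral>x. (1 + z) * (g x - ?m)\<^sup>2 + (1 + 1 / z) * (?h x)\<^sup>2 \<partial>mu)"
      proof (rule integral_mono)
        show "(f x - ?m)\<^sup>2 <= (1 + z) * (g x - ?m)\<^sup>2 + (1 + 1 / z) * (?h x)\<^sup>2" for x
          using young[of "g x - ?m" "?h x"] by (simp add: algebra_simps)
      qed (use ig in simp_all)
      also have "... = (1 + z) * Var g + (1 + 1 / z) * (\<integral>x. (?h x)\<^sup>2 \<partial>mu)"
        unfolding variance_of_def using ig by simp
      also have "... <= (1 + z) * Var g + (1 + 1 / z) * c"
        using gd z by (intro add_left_mono mult_left_mono) auto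
      finally show ?thesis .
    qed
    have D: "Dir g <= (1 + z) * Dir f + (1 + 1 / z) * (2 * c)"
    proof -
      let ?B = "\<lambda>s. (1 + z) * jump f s + (1 + 1 / z) * (2 * (?h s)\<^sup>2 + 2 * Pop (\<lambda>x. (?h x)\<^sup>2) s)"
      let ?b = "\<lambda>s t. (1 + z) * (f s - f t)\<^sup>2 + (1 + 1 / z) * (2 * (?h s)\<^sup>2 + 2 * (?h t)\<^sup>2)"
      have ih2: "integrable mu (Pop (\<lambda>x. (?h x)\<^sup>2))" "(\<integral>s. Pop (\<lambda>x. (?h x)\<^sup>2) s \<partial>mu) = (\<integral>x. (?h x)\<^sup>2 \<partial>mu)"
        using Pop_integral(2,3)[OF ig(2)] by simp_all
      have "(\<integral>s. jump g s \<partial>mu) <= (\<integral>s. ?B s \<partial>mu)"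
      proof (rule integral_mono_AE)
        show "integrable mu (jump g)" by (rule jump_sqi(2)[OF gs])
        show "integrable mu (\<lambda>s. ?B s)"
          using jump_sqi(2)[OF f] ig(2) ih2(1) by simp
        show "AE s in mu. jump g s <= ?B s"
          using jump_sqi(1)[OF f] jump_sqi(1)[OF gs] jump_sqi(1)[OF hs]
        proof eventually_elim
          case (elim s)
          interpret prob_space "L.sw s" by (rule L.prob_space_sw)
          have jf: "integrable (L.sw s) (\<lambda>t. (f s - f t)\<^sup>2)" using elim(1) jump_expand(2) by blast
          have "jump g s <= (\<integral>t. ?b s t \<partial>L.sw s)"
            unfolding jump_def
          proof (rule integral_mono)
            show "integrable (L.sw s) (\<lambda>t. (g s - g t)\<^sup>2)" using elim(2) jump_expand(2) by blast
            show "integrable (L.sw s) (\<lambda>t. ?b s t)"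
              using jf elim(3) by simp
            fix t
            have "(g s - g t)\<^sup>2 <= (1 + z) * (f s - f t)\<^sup>2 + (1 + 1 / z) * (?h t - ?h s)\<^sup>2"
              using young[of "f s - f t" "?h t - ?h s"] by (simp add: algebra_simps)
            also have "... <= ?b s t"
            proof (intro add_left_mono mult_left_mono)
              show "(?h t - ?h s)\<^sup>2 <= 2 * (?h s)\<^sup>2 + 2 * (?h t)\<^sup>2"
                using zero_le_power2[of "?h t + ?h s"] by (simp add: power2_eq_square algebra_simps)
            qed (use z in simp)
            finally show "(g s - g t)\<^sup>2 <= ?b s t" .
          qed
          also have "... = ?B s"
            unfolding jump_def using jf elim(3) by (simp add: prob_space)
          finally show ?case .
        qed
      qed
      also have "... = (1 + z) * (\<integral>s. jump f s \<partial>mu) + (1 + 1 / z) * (4 * (\<integral>x. (?h x)\<^sup>2 \<partial>mu))"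
        using jump_sqi(2)[OF f] ig(2) ih2 by simp
      also have "... <= (1 + z) * (\<integral>s. jump f s \<partial>mu) + (1 + 1 / z) * (4 * c)"
        using gd z by (intro add_left_mono mult_left_mono) auto
      finally show ?thesis unfolding dirichlet_jump by (simp add: field_simps)
    qed
    have "(1 - lam) * Var g <= Dir g"
      using loc[OF g] unfolding dirichlet_cov[OF gg] mcov_self[OF gs] by (simp add: algebra_simps)
    also note D
    finally have VD: "(1 - lam) * Var g <= (1 + z) * Dir f + (1 + 1 / z) * (2 * c)" .
    have "(1 - lam) * Var f <= (1 - lam) * ((1 + z) * Var g + (1 + 1 / z) * c)"
      using V lam by (intro mult_left_mono) auto
    also have "... = (1 + z) * ((1 - lam) * Var g) + (1 - lam) * ((1 + 1 / z) * c)" by (simp add: algebra_simps)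
    also have "... <= (1 + z) * ((1 + z) * Dir f + (1 + 1 / z) * (2 * c)) + 1 * ((1 + 1 / z) * c)"
      using VD lam z c by (intro add_mono mult_left_mono mult_right_mono) auto
    finally show ?thesis by simp
  qed
  have step2: "(1 - lam) * Var f <= (1 + z) * ((1 + z) * Dir f)" if z: "z > 0" for z
  proof (rule tendsto_lowerbound)
    show "((\<lambda>c. (1 + z) * ((1 + z) * Dir f + (1 + 1 / z) * (2 * c)) + (1 + 1 / z) * c) \<longlongrightarrow>
        (1 + z) * ((1 + z) * Dir f)) (at_right 0)"
      using z by (auto intro!: tendsto_eq_intros)
    show "\<forall>\<^sub>F c in at_right 0. (1 - lam) * Var f <= (1 + z) * ((1 + z) * Dir f + (1 + 1 / z) * (2 * c)) + (1 + 1 / z) * c"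
      using step[OF z] by (auto simp: eventually_at_filter)
  qed simp
  show ?thesis
  proof (rule tendsto_lowerbound)
    show "((\<lambda>z. (1 + z) * ((1 + z) * Dir f)) \<longlongrightarrow> Dir f) (at_right 0)"
      by (auto intro!: tendsto_eq_intros)
    show "\<forall>\<^sub>F z in at_right 0. (1 - lam) * Var f <= (1 + z) * ((1 + z) * Dir f)"
      using step2 by (auto simp: eventually_at_filter)
  qed simp
qed

end

subsection \<open>The infinite-volume spectral radius\<close>

context small_sw_graph
begin

text \<open>The data of a rate \<open>b\<close> for the rows. The condition with
  \<open>\<kappa>\<^sup>2\<close> lets sets of two or more edges follow from the rows one step
  earlier, so only single edges have to be checked.\<close>

definition row_bound :: "nat => (nat => real) => bool" where
  "row_bound t b \<longleftrightarrow> (\<forall>s\<le>t. \<forall>e\<in>E. vnorm0 (edge_row e s) <= b s * W) \<and> (\<forall>s. \<kappa>\<^sup>2 * b s <= b (Suc s)) \<and>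
     1 <= b 0 \<and> (\<forall>s. 0 <= b s)"

lemma row_bound_kappa: "row_bound t (\<lambda>s. \<kappa> ^ s)"
  unfolding row_bound_def
proof (intro conjI allI impI ballI)
  have k: "0 < \<kappa>" "\<kappa> <= 1" using kappa_bounds by auto
  show "vnorm0 (edge_row e s) <= \<kappa> ^ s * W" if "e \<in> E" for e s
    using vnorm_edge_row[OF is_level_0 that, of s] by simp
  show "\<kappa>\<^sup>2 * \<kappa> ^ s <= \<kappa> ^ Suc s" for s
    unfolding power_add[symmetric] using k by (intro power_decreasing) auto
  show "0 <= \<kappa> ^ s" for s using k by simp
qed simp

theorem sw_gap_rows:
  assumes "V ~= {}"
  obtains lam where "finite_spectral_gap cfg (\<lambda>x y. measure (sw x) {y}) = 1 - lam" "0 <= lam"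
    "\<forall>f. gcov f (\<lambda>x. sw_op f x) <= lam * gcov f f"
    "\<forall>t b. row_bound t b --> lam ^ t <= b t"
proof -
  obtain lam where lam: "finite_spectral_gap cfg (\<lambda>x y. measure (sw x) {y}) = 1 - lam" "0 <= lam"
    "\<exists>f. (\<exists>x\<in>cfg. \<exists>y\<in>cfg. f x ~= f y) \<and> (\<forall>x\<in>cfg. sw_op f x = lam * f x)"
    "\<And>f. gcov f (\<lambda>x. sw_op f x) <= lam * gcov f f"
    by (rule sw_gap_characterisation[OF assms]) (rule that)
  obtain f x y where f: "x \<in> cfg" "y \<in> cfg" "f x ~= f y" "\<And>x. x \<in> cfg ==> sw_op f x = lam * f x"
    using lam(3) by blast
  have rows: "lam ^ t <= b t" if b: "row_bound t b" for t b
  proof (cases "lam = 0")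
    case True
    then show ?thesis using b unfolding row_bound_def by (cases t) auto
  next
    case False
    show ?thesis
    proof (rule eigenvalue_bound[OF f(4) f(1-3)])
      show "lam > 0" using False lam(2) by simp
      fix G assume G: "G \<in> NE"
      show "vnorm0 ((vstep ^^ t) (\<lambda>F. of_bool (F = G))) <= b t * W ^ card G"
      proof (rule vnorm_rows[OF _ _ _ _ G])
        show "1 <= b s \<or> s > 0" for s using b unfolding row_bound_def by (cases s) auto
      qed (use b row_bound_def in auto)
    qed
  qed
  show thesis by (rule that[OF lam(1,2)]) (use lam(4) rows in blast)+
qed

end

context sw_lattice
begin

section \<open>The second eigenvalue on the tori and its counterpart on the lattice\<close>

definition tlam :: "nat => real" where
  "tlam n = 1 - sw_gap_torus d q \<beta> (n + 3)"

lemma tlam_props: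
  shows "0 <= tlam n" "T.gcov n f (\<lambda>s. T.sw_op n f s) <= tlam n * T.gcov n f f"
    "T.row_bound n t b ==> tlam n ^ t <= b t"
proof -
  have ne: "TV n ~= {}" using tproj_torus[of "n + 3"] by auto
  obtain lam where lam: "finite_spectral_gap (T.cfg n) (\<lambda>s y. measure (T.sw n s) {y}) = 1 - lam" "0 <= lam"
    "\<forall>f. T.gcov n f (\<lambda>s. T.sw_op n f s) <= lam * T.gcov n f f"
    "\<forall>t b. T.row_bound n t b --> lam ^ t <= b t"
    by (rule T.sw_gap_rows[OF ne]) (rule that)
  have e: "tlam n = lam" unfolding tlam_def sw_gap_torus_def lam(1) by simp
  show "0 <= tlam n" "T.gcov n f (\<lambda>s. T.sw_op n f s) <= tlam n * T.gcov n f f"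
    "T.row_bound n t b ==> tlam n ^ t <= b t"
    unfolding e using lam(2-4) by blast+
qed

lemma tlam_le_kappa: "tlam n <= T.\<kappa>"
  using tlam_props(3)[OF T.row_bound_kappa[of n 1]] by simp

definition olam :: real where "olam = 1 - sw_gap_lattice d q \<beta>"

definition ratios :: "real set" where
  "ratios = {Dir f / Var f | f. sqi f \<and> Var f ~= 0}"

lemma gap_Inf: "sw_gap_lattice d q \<beta> = Inf ratios"
  unfolding sw_gap_lattice_def variational_gap_def mu_def[symmetric] ratios_def ..

lemma dirichlet_nonneg: "0 <= Dir f"
  unfolding dirichlet_jump using bochner_nonneg[of mu "jump f"] jump_nonneg by simp

lemma variance_nonneg: "0 <= Var f"
  unfolding variance_of_def by (rule bochner_nonneg) simp

lemma ratios_bdd: "bdd_below ratios"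
  by (rule bdd_belowI[of _ 0]) (auto simp: ratios_def dirichlet_nonneg variance_nonneg)

lemma olam_ge:
  assumes "good f"
  shows "mcov f (Pop f) <= olam * mcov f f"
proof (cases "Var f = 0")
  case True
  then show ?thesis using dirichlet_cov[OF assms] dirichlet_nonneg[of f] mcov_self[OF good_sqi[OF assms]] by simp
next
  case False
  then have v: "Var f > 0" using variance_nonneg[of f] by simp
  have "Inf ratios <= Dir f / Var f"
    by (rule cInf_lower[OF _ ratios_bdd]) (use False good_sqi[OF assms] in \<open>auto simp: ratios_def\<close>)
  then have "Inf ratios * Var f <= Dir f" using v by (simp add: pos_le_divide_eq)
  then show ?thesis unfolding olam_def gap_Inf mcov_self[OF good_sqi[OF assms]] dirichlet_cov[OF assms] by (simp add: algebra_simps)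
qed

text \<open>If the covariance inequality failed for a local function, convergence of covariances
  would make it fail on all large tori, against the bound on infinitely many of them. Density of
  local functions then gives it in full.\<close>

lemma olam_le:
  assumes lam: "0 <= lam" "lam <= 1" and fr: "\<exists>\<^sub>F n in sequentially. tlam n <= lam" and ne: "ratios ~= {}"
  shows "olam <= lam"
proof -
  have loc: "mcov g (Pop g) <= lam * mcov g g" if g: "depends_on (box d r) g" for r g
  proof (rule ccontr)
    assume "\<not> ?thesis"
    then have pos: "0 < mcov g (Pop g) - lam * mcov g g" by simp
    let ?G = "\<lambda>n t. g (per n (\<lambda>_. 0) t)"
    let ?d = "\<lambda>n. T.gcov n (?G n) (\<lambda>t. T.sw_op n (?G n) t) - lam * T.gcov n (?G n) (?G n)"
    have G: "lapprox (\<lambda>n a t. g (per n a t)) g" by (rule lapprox_local[OF finite_box box_sub g])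
    have "(\<lambda>n. ?d n) \<longlonglongrightarrow> mcov g (Pop g) - lam * mcov g g"
      by (intro tendsto_intros lapprox_cov_lim[OF G lapprox_sw[OF G]] lapprox_cov_lim[OF G G])
    then have "\<forall>\<^sub>F n in sequentially. 0 < ?d n"
      using pos by (rule order_tendstoD(1))
    with fr have "\<exists>\<^sub>F n in sequentially. False"
    proof (rule frequently_rev_mp[OF _ eventually_mono])
      fix n assume p: "0 < ?d n"
      show "tlam n <= lam --> False"
      proof
        assume "tlam n <= lam"
        then have "tlam n * T.gcov n (?G n) (?G n) <= lam * T.gcov n (?G n) (?G n)"
          by (rule mult_right_mono) (rule T.gcov_self_nonneg)
        then show False using p tlam_props(2)[of n "?G n"] by linarith
      qed
    qed
    then show False by simp
  qed
  have "1 - lam <= Inf ratios"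
  proof (rule cInf_greatest[OF ne])
    fix x assume "x \<in> ratios"
    then obtain f where f: "sqi f" "Var f ~= 0" "x = Dir f / Var f"
      unfolding ratios_def by blast
    have "Var f > 0" using f(2) variance_nonneg[of f] by simp
    then show "1 - lam <= x" using gap_local_to_sqi[OF lam loc f(1)] unfolding f(3) by (simp add: pos_le_divide_eq)
  qed
  then show ?thesis unfolding olam_def gap_Inf by simp
qed

lemma Pop_add: "good f ==> good g ==> Pop (\<lambda>x. f x + g x) s = Pop f s + Pop g s"
  by (rule Bochner_Integration.integral_add) (rule good_integrable(2), assumption)+

lemma Pop_cmult: "Pop (\<lambda>x. c * f x) s = c * Pop f s"
  by (rule Bochner_Integration.integral_mult_right_zero)

text \<open>Positivity of the form \<open>f \<mapsto> \<integral> f P f\<close> at \<open>f - (1/\<lambda>) P f\<close> turns the quadratic form bound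
  into a bound on the norm of \<open>P\<close>.\<close>

lemma Pop_contract:
  assumes f: "good f" and m: "(\<integral>s. f s \<partial>mu) = 0" and lam: "olam > 0"
  shows "(\<integral>s. (Pop f s)\<^sup>2 \<partial>mu) <= olam\<^sup>2 * (\<integral>s. (f s)\<^sup>2 \<partial>mu)"
proof -
  let ?g = "Pop f"
  define t where "t = - (1 / olam)"
  define N where "N = (\<integral>s. (Pop f s)\<^sup>2 \<partial>mu)"
  have g: "good ?g" by (rule good_Pop[OF f])
  have gm: "(\<integral>s. ?g s \<partial>mu) = 0" using Pop_mean[OF f] m by simp
  have ff: "(\<integral>s. f s * Pop f s \<partial>mu) <= olam * (\<integral>s. (f s)\<^sup>2 \<partial>mu)"
    using olam_ge[OF f] unfolding mcov_def m by (simp add: power2_eq_square)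
  have gg: "(\<integral>s. ?g s * Pop ?g s \<partial>mu) <= olam * N"
    using olam_ge[OF g] unfolding mcov_def gm N_def by (simp add: power2_eq_square)
  have gf: "(\<integral>s. ?g s * Pop f s \<partial>mu) = N" unfolding N_def by (simp add: power2_eq_square)
  have fg: "(\<integral>s. f s * Pop ?g s \<partial>mu) = N"
    using Pop_sym[OF g f] unfolding N_def by (simp add: power2_eq_square)
  have i: "integrable mu (\<lambda>s. f s * Pop f s)" "integrable mu (\<lambda>s. f s * Pop ?g s)"
    "integrable mu (\<lambda>s. ?g s * Pop f s)" "integrable mu (\<lambda>s. ?g s * Pop ?g s)"
    by (intro good_integrable(1) good_mult good_Pop f g)+
  have tg: "good (\<lambda>x. t * ?g x)" by (rule good_cmult[OF g])
  have "0 <= (\<integral>s. (f s + t * ?g s) * Pop (\<lambda>x. f x + t * ?g x) s \<partial>mu)"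
    by (rule Pop_nonneg[OF good_add[OF f tg]])
  also have "(\<integral>s. (f s + t * ?g s) * Pop (\<lambda>x. f x + t * ?g x) s \<partial>mu)
      = (\<integral>s. f s * Pop f s + t * (f s * Pop ?g s) + t * (?g s * Pop f s) + t\<^sup>2 * (?g s * Pop ?g s) \<partial>mu)"
    unfolding Pop_add[OF f tg] Pop_cmult
    by (rule bochner_cong) (simp_all add: algebra_simps power2_eq_square)
  also have "... = (\<integral>s. f s * Pop f s \<partial>mu) + t * (\<integral>s. f s * Pop ?g s \<partial>mu)
      + t * (\<integral>s. ?g s * Pop f s \<partial>mu) + t\<^sup>2 * (\<integral>s. ?g s * Pop ?g s \<partial>mu)"
    using i by simp
  also have "... <= olam * (\<integral>s. (f s)\<^sup>2 \<partial>mu) + t * N + t * N + t\<^sup>2 * (olam * N)"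
    unfolding fg gf using ff gg by (intro add_mono mult_left_mono order_refl) auto
  also have "... = olam * (\<integral>s. (f s)\<^sup>2 \<partial>mu) - N / olam" using lam unfolding t_def by (simp add: power2_eq_square field_simps)
  finally show ?thesis unfolding N_def[symmetric] using lam by (simp add: power2_eq_square field_simps)
qed

definition Piter :: "nat => (nat => int) obs => (nat => int) obs" where
  "Piter t = ((\<lambda>f s. Pop f s) ^^ t)"

lemma Piter_Suc: "Piter (Suc t) f = Pop (Piter t f)"
  by (simp add: Piter_def)

lemma Piter_0: "Piter 0 f = f"
  by (simp add: Piter_def)

lemma lapprox_iter:
  assumes "lapprox F f"
  shows "lapprox (\<lambda>n a y. T.sw_iter n t (F n a) y) (Piter t f)"
proof (induction t)
  case 0
  then show ?case using assms by (simp add: Piter_0 T.sw_iter_def)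
next
  case (Suc t)
  show ?case unfolding Piter_Suc T.sw_iter_Suc using lapprox_sw[OF Suc.IH] by simp
qed

lemma good_iter: "good f ==> good (Piter t f)"
  unfolding good_def using lapprox_iter by blast

lemma Piter_centered:
  assumes f: "good f" and lam: "olam > 0"
  shows "(\<integral>s. Piter t f s \<partial>mu) = (\<integral>s. f s \<partial>mu)"
    and "(\<integral>s. (Piter t f s - (\<integral>s. f s \<partial>mu))\<^sup>2 \<partial>mu) <= (olam ^ t)\<^sup>2 * Var f"
proof (induction t)
  case 0
  case 1 then show ?case by (simp add: Piter_0)
  case 2 then show ?case by (simp add: Piter_0 variance_of_def)
next
  case (Suc t)
  let ?m = "\<integral>s. f s \<partial>mu"
  have gt: "good (Piter t f)" by (rule good_iter[OF f])
  case 1 show ?case unfolding Piter_Suc Pop_mean[OF gt] by (rule Suc.IH)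
  case 2
  interpret prob_space mu by (rule mu_prob)
  interpret S: prob_space "L.sw s" for s by (rule L.prob_space_sw)
  have gc: "good (\<lambda>s. Piter t f s + - ?m)" by (rule good_add[OF gt good_const])
  have P: "Pop (\<lambda>s. Piter t f s + - ?m) s = Piter (Suc t) f s - ?m" for s
    unfolding Pop_add[OF gt good_const] Piter_Suc by (simp add: S.prob_space)
  have mean: "(\<integral>s. Piter t f s + - ?m \<partial>mu) = 0"
    using good_integrable(1)[OF gt] Suc.IH(1) by (simp add: prob_space)
  have "(\<integral>s. (Piter (Suc t) f s - ?m)\<^sup>2 \<partial>mu) <= olam\<^sup>2 * (\<integral>s. (Piter t f s + - ?m)\<^sup>2 \<partial>mu)"
    using Pop_contract[OF gc mean lam] unfolding P .
  also have "... <= olam\<^sup>2 * ((olam ^ t)\<^sup>2 * Var f)"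
    using Suc.IH(2) by (intro mult_left_mono) auto
  finally show ?case by (simp add: power_mult_distrib mult.assoc)
qed

text \<open>The centred iterate has norm at most \<open>olam ^ t\<close> and the centred
  \<open>g\<close> norm at most 1. The Cauchy-Schwarz bound is obtained from the elementary
  inequality for products with weight \<open>c = olam ^ t\<close>, which balances the two
  squares.\<close>

lemma mcov_iter_bound:
  assumes f: "good f" "\<And>s. s \<in> L.cfg ==> \<bar>f s\<bar> <= 1" and g: "good g" "\<And>s. s \<in> L.cfg ==> \<bar>g s\<bar> <= 1" and lam: "olam > 0"
  shows "\<bar>mcov (Piter t f) g\<bar> <= olam ^ t"
proof -
  interpret prob_space mu by (rule mu_prob)
  have v1: "Var h <= 1" if h: "good h" "\<And>s. s \<in> L.cfg ==> \<bar>h s\<bar> <= 1" for h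
  proof -
    have "Var h <= (\<integral>s. (h s - 0)\<^sup>2 \<partial>mu)" by (rule variance_le[OF good_sqi[OF h(1)]])
    also have "... <= (\<integral>s. 1 \<partial>mu)"
      using good_sqi[OF h(1)] h(2) by (intro integral_mono) (auto simp: square_integrable_def mu_space abs_square_le_1)
    finally show ?thesis by (simp add: prob_space)
  qed
  let ?m = "\<integral>s. f s \<partial>mu" and ?k = "\<integral>s. g s \<partial>mu"
  let ?u = "\<lambda>s. Piter t f s - ?m" and ?v = "\<lambda>s. g s - ?k"
  have gt: "good (Piter t f)" by (rule good_iter[OF f(1)])
  have gu: "good ?u" using good_add[OF gt good_const[of "- ?m"]] by simp
  have gv: "good ?v" using good_add[OF g(1) good_const[of "- ?k"]] by simp
  define c where "c = olam ^ t"
  have c: "c > 0" using lam by (simp add: c_def)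
  have i: "integrable mu (Piter t f)" "integrable mu g" "integrable mu (\<lambda>s. Piter t f s * g s)"
    "integrable mu (\<lambda>s. ?u s * ?v s)" "integrable mu (\<lambda>s. (?u s)\<^sup>2)" "integrable mu (\<lambda>s. (?v s)\<^sup>2)"
    using good_integrable(1)[OF gt] good_integrable(1)[OF g(1)] good_integrable(1)[OF good_mult[OF gt g(1)]]
      good_integrable(1)[OF good_mult[OF gu gv]] good_sqi[OF gu] good_sqi[OF gv] unfolding square_integrable_def by auto
  have "(\<integral>s. ?u s * ?v s \<partial>mu) = (\<integral>s. Piter t f s * g s - ?k * Piter t f s - ?m * g s + ?m * ?k \<partial>mu)"
    by (rule bochner_cong) (auto simp: algebra_simps)
  also have "... = mcov (Piter t f) g"
    unfolding mcov_def Piter_centered(1)[OF f(1) lam] using i Piter_centered(1)[OF f(1) lam, of t] by (simp add: prob_space)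
  finally have e: "mcov (Piter t f) g = (\<integral>s. ?u s * ?v s \<partial>mu)" ..
  have young: "\<bar>a * b\<bar> <= (1/2) * (a\<^sup>2 / c + c * b\<^sup>2)" for a b :: real
  proof -
    have "0 <= (\<bar>a\<bar> - c * \<bar>b\<bar>)\<^sup>2 / c" using c by simp
    also have "... = a\<^sup>2 / c + c * b\<^sup>2 - 2 * (\<bar>a\<bar> * \<bar>b\<bar>)"
      using c by (simp add: power2_eq_square field_simps)
    finally show ?thesis by (simp add: abs_mult)
  qed
  have "\<bar>mcov (Piter t f) g\<bar> <= (\<integral>s. \<bar>?u s * ?v s\<bar> \<partial>mu)" unfolding e by (rule integral_abs_bound)
  also have "... <= (\<integral>s. (1/2) * ((?u s)\<^sup>2 / c + c * (?v s)\<^sup>2) \<partial>mu)"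
    by (rule integral_mono) (use i young in auto)
  also have "... = (1/2) * ((\<integral>s. (?u s)\<^sup>2 \<partial>mu) / c + c * (\<integral>s. (?v s)\<^sup>2 \<partial>mu))" using i by simp
  also have "... <= (1/2) * ((c\<^sup>2 * 1) / c + c * 1)"
  proof (intro mult_left_mono add_mono divide_right_mono)
    have "(\<integral>s. (?u s)\<^sup>2 \<partial>mu) <= c\<^sup>2 * Var f" unfolding c_def by (rule Piter_centered(2)[OF f(1) lam])
    also have "... <= c\<^sup>2 * 1" by (intro mult_left_mono v1[OF f]) auto
    finally show "(\<integral>s. (?u s)\<^sup>2 \<partial>mu) <= c\<^sup>2 * 1" .
    show "(\<integral>s. (?v s)\<^sup>2 \<partial>mu) <= 1" using v1[OF g] unfolding variance_of_def .
  qed (use c in auto)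
  also have "... = c" using c by (simp add: power2_eq_square)
  finally show ?thesis unfolding c_def .
qed

end

subsection \<open>Convergence of the torus gaps\<close>

definition origin :: "nat => nat => int" where
  "origin d = (\<lambda>i\<in>{..<d}. 0)"

text \<open>Representatives of the edges up to translation: every torus edge is the image of one of
  these \<open>d\<close> edges for a suitable base point. Finitely many local functions thus serve
  all edges of all tori.\<close>

definition axis_edge :: "nat => nat => (nat => int) set" where
  "axis_edge d i = {origin d, (origin d)(i := origin d i + 1)}"

lemma origin_box: "origin d \<in> box d r"
  unfolding origin_def box_def by auto

lemma axis_edge_box:
  assumes "i < d"
  shows "axis_edge d i \<in> edge_box d 1"
proof -
  have "origin d \<in> lattice_verts d" using origin_box box_sub by blast
  then have "axis_edge d i \<in> lattice_edges d"
    unfolding axis_edge_def using lattice_edgeI[OF _ assms, of "origin d" 1] by simp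
  moreover have "(origin d)(i := origin d i + 1) \<in> box d (0 + 1)"
    by (rule box_step[OF origin_box assms]) simp
  ultimately show ?thesis using origin_box[of d 1] unfolding edge_box_def by (auto simp: axis_edge_def)
qed

lemma tproj_origin:
  assumes "z \<in> torus_verts d n"
  shows "tproj d n z (origin d) = z"
proof
  fix i show "tproj d n z (origin d) i = z i"
    using torus_coord[OF assms, of i] PiE_arb[OF assms[unfolded torus_verts_def], of i]
    by (cases "i < d") (auto simp: tproj_def origin_def)
qed

lemma torus_edge_axis:
  assumes "e \<in> torus_edges d n"
  shows "\<exists>z\<in>torus_verts d n. \<exists>i<d. e = tproj d n z ` axis_edge d i"
proof -
  obtain z i where z: "e = {z, z(i := (z i + 1) mod int n)}" "z \<in> torus_verts d n" "i < d"
    using assms unfolding torus_edges_def by blast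
  have "tproj d n z ` axis_edge d i = e"
    unfolding axis_edge_def z(1) image_insert image_empty tproj_upd[OF z(3)] tproj_origin[OF z(2)] ..
  then show ?thesis using z by blast
qed

lemma card_box: "card (box d r) = (2 * r + 1) ^ d"
proof -
  have "card {- int r..int r} = 2 * r + 1" by simp
  then show ?thesis unfolding box_def by (simp add: card_PiE)
qed

lemma card_edge_box: "card (edge_box d r) <= (2 * r + 1) ^ (2 * d)"
proof -
  have "edge_box d r \<subseteq> (\<lambda>(x, y). {x, y}) ` (box d r \<times> box d r)"
  proof
    fix e assume e: "e \<in> edge_box d r"
    then have "e \<in> lattice_edges d" "e \<subseteq> box d r" unfolding edge_box_def by auto
    moreover from this(1) obtain u v where "e = {u, v}" using lattice_edge_ends by blast
    ultimately show "e \<in> (\<lambda>(x, y). {x, y}) ` (box d r \<times> box d r)" by (intro image_eqI[of _ _ "(u, v)"]) auto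
  qed
  then have "card (edge_box d r) <= card (box d r \<times> box d r)"
    using finite_box by (intro surj_card_le) auto
  then show ?thesis unfolding card_cartesian_product card_box by (simp add: power_add[symmetric] mult_2)
qed

text \<open>A box of radius linear in \<open>s\<close> contains polynomially many edges, which a
  slightly larger geometric rate absorbs.\<close>

lemma poly_geometric_bounded:
  fixes x y :: real
  assumes "0 < x" "x < y" and d: "d >= 1"
  shows "\<exists>C>0. \<forall>s. real (card (edge_box d (L * s + 1))) * x ^ s <= C * y ^ s"
proof -
  \<comment> \<open>The root of order \<open>2 * d\<close> lets the polynomial factor be split into
    \<open>2 * d\<close> equal linear factors, each multiplied by \<open>w ^ s\<close>, which stay
    bounded.\<close>
  define w where "w = root (2 * d) (x / y)"
  have w: "0 <= w" "w < 1" "w ^ (2 * d) = x / y"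
    using assms unfolding w_def by (auto intro: real_root_pow_pos2)
  have "norm w < 1" using w by simp
  then have "(\<lambda>s. real s * w ^ s) \<longlonglongrightarrow> 0" using powser_times_n_limit_0[of w] by simp
  moreover have "(\<lambda>s. w ^ s) \<longlonglongrightarrow> 0" using \<open>norm w < 1\<close> by (rule LIMSEQ_power_zero)
  ultimately have "(\<lambda>s. 2 * real L * (real s * w ^ s) + 3 * w ^ s) \<longlonglongrightarrow> 2 * real L * 0 + 3 * 0"
    by (intro tendsto_add tendsto_mult_left)
  then have "Bseq (\<lambda>s. 2 * real L * (real s * w ^ s) + 3 * w ^ s)" by (rule convergent_imp_Bseq[OF convergentI])
  then obtain B where B: "B > 0" "\<And>s. norm (2 * real L * (real s * w ^ s) + 3 * w ^ s) <= B"
    by (rule BseqE) blast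
  have "real (card (edge_box d (L * s + 1))) * x ^ s <= B ^ (2 * d) * y ^ s" for s
  proof -
    have "real (card (edge_box d (L * s + 1))) <= real ((2 * (L * s + 1) + 1) ^ (2 * d))"
      using card_edge_box[of d "L * s + 1"] by (rule of_nat_mono)
    also have "... = (2 * real L * real s + 3) ^ (2 * d)" by (simp add: algebra_simps)
    finally have "real (card (edge_box d (L * s + 1))) * (x / y) ^ s <= (2 * real L * real s + 3) ^ (2 * d) * (x / y) ^ s"
      using assms by (intro mult_right_mono) auto
    also have "... = ((2 * real L * real s + 3) * w ^ s) ^ (2 * d)"
      unfolding w(3)[symmetric] by (simp add: power_mult_distrib power_mult[symmetric] mult.commute)
    also have "... <= B ^ (2 * d)"
      using B(2)[of s] w(1) by (intro power_mono) (auto simp: algebra_simps)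
    finally have "real (card (edge_box d (L * s + 1))) * (x / y) ^ s * y ^ s <= B ^ (2 * d) * y ^ s"
      using assms by (intro mult_right_mono) auto
    then show ?thesis using assms by (simp add: power_divide)
  qed
  then show ?thesis using B(1) by (intro exI[of _ "B ^ (2 * d)"]) auto
qed

text \<open>The radius \<open>R0\<close> is fixed by \<open>d\<close> and \<open>q\<close> alone, so
  the second condition can be met by small \<open>\<beta>\<close>. The first two conditions give
  diagonal dominance on every torus; the last makes the self-referential term of the row recursion
  at most \<open>p / 8\<close>.\<close>

locale sw_lattice_small = sw_lattice +
  fixes R0 :: nat
  assumes beta_unif: "4 * real q * (exp (2 * real d * \<beta>) - 1) <= 1"
    and beta_diag: "real (card (edge_box d (R0 + 1))) * (2 * (exp (2 * real d * \<beta>) - 1))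
      + (1/2) ^ R0 * (16 * real (2 * d)) <= 1 / (8 * real q)"
    and beta_rows: "8 * (1024 * real q * real d + 16) * (32 * real d)\<^sup>2 * (1 - exp (- \<beta>)) <= 1"
begin

lemma unif_err_eq: "T.unif_err = exp (2 * real d * \<beta>) - 1"
  unfolding T.unif_err_def by simp

abbreviation "tlev n \<equiv> torus_level d (n + 3)"

lemma torus_level_is_level: "T.is_level n (tlev n z)"
  unfolding T.is_level_def
proof (intro ballI)
  fix e u v assume e: "e \<in> TE n" "u \<in> e" "v \<in> e"
  obtain x y where xy: "x \<in> TV n" "y \<in> TV n" "e = {x, y}" using T.edgeE[OF e(1)] by blast
  have te: "{x, y} \<in> TE n" "{y, x} \<in> TE n" using e(1) xy by (auto simp: insert_commute)
  have n0: "n + 3 > 0" by simp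
  consider "u = v" | "u = x" "v = y" | "u = y" "v = x" using e xy by blast
  then show "tlev n z v <= tlev n z u + 1"
    using torus_level_step[OF te(1) xy(1) n0] torus_level_step[OF te(2) xy(2) n0] by cases auto
qed

lemma axis_level:
  assumes "i < d"
  shows "max_level (tlev n z) {tp n z ` axis_edge d i} <= 1"
proof (rule T.max_level_le)
  have "axis_edge d i \<in> LE" using axis_edge_box[OF assms] edge_box_sub by blast
  then show "{tp n z ` axis_edge d i} \<subseteq> TE n" using tproj_edge[of _ d "n + 3"] by simp
  fix v assume "v \<in> \<Union>{tp n z ` axis_edge d i}"
  then obtain x where x: "x \<in> axis_edge d i" "v = tp n z x" by blast
  have "x \<in> box d 1" using axis_edge_box[OF assms] x(1) unfolding edge_box_def by blast
  then show "tlev n z v <= 1" unfolding x(2) by (rule torus_level_le)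
qed

lemma near_edges:
  "{e \<in> TE n. max_level (tlev n z) {e} <= R} \<subseteq> (`) (tp n z) ` edge_box d (R + 1)"
proof
  fix e assume "e \<in> {e \<in> TE n. max_level (tlev n z) {e} <= R}"
  then have e: "e \<in> TE n" "max_level (tlev n z) {e} <= R" by auto
  obtain u v where uv: "u \<in> TV n" "e = {u, v}" using T.edgeE[OF e(1)] by blast
  have "tlev n z u <= max_level (tlev n z) {e}"
    by (rule T.max_level_ge) (use e(1) uv in auto)
  then have l: "tlev n z u <= R" using e(2) by simp
  have uvE: "{u, v} \<in> TE n" using e(1) uv by simp
  show "e \<in> (`) (tp n z) ` edge_box d (R + 1)"
    unfolding uv(2) by (rule torus_edge_near[OF uvE uv(1) _ l]) simp
qed

text \<open>Each edge is an axis edge seen from some base point, hence has level at most one from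
  there. The number of edges within level \<open>R0\<close> is bounded by that of a lattice box,
  uniformly over the tori.\<close>

lemma diag: "T.diag_dominant n"
proof -
  have "\<forall>e\<in>TE n. \<exists>z. z \<in> TV n \<and> (\<exists>i<d. e = tp n z ` axis_edge d i)"
    using torus_edge_axis by blast
  then obtain z where z: "\<And>e. e \<in> TE n ==> \<exists>i<d. e = tp n (z e) ` axis_edge d i"
    by metis
  show ?thesis
  proof (rule T.diag_dominantI[where D = "\<lambda>e. tlev n (z e)" and R = R0 and ?n0.0 = "card (edge_box d (R0 + 1))"])
    show "4 * real q * T.unif_err <= 1" unfolding unif_err_eq by (rule beta_unif)
    show "T.is_level n (tlev n (z e))" for e by (rule torus_level_is_level)
    show "max_level (tlev n (z e)) {e} <= 1" if "e \<in> TE n" for e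
      using z[OF that] axis_level by metis
    show "card {e' \<in> TE n. max_level (tlev n (z e)) {e'} <= R0} <= card (edge_box d (R0 + 1))" for e
      by (rule surj_card_le[OF finite_edge_box near_edges])
    show "real (card (edge_box d (R0 + 1))) * (2 * T.unif_err) + (1 / 2) ^ R0 * (16 * real (2 * d)) <= 1 / (8 * real q)"
      unfolding unif_err_eq by (rule beta_diag)
  qed
qed

lemma lapprox_edge:
  assumes "e \<in> LE"
  shows "lapprox (\<lambda>n a. ph (tp n a ` e)) (ph e)"
proof -
  have "ph (tp n a ` e) = (\<lambda>t. ph e (per n a t))" for n a
  proof
    fix t
    have "ph (tp n a ` e) t = ph e (t \<circ> tp n a)"
      using mono_ind_image[of "tp n a" "{e}" t] by simp
    also have "... = ph e (per n a t)"
      by (rule per_local[OF depends_on_mono_ind, symmetric]) (use L.edge_subset[OF assms] in simp)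
    finally show "ph (tp n a ` e) t = ph e (per n a t)" .
  qed
  moreover have "lapprox (\<lambda>n a t. ph e (per n a t)) (ph e)"
    by (rule lapprox_local[OF _ _ depends_on_mono_ind]) (use L.edge_subset[OF assms] L.finite_edge[OF assms] in auto)
  ultimately show ?thesis by simp
qed

lemma good_edge: "e \<in> LE ==> good (ph e)"
  unfolding good_def using lapprox_edge by blast

lemma edge_image: "e \<in> LE ==> tp n a ` e \<in> TE n"
  by (rule tproj_edge) auto

lemma mcov_edge_self:
  assumes "e \<in> LE"
  shows "1 / (4 * real q) <= mcov (ph e) (ph e)"
proof (rule LIMSEQ_le_const[OF lapprox_cov_lim[OF lapprox_edge lapprox_edge, OF assms assms, of "\<lambda>_ _. 0"]])
  have "4 * real q * T.unif_err <= 1" unfolding unif_err_eq by (rule beta_unif)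
  then show "\<exists>N. \<forall>n\<ge>N. 1 / (4 * real q) <= T.gcov n (ph (tp n (\<lambda>_. 0) ` e)) (ph (tp n (\<lambda>_. 0) ` e))"
    using T.gcov_edge_self[OF edge_image[OF assms]] by blast
qed

lemma mcov_edge_sw:
  assumes "e \<in> LE"
  shows "L.p / 2 * mcov (ph e) (ph e) - 4 / T.W\<^sup>2 <= mcov (ph e) (Pop (ph e))"
proof -
  have "L.p / 2 * mcov (ph e) (ph e) - 4 / T.W\<^sup>2 <= mcov (Pop (ph e)) (ph e)"
  proof (rule LIMSEQ_le)
    let ?F = "\<lambda>n. ph (tp n (\<lambda>_. 0) ` e)"
    note F = lapprox_edge[OF assms]
    show "(\<lambda>n. L.p / 2 * T.gcov n (?F n) (?F n) - 4 / T.W\<^sup>2) \<longlonglongrightarrow> L.p / 2 * mcov (ph e) (ph e) - 4 / T.W\<^sup>2"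
      by (intro tendsto_intros lapprox_cov_lim[OF F F])
    show "(\<lambda>n. T.gcov n (\<lambda>t. T.sw_op n (?F n) t) (?F n)) \<longlonglongrightarrow> mcov (Pop (ph e)) (ph e)"
      by (rule lapprox_cov_lim[OF lapprox_sw[OF F] F])
    show "\<exists>N. \<forall>n\<ge>N. L.p / 2 * T.gcov n (?F n) (?F n) - 4 / T.W\<^sup>2 <= T.gcov n (\<lambda>t. T.sw_op n (?F n) t) (?F n)"
      using T.gcov_sw_edge[OF edge_image[OF assms]] by blast
  qed
  also have "mcov (Pop (ph e)) (ph e) = mcov (ph e) (Pop (ph e))" unfolding mcov_def by (simp add: mult.commute)
  finally show ?thesis .
qed

lemma W_inv: "1 / T.W\<^sup>2 = (32 * real d)\<^sup>2 * L.p\<^sup>2"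
  unfolding T.W_def T.ww_def using L.p_bounds d1 by (simp add: power2_eq_square field_simps)

lemma kappa_sq: "T.\<kappa>\<^sup>2 = 16 / T.W\<^sup>2"
proof -
  have "T.\<kappa> = 4 / T.W" using T.kappa_W T.W_ge by (simp add: field_simps)
  then show ?thesis by (simp add: power_divide)
qed

lemma edge_ex: "axis_edge d 0 \<in> LE"
  using axis_edge_box[of 0 d] d1 edge_box_sub by auto

text \<open>Both terms are multiples of \<open>1 / W\<^sup>2\<close>, which is
  \<open>(32 * d)\<^sup>2\<close> times \<open>p\<^sup>2\<close>; one factor \<open>p\<close> is
  traded for the smallness of \<open>\<beta>\<close>.\<close>

lemma rate_le: "512 * real q * real (2 * d) / T.W\<^sup>2 + T.\<kappa>\<^sup>2 <= L.p / 8"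
proof -
  have "512 * real q * real (2 * d) / T.W\<^sup>2 + T.\<kappa>\<^sup>2 = (1024 * real q * real d + 16) * (1 / T.W\<^sup>2)"
    unfolding kappa_sq by (simp add: algebra_simps add_divide_distrib)
  also have "... = (8 * (1024 * real q * real d + 16) * (32 * real d)\<^sup>2 * L.p) * (L.p / 8)"
    unfolding W_inv by (simp add: power2_eq_square algebra_simps)
  also have "... <= 1 * (L.p / 8)"
    using beta_rows L.p_bounds unfolding L.p_def by (intro mult_right_mono) auto
  finally show ?thesis by simp
qed

text \<open>The indicator of one edge as a test function: its quotient is at least
  \<open>p / 2\<close> minus an error of order \<open>p\<^sup>2\<close> relative to its variance,
  and \<open>rate_le\<close> bounds that error by \<open>p / 4\<close>.\<close>

lemma olam_lower: "L.p / 4 <= olam"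
proof -
  let ?e = "axis_edge d 0" and ?v = "mcov (ph (axis_edge d 0)) (ph (axis_edge d 0))"
  have v: "1 / (4 * real q) <= ?v" by (rule mcov_edge_self[OF edge_ex])
  have q0: "real q > 0" using q_ge_2 by simp
  then have v0: "?v > 0" using v by (smt (verit) divide_pos_pos mult_pos_pos)
  have "4 / T.W\<^sup>2 <= L.p / 4 * ?v"
  proof -
    have "512 * real q * real (2 * d) / T.W\<^sup>2 <= L.p / 8" using rate_le zero_le_power2[of T.\<kappa>] by linarith
    moreover have "64 * real q / T.W\<^sup>2 * 16 <= 512 * real q * real (2 * d) / T.W\<^sup>2"
    proof -
      have "64 * real q * 16 <= 512 * real q * real (2 * d)" using d1 q0 by simp
      then show ?thesis using divide_right_mono[OF _ zero_le_power2[of T.W], of "64 * real q * 16" "512 * real q * real (2 * d)"] by simp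
    qed
    ultimately have "64 * real q / T.W\<^sup>2 <= L.p" using L.p_bounds by linarith
    then have "4 / T.W\<^sup>2 <= L.p / 4 * (1 / (4 * real q))" using q0 by (simp add: field_simps)
    also have "... <= L.p / 4 * ?v" using v L.p_bounds by (intro mult_left_mono) auto
    finally show ?thesis .
  qed
  then have "L.p / 4 * ?v <= mcov (ph ?e) (Pop (ph ?e))" using mcov_edge_sw[OF edge_ex] by linarith
  also have "... <= olam * ?v" by (rule olam_ge[OF good_edge[OF edge_ex]])
  finally show ?thesis using v0 by simp
qed

lemma olam_pos: "0 < olam" using olam_lower L.p_bounds by linarith

lemma ratios_ne: "ratios ~= {}"
proof -
  let ?f = "ph (axis_edge d 0)"
  have s: "sqi ?f" by (rule good_sqi[OF good_edge[OF edge_ex]])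
  have "0 < 1 / (4 * real q)" using q_ge_2 by simp
  also have "... <= Var ?f" using mcov_edge_self[OF edge_ex] unfolding mcov_self[OF s] .
  finally have "Var ?f ~= 0" by simp
  then show ?thesis using s unfolding ratios_def by blast
qed

lemma olam_le_half: "olam <= 1 / 2"
proof (rule olam_le[OF _ _ _ ratios_ne])
  have "tlam n <= 1 / 2" for n using tlam_le_kappa[of n] T.kappa_bounds by linarith
  then show "\<exists>\<^sub>F n in sequentially. tlam n <= 1 / 2" by (intro eventually_frequently always_eventually) auto
qed auto

abbreviation "iter_cov n s a i e \<equiv> T.gcov n (T.sw_iter n s (ph (tp n a ` axis_edge d i))) (ph (tp n a ` e))"

text \<open>For fixed \<open>t\<close> finitely many pairs of axis edge and box edge occur, each
  with covariances that converge uniformly in the base point. The permitted error is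
  \<open>olam ^ s\<close> itself, whence the factor 2; its positivity is essential.\<close>

lemma near_cov:
  "\<forall>\<^sub>F n in sequentially. \<forall>s\<in>{..<t}. \<forall>i\<in>{..<d}. \<forall>e\<in>edge_box d (L * s + 1). \<forall>a.
     \<bar>iter_cov n s a i e\<bar> <= 2 * olam ^ s"
proof (intro eventually_ball_finite ballI finite_lessThan finite_edge_box)
  fix s i e assume i: "i \<in> {..<d}" and e: "e \<in> edge_box d (L * s + 1)"
  have iE: "axis_edge d i \<in> LE" and eE: "e \<in> LE" using axis_edge_box[of i d] i e edge_box_sub by auto
  have b: "\<bar>mcov (Piter s (ph (axis_edge d i))) (ph e)\<bar> <= olam ^ s"
    by (rule mcov_iter_bound[OF good_edge[OF iE] _ good_edge[OF eE] _ olam_pos]) (rule mono_ind_range)+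
  have "olam ^ s > 0" using olam_pos by simp
  from lapprox_cov[OF lapprox_iter[OF lapprox_edge[OF iE], of s] lapprox_edge[OF eE] this]
  show "\<forall>\<^sub>F n in sequentially. \<forall>a. \<bar>iter_cov n s a i e\<bar> <= 2 * olam ^ s"
  proof eventually_elim
    case (elim n)
    show ?case
    proof
      fix a
      have "\<bar>iter_cov n s a i e
        - mcov (Piter s (ph (axis_edge d i))) (ph e)\<bar> <= olam ^ s" using elim by simp
      then show "\<bar>iter_cov n s a i e\<bar> <= 2 * olam ^ s"
        using b by linarith
    qed
  qed
qed

text \<open>The prefactor \<open>M\<close> does not depend on \<open>t\<close>; only the torus size
  from which the bound holds does. The row recursion reproduces the rate \<open>r\<close> because
  half of it is supplied by the covariances and half by the feedback of the row into itself.\<close>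

lemma tlam_power_bound:
  assumes r: "olam < r"
  shows "\<exists>M>0. \<forall>t. \<forall>\<^sub>F n in sequentially. tlam n ^ t <= M * r ^ t"
proof -
  have r0: "r > 0" using r olam_pos by simp
  \<comment> \<open>The slope of the radius: halving with every level over a distance
    \<open>L * s\<close> beats \<open>olam ^ s\<close>, so distant edges are harmless.\<close>
  obtain L where L: "(1/2::real) ^ L < olam" using real_arch_pow_inv[OF olam_pos, of "1/2"] by auto
  obtain C where C: "C > 0" "\<And>s. real (card (edge_box d (L * s + 1))) * olam ^ s <= C * r ^ s"
    using poly_geometric_bounded[OF olam_pos r d1] by blast
  \<comment> \<open>The feedback factor is at most \<open>p / 8\<close>, while \<open>r\<close>
    exceeds \<open>p / 4\<close>, so it is at most half of \<open>r\<close>.\<close>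
  define \<theta> where "\<theta> = 512 * real q * real (2 * d) / T.W\<^sup>2 + T.\<kappa>\<^sup>2"
  have \<theta>: "0 <= \<theta>" "\<theta> <= r / 2" "T.\<kappa>\<^sup>2 <= \<theta>"
    using rate_le olam_lower r unfolding \<theta>_def by (auto simp: add_nonneg_nonneg)
  define K where "K = 32 * real q * (2 * C + 16 * real (2 * d) * T.W)"
  \<comment> \<open>At least 1 for the start of the recursion, and large enough that the source term
    \<open>K\<close> uses up at most half of the next bound.\<close>
  define M where "M = max 1 (2 * K / (r * T.W))"
  have W0: "T.W > 0" by (rule T.W_ge)
  have K0: "K >= 0" unfolding K_def using C(1) W0 by simp
  have M: "M >= 1" "K <= M * T.W * r / 2"
  proof -
    show "M >= 1" by (simp add: M_def)
    have "2 * K / (r * T.W) <= M" by (simp add: M_def)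
    then show "K <= M * T.W * r / 2" using r0 W0 by (simp add: pos_divide_le_eq algebra_simps)
  qed
  have key: "tlam n ^ t <= M * r ^ t"
    if cov: "\<forall>s\<in>{..<t}. \<forall>i\<in>{..<d}. \<forall>e\<in>edge_box d (L * s + 1). \<forall>a.
     \<bar>iter_cov n s a i e\<bar> <= 2 * olam ^ s" for n t
  proof (rule tlam_props(3)[where b = "\<lambda>s. M * r ^ s"], unfold T.row_bound_def, intro conjI allI impI ballI)
    fix s e assume s: "s <= t" and e: "e \<in> TE n"
    obtain z i where i: "i < d" and ez: "e = tp n z ` axis_edge d i" using torus_edge_axis[OF e] by blast
    let ?D = "tlev n z"
    have lev: "max_level ?D {e} <= 1" unfolding ez by (rule axis_level[OF i])
    from s show "T.vnorm0 n (T.edge_row n e s) <= M * r ^ s * T.W"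
    proof (induction s)
      case 0
      have "T.vnorm0 n (T.edge_row n e 0) <= 1 * T.W" using T.vnorm_edge_row[OF T.is_level_0 e, of 0] by simp
      also have "... <= M * T.W" using M(1) W0 by (intro mult_right_mono) auto
      finally show ?case by simp
    next
      case (Suc s)
      let ?c = "\<lambda>e'. \<bar>T.gcov n (T.sw_iter n s (ph e)) (ph e')\<bar>"
      have near: "(\<Sum>e'\<in>{e'\<in>TE n. max_level ?D {e'} <= L * s}. ?c e') <= 2 * C * r ^ s"
      proof -
        have "(\<Sum>e'\<in>{e'\<in>TE n. max_level ?D {e'} <= L * s}. ?c e')
          <= (\<Sum>e'\<in>(`) (tp n z) ` edge_box d (L * s + 1). ?c e')"
          by (rule sum_mono2[OF _ near_edges]) (auto simp: finite_edge_box)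
        also have "... <= (\<Sum>e1\<in>edge_box d (L * s + 1). ?c (tp n z ` e1))"
          using sum_image_le[OF finite_edge_box, of "d" "L * s + 1" ?c "(`) (tp n z)"] by simp
        also have "... <= (\<Sum>e1\<in>edge_box d (L * s + 1). 2 * olam ^ s)"
          unfolding ez using cov Suc.prems i by (intro sum_mono) auto
        also have "... = 2 * (real (card (edge_box d (L * s + 1))) * olam ^ s)" by simp
        also have "... <= 2 * C * r ^ s" using C(2)[of s] by simp
        finally show ?thesis .
      qed
      have far: "(1/2) ^ (L * s) * (16 * real (2 * d) * (T.\<kappa> ^ s * T.W)) <= r ^ s * (16 * real (2 * d) * T.W)"
      proof (intro mult_mono mult_left_mono)
        have "(1/2::real) ^ (L * s) = ((1/2) ^ L) ^ s" by (rule power_mult)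
        also have "... <= r ^ s" using L r by (intro power_mono) auto
        finally show "(1/2::real) ^ (L * s) <= r ^ s" .
        have "T.\<kappa> ^ s <= 1" using T.kappa_bounds by (intro power_le_one) auto
        then show "T.\<kappa> ^ s * T.W <= T.W" using W0 by simp
      qed (use r0 W0 T.kappa_bounds in auto)
      have "T.vnorm0 n (T.edge_row n e (Suc s)) <=
          32 * real q * ((\<Sum>e'\<in>{e'\<in>TE n. max_level ?D {e'} <= L * s}. ?c e')
            + (1/2) ^ (L * s) * (16 * real (2 * d) * (T.\<kappa> ^ s * T.W))) + \<theta> * T.vnorm0 n (T.edge_row n e s)"
        unfolding \<theta>_def by (rule T.row_recursion[OF diag e torus_level_is_level lev])
      also have "... <= 32 * real q * (2 * C * r ^ s + r ^ s * (16 * real (2 * d) * T.W)) + \<theta> * (M * r ^ s * T.W)"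
        using near far Suc.IH Suc.prems \<theta>(1) by (intro add_mono mult_left_mono) auto
      also have "... = K * r ^ s + \<theta> * (M * r ^ s * T.W)" unfolding K_def by (simp add: algebra_simps)
      also have "... <= (M * T.W * r / 2) * r ^ s + r / 2 * (M * r ^ s * T.W)"
        using M \<theta>(2) r0 W0 by (intro add_mono mult_right_mono) auto
      also have "... = M * r ^ Suc s * T.W" by simp
      finally show ?case .
    qed
  next
    fix s
    have "T.\<kappa>\<^sup>2 <= r" using \<theta> r0 by linarith
    then have "T.\<kappa>\<^sup>2 * (M * r ^ s) <= r * (M * r ^ s)" using M(1) r0 by (intro mult_right_mono) auto
    then show "T.\<kappa>\<^sup>2 * (M * r ^ s) <= M * r ^ Suc s" by (simp only: power_Suc mult.left_commute)
    show "0 <= M * r ^ s" using M(1) r0 by simp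
  qed (use M in auto)
  have "\<forall>\<^sub>F n in sequentially. tlam n ^ t <= M * r ^ t" for t
    using near_cov[of t L] by eventually_elim (rule key)
  then show ?thesis using M(1) by (intro exI[of _ M]) auto
qed

text \<open>A torus eigenvalue that stayed below \<open>olam\<close> along a subsequence would give
  a better gap on the lattice, contradicting the definition of \<open>olam\<close>. From above,
  rates \<open>u < r < a\<close> are inserted: \<open>t\<close> is taken so large that
  \<open>M * u ^ t\<close> is below \<open>r ^ t\<close>, then frozen, and the torus size is sent to
  infinity.\<close>

lemma tlam_tendsto: "tlam \<longlonglongrightarrow> olam"
proof (rule order_tendstoI)
  fix a assume a: "a < olam"
  show "\<forall>\<^sub>F n in sequentially. a < tlam n"
  proof (cases "a < 0")
    case True
    then show ?thesis using tlam_props(1) by (auto intro!: always_eventually intro: less_le_trans)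
  next
    case False
    show ?thesis
    proof (rule ccontr)
      assume "\<not> (\<forall>\<^sub>F n in sequentially. a < tlam n)"
      then have "\<exists>\<^sub>F n in sequentially. tlam n <= a" by (simp add: frequently_def not_le)
      then have "olam <= a" using False a olam_le_half by (intro olam_le ratios_ne) auto
      then show False using a by simp
    qed
  qed
next
  fix a assume a: "olam < a"
  define r where "r = (olam + a) / 2"
  define u where "u = (olam + r) / 2"
  have "olam < r" "r < a" using a unfolding r_def by auto
  moreover from this have "olam < u" "u < r" unfolding u_def by auto
  ultimately have u: "olam < u" "u < r" "r < a" "0 < u" using olam_pos by auto
  obtain M where M: "M > 0" "\<And>t. \<forall>\<^sub>F n in sequentially. tlam n ^ t <= M * u ^ t" using tlam_power_bound[OF u(1)] by blast
  have "(\<lambda>t. M * (u / r) ^ t) \<longlonglongrightarrow> M * 0" using u by (intro tendsto_intros LIMSEQ_power_zero) auto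
  then have "\<forall>\<^sub>F t in sequentially. M * (u / r) ^ t < 1" by (intro order_tendstoD(2)[where a = 1]) auto
  then obtain t0 where t0: "\<And>t. t0 <= t ==> M * (u / r) ^ t < 1" unfolding eventually_sequentially by blast
  \<comment> \<open>A successor as exponent guarantees that it is positive, so that the root can be
    taken below.\<close>
  have b: "M * u ^ Suc t0 <= r ^ Suc t0"
    using t0[of "Suc t0"] u by (simp add: power_divide pos_divide_less_eq del: power_Suc)
  show "\<forall>\<^sub>F n in sequentially. tlam n < a"
    using M(2)[of "Suc t0"]
  proof eventually_elim
    case (elim n)
    then have "tlam n ^ Suc t0 <= r ^ Suc t0" using b by linarith
    then have "tlam n <= r" using power_le_imp_le_base[of "tlam n" t0 r] u by simp
    then show ?case using u(3) by simp
  qed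
qed

theorem sw_gap_convergence:
  "(\<lambda>n. sw_gap_torus d q \<beta> n) \<longlonglongrightarrow> sw_gap_lattice d q \<beta> \<and> 0 < sw_gap_lattice d q \<beta> \<and> sw_gap_lattice d q \<beta> < 1"
proof (intro conjI)
  have "(\<lambda>n. 1 - tlam n) \<longlonglongrightarrow> 1 - olam" by (intro tendsto_intros tlam_tendsto)
  then have "(\<lambda>n. sw_gap_torus d q \<beta> (n + 3)) \<longlonglongrightarrow> sw_gap_lattice d q \<beta>" by (simp add: tlam_def olam_def)
  then show "(\<lambda>n. sw_gap_torus d q \<beta> n) \<longlonglongrightarrow> sw_gap_lattice d q \<beta>" by (rule LIMSEQ_offset)
  show "0 < sw_gap_lattice d q \<beta>" using olam_le_half unfolding olam_def by simp
  show "sw_gap_lattice d q \<beta> < 1" using olam_pos unfolding olam_def by simp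
qed

end

theorem theorem1p2:
  fixes d q :: nat
  assumes "d \<ge> 1" and "q \<ge> 2"
  shows "\<exists>\<beta>\<^sub>0 > (0::real). \<forall>\<beta>::real. 0 < \<beta> \<and> \<beta> < \<beta>\<^sub>0 \<longrightarrow>
           (\<lambda>n. sw_gap_torus d q \<beta> n) \<longlonglongrightarrow> sw_gap_lattice d q \<beta> \<and>
           0 < sw_gap_lattice d q \<beta> \<and> sw_gap_lattice d q \<beta> < 1"
proof -
  have pos: "0 < 1 / (8 * real q) / (16 * real (2 * d))" using assms by simp
  \<comment> \<open>The decay radius is chosen before \<open>\<beta>\<close>: the far part alone is
    then strictly below \<open>1 / (8 * real q)\<close>, and the near part tends to zero with
    \<open>\<beta>\<close>.\<close>
  obtain R0 where R0: "(1/2::real) ^ R0 < 1 / (8 * real q) / (16 * real (2 * d))"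
    using real_arch_pow_inv[OF pos, of "1/2"] by auto
  then have R1: "(1/2::real) ^ R0 * (16 * real (2 * d)) < 1 / (8 * real q)"
  proof -
    have "0 < 16 * real (2 * d)" using assms(1) by simp
    then show ?thesis using R0 by (simp only: pos_less_divide_eq)
  qed
  have e: "((\<lambda>\<beta>::real. exp (c * \<beta>)) \<longlongrightarrow> 1) (at_right 0)" for c
    by (auto intro!: tendsto_eq_intros)
  have ev: "\<forall>\<^sub>F \<beta> in at_right 0. f \<beta> < c" if "(f \<longlongrightarrow> l) (at_right 0)" "l < c" for f :: "real \<Rightarrow> real" and l c
    using order_tendstoD(2)[OF that] .
  have "\<forall>\<^sub>F \<beta> in at_right (0::real). 8 * real d * (exp (2 * \<beta>) - 1) < 1"
    by (rule ev[where l = "8 * real d * (1 - 1)"]) (intro tendsto_intros e, simp)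
  moreover have "\<forall>\<^sub>F \<beta> in at_right (0::real). 256 * real d * (1 - exp (- 1 * \<beta>)) < 1"
    by (rule ev[where l = "256 * real d * (1 - 1)"]) (intro tendsto_intros e, simp)
  moreover have "\<forall>\<^sub>F \<beta> in at_right (0::real). 4 * real q * (exp (2 * real d * \<beta>) - 1) < 1"
    by (rule ev[where l = "4 * real q * (1 - 1)"]) (intro tendsto_intros e, simp)
  moreover have "\<forall>\<^sub>F \<beta> in at_right (0::real). real (card (edge_box d (R0 + 1))) * (2 * (exp (2 * real d * \<beta>) - 1))
      + (1/2) ^ R0 * (16 * real (2 * d)) < 1 / (8 * real q)"
    by (rule ev[where l = "real (card (edge_box d (R0 + 1))) * (2 * (1 - 1)) + (1/2) ^ R0 * (16 * real (2 * d))"])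
       (intro tendsto_intros e, use R1 in simp)
  moreover have "\<forall>\<^sub>F \<beta> in at_right (0::real). 8 * (1024 * real q * real d + 16) * (32 * real d)\<^sup>2 * (1 - exp (- 1 * \<beta>)) < 1"
    by (rule ev[where l = "8 * (1024 * real q * real d + 16) * (32 * real d)\<^sup>2 * (1 - 1)"])
       (intro tendsto_intros e, simp)
  ultimately have "\<forall>\<^sub>F \<beta> in at_right 0. sw_lattice_small d q \<beta> R0"
    using eventually_at_right_less[of "0::real"]
  proof eventually_elim
    case (elim \<beta>)
    then show ?case using assms by unfold_locales auto
  qed
  then obtain b where b: "b > 0" "\<And>\<beta>. 0 < \<beta> \<Longrightarrow> \<beta> < b \<Longrightarrow> sw_lattice_small d q \<beta> R0"
    unfolding eventually_at_right_field by blast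
  then show ?thesis using sw_lattice_small.sw_gap_convergence by (intro exI[of _ b]) blast
qed

end
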